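(* Let $A=\mathbb{K}Q/J^2$ be a radical square zero algebra, where $Q$ has $n>3$ vertices. Then $\psi\dim(A)$ is maximal, i.e. $\psi\dim(A)=2n-3$, if and only if the following hold: the member $M(Q)$ is totally ordered (by the relation $x\preceq y$ iff there is a path in $Q$ from $x$ to $y$); $Q$ has a sink; the heart $C(Q)$ has a unique vertex and one or more loops at it; and $Q$ has the form $C(Q)\rightrightarrows M(Q)$, meaning that every arrow of $Q$ between $C(Q)$ and $M(Q)$ starts at the vertex of $C(Q)$ and ends in $M(Q)$, and at least one of the arrows from $C(Q)$ to $M(Q)$ ends at the source of $M(Q)$.
   Context: $\mathbb{K}$ is a field, $Q$ is a finite connected quiver, $J$ is the ideal of $\mathbb{K}Q$ generated by the arrows. Modules are finitely generated right modules, with the convention that the simple modules $S_i$ (one per vertex) satisfy $\Omega(S_i)=\bigoplus_{\alpha:i\to j}S_j$. $A_0$ is the direct sum of all simple modules $S_i$. The heart $C(Q)$ is the full subquiver of $Q$ on the vertices whose simple modules lie both in the support of $\Omega^n(A_0)$ and in the support of $\Omega^{-n}(A_0)$ ($\Omega^{-n}$ is the $n$-th cosyzygy); the member $M(Q)$ is the full subquiver on the vertices not in the heart. $K_0(A)$ is the abelian group generated by symbols $[M]$, one for each isomorphism class of finitely generated $A$-modules, modulo the relations $[M]-[M']-[M'']$ whenever $M\cong M'\oplus M''$ and $[P]$ for each projective $P$. The syzygy $\Omega$ induces a group endomorphism $\overline{\Omega}:K_0(A)\to K_0(A)$. For a module $M$, $\langle \mathrm{add}\, M\rangle$ is the subgroup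 of $K_0(A)$ generated by the classes of the indecomposable direct summands of $M$, and $\phi(M)=\min\{l\in\mathbb{N}: \overline{\Omega}|_{\overline{\Omega}^{l+s}\langle \mathrm{add}\, M\rangle}\text{ is injective for all } s\in\mathbb{N}\}$ ($0\in\mathbb{N}$). The second Igusa-Todorov function is $\psi(M)=\phi(M)+\sup\{\mathrm{pd}(N): N \text{ is a direct summand of }\Omega^{\phi(M)}(M)\text{ with }\mathrm{pd}(N)<\infty\}$, and $\psi\dim(A)=\sup\{\psi(M): M\in\mathrm{mod}\,A\}$. *)

theory Defs
  imports
    "HOL-Algebra.Module"
    "HOL-Algebra.Ideal_Product"
    "HOL-Algebra.QuotRing"
    "HOL-Algebra.Free_Abelian_Groups"
    "HOL-Library.Extended_Nat"
    "Graph_Theory.Graph_Theory"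
begin

section \<open>Right modules over a ring\<close>

text \<open>
  The record of \<^theory>\<open>HOL-Algebra.Module\<close> is reused for right modules over an arbitrary ring.
  Its scalar multiplication takes the scalar first, so we write \<open>x \<triangleleft> a\<close> for
  \<open>smult M a x\<close>.  The fields \<open>mult\<close> and \<open>one\<close> of the record carry no information.
\<close>

abbreviation ract :: "('a, 'b, 'm) module_scheme \<Rightarrow> 'b \<Rightarrow> 'a \<Rightarrow> 'b" (infixl \<open>\<triangleleft>\<index>\<close> 70)
  where "x \<triangleleft>\<^bsub>M\<^esub> a \<equiv> smult M a x"

locale right_module = R?: ring R + M?: abelian_group M
  for R (structure) and M :: "('a, 'b, 'm) module_scheme" (structure) +
  assumes ract_closed:
      "\<lbrakk>x \<in> carrier M; a \<in> carrier R\<rbrakk> \<Longrightarrow> x \<triangleleft>\<^bsub>M\<^esub> a \<in> carrier M"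
    and ract_add_left:
      "\<lbrakk>x \<in> carrier M; y \<in> carrier M; a \<in> carrier R\<rbrakk>
        \<Longrightarrow> (x \<oplus>\<^bsub>M\<^esub> y) \<triangleleft>\<^bsub>M\<^esub> a = x \<triangleleft>\<^bsub>M\<^esub> a \<oplus>\<^bsub>M\<^esub> y \<triangleleft>\<^bsub>M\<^esub> a"
    and ract_add_right:
      "\<lbrakk>x \<in> carrier M; a \<in> carrier R; b \<in> carrier R\<rbrakk>
        \<Longrightarrow> x \<triangleleft>\<^bsub>M\<^esub> (a \<oplus>\<^bsub>R\<^esub> b) = x \<triangleleft>\<^bsub>M\<^esub> a \<oplus>\<^bsub>M\<^esub> x \<triangleleft>\<^bsub>M\<^esub> b"
    and ract_assoc:
      "\<lbrakk>x \<in> carrier M; a \<in> carrier R; b \<in> carrier R\<rbrakk>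
        \<Longrightarrow> x \<triangleleft>\<^bsub>M\<^esub> (a \<otimes>\<^bsub>R\<^esub> b) = (x \<triangleleft>\<^bsub>M\<^esub> a) \<triangleleft>\<^bsub>M\<^esub> b"
    and ract_one:
      "x \<in> carrier M \<Longrightarrow> x \<triangleleft>\<^bsub>M\<^esub> \<one>\<^bsub>R\<^esub> = x"

definition submod :: "('a, 'r) ring_scheme \<Rightarrow> ('a, 'b) module \<Rightarrow> 'b set \<Rightarrow> bool"
  where "submod R M N \<longleftrightarrow>
    additive_subgroup N M \<and> (\<forall>x\<in>N. \<forall>a\<in>carrier R. x \<triangleleft>\<^bsub>M\<^esub> a \<in> N)"

definition fin_gen :: "('a, 'r) ring_scheme \<Rightarrow> ('a, 'b) module \<Rightarrow> bool"
  where "fin_gen R M \<longleftrightarrow>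
    (\<exists>X. finite X \<and> X \<subseteq> carrier M \<and> (\<forall>N. submod R M N \<and> X \<subseteq> N \<longrightarrow> N = carrier M))"

text \<open>
  The category of finitely generated right modules.  Every finitely generated right
  \<open>R\<close>-module is a quotient of some \<open>R\<^sup>m\<close>; transporting the structure to a system of
  representatives of the cosets, it is isomorphic to a module whose underlying set
  consists of elements of type \<open>nat \<Rightarrow> 'a\<close>.  So \<open>fgmod R\<close> contains a copy of every
  finitely generated right \<open>R\<close>-module.
\<close>

type_synonym 'a umod = "('a, nat \<Rightarrow> 'a) module"

definition fgmod :: "('a, 'r) ring_scheme \<Rightarrow> 'a umod set"
  where "fgmod R = {M. right_module R M \<and> fin_gen R M}"

definition mhom :: "('a, 'r) ring_scheme \<Rightarrow> ('a, 'b) module \<Rightarrow> ('a, 'c) module \<Rightarrow> ('b \<Rightarrow> 'c) set"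
  where "mhom R M N = {f \<in> hom (add_monoid M) (add_monoid N).
    \<forall>x\<in>carrier M. \<forall>a\<in>carrier R. f (x \<triangleleft>\<^bsub>M\<^esub> a) = f x \<triangleleft>\<^bsub>N\<^esub> a}"

definition miso :: "('a, 'r) ring_scheme \<Rightarrow> ('a, 'b) module \<Rightarrow> ('a, 'c) module \<Rightarrow> bool"
  where "miso R M N \<longleftrightarrow> (\<exists>f\<in>mhom R M N. bij_betw f (carrier M) (carrier N))"

definition short_exact ::
    "('a, 'r) ring_scheme \<Rightarrow> ('a, 'b) module \<Rightarrow> ('b \<Rightarrow> 'c) \<Rightarrow> ('a, 'c) module \<Rightarrow>
      ('c \<Rightarrow> 'd) \<Rightarrow> ('a, 'd) module \<Rightarrow> bool"
  where "short_exact R L f M g N \<longleftrightarrow>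
    f \<in> mhom R L M \<and> inj_on f (carrier L) \<and>
    g \<in> mhom R M N \<and> g ` carrier M = carrier N \<and>
    f ` carrier L = a_kernel M N g"

subsection \<open>Direct sums, indecomposable and simple modules\<close>

definition msum :: "('a, 'b) module \<Rightarrow> ('a, 'c) module \<Rightarrow> ('a, 'b \<times> 'c) module"
  where "msum M N =
    \<lparr> carrier = carrier M \<times> carrier N, monoid.mult = undefined, monoid.one = undefined,
      ring.zero = (\<zero>\<^bsub>M\<^esub>, \<zero>\<^bsub>N\<^esub>),
      ring.add = (\<lambda>(x, y) (x', y'). (x \<oplus>\<^bsub>M\<^esub> x', y \<oplus>\<^bsub>N\<^esub> y')),
      module.smult = (\<lambda>a (x, y). (x \<triangleleft>\<^bsub>M\<^esub> a, y \<triangleleft>\<^bsub>N\<^esub> a)) \<rparr>"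

definition msum_fam :: "'i set \<Rightarrow> ('i \<Rightarrow> ('a, 'b) module) \<Rightarrow> ('a, 'i \<Rightarrow> 'b) module"
  where "msum_fam I M =
    \<lparr> carrier = (\<Pi>\<^sub>E i\<in>I. carrier (M i)), monoid.mult = undefined, monoid.one = undefined,
      ring.zero = (\<lambda>i\<in>I. \<zero>\<^bsub>M i\<^esub>),
      ring.add = (\<lambda>x y. \<lambda>i\<in>I. x i \<oplus>\<^bsub>M i\<^esub> y i),
      module.smult = (\<lambda>a x. \<lambda>i\<in>I. x i \<triangleleft>\<^bsub>M i\<^esub> a) \<rparr>"

definition direct_summand :: "('a, 'r) ring_scheme \<Rightarrow> 'a umod \<Rightarrow> 'a umod \<Rightarrow> bool"
  where "direct_summand R N M \<longleftrightarrow> N \<in> fgmod R \<and> (\<exists>N'\<in>fgmod R. miso R M (msum N N'))"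

definition indecomposable :: "('a, 'r) ring_scheme \<Rightarrow> 'a umod \<Rightarrow> bool"
  where "indecomposable R M \<longleftrightarrow>
    M \<in> fgmod R \<and> carrier M \<noteq> {\<zero>\<^bsub>M\<^esub>} \<and>
    (\<forall>X\<in>fgmod R. \<forall>Y\<in>fgmod R. miso R M (msum X Y) \<longrightarrow>
      carrier X = {\<zero>\<^bsub>X\<^esub>} \<or> carrier Y = {\<zero>\<^bsub>Y\<^esub>})"

definition simple_mod :: "('a, 'r) ring_scheme \<Rightarrow> 'a umod \<Rightarrow> bool"
  where "simple_mod R S \<longleftrightarrow>
    S \<in> fgmod R \<and> carrier S \<noteq> {\<zero>\<^bsub>S\<^esub>} \<and>
    (\<forall>N. submod R S N \<longrightarrow> N = {\<zero>\<^bsub>S\<^esub>} \<or> N = carrier S)"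

text \<open>
  A simple module \<open>S\<close> lies in the support of \<open>M\<close> if it is a composition factor of \<open>M\<close>, i.e.\
  \<open>S \<cong> N / L\<close> for submodules \<open>L \<subseteq> N\<close> of \<open>M\<close>; here \<open>L\<close> is the kernel of \<open>g\<close>.
\<close>

definition in_support :: "('a, 'r) ring_scheme \<Rightarrow> 'a umod \<Rightarrow> 'a umod \<Rightarrow> bool"
  where "in_support R S M \<longleftrightarrow>
    (\<exists>N. submod R M N \<and> (\<exists>g\<in>mhom R (M\<lparr>carrier := N\<rparr>) S. g ` N = carrier S))"

subsection \<open>Projective and injective modules, syzygies and cosyzygies\<close>

definition projective :: "('a, 'r) ring_scheme \<Rightarrow> 'a umod \<Rightarrow> bool"
  where "projective R P \<longleftrightarrow> P \<in> fgmod R \<and>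
    (\<forall>M\<in>fgmod R. \<forall>N\<in>fgmod R. \<forall>g\<in>mhom R M N. \<forall>f\<in>mhom R P N.
      g ` carrier M = carrier N \<longrightarrow> (\<exists>h\<in>mhom R P M. \<forall>x\<in>carrier P. g (h x) = f x))"

definition injective :: "('a, 'r) ring_scheme \<Rightarrow> 'a umod \<Rightarrow> bool"
  where "injective R I \<longleftrightarrow> I \<in> fgmod R \<and>
    (\<forall>M\<in>fgmod R. \<forall>N\<in>fgmod R. \<forall>g\<in>mhom R M N. \<forall>f\<in>mhom R M I.
      inj_on g (carrier M) \<longrightarrow> (\<exists>h\<in>mhom R N I. \<forall>x\<in>carrier M. h (g x) = f x))"

definition projective_cover ::
    "('a, 'r) ring_scheme \<Rightarrow> 'a umod \<Rightarrow> ((nat \<Rightarrow> 'a) \<Rightarrow> nat \<Rightarrow> 'a) \<Rightarrow> 'a umod \<Rightarrow> bool"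
  where "projective_cover R P p M \<longleftrightarrow>
    projective R P \<and> p \<in> mhom R P M \<and> p ` carrier P = carrier M \<and>
    (\<forall>L. submod R P L \<and> L <+>\<^bsub>P\<^esub> a_kernel P M p = carrier P \<longrightarrow> L = carrier P)"

definition injective_envelope ::
    "('a, 'r) ring_scheme \<Rightarrow> 'a umod \<Rightarrow> ((nat \<Rightarrow> 'a) \<Rightarrow> nat \<Rightarrow> 'a) \<Rightarrow> 'a umod \<Rightarrow> bool"
  where "injective_envelope R M j I \<longleftrightarrow>
    injective R I \<and> j \<in> mhom R M I \<and> inj_on j (carrier M) \<and>
    (\<forall>L. submod R I L \<and> L \<inter> j ` carrier M = {\<zero>\<^bsub>I\<^esub>} \<longrightarrow> L = {\<zero>\<^bsub>I\<^esub>})"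

text \<open>
  \<open>\<Omega> M\<close> is the kernel of a projective cover of \<open>M\<close>, and \<open>\<Omega>\<close> to the power \<open>-1\<close> of \<open>M\<close> is the
  cokernel of an injective envelope.  Both are determined up to isomorphism, and a
  representative is chosen; everything below depends on the isomorphism class only.
\<close>

definition syzygy :: "('a, 'r) ring_scheme \<Rightarrow> 'a umod \<Rightarrow> 'a umod"
  where "syzygy R M = (SOME N. N \<in> fgmod R \<and>
    (\<exists>P i p. projective_cover R P p M \<and> short_exact R N i P p M))"

definition cosyzygy :: "('a, 'r) ring_scheme \<Rightarrow> 'a umod \<Rightarrow> 'a umod"
  where "cosyzygy R M = (SOME N. N \<in> fgmod R \<and>
    (\<exists>I j q. injective_envelope R M j I \<and> short_exact R M j I q N))"

subsection \<open>Projective dimension\<close>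

text \<open>
  A projective resolution \<open>0 \<rightarrow> X (d + 1) \<rightarrow> \<dots> \<rightarrow> X 1 \<rightarrow> X 0 = M \<rightarrow> 0\<close> of length \<open>d\<close>, whose maps
  are \<open>f i : X (i + 1) \<rightarrow> X i\<close>.  The zero module has projective dimension \<open>0\<close>.
\<close>

definition projective_resolution ::
    "('a, 'r) ring_scheme \<Rightarrow> 'a umod \<Rightarrow> nat \<Rightarrow> (nat \<Rightarrow> 'a umod) \<Rightarrow>
      (nat \<Rightarrow> (nat \<Rightarrow> 'a) \<Rightarrow> nat \<Rightarrow> 'a) \<Rightarrow> bool"
  where "projective_resolution R M d X f \<longleftrightarrow>
    X 0 = M \<and>
    (\<forall>i\<le>d. projective R (X (Suc i)) \<and> f i \<in> mhom R (X (Suc i)) (X i)) \<and>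
    f 0 ` carrier (X 1) = carrier (X 0) \<and>
    (\<forall>i<d. f (Suc i) ` carrier (X (Suc (Suc i))) = a_kernel (X (Suc i)) (X i) (f i)) \<and>
    inj_on (f d) (carrier (X (Suc d)))"

definition pd :: "('a, 'r) ring_scheme \<Rightarrow> 'a umod \<Rightarrow> enat"
  where "pd R M = Inf {enat d | d. \<exists>X f. projective_resolution R M d X f}"

section \<open>The Igusa-Todorov functions\<close>

definition iso_class :: "('a, 'r) ring_scheme \<Rightarrow> 'a umod \<Rightarrow> 'a umod set"
  where "iso_class R M = {N \<in> fgmod R. miso R M N}"

definition K0_gens :: "('a, 'r) ring_scheme \<Rightarrow> ('a umod set \<Rightarrow>\<^sub>0 int) monoid"
  where "K0_gens R = free_Abelian_group (iso_class R ` fgmod R)"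

definition K0_rels :: "('a, 'r) ring_scheme \<Rightarrow> ('a umod set \<Rightarrow>\<^sub>0 int) set"
  where "K0_rels R = generate (K0_gens R)
    ({frag_of (iso_class R M) - frag_of (iso_class R M') - frag_of (iso_class R M'') | M M' M''.
        M \<in> fgmod R \<and> M' \<in> fgmod R \<and> M'' \<in> fgmod R \<and> miso R M (msum M' M'')}
     \<union> {frag_of (iso_class R P) | P. projective R P})"

definition K0 :: "('a, 'r) ring_scheme \<Rightarrow> ('a umod set \<Rightarrow>\<^sub>0 int) set monoid"
  where "K0 R = K0_gens R Mod K0_rels R"

definition K0_class :: "('a, 'r) ring_scheme \<Rightarrow> 'a umod \<Rightarrow> ('a umod set \<Rightarrow>\<^sub>0 int) set"
  where "K0_class R M = K0_rels R #>\<^bsub>K0_gens R\<^esub> frag_of (iso_class R M)"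

text \<open>The endomorphism of \<open>K0\<close> induced by \<open>\<Omega>\<close>; it is uniquely determined on the carrier.\<close>

definition Omega_bar ::
    "('a, 'r) ring_scheme \<Rightarrow> ('a umod set \<Rightarrow>\<^sub>0 int) set \<Rightarrow> ('a umod set \<Rightarrow>\<^sub>0 int) set"
  where "Omega_bar R = (SOME h. h \<in> hom (K0 R) (K0 R) \<and>
    (\<forall>M\<in>fgmod R. h (K0_class R M) = K0_class R (syzygy R M)))"

definition add_span :: "('a, 'r) ring_scheme \<Rightarrow> 'a umod \<Rightarrow> ('a umod set \<Rightarrow>\<^sub>0 int) set set"
  where "add_span R M =
    generate (K0 R) {K0_class R N | N. indecomposable R N \<and> direct_summand R N M}"

definition IT_phi :: "('a, 'r) ring_scheme \<Rightarrow> 'a umod \<Rightarrow> nat"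
  where "IT_phi R M =
    (LEAST l. \<forall>s. inj_on (Omega_bar R) ((Omega_bar R ^^ (l + s)) ` add_span R M))"

definition IT_psi :: "('a, 'r) ring_scheme \<Rightarrow> 'a umod \<Rightarrow> enat"
  where "IT_psi R M = enat (IT_phi R M) +
    Sup {pd R N | N. direct_summand R N ((syzygy R ^^ IT_phi R M) M) \<and> pd R N < \<infinity>}"

definition psi_dim :: "('a, 'r) ring_scheme \<Rightarrow> enat"
  where "psi_dim R = Sup (IT_psi R ` fgmod R)"

section \<open>Quivers and radical square zero algebras\<close>

text \<open>
  A quiver is a \<^typ>\<open>('v, 'e) pre_digraph\<close> (loops and multiple arrows are allowed).  A path is a
  pair of its starting vertex and the list of its arrows in the order in which they are
  traversed.  The path algebra consists of the finitely supported functions on paths, with the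
  convolution product for concatenation: \<open>\<alpha>\<beta>\<close> is ``first \<open>\<alpha>\<close>, then \<open>\<beta>\<close>''.  Thus \<open>e\<^sub>i A\<close> is spanned by
  the paths starting at \<open>i\<close>, and right modules satisfy \<open>\<Omega>(S\<^sub>i) \<cong> \<Oplus> S\<^sub>j\<close>, summed over the arrows
  \<open>i \<rightarrow> j\<close>.
\<close>

type_synonym ('v, 'e) path = "'v \<times> 'e list"

definition qpaths :: "('v, 'e) pre_digraph \<Rightarrow> ('v, 'e) path set"
  where "qpaths Q = {(u, p). \<exists>v. pre_digraph.awalk Q u p v}"

definition path_algebra ::
    "'k::field itself \<Rightarrow> ('v, 'e) pre_digraph \<Rightarrow> (('v, 'e) path \<Rightarrow> 'k) ring"
  where "path_algebra K Q =
    \<lparr> carrier = {f. finite {x. f x \<noteq> 0} \<and> {x. f x \<noteq> 0} \<subseteq> qpaths Q},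
      monoid.mult = (\<lambda>f g (u, p). \<Sum>k\<le>length p.
        f (u, take k p) * g (pre_digraph.awlast Q u (take k p), drop k p)),
      monoid.one = (\<lambda>(u, p). if u \<in> verts Q \<and> p = [] then 1 else 0),
      ring.zero = (\<lambda>_. 0),
      ring.add = (\<lambda>f g x. f x + g x) \<rparr>"

definition path_elem :: "('v, 'e) path \<Rightarrow> ('v, 'e) path \<Rightarrow> 'k::field"
  where "path_elem w = (\<lambda>x. if x = w then 1 else 0)"

definition arrow_ideal ::
    "'k::field itself \<Rightarrow> ('v, 'e) pre_digraph \<Rightarrow> (('v, 'e) path \<Rightarrow> 'k) set"
  where "arrow_ideal K Q =
    genideal (path_algebra K Q) {path_elem (tail Q a, [a]) | a. a \<in> arcs Q}"

definition arrow_ideal_sq ::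
    "'k::field itself \<Rightarrow> ('v, 'e) pre_digraph \<Rightarrow> (('v, 'e) path \<Rightarrow> 'k) set"
  where "arrow_ideal_sq K Q =
    ideal_prod (path_algebra K Q) (arrow_ideal K Q) (arrow_ideal K Q)"

definition rad_sq_zero_algebra ::
    "'k::field itself \<Rightarrow> ('v, 'e) pre_digraph \<Rightarrow> (('v, 'e) path \<Rightarrow> 'k) set ring"
  where "rad_sq_zero_algebra K Q = path_algebra K Q Quot arrow_ideal_sq K Q"

definition vertex_idem ::
    "'k::field itself \<Rightarrow> ('v, 'e) pre_digraph \<Rightarrow> 'v \<Rightarrow> (('v, 'e) path \<Rightarrow> 'k) set"
  where "vertex_idem K Q i = arrow_ideal_sq K Q +>\<^bsub>path_algebra K Q\<^esub> path_elem (i, [])"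

text \<open>\<open>S\<^sub>i\<close> is, up to isomorphism, the only simple module on which \<open>e\<^sub>i\<close> does not act as zero.\<close>

definition vertex_simple ::
    "'k::field itself \<Rightarrow> ('v, 'e) pre_digraph \<Rightarrow> 'v \<Rightarrow> (('v, 'e) path \<Rightarrow> 'k) set umod"
  where "vertex_simple K Q i = (SOME S. simple_mod (rad_sq_zero_algebra K Q) S \<and>
    (\<exists>x\<in>carrier S. x \<triangleleft>\<^bsub>S\<^esub> vertex_idem K Q i \<noteq> \<zero>\<^bsub>S\<^esub>))"

definition sum_of_simples ::
    "'k::field itself \<Rightarrow> ('v, 'e) pre_digraph \<Rightarrow> (('v, 'e) path \<Rightarrow> 'k) set umod"
  where "sum_of_simples K Q = (SOME M. M \<in> fgmod (rad_sq_zero_algebra K Q) \<and>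
    miso (rad_sq_zero_algebra K Q) M (msum_fam (verts Q) (vertex_simple K Q)))"

section \<open>Heart and member\<close>

text \<open>The exponent \<open>n\<close> in \<open>\<Omega>\<^sup>n\<close> is the number of vertices of \<open>Q\<close>.\<close>

definition heart :: "'k::field itself \<Rightarrow> ('v, 'e) pre_digraph \<Rightarrow> ('v, 'e) pre_digraph"
  where "heart K Q = (let A = rad_sq_zero_algebra K Q; n = card (verts Q); A0 = sum_of_simples K Q in
    Q \<restriction> {i \<in> verts Q.
      in_support A (vertex_simple K Q i) ((syzygy A ^^ n) A0) \<and>
      in_support A (vertex_simple K Q i) ((cosyzygy A ^^ n) A0)})"

definition member :: "'k::field itself \<Rightarrow> ('v, 'e) pre_digraph \<Rightarrow> ('v, 'e) pre_digraph"
  where "member K Q = Q \<restriction> (verts Q - verts (heart K Q))"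

definition is_sink :: "('v, 'e) pre_digraph \<Rightarrow> 'v \<Rightarrow> bool"
  where "is_sink Q v \<longleftrightarrow> v \<in> verts Q \<and> (\<forall>a\<in>arcs Q. tail Q a \<noteq> v)"

definition is_source :: "('v, 'e) pre_digraph \<Rightarrow> 'v \<Rightarrow> bool"
  where "is_source Q v \<longleftrightarrow> v \<in> verts Q \<and> (\<forall>a\<in>arcs Q. head Q a \<noteq> v)"

definition path_order_on :: "('v, 'e) pre_digraph \<Rightarrow> 'v set \<Rightarrow> ('v \<times> 'v) set"
  where "path_order_on Q V = {(x, y). x \<in> V \<and> y \<in> V \<and> (\<exists>p. pre_digraph.awalk Q x p y)}"

text \<open>
  The form \<open>C \<rightrightarrows> M\<close> of \<open>Q\<close>, for full subquivers \<open>C\<close> and \<open>M\<close>: all arrows between \<open>C\<close> and \<open>M\<close> go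
  from \<open>C\<close> to \<open>M\<close>, and one of them ends at a source of \<open>M\<close>.
\<close>

definition has_form ::
    "('v, 'e) pre_digraph \<Rightarrow> ('v, 'e) pre_digraph \<Rightarrow> ('v, 'e) pre_digraph \<Rightarrow> bool"
  where "has_form Q C M \<longleftrightarrow>
    (\<forall>a\<in>arcs Q.
      (tail Q a \<in> verts C \<and> head Q a \<in> verts M) \<or> (tail Q a \<in> verts M \<and> head Q a \<in> verts C) \<longrightarrow>
      tail Q a \<in> verts C \<and> head Q a \<in> verts M) \<and>
    (\<exists>a\<in>arcs Q. tail Q a \<in> verts C \<and> is_source M (head Q a))"

end

(*
  Over a radical square zero algebra every syzygy is semisimple, so that on classes in K0 the operator
  induced by Omega acts, from the first syzygy on, as the transposed adjacency matrix of Q restricted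
  to the vertices that are not sinks.  Hence phi of a module is bounded by one plus the nilpotency index
  of that matrix, and this is at most n, or n - 1 if Q has a sink and an oriented cycle.  The projective
  dimension of a semisimple module is the length of the longest walk from its support.  If psi reaches
  2n - 3, there is a walk of length n - 1 into some vertex from which the longest walk has length n - 2;
  this forces Q to consist of one vertex with loops followed by a chain of n - 1 vertices.  For such a Q
  the value is attained by the direct sum of S_c and the quotient of e_c A by one arrow into the chain.
  Walks of length n also describe the heart, since cosyzygies of semisimple modules follow the arrows
  backwards.
*)
theory Submission
  imports Defs "HOL-Library.Function_Algebras" "HOL-Library.Extended_Nat" "Jordan_Normal_Form.Missing_VectorSpace"
begin

section \<open>The nilpotency index of an operator\<close>

text \<open>The value 2n-3 arises as (n-1)+(n-2). Passing from a module to its first syzygy costs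
  phi one step; a sink removes one coordinate of the matrix and a cycle keeps one vector alive for
  ever, so each of them lowers the nilpotency index by one. A vertex with bounded walks reaches no
  cycle, which caps the second summand at n-2. The obstacle is K0: there may be infinitely many
  indecomposable modules and no list of their classes. The group is therefore probed only by
  integer-valued additive invariants that vanish on projectives. Two families suffice: the
  dimensions of the first syzygy and, at vertices that are not sinks, the dimension of soc M modulo
  MJ. Projectives enter through one linear condition, \<open>jflat\<close>, which is visible for
  explicit modules and passes to direct summands. Module theory is done in coordinates, and the path
  algebra appears only at the end as an instance. Syzygies, cosyzygies, Omega-bar and the vertex
  simples are chosen by \<open>SOME\<close>, so each needs an existence proof and arguments valid
  for every choice.\<close>

definition fscale :: "real \<Rightarrow> ('v \<Rightarrow> real) \<Rightarrow> 'v \<Rightarrow> real"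
 where "fscale c f = (\<lambda>x. c * f x)"

lemma vector_space_fscale: "vector_space fscale"
 by unfold_locales (auto simp: fscale_def fun_eq_iff algebra_simps)

interpretation FS: vector_space fscale
 by (rule vector_space_fscale)

text \<open>Places everything supported on \<open>V\<close> inside the span of at most
  \<open>card V\<close> point masses, the dimension bound behind both index estimates.\<close>

lemma supported_in_span:
 assumes "finite V" "\<And>x. x \<notin> V \<Longrightarrow> f x = 0"
 shows "f \<in> FS.span ((\<lambda>v x. if x = v then 1 else 0) ` V)"
proof -
 have sum_app: "(\<Sum>v\<in>A. g v) x = (\<Sum>v\<in>A. g v x)" for A :: "'v set" and g :: "'v \<Rightarrow> 'v \<Rightarrow> real" and x
  by (induct A rule: infinite_finite_induct) auto
 have "f = (\<Sum>v\<in>V. fscale (f v) (\<lambda>x. if x = v then 1 else 0))"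
 proof
  fix x
  have "(\<Sum>v\<in>V. fscale (f v) (\<lambda>x. if x = v then 1 else 0)) x
    = (\<Sum>v\<in>V. fscale (f v) (\<lambda>x. if x = v then 1 else 0) x)"
   by (rule sum_app)
  also have "\<dots> = (\<Sum>v\<in>V. if x = v then f v else 0)"
   by (rule sum.cong) (auto simp: fscale_def)
  also have "\<dots> = f x"
   using assms by (simp add: sum.delta)
  finally show "f x = (\<Sum>v\<in>V. fscale (f v) (\<lambda>x. if x = v then 1 else 0)) x" by simp
 qed
 also have "\<dots> \<in> FS.span ((\<lambda>v x. if x = v then 1 else 0) ` V)"
  by (intro FS.span_sum FS.span_scale FS.span_base) auto
 finally show ?thesis .
qed

text \<open>Only the vector \<open>f\<close> is assumed to be annihilated by a power of
  \<open>U\<close>, with exact index \<open>Suc k\<close>; the operator of a quiver with an oriented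
  cycle is not nilpotent itself.\<close>

locale nilpotent_vector =
 fixes U :: "('v \<Rightarrow> real) \<Rightarrow> 'v \<Rightarrow> real" and V :: "'v set" and f :: "'v \<Rightarrow> real" and k :: nat
 assumes fin: "finite V"
  and U_add: "\<And>g h. U (g + h) = U g + U h"
  and U_scale: "\<And>c g. U (fscale c g) = fscale c (U g)"
  and U_supp: "\<And>g x. x \<notin> V \<Longrightarrow> U g x = 0"
  and f_supp: "\<And>x. x \<notin> V \<Longrightarrow> f x = 0"
  and nz: "(U ^^ k) f \<noteq> 0" and z: "(U ^^ Suc k) f = 0"
begin

lemma U_zero: "U 0 = 0"
 using U_scale[of 0 0] by (simp add: fscale_def fun_eq_iff zero_fun_def)

lemma Upow_zero: "(U ^^ n) 0 = 0"
 by (induct n) (simp_all only: funpow.simps o_apply id_apply U_zero)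

lemma Upow_add: "(U ^^ n) (g + h) = (U ^^ n) g + (U ^^ n) h"
 by (induct n) (simp_all only: funpow.simps o_apply id_apply U_add)

lemma Upow_scale: "(U ^^ n) (fscale c g) = fscale c ((U ^^ n) g)"
 by (induct n) (simp_all only: funpow.simps o_apply id_apply U_scale)

lemma Upow_sum: "(U ^^ n) (\<Sum>i\<in>I. fscale (c i) (g i)) = (\<Sum>i\<in>I. fscale (c i) ((U ^^ n) (g i)))"
 by (induct I rule: infinite_finite_induct)
  (simp_all only: sum.infinite sum.empty sum.insert Upow_zero Upow_add Upow_scale not_False_eq_True)

lemma Upow_supp: "(\<And>x. x \<notin> V \<Longrightarrow> g x = 0) \<Longrightarrow> x \<notin> V \<Longrightarrow> (U ^^ n) g x = 0"
 by (cases n) (simp_all add: U_supp)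

lemma z_ge: "Suc k \<le> n \<Longrightarrow> (U ^^ n) f = 0"
proof -
 assume "Suc k \<le> n"
 then obtain m where "n = m + Suc k" by (metis add.commute le_Suc_ex)
 then show ?thesis by (simp only: funpow_add o_apply z Upow_zero)
qed

text \<open>Strong induction on the index: applying \<open>U ^^ (k - i)\<close> to the relation
  kills the terms after \<open>i\<close>, which overshoot \<open>k\<close>, and the terms before
  \<open>i\<close> already have vanishing coefficients, so \<open>c i\<close> times the nonzero
  vector \<open>(U ^^ k) f\<close> remains.\<close>

lemma coeffs_zero:
 assumes "(\<Sum>i\<le>k. fscale (c i) ((U ^^ i) f)) = 0" "i \<le> k"
 shows "c i = 0"
 using assms(2)
proof (induct i rule: less_induct)
 case (less i)
 have "0 = (U ^^ (k - i)) (\<Sum>j\<le>k. fscale (c j) ((U ^^ j) f))"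
  by (simp add: assms Upow_zero)
 also have "\<dots> = (\<Sum>j\<le>k. fscale (c j) ((U ^^ (k - i + j)) f))"
  by (simp add: Upow_sum funpow_add)
 also have "\<dots> = (\<Sum>j\<le>k. if j = i then fscale (c i) ((U ^^ k) f) else 0)"
 proof (rule sum.cong, simp)
  fix j assume "j \<in> {..k}"
  have "fscale (c j) ((U ^^ (k - i + j)) f) = 0" if "j \<noteq> i"
  proof (cases "j < i")
   case True
   then have "c j = 0" using less by simp
   then show ?thesis by (simp add: fscale_def zero_fun_def)
  next
   case False
   then have "(U ^^ (k - i + j)) f = 0" using that less.prems by (intro z_ge) simp
   then show ?thesis by (simp add: fscale_def zero_fun_def)
  qed
  then show "fscale (c j) ((U ^^ (k - i + j)) f) = (if j = i then fscale (c i) ((U ^^ k) f) else 0)"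
   using less.prems by auto
 qed
 also have "\<dots> = fscale (c i) ((U ^^ k) f)" using less.prems by simp
 finally have e: "fscale (c i) ((U ^^ k) f) = 0" by simp
 obtain x where "(U ^^ k) f x \<noteq> 0" using nz by (auto simp: fun_eq_iff)
 then show ?case using fun_cong[OF e, of x] by (simp add: fscale_def)
qed

lemma inj_orbit: "inj_on (\<lambda>i. (U ^^ i) f) {..k}"
proof (rule inj_onI)
 fix i j assume ij: "i \<in> {..k}" "j \<in> {..k}" and eq: "(U ^^ i) f = (U ^^ j) f"
 show "i = j"
 proof (rule ccontr)
  assume "i \<noteq> j"
  \<comment> \<open>A coincidence of two orbit vectors is a linear relation with coefficients 1 and
    -1, so \<open>coeffs_zero\<close> excludes it.\<close>
  define c where "c = (\<lambda>l. if l = i then 1 else if l = j then -1 else (0::real))"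
  have "(\<Sum>l\<le>k. fscale (c l) ((U ^^ l) f))
    = (\<Sum>l\<le>k. (if l = i then (U ^^ i) f else 0) + (if l = j then - (U ^^ i) f else 0))"
   using \<open>i \<noteq> j\<close> by (intro sum.cong) (auto simp: c_def fscale_def fun_eq_iff zero_fun_def eq)
  also have "\<dots> = 0" using ij by (simp add: sum.distrib)
  finally have "c i = 0" using ij by (intro coeffs_zero) auto
  then show False by (simp add: c_def)
 qed
qed

lemma independent_orbit: "\<not> FS.dependent ((\<lambda>i. (U ^^ i) f) ` {..k})"
proof (rule FS.independent_if_scalars_zero)
 fix g x assume s: "(\<Sum>x\<in>(\<lambda>i. (U ^^ i) f) ` {..k}. fscale (g x) x) = 0"
  and x: "x \<in> (\<lambda>i. (U ^^ i) f) ` {..k}"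
 then obtain i where i: "i \<le> k" "x = (U ^^ i) f" by auto
 have "(\<Sum>i\<le>k. fscale (g ((U ^^ i) f)) ((U ^^ i) f)) = 0"
  using s by (simp add: sum.reindex[OF inj_orbit])
 then have "g ((U ^^ i) f) = 0" by (rule coeffs_zero) (rule i)
 then show "g x = 0" by (simp add: i)
qed simp

lemma index_le: "Suc k \<le> card V"
proof -
 let ?t = "(\<lambda>v x. if x = v then 1 else 0 :: real) ` V"
 have "(\<lambda>i. (U ^^ i) f) ` {..k} \<subseteq> FS.span ?t"
  using Upow_supp[OF f_supp] fin by (auto intro!: supported_in_span)
 then have "card ((\<lambda>i. (U ^^ i) f) ` {..k}) \<le> card ?t"
  using FS.independent_span_bound[OF _ independent_orbit, of ?t] fin by simp
 also have "\<dots> \<le> card V" by (rule card_image_le[OF fin])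
 finally show ?thesis by (simp add: card_image[OF inj_orbit])
qed

text \<open>A vector that no power of \<open>U\<close> kills lies outside the span of the orbit, on
  which \<open>U ^^ Suc k\<close> is zero. It enlarges the independent set by one; this is how an
  oriented cycle improves the bound.\<close>

lemma index_less:
 assumes g: "\<And>x. x \<notin> V \<Longrightarrow> g x = 0" and gn: "\<And>n. (U ^^ n) g \<noteq> 0"
 shows "Suc k < card V"
proof -
 let ?t = "(\<lambda>v x. if x = v then 1 else 0 :: real) ` V"
 let ?s = "(\<lambda>i. (U ^^ i) f) ` {..k}"
 have "g \<notin> FS.span ?s"
 proof
  assume "g \<in> FS.span ?s"
  then have "(U ^^ Suc k) g = 0"
  proof (induct rule: FS.span_induct_alt)
   case base then show ?case by (rule Upow_zero)
  next
   case (step c x y)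
   then obtain i where "x = (U ^^ i) f" by auto
   then have "(U ^^ Suc k) x = (U ^^ (Suc k + i)) f" by (simp only: funpow_add o_apply)
   then have "(U ^^ Suc k) x = 0" using z_ge[of "Suc k + i"] by simp
   then have "(U ^^ Suc k) (fscale c x) = 0"
    by (simp only: Upow_scale) (simp add: fscale_def zero_fun_def)
   then show ?case using step by (simp only: Upow_add) simp
  qed
  then show False using gn by blast
 qed
 then have ind: "\<not> FS.dependent (insert g ?s)"
  by (rule FS.independent_insertI) (rule independent_orbit)
 have "insert g ?s \<subseteq> FS.span ?t"
  using Upow_supp[OF f_supp] fin g by (auto intro!: supported_in_span)
 then have "card (insert g ?s) \<le> card ?t"
  using FS.independent_span_bound[OF _ ind, of ?t] fin by simp
 also have "\<dots> \<le> card V" by (rule card_image_le[OF fin])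
 finally have "card (insert g ?s) \<le> card V" .
 moreover have "g \<notin> ?s" using \<open>g \<notin> FS.span ?s\<close> FS.span_base[of g ?s] by (rule contrapos_nn)
 ultimately show ?thesis by (simp add: card_image[OF inj_orbit])
qed

end

section \<open>Long walks in a finite relation\<close>

lemma cycle_relpow:
 assumes "(z, z) \<in> r\<^sup>+"
 obtains m where "n \<le> m" "(z, z) \<in> r ^^ m"
proof -
 obtain k where k: "k > 0" "(z, z) \<in> r ^^ k" using assms by (auto simp: trancl_power)
 have "(z, z) \<in> r ^^ (k * n)" for n
  by (induct n) (use k in \<open>auto simp: relpow_add\<close>)
 then show thesis using that[of "k * n"] k by simp
qed

text \<open>A closed walk is repeated until it is long enough and then cut after exactly
  \<open>n\<close> steps; a closed walk of length \<open>n\<close> need not exist.\<close>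

lemma cycle_relpow_from: "(z, z) \<in> r\<^sup>+ \<Longrightarrow> \<exists>y. (z, y) \<in> r ^^ n"
 by (erule cycle_relpow[of z r n]) (auto simp: relpow_add dest!: le_Suc_ex)

lemma cycle_relpow_to: "(z, z) \<in> r\<^sup>+ \<Longrightarrow> \<exists>y. (y, z) \<in> r ^^ n"
proof (erule cycle_relpow[of z r n])
 fix m assume "n \<le> m" "(z, z) \<in> r ^^ m"
 then have "(z, z) \<in> r ^^ (m - n + n)" by simp
 then show ?thesis unfolding relpow_add by blast
qed

text \<open>Pigeonhole: a walk with \<open>L\<close> arrows has \<open>L + 1\<close> positions, more
  than there are vertices.\<close>

lemma long_walk_cycle:
 assumes fin: "finite V" and r: "r \<subseteq> V \<times> V" and w: "\<And>k. k < L \<Longrightarrow> (w k, w (Suc k)) \<in> r"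
  and w0: "w 0 \<in> V" and L: "card V \<le> L"
 shows "\<exists>k\<le>L. (w k, w k) \<in> r\<^sup>+"
proof -
 have inV: "k \<le> L \<Longrightarrow> w k \<in> V" for k
  using r w[of "k - 1"] w0 by (cases k) auto
 have "\<not> inj_on w {..L}"
 proof
  assume "inj_on w {..L}"
  then have "card {..L} \<le> card V" using inV fin by (intro card_inj_on_le) auto
  then show False using L by simp
 qed
 then obtain i j where ij: "i < j" "j \<le> L" "w i = w j"
  unfolding inj_on_def by (metis atMost_iff linorder_neqE_nat)
 have "(w i, w (i + k)) \<in> r\<^sup>*" if "i + k \<le> L" for k
  using that by (induct k) (auto intro: rtrancl_into_rtrancl[OF _ w])
 from this[of "j - Suc i"] ij w[of "j - 1"] have "(w i, w j) \<in> r\<^sup>+"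
  by (cases j) auto
 then show ?thesis using ij by (intro exI[of _ i]) auto
qed

text \<open>Keeps the position of the cycle on the walk: reachability from the start is what turns
  one long walk into walks of every length.\<close>

lemma relpow_cycle:
 assumes fin: "finite V" and r: "r \<subseteq> V \<times> V" and w: "(u, v) \<in> r ^^ L" and V: "u \<in> V" and L: "card V \<le> L"
 shows "\<exists>z. (u, z) \<in> r\<^sup>* \<and> (z, z) \<in> r\<^sup>+ \<and> (z, v) \<in> r\<^sup>*"
proof -
 obtain f where f: "f 0 = u" "f L = v" "\<And>i. i < L \<Longrightarrow> (f i, f (Suc i)) \<in> r"
  using w unfolding relpow_fun_conv by auto
 obtain k where k: "k \<le> L" "(f k, f k) \<in> r\<^sup>+"
  using long_walk_cycle[OF fin r, of L f] f V L by auto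
 have "(f 0, f j) \<in> r\<^sup>*" if "j \<le> L" for j
  using that by (induct j) (auto intro: rtrancl_into_rtrancl[OF _ f(3)])
 moreover have "(f k, f (k + j)) \<in> r\<^sup>*" if "k + j \<le> L" for j
  using that by (induct j) (auto intro: rtrancl_into_rtrancl[OF _ f(3)])
 from this[of "L - k"] have "(f k, v) \<in> r\<^sup>*" using k f by simp
 ultimately show ?thesis using k f by auto
qed

text \<open>Combinatorial core shared by both sides of the equivalence. Arrows may skip ahead along
  the chain and may leave \<open>c\<close> for any chain vertex; multiplicities are invisible
  because \<open>r\<close> is a relation. The indices run below \<open>n - 1\<close> since
  \<open>c\<close> is the remaining vertex.\<close>

definition chain_form :: "('v \<times> 'v) set \<Rightarrow> 'v set \<Rightarrow> nat \<Rightarrow> 'v \<Rightarrow> (nat \<Rightarrow> 'v) \<Rightarrow> bool"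
 where "chain_form r V n c w \<longleftrightarrow>
  V = insert c (w ` {..<n - 1}) \<and> inj_on w {..<n - 1} \<and> c \<notin> w ` {..<n - 1} \<and>
  (c, c) \<in> r \<and> (c, w 0) \<in> r \<and> (\<forall>k. Suc k < n - 1 --> (w k, w (Suc k)) \<in> r) \<and>
  (\<forall>k<n - 1. (w k, c) \<notin> r) \<and> (\<forall>j<n - 1. \<forall>k<n - 1. (w j, w k) \<in> r --> j < k)"

text \<open>The walk of length \<open>p\<close> into \<open>i\<close> will come from phi, the
  longest walk of length \<open>d\<close> out of \<open>i\<close> from a projective dimension.
  Vertices reachable from \<open>i\<close> lie on no cycle, so the longest walk has
  \<open>d + 1\<close> distinct vertices; the combined walk is too long to avoid a cycle, whose
  vertex is one more, so \<open>d\<close> is at most \<open>n - 2\<close>. The last vertex of the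
  longest walk is a sink, hence \<open>p\<close> is at most \<open>n - 1\<close> by
  \<open>cyc\<close>, and both bounds must be equalities.\<close>

lemma chain_formI_walk:
 fixes p d n :: nat
 assumes fin: "finite V" and r: "r \<subseteq> V \<times> V" and n: "card V = n" "n > 3"
  and u: "(u, i) \<in> r ^^ p" and x: "(i, x) \<in> r ^^ d" and max: "\<And>y. (i, y) \<notin> r ^^ Suc d"
  and pd: "2 * n - 3 \<le> p + d" and p: "p \<le> n"
  and cyc: "\<And>z s. (z, z) \<in> r\<^sup>+ \<Longrightarrow> s \<in> V \<Longrightarrow> s \<notin> Domain r \<Longrightarrow> p \<le> n - 1"
 shows "p = n - 1 \<and> d = n - 2 \<and> (\<exists>c w. chain_form r V n c w)"
proof -
 have d0: "d > 0" using pd p n by linarith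
 have start: "a \<in> V" if "(a, b) \<in> r ^^ m" "m > 0" for a b m
  by (rule relpow_E2[OF that(1)]) (use that r in auto)
 have iV: "i \<in> V" using start[OF x d0] .
 define D where "D = {y. (i, y) \<in> r\<^sup>*}"
 have DV: "D \<subseteq> V" using r iV unfolding D_def by (auto elim: rtranclE)
 \<comment> \<open>A cycle reachable from \<open>i\<close> would give walks from \<open>i\<close> of
   every length.\<close>
 have acyc: "(z, z) \<notin> r\<^sup>+" if zD: "z \<in> D" for z
 proof
  assume c: "(z, z) \<in> r\<^sup>+"
  obtain k where k: "(i, z) \<in> r ^^ k" using zD unfolding D_def by (auto dest: rtrancl_imp_relpow)
  obtain y where "(z, y) \<in> r ^^ Suc d" using cycle_relpow_from[OF c] by blast
  then have "(i, y) \<in> r ^^ (Suc d + k)" using k by (metis add.commute relcomp.relcompI relpow_add)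
  then obtain y' where "(i, y') \<in> r ^^ Suc d" unfolding relpow_add by blast
  then show False using max by blast
 qed
 obtain w where w: "w 0 = i" "w d = x" "\<And>k. k < d \<Longrightarrow> (w k, w (Suc k)) \<in> r"
  using x unfolding relpow_fun_conv by auto
 have w_path: "(w j, w (j + k)) \<in> r\<^sup>*" if "j + k \<le> d" for j k
  using that by (induct k) (auto intro: rtrancl_into_rtrancl[OF _ w(3)])
 have w_path_less: "(w j, w k) \<in> r\<^sup>+" if "j < k" "k \<le> d" for j k
  using that w_path[of "Suc j" "k - Suc j"] w(3)[of j] by auto
 have wD: "w k \<in> D" if "k \<le> d" for k using w_path[of 0 k] w(1) that by (simp add: D_def)
 have inj: "inj_on w {..d}"
  by (rule inj_onI) (metis acyc atMost_iff linorder_neqE_nat w_path_less wD)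
 have cardw: "card (w ` {..d}) = Suc d" by (simp add: card_image[OF inj])
 have "w ` {..d} \<subseteq> V" using wD DV by auto
 then have "Suc d \<le> n" using card_mono[OF fin] cardw n by metis
 then have "p > 0" using pd n by linarith
 have uV: "u \<in> V" using start[OF u \<open>p > 0\<close>] .
 \<comment> \<open>The concatenated walk has at least \<open>2 * n - 3\<close> arrows, hence at
   least \<open>n\<close>, and so meets a cycle; by \<open>acyc\<close> the vertex found is not in
   \<open>D\<close>.\<close>
 have "(u, x) \<in> r ^^ (p + d)" using u x by (metis relcomp.relcompI relpow_add)
 moreover have "card V \<le> p + d" using n pd by linarith
 ultimately obtain c where c: "(c, c) \<in> r\<^sup>+" using relpow_cycle[OF fin r _ uV] by blast
 have cD: "c \<notin> D" using acyc c by blast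
 have cV: "c \<in> V" using c r by (auto dest: tranclD)
 have sub: "insert c (w ` {..d}) \<subseteq> V" using cV wD DV by auto
 have cnw: "c \<notin> w ` {..d}" using wD cD by auto
 have "card (insert c (w ` {..d})) \<le> n" using card_mono[OF fin sub] n by simp
 then have dn: "d \<le> n - 2" using cardw cnw by simp
 \<comment> \<open>The end of a longest walk is a sink; together with the cycle through
   \<open>c\<close> it activates the sharper bound on \<open>p\<close>.\<close>
 have "x \<notin> Domain r" using max x by (auto intro: relpow_Suc_I)
 moreover have "x \<in> V" using wD[of d] w DV by auto
 ultimately have "p \<le> n - 1" using cyc c by blast
 then have pn: "p = n - 1" and dn': "d = n - 2" using dn pd n by linarith+
 have Veq: "V = insert c (w ` {..d})"
  using card_subset_eq[OF fin sub] cardw cnw n dn' by simp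
 have stay: "b \<in> D" if "a \<in> D" "(a, b) \<in> r" for a b
  using that unfolding D_def by auto
 have VD: "v = c" if "v \<in> V" "v \<notin> D" for v using that Veq wD by auto
 \<comment> \<open>The cycle through \<open>c\<close> cannot enter \<open>D\<close>, which is closed
   under successors, and \<open>c\<close> is the only vertex outside \<open>D\<close>; so its first
   arrow is a loop.\<close>
 have loop: "(c, c) \<in> r"
 proof -
  obtain b where b: "(c, b) \<in> r" "(b, c) \<in> r\<^sup>*" using c by (meson tranclD)
  have "b \<notin> D"
  proof
   assume "b \<in> D"
   then have "c \<in> D" using b(2) unfolding D_def by auto
   then show False using cD by simp
  qed
  then show ?thesis using VD[of b] b r by auto
 qed
 have "(c, w 0) \<in> r"
 proof -
  obtain p' where "p = Suc p'" using \<open>p > 0\<close> by (cases p) auto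
  then obtain b where b: "(b, i) \<in> r" using u by auto
  have "b \<notin> D"
  proof
   assume "b \<in> D"
   then have "(i, i) \<in> r\<^sup>+" using b unfolding D_def by auto
   then show False using acyc[of i] by (simp add: D_def)
  qed
  then show ?thesis using VD[of b] b r w by auto
 qed
 moreover have "{..<n - 1} = {..d}" using dn' n by auto
 moreover have "(w k, c) \<notin> r" if "k \<le> d" for k using stay wD that cD by blast
 moreover have "j < k" if "j \<le> d" "k \<le> d" "(w j, w k) \<in> r" for j k
 proof (rule ccontr)
  assume "\<not> j < k"
  then have "(w k, w j) \<in> r\<^sup>*" using w_path[of k "j - k"] that by simp
  then have "(w k, w k) \<in> r\<^sup>+" using that by simp
  then show False using acyc wD that by blast
 qed
 ultimately have "chain_form r V n c w"
  unfolding chain_form_def using Veq inj cnw loop w(3) dn' n by auto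
 then show ?thesis using pn dn' by blast
qed

text \<open>No arrow returns to \<open>c\<close> and every arrow inside the chain raises the index,
  so \<open>m\<close> steps raise it by at least \<open>m\<close>. For large \<open>m\<close> the
  set is empty, and that is how lengths of walks are bounded.\<close>

lemma chain_form_walks:
 assumes "chain_form r V n c w" "r \<subseteq> V \<times> V" "k < n - 1" "(w k, y) \<in> r ^^ m"
 shows "y \<in> w ` {k + m..<n - 1}"
 using assms(4)
proof (induct m arbitrary: y)
 case 0 then show ?case using assms(3) by auto
next
 case (Suc m)
 then obtain x where x: "(w k, x) \<in> r ^^ m" "(x, y) \<in> r" by auto
 from Suc.hyps[OF x(1)] obtain j where j: "x = w j" "k + m \<le> j" "j < n - 1" by auto
 have "y \<in> V" "y \<noteq> c" using x(2) assms j unfolding chain_form_def by auto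
 then obtain l where l: "y = w l" "l < n - 1" using assms(1) unfolding chain_form_def by auto
 have "j < l" using x(2) j l assms(1) unfolding chain_form_def by blast
 then show ?case using l j by auto
qed

text \<open>The loop gives \<open>c\<close> walks of every length on both sides. Walks of length
  \<open>n\<close> do end at the chain vertices, but none starts there.\<close>

lemma chain_form_heart:
 assumes cf: "chain_form r V n c w" "r \<subseteq> V \<times> V" "n > 3"
 shows "{i\<in>V. (\<exists>y. (y, i) \<in> r ^^ n) \<and> (\<exists>y. (i, y) \<in> r ^^ n)} = {c}"
proof -
 have "(c, c) \<in> r\<^sup>+" using cf by (auto simp: chain_form_def)
 then have "\<exists>y. (y, c) \<in> r ^^ n" "\<exists>y. (c, y) \<in> r ^^ n"
  by (rule cycle_relpow_to, rule cycle_relpow_from)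
 moreover have "(w k, y) \<notin> r ^^ n" if "k < n - 1" for k y
  using chain_form_walks[OF cf(1,2) that, of y n] by auto
 ultimately show ?thesis using cf unfolding chain_form_def by auto
qed

text \<open>Conversely, a heart consisting of one vertex with a loop, from which a totally ordered
 member is entered at its source, forces the chain form.\<close>

lemma chain_formI_order:
 assumes fin: "finite V" and r: "r \<subseteq> V \<times> V" and n: "card V = n" "n > 3"
  and heart: "{i\<in>V. (\<exists>y. (y, i) \<in> r ^^ n) \<and> (\<exists>y. (i, y) \<in> r ^^ n)} = {c}"
  and loop: "(c, c) \<in> r" and bk: "\<And>x. (x, c) \<in> r \<Longrightarrow> x = c"
  and lin: "linear_order_on (V - {c}) {(x, y). x \<in> V - {c} \<and> y \<in> V - {c} \<and> (x, y) \<in> r\<^sup>*}"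
  and src: "(c, s) \<in> r" "s \<in> V - {c}" "\<And>x. (x, s) \<in> r \<Longrightarrow> x = c"
 shows "\<exists>w. chain_form r V n c w"
proof -
 define X where "X = V - {c}"
 have cV: "c \<in> V" using heart by blast
 have X: "finite X" "card X = n - 1" using fin cV n by (auto simp: X_def)
 \<comment> \<open>A vertex on a cycle has walks of length \<open>n\<close> in both directions, so
   it would belong to the heart.\<close>
 have acyc: "(z, z) \<notin> r\<^sup>+" if "z \<in> X" for z
 proof
  assume "(z, z) \<in> r\<^sup>+"
  then have "z \<in> {i\<in>V. (\<exists>y. (y, i) \<in> r ^^ n) \<and> (\<exists>y. (i, y) \<in> r ^^ n)}"
   using that cycle_relpow_to[of z r n] cycle_relpow_from[of z r n] by (simp add: X_def)
  then show False using that by (simp only: heart) (simp add: X_def)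
 qed
 have tot: "x \<noteq> y \<Longrightarrow> (x, y) \<in> r\<^sup>* \<or> (y, x) \<in> r\<^sup>*" if "x \<in> X" "y \<in> X" for x y
  using lin that by (auto simp: linear_order_on_def total_on_def X_def)
 have inX: "y \<in> X" if "(x, y) \<in> r\<^sup>*" "x \<in> X" for x y
  using that by (induct rule: rtrancl_induct) (use r bk in \<open>auto simp: X_def\<close>)
 \<comment> \<open>The number of strict predecessors in the member. Acyclicity makes it strictly
   increasing along walks and totality makes it injective, so it numbers the member from
   \<open>0\<close> to \<open>n - 2\<close>.\<close>
 define rk where "rk x = card {y\<in>X. (y, x) \<in> r\<^sup>+}" for x
 have rk_less: "rk x < rk y" if "x \<in> X" "(x, y) \<in> r\<^sup>+" for x y
 proof -
  have "{z\<in>X. (z, x) \<in> r\<^sup>+} \<subset> {z\<in>X. (z, y) \<in> r\<^sup>+}" using that acyc by auto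
  then show ?thesis unfolding rk_def using X by (intro psubset_card_mono) auto
 qed
 have rk_iff: "rk x < rk y \<longleftrightarrow> (x, y) \<in> r\<^sup>+" if "x \<in> X" "y \<in> X" for x y
 proof
  assume "rk x < rk y"
  then have "x \<noteq> y" "(y, x) \<notin> r\<^sup>+" using rk_less[of y x] that by auto
  then show "(x, y) \<in> r\<^sup>+" using tot[OF that] by (auto dest: rtranclD)
 qed (use rk_less that in auto)
 have inj: "inj_on rk X"
 proof (rule inj_onI)
  fix x y assume xy: "x \<in> X" "y \<in> X" "rk x = rk y"
  then show "x = y" using tot[of x y] rk_iff[of x y] rk_iff[of y x] by (auto dest!: rtranclD)
 qed
 have "rk x < n - 1" if "x \<in> X" for x
 proof -
  have "{z\<in>X. (z, x) \<in> r\<^sup>+} \<subset> X" using that acyc by auto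
  then show ?thesis unfolding rk_def X(2)[symmetric] using X by (intro psubset_card_mono) auto
 qed
 then have img: "rk ` X = {..<n - 1}"
  using X card_image[OF inj] by (intro card_subset_eq) auto
 define w where "w = inv_into X rk"
 have w: "w k \<in> X" "rk (w k) = k" if "k < n - 1" for k
  using that img inv_into_into[of k rk X] f_inv_into_f[of k rk X] by (auto simp: w_def)
 have wimg: "w ` {..<n - 1} = X"
  unfolding w_def img[symmetric] using inj by (force simp: image_iff)
 have winj: "inj_on w {..<n - 1}" by (rule inj_on_inverseI[of _ rk]) (use w in auto)
 \<comment> \<open>The first vertex after \<open>w k\<close> on a walk to \<open>w (Suc k)\<close>
   has rank above \<open>k\<close> and, unless it is already \<open>w (Suc k)\<close>, below
   \<open>Suc k\<close>; so the arrow is direct.\<close>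
 have suc: "(w k, w (Suc k)) \<in> r" if k: "Suc k < n - 1" for k
 proof -
  have "(w k, w (Suc k)) \<in> r\<^sup>+" using rk_iff[of "w k" "w (Suc k)"] w[of k] w[of "Suc k"] k by auto
  then obtain y where y: "(w k, y) \<in> r" "(y, w (Suc k)) \<in> r\<^sup>*" by (meson tranclD)
  have yX: "y \<in> X" using inX[of "w k" y] y w[of k] k by auto
  have "k < rk y" using rk_less[of "w k" y] y w[of k] k by auto
  moreover have "y \<noteq> w (Suc k) \<Longrightarrow> rk y < Suc k"
   using y(2) rk_less[OF yX, of "w (Suc k)"] w[of "Suc k"] k by (auto dest!: rtranclD)
  ultimately have "y = w (Suc k)" by linarith
  then show ?thesis using y by simp
 qed
 \<comment> \<open>Otherwise \<open>s\<close> would come after \<open>w 0\<close> and receive an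
   arrow from inside the member, against its being a source there.\<close>
 have "s = w 0"
 proof (rule ccontr)
  assume "s \<noteq> w 0"
  have 0: "w 0 \<in> X" "rk (w 0) = 0" using w[of 0] n by auto
  have sX: "s \<in> X" using src(2) by (simp add: X_def)
  have "(s, w 0) \<notin> r\<^sup>+" using rk_iff[OF sX 0(1)] 0 by simp
  then have "(w 0, s) \<in> r\<^sup>+" using tot[OF 0(1) sX] \<open>s \<noteq> w 0\<close> by (metis rtranclD)
  then obtain x where x: "(w 0, x) \<in> r\<^sup>*" "(x, s) \<in> r" by (meson tranclD2)
  then have "x \<in> X" using inX 0 by blast
  then show False using src(3)[OF x(2)] by (simp add: X_def)
 qed
 moreover have "j < k" if "j < n - 1" "k < n - 1" "(w j, w k) \<in> r" for j k
  using rk_less[of "w j" "w k"] w that by auto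
 moreover have "(w k, c) \<notin> r" if "k < n - 1" for k using bk w(1)[OF that] by (auto simp: X_def)
 ultimately have "chain_form r V n c w"
  unfolding chain_form_def using wimg winj suc loop src(1) cV by (auto simp: X_def)
 then show ?thesis by auto
qed

no_notation vwalk_join (infixr "\<oplus>" 65)

section \<open>Finite-dimensional subspaces of an abelian group with scalars\<close>

text \<open>Scalars form a type of class \<open>field\<close>, whereas the dimension theory speaks
  of ring records with a carrier; this record connects the two.\<close>

definition kring :: "'k::field ring"
 where "kring = \<lparr>carrier = UNIV, monoid.mult = (*), monoid.one = 1, ring.zero = 0, ring.add = (+)\<rparr>"

lemma field_kring: "field (kring :: 'k::field ring)"
proof -
 have inv: "\<exists>y. x + y = 0" for x :: 'k
  by (rule exI[of _ "- x"]) simp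
 interpret cring "kring :: 'k ring"
  by unfold_locales (auto simp: kring_def Units_def algebra_simps add.commute[of _ "_::'k"] intro: inv)
 show ?thesis
  by (rule cring_fieldI2) (auto simp: kring_def intro: right_inverse)
qed

text \<open>Makes a subset the carrier of a separate vector space with the inherited operations, so
  that the dimension of a subspace is an absolute dimension.\<close>

definition vsp :: "('b, 'm) ring_scheme \<Rightarrow> ('k::field \<Rightarrow> 'b \<Rightarrow> 'b) \<Rightarrow> 'b set \<Rightarrow> ('k, 'b) module"
 where "vsp M s W = \<lparr>carrier = W, monoid.mult = undefined, monoid.one = undefined,
  ring.zero = \<zero>\<^bsub>M\<^esub>, ring.add = (\<oplus>\<^bsub>M\<^esub>), module.smult = s\<rparr>"

definition ksub :: "('b, 'm) ring_scheme \<Rightarrow> ('k::field \<Rightarrow> 'b \<Rightarrow> 'b) \<Rightarrow> 'b set \<Rightarrow> bool"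
 where "ksub M s W \<longleftrightarrow> W \<subseteq> carrier M \<and> \<zero>\<^bsub>M\<^esub> \<in> W \<and>
  (\<forall>x\<in>W. \<forall>y\<in>W. x \<oplus>\<^bsub>M\<^esub> y \<in> W) \<and> (\<forall>c. \<forall>x\<in>W. s c x \<in> W)"

text \<open>Spanning is phrased through the subspaces containing the generators, so it can be
  carried along linear maps by taking preimages, without linear combinations.\<close>

definition kfin :: "('b, 'm) ring_scheme \<Rightarrow> ('k::field \<Rightarrow> 'b \<Rightarrow> 'b) \<Rightarrow> 'b set \<Rightarrow> bool"
 where "kfin M s W \<longleftrightarrow>
  (\<exists>X. finite X \<and> X \<subseteq> W \<and> (\<forall>Z. ksub M s Z \<and> X \<subseteq> Z --> W \<subseteq> Z))"

lemma kfinE: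
 assumes "kfin M s W"
 obtains X where "finite X" "X \<subseteq> W" "\<And>Z. ksub M s Z \<Longrightarrow> X \<subseteq> Z \<Longrightarrow> W \<subseteq> Z"
proof -
 obtain X where "finite X \<and> X \<subseteq> W \<and> (\<forall>Z. ksub M s Z \<and> X \<subseteq> Z --> W \<subseteq> Z)"
  using assms unfolding kfin_def ..
 then show thesis by (intro that[of X]) simp_all
qed

definition kdim :: "('b, 'm) ring_scheme \<Rightarrow> ('k::field \<Rightarrow> 'b \<Rightarrow> 'b) \<Rightarrow> 'b set \<Rightarrow> nat"
 where "kdim M s W = vectorspace.dim kring (vsp M s W)"

text \<open>The scalar action is a separate parameter: in the modules to come the
  \<open>smult\<close> field holds the action of the algebra, and scalars act through it by
  \<open>kact\<close>.\<close>

locale kspace = abelian_group M for M :: "('b, 'm) ring_scheme" (structure) +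
 fixes s :: "'k::field \<Rightarrow> 'b \<Rightarrow> 'b"
 assumes s_closed [simp, intro]: "x \<in> carrier M \<Longrightarrow> s c x \<in> carrier M"
  and s_add: "\<lbrakk>x \<in> carrier M; y \<in> carrier M\<rbrakk> \<Longrightarrow> s c (x \<oplus> y) = s c x \<oplus> s c y"
  and s_add_left: "x \<in> carrier M \<Longrightarrow> s (c + d) x = s c x \<oplus> s d x"
  and s_mult: "x \<in> carrier M \<Longrightarrow> s (c * d) x = s c (s d x)"
  and s_one: "x \<in> carrier M \<Longrightarrow> s 1 x = x"
begin

lemma s_zero_left [simp]: "x \<in> carrier M \<Longrightarrow> s 0 x = \<zero>"
 using s_add_left[of x 0 0] by (metis add.inv_closed add_cancel_left_left add.r_cancel_one' s_closed)

lemma s_zero [simp]: "s c \<zero> = \<zero>"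
 using s_add[of \<zero> \<zero> c] by (metis add.r_cancel_one' add.one_closed l_zero s_closed)

lemma s_minus: "x \<in> carrier M \<Longrightarrow> s (- c) x = \<ominus> s c x"
 using s_add_left[of x "- c" c] by (metis add.inv_equality add.left_inverse s_closed s_zero_left)

lemma s_minus_one: "x \<in> carrier M \<Longrightarrow> s (- 1) x = \<ominus> x"
 by (simp add: s_minus s_one)

lemma s_finsum:
 "f \<in> A \<rightarrow> carrier M \<Longrightarrow> s c (\<Oplus>x\<in>A. f x) = (\<Oplus>x\<in>A. s c (f x))"
proof (induct A rule: infinite_finite_induct)
 case (insert a A)
 then show ?case by (subst (1 2) finsum_insert) (auto simp: s_add Pi_def)
qed auto

section \<open>Subspaces, complements and projections\<close>

lemma ksubD:
 assumes "ksub M s W"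
 shows "x \<in> W \<Longrightarrow> x \<in> carrier M" "\<zero> \<in> W" "x \<in> W \<Longrightarrow> y \<in> W \<Longrightarrow> x \<oplus> y \<in> W"
  "x \<in> W \<Longrightarrow> s c x \<in> W" "x \<in> W \<Longrightarrow> \<ominus> x \<in> W" "x \<in> W \<Longrightarrow> y \<in> W \<Longrightarrow> x \<ominus> y \<in> W"
proof -
 show 1: "x \<in> W \<Longrightarrow> x \<in> carrier M" for x using assms by (auto simp: ksub_def)
 show 2: "x \<in> W \<Longrightarrow> y \<in> W \<Longrightarrow> x \<oplus> y \<in> W" for x y using assms by (auto simp: ksub_def)
 show 3: "x \<in> W \<Longrightarrow> \<ominus> x \<in> W" for x
  using assms s_minus_one[OF 1, of x] unfolding ksub_def by metis
 show "x \<in> W \<Longrightarrow> y \<in> W \<Longrightarrow> x \<ominus> y \<in> W" using 2 3 by (simp add: a_minus_def)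
 show "\<zero> \<in> W" "x \<in> W \<Longrightarrow> s c x \<in> W" using assms by (auto simp: ksub_def)
qed

lemma ksub_finsum: "ksub M s W \<Longrightarrow> f \<in> A \<rightarrow> W \<Longrightarrow> (\<Oplus>x\<in>A. f x) \<in> W"
proof (induct A rule: infinite_finite_induct)
 case (insert a A)
 have "f \<in> A \<rightarrow> carrier M" "f a \<in> carrier M" using insert ksubD(1) by blast+
 then show ?case using insert by (simp add: ksubD)
qed (auto simp: ksubD)

lemma ksub_zero: "ksub M s {\<zero>}" by (auto simp: ksub_def)
lemma ksub_carrier: "ksub M s (carrier M)" by (auto simp: ksub_def)
lemma ksub_Int: "ksub M s U \<Longrightarrow> ksub M s W \<Longrightarrow> ksub M s (U \<inter> W)" by (auto simp: ksub_def)

lemma vectorspace_vsp: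
 assumes W: "ksub M s W"
 shows "vectorspace kring (vsp M s W)"
proof (rule vs_criteria[OF field_kring])
 have W': "W \<subseteq> carrier M" using W by (simp add: ksub_def)
 show "\<forall>v\<in>carrier (vsp M s W). \<exists>neg_v\<in>carrier (vsp M s W). v \<oplus>\<^bsub>vsp M s W\<^esub> neg_v = \<zero>\<^bsub>vsp M s W\<^esub>"
  using ksubD[OF W] by (auto simp: vsp_def intro!: bexI[of _ "\<ominus> _"] r_neg)
qed (insert ksubD[OF W],
  auto simp: vsp_def kring_def a_ac s_add s_add_left s_mult s_one ksubD[OF W] ksubD(1)[OF W])

definition kl :: "('b \<Rightarrow> 'k) \<Rightarrow> 'b set \<Rightarrow> 'b"
 where "kl c G = (\<Oplus>x\<in>G. s (c x) x)"

lemma kl_closed: "G \<subseteq> carrier M \<Longrightarrow> kl c G \<in> carrier M"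
 unfolding kl_def by (rule finsum_closed) auto

lemma kl_add: "G \<subseteq> carrier M \<Longrightarrow> kl (\<lambda>x. b x + c x) G = kl b G \<oplus> kl c G"
proof -
 assume G: "G \<subseteq> carrier M"
 have "kl (\<lambda>x. b x + c x) G = (\<Oplus>x\<in>G. s (b x) x \<oplus> s (c x) x)"
  unfolding kl_def using G by (intro finsum_cong') (auto simp: s_add_left)
 also have "\<dots> = kl b G \<oplus> kl c G" unfolding kl_def using G by (intro finsum_addf) auto
 finally show ?thesis .
qed

lemma kl_scale: "G \<subseteq> carrier M \<Longrightarrow> s d (kl c G) = kl (\<lambda>x. d * c x) G"
 unfolding kl_def
 by (subst s_finsum) (auto intro!: finsum_cong' simp: s_mult subset_iff)

lemma kl_zero: "G \<subseteq> carrier M \<Longrightarrow> (\<And>x. x \<in> G \<Longrightarrow> c x = 0) \<Longrightarrow> kl c G = \<zero>"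
 unfolding kl_def by (subst finsum_cong'[where g = "\<lambda>_. \<zero>"]) (auto simp: subset_iff)

lemma kl_cong: "G \<subseteq> carrier M \<Longrightarrow> (\<And>x. x \<in> G \<Longrightarrow> b x = c x) \<Longrightarrow> kl b G = kl c G"
 unfolding kl_def by (rule finsum_cong') (auto simp: subset_iff)

lemma kl_remove:
 assumes "finite G" "G \<subseteq> carrier M" "g \<in> G"
 shows "kl c G = s (c g) g \<oplus> kl c (G - {g})"
proof -
 have "kl c (insert g (G - {g})) = s (c g) g \<oplus> kl c (G - {g})"
  unfolding kl_def using assms by (subst finsum_insert) auto
 then show ?thesis using assms by (simp add: insert_absorb)
qed

lemma kl_single:
 assumes "finite G" "G \<subseteq> carrier M" "g \<in> G"
 shows "kl (\<lambda>x. if x = g then 1 else 0) G = g"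
proof -
 have "kl (\<lambda>x. if x = g then 1 else 0) (G - {g}) = \<zero>" using assms by (intro kl_zero) auto
 then show ?thesis using assms kl_remove[OF assms, of "\<lambda>x. if x = g then 1 else 0"] by (auto simp: s_one)
qed

lemma ksub_sum_kl:
 assumes U: "ksub M s U" and G: "G \<subseteq> carrier M"
 shows "ksub M s {u \<oplus> kl c G | u c. u \<in> U}"
 unfolding ksub_def
proof (intro conjI ballI allI)
 show "{u \<oplus> kl c G | u c. u \<in> U} \<subseteq> carrier M" using ksubD(1)[OF U] kl_closed[OF G] by auto
 show "\<zero> \<in> {u \<oplus> kl c G | u c. u \<in> U}"
  using ksubD(2)[OF U] kl_zero[OF G, of "\<lambda>_. 0"] by (auto intro!: exI[of _ "\<zero>"] exI[of _ "\<lambda>_. 0"])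
next
 fix x y assume "x \<in> {u \<oplus> kl c G | u c. u \<in> U}" "y \<in> {u \<oplus> kl c G | u c. u \<in> U}"
 then obtain u b v c where *: "u \<in> U" "v \<in> U" "x = u \<oplus> kl b G" "y = v \<oplus> kl c G" by auto
 have "x \<oplus> y = (u \<oplus> v) \<oplus> kl (\<lambda>x. b x + c x) G"
  using * ksubD(1)[OF U] by (simp add: kl_add[OF G] kl_closed[OF G] a_ac)
 then show "x \<oplus> y \<in> {u \<oplus> kl c G | u c. u \<in> U}" using * ksubD(3)[OF U] by blast
next
 fix d x assume "x \<in> {u \<oplus> kl c G | u c. u \<in> U}"
 then obtain u c where *: "u \<in> U" "x = u \<oplus> kl c G" by auto
 have "s d x = s d u \<oplus> kl (\<lambda>x. d * c x) G"
  using * ksubD(1)[OF U] by (simp add: s_add kl_scale[OF G] kl_closed[OF G])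
 then show "s d x \<in> {u \<oplus> kl c G | u c. u \<in> U}" using * ksubD(4)[OF U] by blast
qed

text \<open>Among the finite sets spanning \<open>W\<close> modulo \<open>U\<close> one of least
  cardinality is taken. A combination lying in \<open>U\<close> with a nonzero coefficient would
  allow an element to be dropped.\<close>

lemma complement_exists:
 assumes U: "ksub M s U" and W: "ksub M s W" and fd: "kfin M s W" and UW: "U \<subseteq> W"
 obtains G where "finite G" "G \<subseteq> W" "\<And>w. w \<in> W \<Longrightarrow> \<exists>u\<in>U. \<exists>c. w = u \<oplus> kl c G"
  "\<And>c g. kl c G \<in> U \<Longrightarrow> g \<in> G \<Longrightarrow> c g = 0"
proof -
 define P where "P G \<longleftrightarrow> finite G \<and> G \<subseteq> W \<and> (\<forall>w\<in>W. \<exists>u\<in>U. \<exists>c. w = u \<oplus> kl c G)" for G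
 obtain X where X: "finite X" "X \<subseteq> W" "\<And>Z. ksub M s Z \<Longrightarrow> X \<subseteq> Z \<Longrightarrow> W \<subseteq> Z"
  by (rule kfinE[OF fd]) (rule that)
 have Xc: "X \<subseteq> carrier M" using X ksubD(1)[OF W] by auto
 have "X \<subseteq> {u \<oplus> kl c X | u c. u \<in> U}"
 proof
  fix x assume x: "x \<in> X"
  then have "x = \<zero> \<oplus> kl (\<lambda>y. if y = x then 1 else 0) X"
   using kl_single[OF X(1) Xc x] Xc by auto
  then show "x \<in> {u \<oplus> kl c X | u c. u \<in> U}" using ksubD(2)[OF U] by blast
 qed
 then have "W \<subseteq> {u \<oplus> kl c X | u c. u \<in> U}" using X(3)[OF ksub_sum_kl[OF U Xc]] by simp
 then have "P X" using X unfolding P_def by blast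
 then obtain G where G: "P G" "\<And>H. P H \<Longrightarrow> card G \<le> card H"
  using ex_has_least_nat[of P X card] by auto
 have Gf: "finite G" "G \<subseteq> W" and Gs: "\<And>w. w \<in> W \<Longrightarrow> \<exists>u\<in>U. \<exists>c. w = u \<oplus> kl c G"
  using G(1) by (auto simp: P_def)
 have Gc: "G \<subseteq> carrier M" using Gf ksubD(1)[OF W] by auto
 have "c g = 0" if c: "kl c G \<in> U" and g: "g \<in> G" for c g
 proof (rule ccontr)
  assume cg: "c g \<noteq> 0"
  have "\<exists>u\<in>U. \<exists>c. w = u \<oplus> kl c (G - {g})" if w: "w \<in> W" for w
  proof -
   obtain u b where ub: "u \<in> U" "w = u \<oplus> kl b G" using Gs[OF w] by blast
   \<comment> \<open>Subtracting this multiple of the relation removes the coefficient of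
     \<open>g\<close>; the multiple itself lies in \<open>U\<close> and is absorbed there.\<close>
   let ?d = "b g / c g"
   let ?b = "\<lambda>x. b x + (- ?d) * c x"
   have Gc': "G - {g} \<subseteq> carrier M" using Gc by auto
   have "kl b G = kl (\<lambda>x. ?b x + ?d * c x) G" by (rule kl_cong[OF Gc]) simp
   also have "\<dots> = kl ?b G \<oplus> s ?d (kl c G)"
    by (simp only: kl_add[OF Gc, of ?b] kl_scale[OF Gc])
   also have "kl ?b G = kl ?b (G - {g})"
    using cg g Gc Gc' by (subst kl_remove[OF Gf(1) Gc g]) (auto simp: kl_closed subset_iff)
   finally have "w = (u \<oplus> s ?d (kl c G)) \<oplus> kl ?b (G - {g})"
    using ub ksubD(1)[OF U] c kl_closed[OF Gc'] by (simp add: a_ac)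
   then show ?thesis using ksubD[OF U] ub c by blast
  qed
  then have "P (G - {g})" using Gf unfolding P_def by auto
  then show False using G(2)[of "G - {g}"] g Gf by (meson card_Diff1_less linorder_not_less)
 qed
 then show thesis using that Gf Gs by blast
qed

text \<open>Reads off the component in \<open>U\<close> with respect to a complement; independence
  modulo \<open>U\<close> makes it well defined. It replaces the extension of bases when subspaces,
  functionals and extensions of maps are treated.\<close>

lemma projection_exists:
 assumes U: "ksub M s U" and W: "ksub M s W" and fd: "kfin M s W" and UW: "U \<subseteq> W"
 obtains \<pi> where "\<And>w. w \<in> W \<Longrightarrow> \<pi> w \<in> U" "\<And>u. u \<in> U \<Longrightarrow> \<pi> u = u"
  "\<And>x y. x \<in> W \<Longrightarrow> y \<in> W \<Longrightarrow> \<pi> (x \<oplus> y) = \<pi> x \<oplus> \<pi> y" "\<And>c x. x \<in> W \<Longrightarrow> \<pi> (s c x) = s c (\<pi> x)"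
proof -
 obtain G where G: "finite G" "G \<subseteq> W" "\<And>w. w \<in> W \<Longrightarrow> \<exists>u\<in>U. \<exists>c. w = u \<oplus> kl c G"
  "\<And>c g. kl c G \<in> U \<Longrightarrow> g \<in> G \<Longrightarrow> c g = 0" by (rule complement_exists[OF assms]) (rule that)
 have Gc: "G \<subseteq> carrier M" using G ksubD(1)[OF W] by auto
 define \<pi> where "\<pi> w = (THE u. u \<in> U \<and> (\<exists>c. w = u \<oplus> kl c G))" for w
 have \<pi>: "\<pi> (u \<oplus> kl c G) = u" if u: "u \<in> U" for u c
  unfolding \<pi>_def
 proof (rule the_equality)
  show "u \<in> U \<and> (\<exists>b. u \<oplus> kl c G = u \<oplus> kl b G)" using u by blast
  fix v assume "v \<in> U \<and> (\<exists>b. u \<oplus> kl c G = v \<oplus> kl b G)"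
  then obtain b where v: "v \<in> U" and b: "u \<oplus> kl c G = v \<oplus> kl b G" by blast
  let ?d = "\<lambda>x. c x + (- 1) * b x"
  have "kl ?d G = kl c G \<oplus> \<ominus> kl b G"
   using Gc kl_closed[OF Gc] by (simp only: kl_add[OF Gc] kl_scale[OF Gc, symmetric] s_minus_one)
  also have "\<dots> = v \<ominus> u"
  proof -
   have "kl c G = \<ominus> u \<oplus> (u \<oplus> kl c G)" using ksubD(1)[OF U u] kl_closed[OF Gc] by (simp add: r_neg1)
   also have "\<dots> = \<ominus> u \<oplus> (v \<oplus> kl b G)" by (simp only: b)
   finally show ?thesis
    using ksubD(1)[OF U u] ksubD(1)[OF U v] kl_closed[OF Gc]
    by (simp add: a_minus_def a_ac r_neg r_neg1 r_neg2)
  qed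
  finally have d: "kl ?d G = v \<ominus> u" .
  then have "kl ?d G \<in> U" using ksubD(6)[OF U v u] by simp
  then have "\<And>g. g \<in> G \<Longrightarrow> ?d g = 0" using G(4) by blast
  then have "kl ?d G = \<zero>" by (rule kl_zero[OF Gc])
  then have "v \<ominus> u = \<zero>" using d by (simp only:)
  then show "v = u" using ksubD(1)[OF U u] ksubD(1)[OF U v] by simp
 qed
 show thesis
 proof
  show "\<pi> w \<in> U" if "w \<in> W" for w using G(3)[OF that] \<pi> by auto
  show "\<pi> u = u" if u: "u \<in> U" for u
   using \<pi>[OF u, of "\<lambda>_. 0"] kl_zero[OF Gc, of "\<lambda>_. 0"] ksubD(1)[OF U u] by simp
  fix x assume "x \<in> W"
  then obtain u b where x: "u \<in> U" "x = u \<oplus> kl b G" using G(3) by blast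
  have sx: "s c x = s c u \<oplus> kl (\<lambda>x. c * b x) G" for c
   using x ksubD(1)[OF U] by (simp add: s_add kl_scale[OF Gc] kl_closed[OF Gc])
  show "\<pi> (s c x) = s c (\<pi> x)" for c
   unfolding sx using x ksubD(4)[OF U] by (simp add: \<pi>)
  fix y assume "y \<in> W"
  then obtain v c where y: "v \<in> U" "y = v \<oplus> kl c G" using G(3) by blast
  have "x \<oplus> y = (u \<oplus> v) \<oplus> kl (\<lambda>x. b x + c x) G"
   using x y ksubD(1)[OF U] by (simp add: kl_add[OF Gc] kl_closed[OF Gc] a_ac)
  then show "\<pi> (x \<oplus> y) = \<pi> x \<oplus> \<pi> y" using x y ksubD(3)[OF U] by (simp add: \<pi>)
 qed
qed

lemma ksub_line: "y \<in> carrier M \<Longrightarrow> ksub M s (range (\<lambda>c. s c y))"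
 unfolding ksub_def
proof (intro conjI ballI allI)
 assume y: "y \<in> carrier M"
 show "range (\<lambda>c. s c y) \<subseteq> carrier M" using y by auto
 show "\<zero> \<in> range (\<lambda>c. s c y)" using s_zero_left[OF y] by (metis rangeI)
 fix x assume "x \<in> range (\<lambda>c. s c y)"
 then obtain a where a: "x = s a y" by auto
 show "s c x \<in> range (\<lambda>c. s c y)" for c using s_mult[OF y, of c a] a by (metis rangeI)
 fix z assume "z \<in> range (\<lambda>c. s c y)"
 then obtain b where b: "z = s b y" by auto
 show "x \<oplus> z \<in> range (\<lambda>c. s c y)" using s_add_left[OF y, of a b] a b by (metis rangeI)
qed

text \<open>The coordinate of a projection onto the line through \<open>y\<close>.\<close>

lemma functional_exists:
 assumes W: "ksub M s W" and fd: "kfin M s W" and y: "y \<in> W" "y \<noteq> \<zero>"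
 obtains f where "f y = (1::'k)" "\<And>u v. u \<in> W \<Longrightarrow> v \<in> W \<Longrightarrow> f (u \<oplus> v) = f u + f v"
  "\<And>c u. u \<in> W \<Longrightarrow> f (s c u) = c * f u"
proof -
 let ?U = "range (\<lambda>c. s c y)"
 have yc: "y \<in> carrier M" using ksubD(1)[OF W y(1)] .
 obtain p where p: "\<And>w. w \<in> W \<Longrightarrow> p w \<in> ?U" "\<And>u. u \<in> ?U \<Longrightarrow> p u = u"
  "\<And>x y. x \<in> W \<Longrightarrow> y \<in> W \<Longrightarrow> p (x \<oplus> y) = p x \<oplus> p y" "\<And>c x. x \<in> W \<Longrightarrow> p (s c x) = s c (p x)"
  by (rule projection_exists[OF ksub_line[OF yc] W fd]) (use ksubD(4)[OF W y(1)] in auto)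
 have inj: "a = b" if "s a y = s b y" for a b
 proof (rule ccontr)
  assume "a \<noteq> b"
  have "s (a - b) y = \<zero>"
   using s_add_left[OF yc, of a "- b"] that yc by (simp add: s_minus r_neg)
  then have "s (inverse (a - b)) (s (a - b) y) = \<zero>" by simp
  then have "s (inverse (a - b) * (a - b)) y = \<zero>" by (simp only: s_mult[OF yc])
  then show False using \<open>a \<noteq> b\<close> y yc by (simp add: s_one)
 qed
 define f where "f w = (THE c. p w = s c y)" for w
 have f: "p w = s (f w) y" if w: "w \<in> W" for w
 proof -
  obtain c where "p w = s c y" using p(1)[OF w] by auto
  then have "\<exists>!c. p w = s c y" using inj by metis
  then show ?thesis unfolding f_def by (rule theI')
 qed
 show thesis
 proof
  show "f y = 1" using f[OF y(1)] p(2)[of y] s_one[OF yc] inj by (metis rangeI)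
  show "f (u \<oplus> v) = f u + f v" if "u \<in> W" "v \<in> W" for u v
   using f[OF that(1)] f[OF that(2)] f[of "u \<oplus> v"] p(3)[OF that] ksubD(3)[OF W that]
   by (intro inj) (simp add: s_add_left yc)
  show "f (s c u) = c * f u" if "u \<in> W" for c u
   using f[OF that] f[of "s c u"] p(4)[OF that] ksubD(4)[OF W that]
   by (intro inj) (simp add: s_mult yc)
 qed
qed

lemma kfin_imp_fin_dim:
 assumes W: "ksub M s W" and fd: "kfin M s W"
 shows "vectorspace.fin_dim kring (vsp M s W)"
proof -
 interpret V: vectorspace "kring :: 'k ring" "vsp M s W" by (rule vectorspace_vsp[OF W])
 have car: "carrier (vsp M s W) = W" by (simp add: vsp_def)
 obtain X where X: "finite X" "X \<subseteq> W" "\<And>Z. ksub M s Z \<Longrightarrow> X \<subseteq> Z \<Longrightarrow> W \<subseteq> Z"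
  by (rule kfinE[OF fd]) (rule that)
 have sub: "submodule kring (V.span X) (vsp M s W)"
  using X by (intro V.span_is_submodule) (simp add: car)
 have "ksub M s (V.span X)"
  using sub W unfolding submodule_def ksub_def by (auto simp: vsp_def kring_def)
 moreover have "X \<subseteq> V.span X" using X by (intro V.in_own_span) (simp add: car)
 ultimately have "W \<subseteq> V.span X" by (rule X(3))
 moreover have "V.span X \<subseteq> W" using sub unfolding submodule_def by (auto simp: vsp_def)
 ultimately have "V.span X = carrier (vsp M s W)" by (simp add: car)
 then show ?thesis unfolding V.fin_dim_def using X by (intro exI[of _ X]) (simp add: car)
qed

text \<open>The given generators of \<open>W\<close> need not meet \<open>U\<close>, but their
  images under a projection onto \<open>U\<close> generate it.\<close>

lemma kfin_sub:
 assumes U: "ksub M s U" and W: "ksub M s W" and fd: "kfin M s W" and UW: "U \<subseteq> W"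
 shows "kfin M s U"
proof -
 obtain p where p: "\<And>w. w \<in> W \<Longrightarrow> p w \<in> U" "\<And>u. u \<in> U \<Longrightarrow> p u = u"
  "\<And>x y. x \<in> W \<Longrightarrow> y \<in> W \<Longrightarrow> p (x \<oplus> y) = p x \<oplus> p y" "\<And>c x. x \<in> W \<Longrightarrow> p (s c x) = s c (p x)"
  by (rule projection_exists[OF assms]) (rule that)
 obtain X where X: "finite X" "X \<subseteq> W" "\<And>Z. ksub M s Z \<Longrightarrow> X \<subseteq> Z \<Longrightarrow> W \<subseteq> Z"
  by (rule kfinE[OF fd]) (rule that)
 have "U \<subseteq> Z" if Z: "ksub M s Z" and XZ: "p ` X \<subseteq> Z" for Z
 proof -
  have "ksub M s {w\<in>W. p w \<in> Z}"
   using p ksubD[OF W] ksubD[OF Z] ksubD(2)[OF U] unfolding ksub_def by auto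
  moreover have "X \<subseteq> {w\<in>W. p w \<in> Z}" using X XZ by auto
  ultimately have "W \<subseteq> {w\<in>W. p w \<in> Z}" by (rule X(3))
  then show ?thesis using p(2) UW by auto
 qed
 then show ?thesis unfolding kfin_def using X p(1) by (intro exI[of _ "p ` X"]) auto
qed

lemma kfin_zero: "kfin M s {\<zero>}"
 unfolding kfin_def by (intro exI[of _ "{}"]) (auto simp: ksubD)

lemma kdim_zero: "kdim M s {\<zero>} = 0"
proof -
 interpret V: vectorspace "kring :: 'k ring" "vsp M s {\<zero>}" by (rule vectorspace_vsp[OF ksub_zero])
 have "V.span {} = carrier (vsp M s {\<zero>})" using V.span_empty by (simp add: vsp_def)
 then have "V.basis {}" unfolding V.basis_def by (auto simp: V.lin_dep_def)
 then show ?thesis unfolding kdim_def using V.dim_basis[of "{}"] by simp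
qed

lemma kdim_eq_0:
 assumes W: "ksub M s W" and fd: "kfin M s W" and "kdim M s W = 0"
 shows "W = {\<zero>}"
proof -
 interpret V: vectorspace "kring :: 'k ring" "vsp M s W" by (rule vectorspace_vsp[OF W])
 obtain B where "finite B" "V.basis B" using V.finite_basis_exists[OF kfin_imp_fin_dim[OF W fd]] by blast
 moreover from this have "card B = 0" using V.dim_basis[of B] assms(3) by (simp add: kdim_def)
 ultimately have "V.span {} = carrier (vsp M s W)" by (simp add: V.basis_def)
 then show ?thesis using V.span_empty by (simp add: vsp_def)
qed

end

section \<open>Linear maps between subspaces, rank and nullity\<close>

lemma ksub_image:
 assumes "kspace M s" "kspace N s'" and W: "ksub M s W" and T: "T \<in> W \<rightarrow> carrier N"
  and add: "\<And>x y. x \<in> W \<Longrightarrow> y \<in> W \<Longrightarrow> T (x \<oplus>\<^bsub>M\<^esub> y) = T x \<oplus>\<^bsub>N\<^esub> T y"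
  and sc: "\<And>c x. x \<in> W \<Longrightarrow> T (s c x) = s' c (T x)"
 shows "ksub N s' (T ` W)" "ksub M s {x\<in>W. T x = \<zero>\<^bsub>N\<^esub>}" "T \<zero>\<^bsub>M\<^esub> = \<zero>\<^bsub>N\<^esub>"
proof -
 interpret M: kspace M s by fact
 interpret N: kspace N s' by fact
 note WD = M.ksubD[OF W]
 show T0: "T \<zero>\<^bsub>M\<^esub> = \<zero>\<^bsub>N\<^esub>"
  using sc[OF WD(2), of 0] funcset_mem[OF T WD(2)] by simp
 show "ksub M s {x\<in>W. T x = \<zero>\<^bsub>N\<^esub>}"
  using WD T0 add sc unfolding ksub_def by auto
 show "ksub N s' (T ` W)"
  unfolding ksub_def
 proof (intro conjI ballI allI)
  show "T ` W \<subseteq> carrier N" using T by auto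
  show "\<zero>\<^bsub>N\<^esub> \<in> T ` W" using T0 WD(2) by (metis imageI)
  fix x assume "x \<in> T ` W"
  then obtain u where u: "u \<in> W" "x = T u" by auto
  show "s' c x \<in> T ` W" for c using sc[OF u(1), of c] u WD(4)[OF u(1), of c] by (metis imageI)
  fix y assume "y \<in> T ` W"
  then obtain v where v: "v \<in> W" "y = T v" by auto
  show "x \<oplus>\<^bsub>N\<^esub> y \<in> T ` W" using add[OF u(1) v(1)] u v WD(3)[OF u(1) v(1)] by (metis imageI)
 qed
qed

lemma kfin_image:
 assumes "kspace M s" "kspace N s'" and W: "ksub M s W" and fd: "kfin M s W" and T: "T \<in> W \<rightarrow> carrier N"
  and add: "\<And>x y. x \<in> W \<Longrightarrow> y \<in> W \<Longrightarrow> T (x \<oplus>\<^bsub>M\<^esub> y) = T x \<oplus>\<^bsub>N\<^esub> T y"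
  and sc: "\<And>c x. x \<in> W \<Longrightarrow> T (s c x) = s' c (T x)"
 shows "kfin N s' (T ` W)"
proof -
 interpret M: kspace M s by fact
 interpret N: kspace N s' by fact
 obtain X where X: "finite X" "X \<subseteq> W" "\<And>Z. ksub M s Z \<Longrightarrow> X \<subseteq> Z \<Longrightarrow> W \<subseteq> Z"
  by (rule kfinE[OF fd]) (rule that)
 have "T ` W \<subseteq> Z" if Z: "ksub N s' Z" and XZ: "T ` X \<subseteq> Z" for Z
 proof -
  have "ksub M s {w\<in>W. T w \<in> Z}"
   using add sc ksub_image(3)[of M s N s' W T, OF assms(1-3,5-7)] M.ksubD[OF W] N.ksubD[OF Z] unfolding ksub_def by auto
  moreover have "X \<subseteq> {w\<in>W. T w \<in> Z}" using X XZ by auto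
  ultimately have "W \<subseteq> {w\<in>W. T w \<in> Z}" by (rule X(3))
  then show ?thesis by auto
 qed
 then show ?thesis unfolding kfin_def using X by (intro exI[of _ "T ` X"]) auto
qed

text \<open>\<open>T\<close> is constrained on \<open>W\<close> only and the target is cut down to
  the image, so maps such as multiplication by an arrow on one vertex component fit
  directly.\<close>

lemma kdim_rank_nullity:
 assumes "kspace M s" "kspace N s'" and W: "ksub M s W" and fd: "kfin M s W" and T: "T \<in> W \<rightarrow> carrier N"
  and add: "\<And>x y. x \<in> W \<Longrightarrow> y \<in> W \<Longrightarrow> T (x \<oplus>\<^bsub>M\<^esub> y) = T x \<oplus>\<^bsub>N\<^esub> T y"
  and sc: "\<And>c x. x \<in> W \<Longrightarrow> T (s c x) = s' c (T x)"
 shows "kdim N s' (T ` W) + kdim M s {x\<in>W. T x = \<zero>\<^bsub>N\<^esub>} = kdim M s W"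
proof -
 interpret M: kspace M s by fact
 interpret N: kspace N s' by fact
 note im = ksub_image[of M s N s' W T, OF assms(1-3,5-7)]
 let ?A = "vsp M s W" and ?B = "vsp N s' (T ` W)"
 have A: "vectorspace kring ?A" by (rule M.vectorspace_vsp[OF W])
 have B: "vectorspace kring ?B" by (rule N.vectorspace_vsp[OF im(1)])
 have "T \<in> module_hom kring ?A ?B" unfolding module_hom_def by (simp add: vsp_def add sc)
 then have h: "mod_hom kring ?A ?B T"
  using A B unfolding vectorspace_def mod_hom_def mod_hom_axioms_def by blast
 then have L: "linear_map kring ?A ?B T" using A B unfolding linear_map_def by blast
 have "mod_hom.im ?A T = T ` W" by (subst mod_hom.im_def[OF h]) (simp add: vsp_def)
 moreover have "mod_hom.ker ?A ?B T = {x\<in>W. T x = \<zero>\<^bsub>N\<^esub>}"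
  by (subst mod_hom.ker_def[OF h]) (simp add: vsp_def)
 moreover have "?B\<lparr>carrier := T ` W\<rparr> = ?B" by (simp add: vsp_def)
 moreover have "?A\<lparr>carrier := Z\<rparr> = vsp M s Z" for Z by (simp add: vsp_def)
 ultimately show ?thesis
  using linear_map.rank_nullity[OF L M.kfin_imp_fin_dim[OF W fd]] by (simp add: kdim_def)
qed

lemma kdim_inj:
 assumes "kspace M s" "kspace N s'" and W: "ksub M s W" and fd: "kfin M s W" and T: "T \<in> W \<rightarrow> carrier N"
  and add: "\<And>x y. x \<in> W \<Longrightarrow> y \<in> W \<Longrightarrow> T (x \<oplus>\<^bsub>M\<^esub> y) = T x \<oplus>\<^bsub>N\<^esub> T y"
  and sc: "\<And>c x. x \<in> W \<Longrightarrow> T (s c x) = s' c (T x)"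
  and inj: "\<And>x. x \<in> W \<Longrightarrow> T x = \<zero>\<^bsub>N\<^esub> \<Longrightarrow> x = \<zero>\<^bsub>M\<^esub>"
 shows "kdim N s' (T ` W) = kdim M s W"
proof -
 interpret M: kspace M s by fact
 have "{x\<in>W. T x = \<zero>\<^bsub>N\<^esub>} = {\<zero>\<^bsub>M\<^esub>}"
 proof (intro equalityI subsetI)
  fix x assume "x \<in> {x\<in>W. T x = \<zero>\<^bsub>N\<^esub>}"
  then show "x \<in> {\<zero>\<^bsub>M\<^esub>}" using inj[of x] by blast
 qed (use M.ksubD(2)[OF W] ksub_image(3)[of M s N s' W T, OF assms(1-3,5-7)] in simp)
 then show ?thesis using kdim_rank_nullity[of M s N s' W T, OF assms(1-7)] M.kdim_zero by simp
qed

context kspace begin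

lemma kdim_line:
 assumes y: "y \<in> carrier M" "y \<noteq> \<zero>"
 shows "kdim M s (range (\<lambda>c. s c y)) = 1" "kfin M s (range (\<lambda>c. s c y))"
proof -
 let ?W = "range (\<lambda>c. s c y)"
 have W: "ksub M s ?W" by (rule ksub_line[OF y(1)])
 interpret V: vectorspace "kring :: 'k ring" "vsp M s ?W" by (rule vectorspace_vsp[OF W])
 have yW: "y \<in> ?W" using s_one[OF y(1)] by (metis rangeI)
 then have sub: "submodule kring (V.span {y}) (vsp M s ?W)"
  by (intro V.span_is_submodule) (simp add: vsp_def)
 have "y \<in> V.span {y}" using yW V.in_own_span[of "{y}"] by (simp add: vsp_def)
 then have "V.span {y} = carrier (vsp M s ?W)"
  using sub unfolding submodule_def by (auto simp: vsp_def kring_def)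
 then show "kdim M s ?W = 1"
  unfolding kdim_def using yW y by (intro V.dim1I) (auto simp: vsp_def)
 show "kfin M s ?W" unfolding kfin_def using yW by (intro exI[of _ "{y}"]) (auto simp: ksub_def)
qed

lemma kdim_mono:
 assumes U: "ksub M s U" and W: "ksub M s W" and fd: "kfin M s W" and UW: "U \<subseteq> W"
 shows "kdim M s U \<le> kdim M s W"
proof -
 obtain p where p: "\<And>w. w \<in> W \<Longrightarrow> p w \<in> U" "\<And>u. u \<in> U \<Longrightarrow> p u = u"
  "\<And>x y. x \<in> W \<Longrightarrow> y \<in> W \<Longrightarrow> p (x \<oplus> y) = p x \<oplus> p y" "\<And>c x. x \<in> W \<Longrightarrow> p (s c x) = s c (p x)"
  by (rule projection_exists[OF assms]) (rule that)
 have "p ` W = U" using p(1,2) UW by force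
 moreover have "p \<in> W \<rightarrow> carrier M" using p(1) ksubD(1)[OF U] by auto
 ultimately show ?thesis
  using kdim_rank_nullity[OF kspace_axioms kspace_axioms W fd, of p] p(3,4) by simp
qed

text \<open>By rank and nullity the projection onto \<open>U\<close> has a zero kernel, and every
  \<open>w\<close> differs from its projection by a kernel element.\<close>

lemma kdim_sub_eq:
 assumes U: "ksub M s U" and W: "ksub M s W" and fd: "kfin M s W" and UW: "U \<subseteq> W"
  and eq: "kdim M s U = kdim M s W"
 shows "U = W"
proof -
 obtain p where p: "\<And>w. w \<in> W \<Longrightarrow> p w \<in> U" "\<And>u. u \<in> U \<Longrightarrow> p u = u"
  "\<And>x y. x \<in> W \<Longrightarrow> y \<in> W \<Longrightarrow> p (x \<oplus> y) = p x \<oplus> p y" "\<And>c x. x \<in> W \<Longrightarrow> p (s c x) = s c (p x)"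
  by (rule projection_exists[OF U W fd UW]) (rule that)
 have pc: "p \<in> W \<rightarrow> carrier M" using p(1) ksubD(1)[OF U] by auto
 have im: "p ` W = U" using p(1,2) UW by force
 let ?K = "{x\<in>W. p x = \<zero>}"
 have K: "ksub M s ?K" using ksub_image(2)[OF kspace_axioms kspace_axioms W pc] p(3,4) by blast
 have "kdim M s ?K = 0"
  using kdim_rank_nullity[OF kspace_axioms kspace_axioms W fd pc] p(3,4) im eq by simp
 then have K0: "?K = {\<zero>}" using kdim_eq_0[OF K kfin_sub[OF K W fd]] by auto
 have "w \<in> U" if w: "w \<in> W" for w
 proof -
  have pw: "p w \<in> W" using p(1)[OF w] UW by auto
  have "\<ominus> p w \<in> W" "p (\<ominus> p w) = \<ominus> p w" using ksubD(5)[OF U] p(1,2) w UW by auto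
  then have "p (w \<ominus> p w) = p w \<ominus> p w" using p(3)[OF w] by (simp add: a_minus_def)
  then have "w \<ominus> p w \<in> ?K" using ksubD[OF W] w pw ksubD(1)[OF U p(1)[OF w]] by (simp add: r_neg a_minus_def)
  then have "w = p w" using K0 ksubD(1)[OF W] w pw by auto
  then show ?thesis using p(1)[OF w] by simp
 qed
 then show ?thesis using UW by auto
qed

end

section \<open>Algebras with radical square zero in coordinates\<close>

text \<open>The algebra has a basis of idempotents, indexed by \<open>V\<close>, and arrows, indexed by \<open>E\<close>;
 \<open>ec\<close> and \<open>xc\<close> are the coordinate functions.\<close>

locale rsz = R: ring R for R :: "('a, 'r) ring_scheme" +
 fixes V :: "'v set" and E :: "'e set" and src tgt :: "'e \<Rightarrow> 'v"
  and ec :: "'a \<Rightarrow> 'v \<Rightarrow> 'k::field" and xc :: "'a \<Rightarrow> 'e \<Rightarrow> 'k"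
 assumes finV: "finite V" and V_ne: "V \<noteq> {}" and finE: "finite E"
  and srcV: "a \<in> E \<Longrightarrow> src a \<in> V" and tgtV: "a \<in> E \<Longrightarrow> tgt a \<in> V"
  and ec_add: "\<lbrakk>r \<in> carrier R; r' \<in> carrier R; i \<in> V\<rbrakk> \<Longrightarrow> ec (r \<oplus>\<^bsub>R\<^esub> r') i = ec r i + ec r' i"
  and xc_add: "\<lbrakk>r \<in> carrier R; r' \<in> carrier R; a \<in> E\<rbrakk> \<Longrightarrow> xc (r \<oplus>\<^bsub>R\<^esub> r') a = xc r a + xc r' a"
  and ec_mult: "\<lbrakk>r \<in> carrier R; r' \<in> carrier R; i \<in> V\<rbrakk> \<Longrightarrow> ec (r \<otimes>\<^bsub>R\<^esub> r') i = ec r i * ec r' i"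
  and xc_mult: "\<lbrakk>r \<in> carrier R; r' \<in> carrier R; a \<in> E\<rbrakk> \<Longrightarrow>
   xc (r \<otimes>\<^bsub>R\<^esub> r') a = ec r (src a) * xc r' a + xc r a * ec r' (tgt a)"
  and ec_one: "i \<in> V \<Longrightarrow> ec \<one>\<^bsub>R\<^esub> i = 1" and xc_one: "a \<in> E \<Longrightarrow> xc \<one>\<^bsub>R\<^esub> a = 0"
  and coord_inj: "\<lbrakk>r \<in> carrier R; r' \<in> carrier R; \<And>i. i \<in> V \<Longrightarrow> ec r i = ec r' i;
   \<And>a. a \<in> E \<Longrightarrow> xc r a = xc r' a\<rbrakk> \<Longrightarrow> r = r'"
  and coord_ex: "\<exists>r\<in>carrier R. (\<forall>i\<in>V. ec r i = f i) \<and> (\<forall>a\<in>E. xc r a = g a)"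
begin

definition mk :: "('v \<Rightarrow> 'k) \<Rightarrow> ('e \<Rightarrow> 'k) \<Rightarrow> 'a"
 where "mk f g = (SOME r. r \<in> carrier R \<and> (\<forall>i\<in>V. ec r i = f i) \<and> (\<forall>a\<in>E. xc r a = g a))"

text \<open>For \<open>i\<close> outside \<open>V\<close> all coordinates vanish and this is the
  zero element; \<open>dd_outside\<close> relies on it.\<close>

definition e :: "'v \<Rightarrow> 'a" where "e i = mk (\<lambda>j. if j = i then 1 else 0) (\<lambda>_. 0)"
definition ar :: "'e \<Rightarrow> 'a" where "ar a = mk (\<lambda>_. 0) (\<lambda>b. if b = a then 1 else 0)"
definition sc :: "'k \<Rightarrow> 'a" where "sc c = mk (\<lambda>_. c) (\<lambda>_. 0)"

lemma mk: "mk f g \<in> carrier R \<and> (\<forall>i\<in>V. ec (mk f g) i = f i) \<and> (\<forall>a\<in>E. xc (mk f g) a = g a)"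
 unfolding mk_def by (rule someI_ex) (use coord_ex[of f g] in blast)

lemma e_closed [simp, intro]: "e i \<in> carrier R" and ar_closed [simp, intro]: "ar a \<in> carrier R"
 and sc_closed [simp, intro]: "sc c \<in> carrier R"
 by (simp_all add: e_def ar_def sc_def mk)

lemma coords [simp]:
 "j \<in> V \<Longrightarrow> ec (e i) j = (if j = i then 1 else 0)" "b \<in> E \<Longrightarrow> xc (e i) b = 0"
 "j \<in> V \<Longrightarrow> ec (ar a) j = 0" "b \<in> E \<Longrightarrow> xc (ar a) b = (if b = a then 1 else 0)"
 "j \<in> V \<Longrightarrow> ec (sc c) j = c" "b \<in> E \<Longrightarrow> xc (sc c) b = 0"
 by (simp_all add: e_def ar_def sc_def mk)

lemma coords_zero [simp]: "i \<in> V \<Longrightarrow> ec \<zero>\<^bsub>R\<^esub> i = 0" "a \<in> E \<Longrightarrow> xc \<zero>\<^bsub>R\<^esub> a = 0"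
 using ec_add[of "\<zero>\<^bsub>R\<^esub>" "\<zero>\<^bsub>R\<^esub>" i] xc_add[of "\<zero>\<^bsub>R\<^esub>" "\<zero>\<^bsub>R\<^esub>" a]
 by (simp_all only: R.zero_closed R.r_zero add_cancel_right_right)

lemmas coord_simps = ec_add xc_add ec_mult xc_mult ec_one xc_one srcV tgtV

lemma e_e: "j \<in> V \<Longrightarrow> e i \<otimes>\<^bsub>R\<^esub> e j = (if i = j then e j else \<zero>\<^bsub>R\<^esub>)"
 by (rule coord_inj) (auto simp: coord_simps)
lemma e_x: "a \<in> E \<Longrightarrow> e i \<otimes>\<^bsub>R\<^esub> ar a = (if i = src a then ar a else \<zero>\<^bsub>R\<^esub>)"
 by (rule coord_inj) (auto simp: coord_simps)
lemma x_e: "a \<in> E \<Longrightarrow> ar a \<otimes>\<^bsub>R\<^esub> e i = (if i = tgt a then ar a else \<zero>\<^bsub>R\<^esub>)"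
 by (rule coord_inj) (auto simp: coord_simps)
lemma x_x: "a \<in> E \<Longrightarrow> b \<in> E \<Longrightarrow> ar a \<otimes>\<^bsub>R\<^esub> ar b = \<zero>\<^bsub>R\<^esub>"
 by (rule coord_inj) (auto simp: coord_simps)
lemma sc_comm: "r \<in> carrier R \<Longrightarrow> r \<otimes>\<^bsub>R\<^esub> sc c = sc c \<otimes>\<^bsub>R\<^esub> r"
 by (rule coord_inj) (auto simp: coord_simps)
lemma sc_add: "sc (c + d) = sc c \<oplus>\<^bsub>R\<^esub> sc d"
 by (rule coord_inj) (auto simp: coord_simps)
lemma sc_mult: "sc (c * d) = sc d \<otimes>\<^bsub>R\<^esub> sc c"
 by (rule coord_inj) (auto simp: coord_simps)
lemma sc_one: "sc 1 = \<one>\<^bsub>R\<^esub>"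
 by (rule coord_inj) (auto simp: coord_simps)

lemma ec_finsum: "f \<in> A \<rightarrow> carrier R \<Longrightarrow> i \<in> V \<Longrightarrow> ec (finsum R f A) i = (\<Sum>a\<in>A. ec (f a) i)"
 by (induct A rule: infinite_finite_induct) (auto simp: ec_add Pi_def R.finsum_insert)

lemma xc_finsum: "f \<in> A \<rightarrow> carrier R \<Longrightarrow> b \<in> E \<Longrightarrow> xc (finsum R f A) b = (\<Sum>a\<in>A. xc (f a) b)"
 by (induct A rule: infinite_finite_induct) (auto simp: xc_add Pi_def R.finsum_insert)

text \<open>The algebra is spanned over the scalars by idempotents and arrows. Through this, claims
  about the action of \<open>R\<close> reduce to scalars, \<open>e i\<close> and
  \<open>ar a\<close>.\<close>

lemma expand:
 assumes "r \<in> carrier R"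
 shows "r = finsum R (\<lambda>i. e i \<otimes>\<^bsub>R\<^esub> sc (ec r i)) V \<oplus>\<^bsub>R\<^esub> finsum R (\<lambda>a. ar a \<otimes>\<^bsub>R\<^esub> sc (xc r a)) E"
proof -
 have 1: "(\<lambda>i. e i \<otimes>\<^bsub>R\<^esub> sc (ec r i)) \<in> V \<rightarrow> carrier R" "(\<lambda>a. ar a \<otimes>\<^bsub>R\<^esub> sc (xc r a)) \<in> E \<rightarrow> carrier R"
  by auto
 note 2 = R.finsum_closed[OF 1(1)] R.finsum_closed[OF 1(2)]
 show ?thesis
 proof (rule coord_inj)
  fix i assume i: "i \<in> V"
  have "(\<Sum>a\<in>V. ec (e a \<otimes>\<^bsub>R\<^esub> sc (ec r a)) i) = (\<Sum>a\<in>V. if i = a then ec r i else 0)"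
   using i by (intro sum.cong) (auto simp: ec_mult)
  then show "ec r i = ec (finsum R (\<lambda>i. e i \<otimes>\<^bsub>R\<^esub> sc (ec r i)) V \<oplus>\<^bsub>R\<^esub> finsum R (\<lambda>a. ar a \<otimes>\<^bsub>R\<^esub> sc (xc r a)) E) i"
   using i 2 finV by (simp add: ec_add ec_finsum[OF 1(1)] ec_finsum[OF 1(2)] ec_mult)
 next
  fix b assume b: "b \<in> E"
  have "(\<Sum>a\<in>E. xc (ar a \<otimes>\<^bsub>R\<^esub> sc (xc r a)) b) = (\<Sum>a\<in>E. if b = a then xc r b else 0)"
   using b by (intro sum.cong) (auto simp: xc_mult srcV tgtV)
  then show "xc r b = xc (finsum R (\<lambda>i. e i \<otimes>\<^bsub>R\<^esub> sc (ec r i)) V \<oplus>\<^bsub>R\<^esub> finsum R (\<lambda>a. ar a \<otimes>\<^bsub>R\<^esub> sc (xc r a)) E) b"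
   using b 2 finE by (simp add: xc_add xc_finsum[OF 1(1)] xc_finsum[OF 1(2)] xc_mult srcV tgtV)
 qed (use assms 2 in auto)
qed

definition kact :: "('a, 'b) module \<Rightarrow> 'k \<Rightarrow> 'b \<Rightarrow> 'b"
 where "kact M c y = y \<triangleleft>\<^bsub>M\<^esub> sc c"

definition comp :: "('a, 'b) module \<Rightarrow> 'v \<Rightarrow> 'b set"
 where "comp M i = {y\<in>carrier M. y \<triangleleft>\<^bsub>M\<^esub> e i = y}"

text \<open>The submodule MJ. One summand per arrow is enough because terms with the same arrow can
  be collected.\<close>

definition rad :: "('a, 'b) module \<Rightarrow> 'b set"
 where "rad M = {finsum M (\<lambda>a. z a \<triangleleft>\<^bsub>M\<^esub> ar a) E | z. z \<in> E \<rightarrow> carrier M}"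

text \<open>The elements annihilated by J, which form the socle since A/J is semisimple.\<close>

definition soc :: "('a, 'b) module \<Rightarrow> 'b set"
 where "soc M = {y\<in>carrier M. \<forall>a\<in>E. y \<triangleleft>\<^bsub>M\<^esub> ar a = \<zero>\<^bsub>M\<^esub>}"

end

section \<open>Calculus in a single module: vertex components, radical, socle, submodules\<close>

locale rsz_module = rsz R V E src tgt ec xc + right_module R M
 for R :: "('a, 'r) ring_scheme" and V :: "'v set" and E :: "'e set" and src tgt :: "'e \<Rightarrow> 'v"
  and ec :: "'a \<Rightarrow> 'v \<Rightarrow> 'k::field" and xc :: "'a \<Rightarrow> 'e \<Rightarrow> 'k"
  and M :: "('a, 'b) module" (structure)
begin

lemma kspace_kact: "kspace M (kact M)"
proof
 fix y z c d assume y: "y \<in> carrier M"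
 show "kact M c y \<in> carrier M" using y by (simp add: kact_def ract_closed)
 show "kact M (c + d) y = kact M c y \<oplus> kact M d y"
  using y by (simp add: kact_def sc_add ract_add_right)
 show "kact M (c * d) y = kact M c (kact M d y)"
  using y by (simp add: kact_def sc_mult ract_assoc)
 show "kact M 1 y = y" using y by (simp add: kact_def sc_one ract_one)
 assume z: "z \<in> carrier M"
 show "kact M c (y \<oplus> z) = kact M c y \<oplus> kact M c z"
  using y z by (simp add: kact_def ract_add_left)
qed

sublocale K: kspace M "kact M" by (rule kspace_kact)

declare ract_closed [simp, intro]

lemma ract_zero_left [simp]: "r \<in> carrier R \<Longrightarrow> \<zero> \<triangleleft> r = \<zero>"
 using ract_add_left[of \<zero> \<zero> r] by (metis M.add.r_cancel_one' M.l_zero M.zero_closed ract_closed)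

lemma ract_zero_right [simp]: "y \<in> carrier M \<Longrightarrow> y \<triangleleft> \<zero>\<^bsub>R\<^esub> = \<zero>"
 using ract_add_right[of y "\<zero>\<^bsub>R\<^esub>" "\<zero>\<^bsub>R\<^esub>"]
 by (metis M.add.r_cancel_one' R.zero_closed R.l_zero ract_closed)

lemma ract_minus: "y \<in> carrier M \<Longrightarrow> r \<in> carrier R \<Longrightarrow> (\<ominus> y) \<triangleleft> r = \<ominus> (y \<triangleleft> r)"
 using ract_add_left[of "\<ominus> y" y r] by (metis M.a_inv_closed M.l_neg M.minus_equality ract_closed ract_zero_left)

lemma ract_finsum_left:
 "f \<in> A \<rightarrow> carrier M \<Longrightarrow> r \<in> carrier R \<Longrightarrow> (\<Oplus>a\<in>A. f a) \<triangleleft> r = (\<Oplus>a\<in>A. f a \<triangleleft> r)"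
proof (induct A rule: infinite_finite_induct)
 case (insert a A)
 then show ?case by (subst (1 2) M.finsum_insert) (auto simp: ract_add_left Pi_def)
qed auto

lemma ract_finsum_right:
 "f \<in> A \<rightarrow> carrier R \<Longrightarrow> y \<in> carrier M \<Longrightarrow> y \<triangleleft> (finsum R f A) = (\<Oplus>a\<in>A. y \<triangleleft> f a)"
proof (induct A rule: infinite_finite_induct)
 case (insert a A)
 then show ?case by (subst M.finsum_insert, force, force, force, force) (auto simp: ract_add_right Pi_def R.finsum_insert)
qed auto

lemma kact_ract: "y \<in> carrier M \<Longrightarrow> r \<in> carrier R \<Longrightarrow> kact M c y \<triangleleft> r = kact M c (y \<triangleleft> r)"
 by (simp add: kact_def ract_assoc[symmetric] sc_comm)

lemma ract_expand:
 assumes y: "y \<in> carrier M" and r: "r \<in> carrier R"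
 shows "y \<triangleleft> r = (\<Oplus>i\<in>V. kact M (ec r i) (y \<triangleleft> e i)) \<oplus> (\<Oplus>a\<in>E. kact M (xc r a) (y \<triangleleft> ar a))"
proof -
 have "y \<triangleleft> r = y \<triangleleft> (finsum R (\<lambda>i. e i \<otimes>\<^bsub>R\<^esub> sc (ec r i)) V \<oplus>\<^bsub>R\<^esub> finsum R (\<lambda>a. ar a \<otimes>\<^bsub>R\<^esub> sc (xc r a)) E)"
  using expand[OF r] by simp
 also have "\<dots> = y \<triangleleft> finsum R (\<lambda>i. e i \<otimes>\<^bsub>R\<^esub> sc (ec r i)) V \<oplus> y \<triangleleft> finsum R (\<lambda>a. ar a \<otimes>\<^bsub>R\<^esub> sc (xc r a)) E"
  using y by (intro ract_add_right R.finsum_closed) auto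
 also have "y \<triangleleft> finsum R (\<lambda>i. e i \<otimes>\<^bsub>R\<^esub> sc (ec r i)) V = (\<Oplus>i\<in>V. kact M (ec r i) (y \<triangleleft> e i))"
  using y by (subst ract_finsum_right) (auto simp: kact_def ract_assoc)
 also have "y \<triangleleft> finsum R (\<lambda>a. ar a \<otimes>\<^bsub>R\<^esub> sc (xc r a)) E = (\<Oplus>a\<in>E. kact M (xc r a) (y \<triangleleft> ar a))"
  using y by (subst ract_finsum_right) (auto simp: kact_def ract_assoc)
 finally show ?thesis .
qed

lemma e_act: "y \<in> carrier M \<Longrightarrow> j \<in> V \<Longrightarrow> (y \<triangleleft> e i) \<triangleleft> e j = (if i = j then y \<triangleleft> e j else \<zero>)"
 by (simp add: ract_assoc[symmetric] e_e)
lemma e_x_act: "y \<in> carrier M \<Longrightarrow> a \<in> E \<Longrightarrow> (y \<triangleleft> e i) \<triangleleft> ar a = (if i = src a then y \<triangleleft> ar a else \<zero>)"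
 by (simp add: ract_assoc[symmetric] e_x)
lemma x_e_act: "y \<in> carrier M \<Longrightarrow> a \<in> E \<Longrightarrow> (y \<triangleleft> ar a) \<triangleleft> e i = (if i = tgt a then y \<triangleleft> ar a else \<zero>)"
 by (simp add: ract_assoc[symmetric] x_e)
lemma x_x_act: "y \<in> carrier M \<Longrightarrow> a \<in> E \<Longrightarrow> b \<in> E \<Longrightarrow> (y \<triangleleft> ar a) \<triangleleft> ar b = \<zero>"
 by (simp add: ract_assoc[symmetric] x_x)

lemma finsum_zero': "(\<And>a. a \<in> A \<Longrightarrow> f a = \<zero>) \<Longrightarrow> (\<Oplus>a\<in>A. f a) = \<zero>"
 by (subst M.finsum_cong'[where g = "\<lambda>_. \<zero>"]) auto

lemma sum_e: "y \<in> carrier M \<Longrightarrow> (\<Oplus>i\<in>V. y \<triangleleft> e i) = y"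
proof -
 assume y: "y \<in> carrier M"
 have "y = y \<triangleleft> \<one>\<^bsub>R\<^esub>" using y by (simp add: ract_one)
 also have "\<dots> = (\<Oplus>i\<in>V. kact M (ec \<one>\<^bsub>R\<^esub> i) (y \<triangleleft> e i)) \<oplus> (\<Oplus>a\<in>E. kact M (xc \<one>\<^bsub>R\<^esub> a) (y \<triangleleft> ar a))"
  by (rule ract_expand) (use y in auto)
 also have "(\<Oplus>a\<in>E. kact M (xc \<one>\<^bsub>R\<^esub> a) (y \<triangleleft> ar a)) = \<zero>"
  using y by (intro finsum_zero') (simp add: xc_one)
 also have "(\<Oplus>i\<in>V. kact M (ec \<one>\<^bsub>R\<^esub> i) (y \<triangleleft> e i)) = (\<Oplus>i\<in>V. y \<triangleleft> e i)"
  using y by (intro M.finsum_cong') (auto simp: ec_one K.s_one)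
 finally show ?thesis using y by simp
qed

lemma compD: "y \<in> comp M i \<Longrightarrow> y \<in> carrier M" "y \<in> comp M i \<Longrightarrow> y \<triangleleft> e i = y"
 by (auto simp: comp_def)

lemma comp_e_other: "y \<in> comp M i \<Longrightarrow> j \<in> V \<Longrightarrow> j \<noteq> i \<Longrightarrow> y \<triangleleft> e j = \<zero>"
 using e_act[of y j i] by (simp add: comp_def)

lemma comp_x: "y \<in> comp M i \<Longrightarrow> a \<in> E \<Longrightarrow> i \<noteq> src a \<Longrightarrow> y \<triangleleft> ar a = \<zero>"
 using e_x_act[of y a i] by (simp add: comp_def)

lemma e_in_comp [simp, intro]: "y \<in> carrier M \<Longrightarrow> i \<in> V \<Longrightarrow> y \<triangleleft> e i \<in> comp M i"
 by (simp add: comp_def e_act)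

lemma x_in_comp: "y \<in> carrier M \<Longrightarrow> a \<in> E \<Longrightarrow> y \<triangleleft> ar a \<in> comp M (tgt a)"
 by (simp add: comp_def x_e_act)

lemma ksub_comp: "ksub M (kact M) (comp M i)"
 by (auto simp: ksub_def comp_def ract_add_left kact_ract)

lemma comp_zero: "\<zero> \<in> comp M i" using K.ksubD(2)[OF ksub_comp] .

lemma ksub_soc: "ksub M (kact M) (soc M)"
 by (auto simp: ksub_def soc_def ract_add_left kact_ract)

lemma soc_e: "y \<in> soc M \<Longrightarrow> y \<triangleleft> e i \<in> soc M"
 by (auto simp: soc_def e_x_act)

lemma radI: "z \<in> E \<rightarrow> carrier M \<Longrightarrow> (\<Oplus>a\<in>E. z a \<triangleleft> ar a) \<in> rad M"
 by (auto simp: rad_def)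

text \<open>Only the part of \<open>z a\<close> at the source of \<open>a\<close> survives
  multiplication by \<open>a\<close>. Coefficients normalised in this way are what
  \<open>jflat\<close> speaks about.\<close>

lemma radE:
 assumes "y \<in> rad M"
 obtains z where "\<And>a. a \<in> E \<Longrightarrow> z a \<in> comp M (src a)" "y = (\<Oplus>a\<in>E. z a \<triangleleft> ar a)"
proof -
 obtain z where z: "z \<in> E \<rightarrow> carrier M" "y = (\<Oplus>a\<in>E. z a \<triangleleft> ar a)" using assms by (auto simp: rad_def)
 have "(\<Oplus>a\<in>E. z a \<triangleleft> ar a) = (\<Oplus>a\<in>E. (z a \<triangleleft> e (src a)) \<triangleleft> ar a)"
  using z(1) by (intro M.finsum_cong') (auto simp: e_x_act Pi_def)
 then show thesis using z srcV by (intro that[of "\<lambda>a. z a \<triangleleft> e (src a)"]) (auto simp: Pi_def)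
qed

lemma rad_carrier: "y \<in> rad M \<Longrightarrow> y \<in> carrier M"
 by (auto simp: rad_def intro!: M.finsum_closed)

lemma ksub_rad: "ksub M (kact M) (rad M)"
 unfolding ksub_def
proof (intro conjI ballI allI subsetI)
 show "\<zero> \<in> rad M" using radI[of "\<lambda>_. \<zero>"] by simp
 fix y assume y: "y \<in> rad M"
 then show "y \<in> carrier M" by (rule rad_carrier)
 obtain z where z: "z \<in> E \<rightarrow> carrier M" "y = (\<Oplus>a\<in>E. z a \<triangleleft> ar a)" using y by (auto simp: rad_def)
 have zx: "(\<lambda>a. z a \<triangleleft> ar a) \<in> E \<rightarrow> carrier M" using z by auto
 show "kact M c y \<in> rad M" for c
 proof -
  have "kact M c y = (\<Oplus>a\<in>E. kact M c (z a) \<triangleleft> ar a)"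
   unfolding z(2) K.s_finsum[OF zx] using z by (intro M.finsum_cong') (auto simp: kact_ract Pi_def)
  then show ?thesis using z by (auto intro!: radI)
 qed
 fix y' assume y': "y' \<in> rad M"
 obtain z' where z': "z' \<in> E \<rightarrow> carrier M" "y' = (\<Oplus>a\<in>E. z' a \<triangleleft> ar a)" using y' by (auto simp: rad_def)
 have "y \<oplus> y' = (\<Oplus>a\<in>E. z a \<triangleleft> ar a \<oplus> z' a \<triangleleft> ar a)"
  unfolding z(2) z'(2) using z z' by (intro M.finsum_addf[symmetric]) auto
 also have "\<dots> = (\<Oplus>a\<in>E. (z a \<oplus> z' a) \<triangleleft> ar a)"
  using z z' by (intro M.finsum_cong') (auto simp: ract_add_left Pi_def)
 also have "\<dots> \<in> rad M" using z z' by (auto intro!: radI)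
 finally show "y \<oplus> y' \<in> rad M" .
qed

lemma finsum_single:
 assumes "finite A" "b \<in> A" "f \<in> A \<rightarrow> carrier M"
 shows "(\<Oplus>a\<in>A. if a = b then f a else \<zero>) = f b"
proof -
 have "(\<Oplus>a\<in>A. if a = b then f a else \<zero>) = (\<Oplus>a\<in>A. if b = a then f a else \<zero>)"
  using assms by (intro M.finsum_cong') auto
 then show ?thesis using M.finsum_singleton[of b A f] assms by simp
qed

lemma x_in_rad: "y \<in> carrier M \<Longrightarrow> b \<in> E \<Longrightarrow> y \<triangleleft> ar b \<in> rad M"
proof -
 assume y: "y \<in> carrier M" "b \<in> E"
 have "(\<Oplus>a\<in>E. (if a = b then y else \<zero>) \<triangleleft> ar a) = (\<Oplus>a\<in>E. if a = b then y \<triangleleft> ar a else \<zero>)"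
  using y by (intro M.finsum_cong') auto
 also have "\<dots> = y \<triangleleft> ar b" using y finE by (intro finsum_single) auto
 finally show ?thesis using radI[of "\<lambda>a. if a = b then y else \<zero>"] y by auto
qed

lemma finsum_filter:
 assumes "finite A" "f \<in> A \<rightarrow> carrier M"
 shows "(\<Oplus>a\<in>A. if P a then f a else \<zero>) = (\<Oplus>a\<in>{a\<in>A. P a}. f a)"
proof -
 have "(\<Oplus>a\<in>{a\<in>A. P a} \<union> {a\<in>A. \<not> P a}. if P a then f a else \<zero>)
   = (\<Oplus>a\<in>{a\<in>A. P a}. if P a then f a else \<zero>) \<oplus> (\<Oplus>a\<in>{a\<in>A. \<not> P a}. if P a then f a else \<zero>)"
  using assms by (intro M.finsum_Un_disjoint) auto
 also have "(\<Oplus>a\<in>{a\<in>A. P a}. if P a then f a else \<zero>) = (\<Oplus>a\<in>{a\<in>A. P a}. f a)"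
  using assms by (intro M.finsum_cong') auto
 also have "(\<Oplus>a\<in>{a\<in>A. \<not> P a}. if P a then f a else \<zero>) = \<zero>" by (rule finsum_zero') auto
 also have "{a\<in>A. P a} \<union> {a\<in>A. \<not> P a} = A" by auto
 finally show ?thesis using assms by (auto intro!: M.r_zero M.finsum_closed)
qed

lemma rad_e_eq:
 assumes "z \<in> E \<rightarrow> carrier M"
 shows "(\<Oplus>a\<in>E. z a \<triangleleft> ar a) \<triangleleft> e j = (\<Oplus>a\<in>{a\<in>E. tgt a = j}. z a \<triangleleft> ar a)"
proof -
 have "(\<Oplus>a\<in>E. z a \<triangleleft> ar a) \<triangleleft> e j = (\<Oplus>a\<in>E. if tgt a = j then z a \<triangleleft> ar a else \<zero>)"
  using assms by (subst ract_finsum_left) (auto intro!: M.finsum_cong' simp: x_e_act Pi_def)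
 also have "\<dots> = (\<Oplus>a\<in>{a\<in>E. tgt a = j}. z a \<triangleleft> ar a)"
  using assms finE by (intro finsum_filter) auto
 finally show ?thesis .
qed

lemma rad_e: "y \<in> rad M \<Longrightarrow> y \<triangleleft> e j \<in> rad M"
proof -
 assume "y \<in> rad M"
 then obtain z where z: "z \<in> E \<rightarrow> carrier M" "y = (\<Oplus>a\<in>E. z a \<triangleleft> ar a)" by (auto simp: rad_def)
 show ?thesis unfolding z(2) rad_e_eq[OF z(1)] using z(1)
  by (intro K.ksub_finsum[OF ksub_rad]) (auto intro: x_in_rad)
qed

text \<open>The relation J^2 = 0 enters here: J kills every term of a sum in MJ.\<close>

lemma rad_soc: "y \<in> rad M \<Longrightarrow> y \<in> soc M"
proof -
 assume y: "y \<in> rad M"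
 then obtain z where z: "z \<in> E \<rightarrow> carrier M" "y = (\<Oplus>a\<in>E. z a \<triangleleft> ar a)" by (auto simp: rad_def)
 have "y \<triangleleft> ar b = \<zero>" if "b \<in> E" for b
  unfolding z(2) using z(1) that
  by (subst ract_finsum_left) (auto intro!: finsum_zero' simp: x_x_act Pi_def)
 then show ?thesis using rad_carrier[OF y] by (simp add: soc_def)
qed

lemma rad_compE:
 assumes "y \<in> rad M \<inter> comp M j"
 obtains z where "\<And>a. a \<in> E \<Longrightarrow> z a \<in> comp M (src a)" "y = (\<Oplus>a\<in>{a\<in>E. tgt a = j}. z a \<triangleleft> ar a)"
proof -
 have 1: "y \<in> rad M" "y \<triangleleft> e j = y" using assms by (auto simp: comp_def)
 obtain z where z: "\<And>a. a \<in> E \<Longrightarrow> z a \<in> comp M (src a)" "y = (\<Oplus>a\<in>E. z a \<triangleleft> ar a)"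
  by (rule radE[OF 1(1)]) (rule that)
 have "z \<in> E \<rightarrow> carrier M" using z(1) by (auto simp: comp_def)
 then show thesis using that[OF z(1)] rad_e_eq[of z j] 1(2) z(2) by simp
qed

lemma mem_by_comps:
 assumes W: "ksub M (kact M) W" and y: "y \<in> carrier M" "\<And>i. i \<in> V \<Longrightarrow> y \<triangleleft> e i \<in> W"
 shows "y \<in> W"
 using K.ksub_finsum[OF W, of "\<lambda>i. y \<triangleleft> e i" V] y sum_e[OF y(1)] by simp

lemma submodI:
 assumes W: "ksub M (kact M) W" and e: "\<And>y i. y \<in> W \<Longrightarrow> i \<in> V \<Longrightarrow> y \<triangleleft> e i \<in> W"
  and x: "\<And>y a. y \<in> W \<Longrightarrow> a \<in> E \<Longrightarrow> y \<triangleleft> ar a \<in> W"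
 shows "submod R M W"
 unfolding submod_def
proof (intro conjI ballI)
 show "additive_subgroup W M"
  by (intro additive_subgroup.intro M.add.subgroupI)
   (use K.ksubD[OF W] in \<open>auto simp: a_inv_def[symmetric]\<close>)
 fix y r assume y: "y \<in> W" and r: "r \<in> carrier R"
 have "(\<Oplus>i\<in>V. kact M (ec r i) (y \<triangleleft> e i)) \<in> W" "(\<Oplus>a\<in>E. kact M (xc r a) (y \<triangleleft> ar a)) \<in> W"
  using e[OF y] x[OF y] K.ksubD(4)[OF W] by (auto intro!: K.ksub_finsum[OF W])
 then show "y \<triangleleft> r \<in> W"
  using ract_expand[OF K.ksubD(1)[OF W y] r] K.ksubD(3)[OF W] by simp
qed

lemma submodD:
 assumes "submod R M W"
 shows "ksub M (kact M) W" "y \<in> W \<Longrightarrow> r \<in> carrier R \<Longrightarrow> y \<triangleleft> r \<in> W"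
proof -
 interpret additive_subgroup W M using assms by (simp add: submod_def)
 show 1: "y \<in> W \<Longrightarrow> r \<in> carrier R \<Longrightarrow> y \<triangleleft> r \<in> W" for y r
  using assms by (simp add: submod_def)
 show "ksub M (kact M) W"
  unfolding ksub_def kact_def using a_subset 1 by auto
qed

lemma right_module_submod:
 assumes N: "submod R M N"
 shows "right_module R (M\<lparr>carrier := N\<rparr>)"
proof -
 note D = K.ksubD[OF submodD(1)[OF N]]
 have "abelian_group (M\<lparr>carrier := N\<rparr>)"
 proof (rule abelian_groupI)
  fix y assume y: "y \<in> carrier (M\<lparr>carrier := N\<rparr>)"
  show "\<exists>z\<in>carrier (M\<lparr>carrier := N\<rparr>). z \<oplus>\<^bsub>M\<lparr>carrier := N\<rparr>\<^esub> y = \<zero>\<^bsub>M\<lparr>carrier := N\<rparr>\<^esub>"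
   using y D by (auto intro!: bexI[of _ "\<ominus> y"] M.l_neg)
 qed (use D in \<open>auto simp: M.a_ac\<close>)
 then show ?thesis
  using D submodD(2)[OF N]
  by (intro right_module.intro R.ring_axioms right_module_axioms.intro)
   (auto simp: ract_add_left ract_add_right ract_assoc ract_one)
qed

text \<open>The products of the generators with idempotents and arrows span the module: if a
  subspace \<open>Z\<close> contains them, then the largest submodule inside \<open>Z\<close>,
  written \<open>?N\<close>, contains the generators and so is everything.\<close>

lemma kfin_carrier:
 assumes "fin_gen R M"
 shows "kfin M (kact M) (carrier M)"
proof -
 obtain X where X: "finite X" "X \<subseteq> carrier M" "\<And>N. submod R M N \<Longrightarrow> X \<subseteq> N \<Longrightarrow> N = carrier M"
  using assms unfolding fin_gen_def by auto
 define Y where "Y = (\<Union>i\<in>V. (\<lambda>y. y \<triangleleft> e i) ` X) \<union> (\<Union>a\<in>E. (\<lambda>y. y \<triangleleft> ar a) ` X)"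
 have "carrier M \<subseteq> Z" if Z: "ksub M (kact M) Z" and YZ: "Y \<subseteq> Z" for Z
 proof -
  let ?N = "{y\<in>carrier M. \<forall>r\<in>carrier R. y \<triangleleft> r \<in> Z}"
  have "submod R M ?N"
  proof (rule submodI)
   show "ksub M (kact M) ?N"
    using K.ksubD[OF Z] by (auto simp: ksub_def ract_add_left kact_ract)
  qed (auto simp: ract_assoc[symmetric])
  moreover have "X \<subseteq> ?N"
  proof
   fix y assume y: "y \<in> X"
   then have yc: "y \<in> carrier M" using X by auto
   have "y \<triangleleft> e i \<in> Z" if "i \<in> V" for i using y YZ that unfolding Y_def by blast
   moreover have "y \<triangleleft> ar a \<in> Z" if "a \<in> E" for a using y YZ that unfolding Y_def by blast
   ultimately have "y \<triangleleft> r \<in> Z" if r: "r \<in> carrier R" for r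
    unfolding ract_expand[OF yc r] using K.ksubD(4)[OF Z]
    by (intro K.ksubD(3)[OF Z] K.ksub_finsum[OF Z]) auto
   then show "y \<in> ?N" using yc by auto
  qed
  ultimately have N: "?N = carrier M" by (rule X(3))
  show ?thesis
  proof
   fix y assume y: "y \<in> carrier M"
   then have "y \<in> ?N" using N by simp
   then have "y \<triangleleft> \<one>\<^bsub>R\<^esub> \<in> Z" using R.one_closed by blast
   then show "y \<in> Z" using y by (simp add: ract_one)
  qed
 qed
 moreover have "finite Y" "Y \<subseteq> carrier M" using X finV finE unfolding Y_def by auto
 ultimately show ?thesis unfolding kfin_def by blast
qed

lemma fin_genI: "kfin M (kact M) (carrier M) \<Longrightarrow> fin_gen R M"
 unfolding fin_gen_def
proof (erule kfinE)
 fix X assume X: "finite X" "X \<subseteq> carrier M" "\<And>Z. ksub M (kact M) Z \<Longrightarrow> X \<subseteq> Z \<Longrightarrow> carrier M \<subseteq> Z"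
 show "\<exists>X. finite X \<and> X \<subseteq> carrier M \<and> (\<forall>N. submod R M N \<and> X \<subseteq> N --> N = carrier M)"
 proof (intro exI[of _ X] conjI allI impI)
  fix N assume "submod R M N \<and> X \<subseteq> N"
  then show "N = carrier M"
   using X(3)[of N] submodD(1)[of N] K.ksubD(1)[of N] by auto
 qed (use X in auto)
qed

lemma kfin_any: "fin_gen R M \<Longrightarrow> ksub M (kact M) W \<Longrightarrow> kfin M (kact M) W"
 using K.kfin_sub[OF _ K.ksub_carrier kfin_carrier] K.ksubD(1)[of W] by blast

end

section \<open>Submodules and homomorphisms in coordinates\<close>

context rsz begin

lemma rsz_moduleI: "right_module R M \<Longrightarrow> rsz_module R V E src tgt ec xc M"
 by (intro rsz_module.intro rsz_axioms)

lemma fg_rsz_module: "M \<in> fgmod R \<Longrightarrow> rsz_module R V E src tgt ec xc M"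
 by (intro rsz_moduleI) (simp add: fgmod_def)

lemma kact_upd [simp]: "kact (M\<lparr>carrier := N\<rparr>) = kact M"
 by (simp add: kact_def fun_eq_iff)

text \<open>Finite generation amounts to finite dimension, which passes to subspaces.\<close>

lemma fgmod_submod:
 assumes "M \<in> fgmod R" "submod R M N"
 shows "M\<lparr>carrier := N\<rparr> \<in> fgmod R"
proof -
 interpret M: rsz_module R V E src tgt ec xc M by (rule fg_rsz_module[OF assms(1)])
 have rm: "right_module R (M\<lparr>carrier := N\<rparr>)" by (rule M.right_module_submod[OF assms(2)])
 interpret N: rsz_module R V E src tgt ec xc "M\<lparr>carrier := N\<rparr>" by (rule rsz_moduleI[OF rm])
 have kN: "ksub M (kact M) N" by (rule M.submodD(1)[OF assms(2)])
 have "kfin M (kact M) N" using assms(1) kN by (intro M.kfin_any) (simp_all add: fgmod_def)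
 then obtain X where X: "finite X" "X \<subseteq> N" "\<And>Z. ksub M (kact M) Z \<Longrightarrow> X \<subseteq> Z \<Longrightarrow> N \<subseteq> Z"
  by (rule kfinE) (rule that)
 have "N \<subseteq> Z" if "ksub (M\<lparr>carrier := N\<rparr>) (kact M) Z" "X \<subseteq> Z" for Z
  using that M.K.ksubD(1)[OF kN] by (intro X(3)) (auto simp: ksub_def)
 then have "kfin (M\<lparr>carrier := N\<rparr>) (kact (M\<lparr>carrier := N\<rparr>)) (carrier (M\<lparr>carrier := N\<rparr>))"
  unfolding kfin_def kact_upd using X(1,2) by (intro exI[of _ X]) simp
 then have "fin_gen R (M\<lparr>carrier := N\<rparr>)" by (rule N.fin_genI)
 then show ?thesis using rm by (simp add: fgmod_def)
qed

lemma mhomD: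
 assumes "f \<in> mhom R M N"
 shows "y \<in> carrier M \<Longrightarrow> f y \<in> carrier N"
  "y \<in> carrier M \<Longrightarrow> y' \<in> carrier M \<Longrightarrow> f (y \<oplus>\<^bsub>M\<^esub> y') = f y \<oplus>\<^bsub>N\<^esub> f y'"
  "y \<in> carrier M \<Longrightarrow> r \<in> carrier R \<Longrightarrow> f (y \<triangleleft>\<^bsub>M\<^esub> r) = f y \<triangleleft>\<^bsub>N\<^esub> r"
  "y \<in> carrier M \<Longrightarrow> f (kact M c y) = kact N c (f y)"
 using assms by (auto simp: mhom_def hom_def kact_def)

lemma mhom_zero: "right_module R M \<Longrightarrow> right_module R N \<Longrightarrow> f \<in> mhom R M N \<Longrightarrow> f \<zero>\<^bsub>M\<^esub> = \<zero>\<^bsub>N\<^esub>"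
proof -
 assume a: "right_module R M" "right_module R N" "f \<in> mhom R M N"
 interpret M: rsz_module R V E src tgt ec xc M by (rule rsz_moduleI[OF a(1)])
 interpret N: rsz_module R V E src tgt ec xc N by (rule rsz_moduleI[OF a(2)])
 have "f (\<zero>\<^bsub>M\<^esub> \<oplus>\<^bsub>M\<^esub> \<zero>\<^bsub>M\<^esub>) = f \<zero>\<^bsub>M\<^esub> \<oplus>\<^bsub>N\<^esub> f \<zero>\<^bsub>M\<^esub>" by (rule mhomD(2)[OF a(3)]) auto
 then show ?thesis using mhomD(1)[OF a(3), of "\<zero>\<^bsub>M\<^esub>"] by simp
qed

lemma mhom_minus:
 assumes "right_module R M" "right_module R N" "f \<in> mhom R M N" "y \<in> carrier M" "z \<in> carrier M"
 shows "f (y \<ominus>\<^bsub>M\<^esub> z) = f y \<ominus>\<^bsub>N\<^esub> f z"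
proof -
 interpret M: rsz_module R V E src tgt ec xc M by (rule rsz_moduleI[OF assms(1)])
 interpret N: rsz_module R V E src tgt ec xc N by (rule rsz_moduleI[OF assms(2)])
 have "f (\<ominus>\<^bsub>M\<^esub> z) = \<ominus>\<^bsub>N\<^esub> f z"
  using assms mhomD(4)[OF assms(3,5), of "- 1"] mhomD(1)[OF assms(3,5)]
  by (simp add: M.K.s_minus_one N.K.s_minus_one)
 then show ?thesis using mhomD(2)[OF assms(3,4), of "\<ominus>\<^bsub>M\<^esub> z"] assms(5) by (simp add: a_minus_def)
qed

lemma additive_finsum:
 fixes M :: "('a, 'b) module" and N :: "('a, 'c) module"
 assumes "right_module R M" "right_module R N" and c: "\<And>y. y \<in> carrier M \<Longrightarrow> f y \<in> carrier N"
  and add: "\<And>y z. y \<in> carrier M \<Longrightarrow> z \<in> carrier M \<Longrightarrow> f (y \<oplus>\<^bsub>M\<^esub> z) = f y \<oplus>\<^bsub>N\<^esub> f z"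
  and z: "f \<zero>\<^bsub>M\<^esub> = \<zero>\<^bsub>N\<^esub>" and g: "g \<in> A \<rightarrow> carrier M"
 shows "f (finsum M g A) = finsum N (\<lambda>a. f (g a)) A"
proof -
 interpret M: rsz_module R V E src tgt ec xc M by (rule rsz_moduleI[OF assms(1)])
 interpret N: rsz_module R V E src tgt ec xc N by (rule rsz_moduleI[OF assms(2)])
 show ?thesis using g
 proof (induct A rule: infinite_finite_induct)
  case (insert a A)
  then show ?case
   by (subst M.finsum_insert, simp, simp, force, force, subst N.finsum_insert)
    (auto simp: add c Pi_def)
 qed (use z in auto)
qed

lemma mhom_finsum:
 fixes M :: "('a, 'b) module" and N :: "('a, 'c) module"
 assumes "right_module R M" "right_module R N" "f \<in> mhom R M N" "g \<in> A \<rightarrow> carrier M"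
 shows "f (finsum M g A) = finsum N (\<lambda>a. f (g a)) A"
 by (rule additive_finsum[where f = f, OF assms(1,2)]) (use assms mhomD mhom_zero in auto)

lemma mhomI:
 assumes "right_module R M" "right_module R N" and c: "\<And>y. y \<in> carrier M \<Longrightarrow> f y \<in> carrier N"
  and add: "\<And>y z. y \<in> carrier M \<Longrightarrow> z \<in> carrier M \<Longrightarrow> f (y \<oplus>\<^bsub>M\<^esub> z) = f y \<oplus>\<^bsub>N\<^esub> f z"
  and k: "\<And>y c. y \<in> carrier M \<Longrightarrow> f (kact M c y) = kact N c (f y)"
  and e: "\<And>y i. y \<in> carrier M \<Longrightarrow> i \<in> V \<Longrightarrow> f (y \<triangleleft>\<^bsub>M\<^esub> e i) = f y \<triangleleft>\<^bsub>N\<^esub> e i"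
  and x: "\<And>y a. y \<in> carrier M \<Longrightarrow> a \<in> E \<Longrightarrow> f (y \<triangleleft>\<^bsub>M\<^esub> ar a) = f y \<triangleleft>\<^bsub>N\<^esub> ar a"
 shows "f \<in> mhom R M N"
proof -
 interpret M: rsz_module R V E src tgt ec xc M by (rule rsz_moduleI[OF assms(1)])
 interpret N: rsz_module R V E src tgt ec xc N by (rule rsz_moduleI[OF assms(2)])
 have z: "f \<zero>\<^bsub>M\<^esub> = \<zero>\<^bsub>N\<^esub>" using k[of "\<zero>\<^bsub>M\<^esub>" 0] c[of "\<zero>\<^bsub>M\<^esub>"] by simp
 have "f (y \<triangleleft>\<^bsub>M\<^esub> r) = f y \<triangleleft>\<^bsub>N\<^esub> r" if y: "y \<in> carrier M" and r: "r \<in> carrier R" for y r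
 proof -
  let ?g = "\<lambda>i. kact M (ec r i) (y \<triangleleft>\<^bsub>M\<^esub> e i)" and ?h = "\<lambda>a. kact M (xc r a) (y \<triangleleft>\<^bsub>M\<^esub> ar a)"
  have gh: "?g \<in> V \<rightarrow> carrier M" "?h \<in> E \<rightarrow> carrier M" using y by auto
  have "f (y \<triangleleft>\<^bsub>M\<^esub> r) = f (finsum M ?g V) \<oplus>\<^bsub>N\<^esub> f (finsum M ?h E)"
   unfolding M.ract_expand[OF y r] using gh by (intro add M.finsum_closed)
  also have "f (finsum M ?g V) = finsum N (\<lambda>i. f (?g i)) V"
   by (rule additive_finsum[where f = f, OF assms(1,2) c add z gh(1)])
  also have "f (finsum M ?h E) = finsum N (\<lambda>i. f (?h i)) E"
   by (rule additive_finsum[where f = f, OF assms(1,2) c add z gh(2)])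
  also have "finsum N (\<lambda>i. f (?g i)) V = finsum N (\<lambda>i. kact N (ec r i) (f y \<triangleleft>\<^bsub>N\<^esub> e i)) V"
   using y c[OF y] by (intro N.finsum_cong') (auto simp: k e)
  also have "finsum N (\<lambda>i. f (?h i)) E = finsum N (\<lambda>a. kact N (xc r a) (f y \<triangleleft>\<^bsub>N\<^esub> ar a)) E"
   using y c[OF y] by (intro N.finsum_cong') (auto simp: k x)
  finally show ?thesis using N.ract_expand[OF c[OF y] r] by simp
 qed
 then show ?thesis using c add by (auto simp: mhom_def hom_def)
qed

section \<open>Dimension vectors, direct sums and explicit modules\<close>

text \<open>Dimension vectors of \<open>M\<close>, of MJ and of the socle. Syzygies and the
  invariants of K0 will be expressed by these numbers alone.\<close>

definition dd :: "('a, 'b) module \<Rightarrow> 'v \<Rightarrow> nat"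
 where "dd M i = kdim M (kact M) (comp M i)"
definition rr :: "('a, 'b) module \<Rightarrow> 'v \<Rightarrow> nat"
 where "rr M i = kdim M (kact M) (rad M \<inter> comp M i)"
definition ss :: "('a, 'b) module \<Rightarrow> 'v \<Rightarrow> nat"
 where "ss M i = kdim M (kact M) (soc M \<inter> comp M i)"

section \<open>Behaviour of the dimension vectors under homomorphisms and isomorphisms\<close>

lemma mhom_comp: "f \<in> mhom R M N \<Longrightarrow> y \<in> comp M i \<Longrightarrow> f y \<in> comp N i"
 using mhomD(1,3)[of f M N y] by (simp add: comp_def) (metis e_closed)

lemma mhom_soc:
 assumes "right_module R M" "right_module R N" "f \<in> mhom R M N" "y \<in> soc M"
 shows "f y \<in> soc N"
 using assms mhomD(1,3)[OF assms(3), of y] mhom_zero[OF assms(1-3)]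
 by (simp add: soc_def) (metis ar_closed)

lemma mhom_rad:
 assumes "right_module R M" "right_module R N" and f: "f \<in> mhom R M N" and y: "y \<in> rad M"
 shows "f y \<in> rad N"
proof -
 interpret M: rsz_module R V E src tgt ec xc M by (rule rsz_moduleI[OF assms(1)])
 interpret N: rsz_module R V E src tgt ec xc N by (rule rsz_moduleI[OF assms(2)])
 obtain z where z: "z \<in> E \<rightarrow> carrier M" "y = finsum M (\<lambda>a. z a \<triangleleft>\<^bsub>M\<^esub> ar a) E" using y by (auto simp: rad_def)
 have "f y = finsum N (\<lambda>a. f (z a \<triangleleft>\<^bsub>M\<^esub> ar a)) E"
  unfolding z(2) using z(1) by (intro mhom_finsum[OF assms(1-3)]) auto
 also have "\<dots> = finsum N (\<lambda>a. f (z a) \<triangleleft>\<^bsub>N\<^esub> ar a) E"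
  using z(1) mhomD[OF f] by (intro N.finsum_cong') (auto simp: Pi_def)
 also have "\<dots> \<in> rad N" using z(1) mhomD[OF f] by (intro N.radI) (auto simp: Pi_def)
 finally show ?thesis .
qed

lemma mhom_compose: "f \<in> mhom R L M \<Longrightarrow> g \<in> mhom R M N \<Longrightarrow> (\<lambda>y. g (f y)) \<in> mhom R L N"
 by (auto simp: mhom_def hom_def Pi_def)

lemma mhom_inv:
 assumes "right_module R M" and f: "f \<in> mhom R M N" and b: "bij_betw f (carrier M) (carrier N)"
 shows "inv_into (carrier M) f \<in> mhom R N M"
proof -
 interpret M: rsz_module R V E src tgt ec xc M by (rule rsz_moduleI[OF assms(1)])
 let ?g = "inv_into (carrier M) f"
 have g: "?g y \<in> carrier M" "f (?g y) = y" if "y \<in> carrier N" for y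
  using b that by (auto simp: bij_betw_def inv_into_into f_inv_into_f)
 have eq: "?g y = u" if "u \<in> carrier M" "f u = y" for u y
  using b that by (auto simp: bij_betw_def)
 show ?thesis
  unfolding mhom_def hom_def
  by (auto simp: g mhomD[OF f] intro!: eq)
qed

lemma miso_refl: "miso R M M"
 unfolding miso_def by (rule bexI[of _ "\<lambda>y. y"]) (auto simp: mhom_def hom_def bij_betw_def)

lemma miso_sym: "right_module R M \<Longrightarrow> miso R M N \<Longrightarrow> miso R N M"
 unfolding miso_def using mhom_inv bij_betw_inv_into by blast

lemma miso_trans: "miso R L M \<Longrightarrow> miso R M N \<Longrightarrow> miso R L N"
proof -
 assume "miso R L M" "miso R M N"
 then obtain f g where f: "f \<in> mhom R L M" "bij_betw f (carrier L) (carrier M)"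
  and g: "g \<in> mhom R M N" "bij_betw g (carrier M) (carrier N)" by (auto simp: miso_def)
 have "bij_betw (\<lambda>y. g (f y)) (carrier L) (carrier N)"
  using bij_betw_trans[OF f(2) g(2)] by (simp add: o_def)
 then show ?thesis using mhom_compose[OF f(1) g(1)] by (auto simp: miso_def)
qed

lemma miso_dims:
 assumes M: "right_module R M" "fin_gen R M" and N: "right_module R N" and iso: "miso R M N"
 shows "dd N i = dd M i" "rr N i = rr M i" "ss N i = ss M i" "fin_gen R N"
proof -
 interpret M: rsz_module R V E src tgt ec xc M by (rule rsz_moduleI[OF M(1)])
 interpret N: rsz_module R V E src tgt ec xc N by (rule rsz_moduleI[OF N])
 obtain f where f: "f \<in> mhom R M N" "bij_betw f (carrier M) (carrier N)" using iso by (auto simp: miso_def)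
 define g where "g = inv_into (carrier M) f"
 have g: "g \<in> mhom R N M" unfolding g_def by (rule mhom_inv[OF M(1) f])
 have fg: "f (g y) = y" if "y \<in> carrier N" for y
  using f(2) that unfolding g_def by (auto simp: bij_betw_def f_inv_into_f)
 have inj: "f y = \<zero>\<^bsub>N\<^esub> \<Longrightarrow> y = \<zero>\<^bsub>M\<^esub>" if "y \<in> carrier M" for y
  using f(2) that mhom_zero[OF M(1) N f(1)] unfolding bij_betw_def inj_on_def by (metis M.zero_closed)
 have key: "kdim N (kact N) W' = kdim M (kact M) W" if W: "ksub M (kact M) W" and im: "f ` W = W'" for W W'
  unfolding im[symmetric]
  by (rule kdim_inj[of M "kact M" N "kact N" W f])
   (use M.K.ksubD(1)[OF W] M.kfin_any[OF M(2) W] W M.kspace_kact N.kspace_kact inj in \<open>auto simp: mhomD[OF f(1)]\<close>)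
 have img: "f ` W = W'" if "\<And>y. y \<in> W \<Longrightarrow> f y \<in> W'" "\<And>y. y \<in> W' \<Longrightarrow> g y \<in> W" "W' \<subseteq> carrier N" for W W'
  using that fg by (force simp: image_iff)
 have c: "y \<in> comp M i \<Longrightarrow> f y \<in> comp N i" "z \<in> comp N i \<Longrightarrow> g z \<in> comp M i" for y z
  by (rule mhom_comp[OF f(1)], assumption) (rule mhom_comp[OF g])
 have r: "y \<in> rad M \<Longrightarrow> f y \<in> rad N" "z \<in> rad N \<Longrightarrow> g z \<in> rad M" for y z
  by (rule mhom_rad[OF M(1) N f(1)], assumption) (rule mhom_rad[OF N M(1) g])
 have s: "y \<in> soc M \<Longrightarrow> f y \<in> soc N" "z \<in> soc N \<Longrightarrow> g z \<in> soc M" for y z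
  by (rule mhom_soc[OF M(1) N f(1)], assumption) (rule mhom_soc[OF N M(1) g])
 have cc: "comp N i \<subseteq> carrier N" by (auto simp: comp_def)
 have "f ` comp M i = comp N i" by (rule img) (fact c cc)+
 then show "dd N i = dd M i" unfolding dd_def by (rule key[OF M.ksub_comp])
 have "f ` (rad M \<inter> comp M i) = rad N \<inter> comp N i" by (rule img) (use c r cc in blast)+
 then show "rr N i = rr M i" unfolding rr_def
  by (rule key[OF M.K.ksub_Int[OF M.ksub_rad M.ksub_comp]])
 have "f ` (soc M \<inter> comp M i) = soc N \<inter> comp N i" by (rule img) (use c s cc in blast)+
 then show "ss N i = ss M i" unfolding ss_def
  by (rule key[OF M.K.ksub_Int[OF M.ksub_soc M.ksub_comp]])
 have "kfin N (kact N) (f ` carrier M)"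
  by (rule kfin_image[OF M.kspace_kact N.kspace_kact M.K.ksub_carrier M.kfin_carrier[OF M(2)]])
   (auto simp: mhomD[OF f(1)])
 then show "fin_gen R N" using f(2) by (intro N.fin_genI) (simp add: bij_betw_def)
qed

lemma carrier_zero_iff:
 assumes "right_module R M" "fin_gen R M"
 shows "carrier M = {\<zero>\<^bsub>M\<^esub>} \<longleftrightarrow> (\<forall>i\<in>V. dd M i = 0)"
proof
 interpret M: rsz_module R V E src tgt ec xc M by (rule rsz_moduleI[OF assms(1)])
 assume "carrier M = {\<zero>\<^bsub>M\<^esub>}"
 then have "comp M i = {\<zero>\<^bsub>M\<^esub>}" for i using M.comp_zero[of i] by (auto simp: comp_def)
 then show "\<forall>i\<in>V. dd M i = 0" by (simp add: dd_def M.K.kdim_zero)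
next
 interpret M: rsz_module R V E src tgt ec xc M by (rule rsz_moduleI[OF assms(1)])
 assume 0: "\<forall>i\<in>V. dd M i = 0"
 have "comp M i = {\<zero>\<^bsub>M\<^esub>}" if "i \<in> V" for i
  using 0 that by (intro M.K.kdim_eq_0[OF M.ksub_comp M.kfin_any[OF assms(2) M.ksub_comp]]) (simp add: dd_def)
 then have "y = \<zero>\<^bsub>M\<^esub>" if "y \<in> carrier M" for y
  using M.mem_by_comps[OF M.K.ksub_zero that] that M.e_in_comp by blast
 then show "carrier M = {\<zero>\<^bsub>M\<^esub>}" by auto
qed

lemma dd_pos_iff:
 assumes "right_module R M" "fin_gen R M"
 shows "dd M i > 0 \<longleftrightarrow> (\<exists>y\<in>comp M i. y \<noteq> \<zero>\<^bsub>M\<^esub>)"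
proof -
 interpret M: rsz_module R V E src tgt ec xc M by (rule rsz_moduleI[OF assms(1)])
 have "dd M i = 0 \<longleftrightarrow> comp M i = {\<zero>\<^bsub>M\<^esub>}"
  using M.K.kdim_eq_0[OF M.ksub_comp M.kfin_any[OF assms(2) M.ksub_comp]] M.K.kdim_zero
  by (auto simp: dd_def)
 then show ?thesis using M.comp_zero[of i] by auto
qed

lemma rr_le_dd:
 assumes "right_module R M" "fin_gen R M"
 shows "rr M i \<le> dd M i" "rr M i \<le> ss M i"
proof -
 interpret M: rsz_module R V E src tgt ec xc M by (rule rsz_moduleI[OF assms(1)])
 note k = M.K.ksub_Int[OF M.ksub_rad M.ksub_comp] M.K.ksub_Int[OF M.ksub_soc M.ksub_comp]
 show "rr M i \<le> dd M i" unfolding rr_def dd_def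
  by (rule M.K.kdim_mono[OF k(1) M.ksub_comp M.kfin_any[OF assms(2) M.ksub_comp]]) auto
 show "rr M i \<le> ss M i" unfolding rr_def ss_def
  by (rule M.K.kdim_mono[OF k(1,2) M.kfin_any[OF assms(2) k(2)]]) (auto intro: M.rad_soc)
qed

subsection \<open>Direct sums\<close>

lemma msum_simps [simp]:
 "carrier (msum M N) = carrier M \<times> carrier N" "\<zero>\<^bsub>msum M N\<^esub> = (\<zero>\<^bsub>M\<^esub>, \<zero>\<^bsub>N\<^esub>)"
 "(y, z) \<oplus>\<^bsub>msum M N\<^esub> (y', z') = (y \<oplus>\<^bsub>M\<^esub> y', z \<oplus>\<^bsub>N\<^esub> z')"
 "(y, z) \<triangleleft>\<^bsub>msum M N\<^esub> r = (y \<triangleleft>\<^bsub>M\<^esub> r, z \<triangleleft>\<^bsub>N\<^esub> r)"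
 by (simp_all add: msum_def)

lemma kact_msum [simp]: "kact (msum M N) c (y, z) = (kact M c y, kact N c z)"
 by (simp add: kact_def)

lemma right_module_msum:
 assumes "right_module R M" "right_module R N"
 shows "right_module R (msum M N)"
proof -
 interpret M: rsz_module R V E src tgt ec xc M by (rule rsz_moduleI[OF assms(1)])
 interpret N: rsz_module R V E src tgt ec xc N by (rule rsz_moduleI[OF assms(2)])
 have "abelian_group (msum M N)"
 proof (rule abelian_groupI)
  fix y assume "y \<in> carrier (msum M N)"
  then obtain u v where "y = (u, v)" "u \<in> carrier M" "v \<in> carrier N" by auto
  then show "\<exists>z\<in>carrier (msum M N). z \<oplus>\<^bsub>msum M N\<^esub> y = \<zero>\<^bsub>msum M N\<^esub>"
   by (intro bexI[of _ "(\<ominus>\<^bsub>M\<^esub> u, \<ominus>\<^bsub>N\<^esub> v)"]) (simp_all add: M.l_neg N.l_neg)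
 qed (auto simp: M.a_ac N.a_ac)
 then show ?thesis
  by (intro right_module.intro R.ring_axioms right_module_axioms.intro)
   (auto simp: M.ract_add_left N.ract_add_left M.ract_add_right N.ract_add_right
    M.ract_assoc N.ract_assoc M.ract_one N.ract_one)
qed

lemma mhom_msum:
 assumes "right_module R M" "right_module R N"
 shows "fst \<in> mhom R (msum M N) M" "snd \<in> mhom R (msum M N) N"
  "(\<lambda>y. (y, \<zero>\<^bsub>N\<^esub>)) \<in> mhom R M (msum M N)" "(\<lambda>z. (\<zero>\<^bsub>M\<^esub>, z)) \<in> mhom R N (msum M N)"
proof -
 interpret M: rsz_module R V E src tgt ec xc M by (rule rsz_moduleI[OF assms(1)])
 interpret N: rsz_module R V E src tgt ec xc N by (rule rsz_moduleI[OF assms(2)])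
 show "fst \<in> mhom R (msum M N) M" "snd \<in> mhom R (msum M N) N"
  "(\<lambda>y. (y, \<zero>\<^bsub>N\<^esub>)) \<in> mhom R M (msum M N)" "(\<lambda>z. (\<zero>\<^bsub>M\<^esub>, z)) \<in> mhom R N (msum M N)"
  by (auto simp: mhom_def hom_def)
qed

text \<open>Rank and nullity for the second projection, whose kernel is a copy of
  \<open>U\<close>.\<close>

lemma kdim_Times:
 assumes M: "right_module R M" "fin_gen R M" and N: "right_module R N" "fin_gen R N"
  and U: "ksub M (kact M) U" and W: "ksub N (kact N) W"
 shows "ksub (msum M N) (kact (msum M N)) (U \<times> W)" "kfin (msum M N) (kact (msum M N)) (U \<times> W)"
  "kdim (msum M N) (kact (msum M N)) (U \<times> W) = kdim M (kact M) U + kdim N (kact N) W"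
proof -
 interpret M: rsz_module R V E src tgt ec xc M by (rule rsz_moduleI[OF M(1)])
 interpret N: rsz_module R V E src tgt ec xc N by (rule rsz_moduleI[OF N(1)])
 interpret S: rsz_module R V E src tgt ec xc "msum M N" by (rule rsz_moduleI[OF right_module_msum[OF M(1) N(1)]])
 note h = mhom_msum[OF M(1) N(1)]
 note UD = M.K.ksubD[OF U] and WD = N.K.ksubD[OF W]
 show UW: "ksub (msum M N) (kact (msum M N)) (U \<times> W)"
  using UD WD unfolding ksub_def by auto
 obtain X where X: "finite X" "X \<subseteq> U" "\<And>Z. ksub M (kact M) Z \<Longrightarrow> X \<subseteq> Z \<Longrightarrow> U \<subseteq> Z"
  by (rule kfinE[OF M.kfin_any[OF M(2) U]]) (rule that)
 obtain Y where Y: "finite Y" "Y \<subseteq> W" "\<And>Z. ksub N (kact N) Z \<Longrightarrow> Y \<subseteq> Z \<Longrightarrow> W \<subseteq> Z"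
  by (rule kfinE[OF N.kfin_any[OF N(2) W]]) (rule that)
 let ?XY = "(\<lambda>y. (y, \<zero>\<^bsub>N\<^esub>)) ` X \<union> (\<lambda>z. (\<zero>\<^bsub>M\<^esub>, z)) ` Y"
 have "U \<times> W \<subseteq> Z" if Z: "ksub (msum M N) (kact (msum M N)) Z" and XYZ: "?XY \<subseteq> Z" for Z
 proof -
  note ZD = S.K.ksubD[OF Z]
  have "ksub M (kact M) {y\<in>carrier M. (y, \<zero>\<^bsub>N\<^esub>) \<in> Z}"
   using ZD(2) ZD(3)[of "(_, \<zero>\<^bsub>N\<^esub>)" "(_, \<zero>\<^bsub>N\<^esub>)"] ZD(4)[of "(_, \<zero>\<^bsub>N\<^esub>)"] unfolding ksub_def by auto
  then have 1: "U \<subseteq> {y\<in>carrier M. (y, \<zero>\<^bsub>N\<^esub>) \<in> Z}" using XYZ X(2) UD(1) by (intro X(3)) auto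
  have "ksub N (kact N) {z\<in>carrier N. (\<zero>\<^bsub>M\<^esub>, z) \<in> Z}"
   using ZD(2) ZD(3)[of "(\<zero>\<^bsub>M\<^esub>, _)" "(\<zero>\<^bsub>M\<^esub>, _)"] ZD(4)[of "(\<zero>\<^bsub>M\<^esub>, _)"] unfolding ksub_def by auto
  then have 2: "W \<subseteq> {z\<in>carrier N. (\<zero>\<^bsub>M\<^esub>, z) \<in> Z}" using XYZ Y(2) WD(1) by (intro Y(3)) auto
  show ?thesis
  proof
   fix p assume "p \<in> U \<times> W"
   then obtain u w where p: "p = (u, w)" "u \<in> U" "w \<in> W" by auto
   have "(u, \<zero>\<^bsub>N\<^esub>) \<oplus>\<^bsub>msum M N\<^esub> (\<zero>\<^bsub>M\<^esub>, w) \<in> Z" using 1 2 p by (intro ZD(3)) auto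
   then show "p \<in> Z" using p UD(1) WD(1) by simp
  qed
 qed
 then show fd: "kfin (msum M N) (kact (msum M N)) (U \<times> W)"
  unfolding kfin_def using X Y UD(2) WD(2) by (intro exI[of _ ?XY]) auto
 have rn: "kdim N (kact N) (snd ` (U \<times> W)) + kdim (msum M N) (kact (msum M N)) {p\<in>U \<times> W. snd p = \<zero>\<^bsub>N\<^esub>}
   = kdim (msum M N) (kact (msum M N)) (U \<times> W)"
  by (rule kdim_rank_nullity[OF S.kspace_kact N.kspace_kact UW fd])
   (use UD(1) WD(1) in auto)
 have "snd ` (U \<times> W) = W" using UD(2) by force
 moreover have "{p\<in>U \<times> W. snd p = \<zero>\<^bsub>N\<^esub>} = (\<lambda>y. (y, \<zero>\<^bsub>N\<^esub>)) ` U" using WD(2) by auto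
 moreover have "kdim (msum M N) (kact (msum M N)) ((\<lambda>y. (y, \<zero>\<^bsub>N\<^esub>)) ` U) = kdim M (kact M) U"
  by (rule kdim_inj[OF M.kspace_kact S.kspace_kact U M.kfin_any[OF M(2) U]]) (use UD(1) in auto)
 ultimately show "kdim (msum M N) (kact (msum M N)) (U \<times> W) = kdim M (kact M) U + kdim N (kact N) W"
  using rn by simp
qed

lemma msum_parts:
 assumes "right_module R M" "right_module R N"
 shows "comp (msum M N) i = comp M i \<times> comp N i" "soc (msum M N) = soc M \<times> soc N"
  "rad (msum M N) = rad M \<times> rad N"
proof -
 interpret M: rsz_module R V E src tgt ec xc M by (rule rsz_moduleI[OF assms(1)])
 interpret N: rsz_module R V E src tgt ec xc N by (rule rsz_moduleI[OF assms(2)])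
 interpret S: rsz_module R V E src tgt ec xc "msum M N" by (rule rsz_moduleI[OF right_module_msum[OF assms]])
 note rm = assms right_module_msum[OF assms] and h = mhom_msum[OF assms]
 show "comp (msum M N) i = comp M i \<times> comp N i" "soc (msum M N) = soc M \<times> soc N"
  by (auto simp: comp_def soc_def)
 show "rad (msum M N) = rad M \<times> rad N"
 proof (intro equalityI subsetI)
  fix p assume p: "p \<in> rad (msum M N)"
  have "fst p \<in> rad M" "snd p \<in> rad N"
   using mhom_rad[OF rm(3,1) h(1) p] mhom_rad[OF rm(3,2) h(2) p] .
  then show "p \<in> rad M \<times> rad N" by (simp add: mem_Times_iff)
 next
  fix p assume "p \<in> rad M \<times> rad N"
  then obtain u w where p: "p = (u, w)" "u \<in> rad M" "w \<in> rad N" by auto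
  have "(u, \<zero>\<^bsub>N\<^esub>) \<oplus>\<^bsub>msum M N\<^esub> (\<zero>\<^bsub>M\<^esub>, w) \<in> rad (msum M N)"
   using mhom_rad[OF rm(1,3) h(3) p(2)] mhom_rad[OF rm(2,3) h(4) p(3)] by (rule S.K.ksubD(3)[OF S.ksub_rad])
  then show "p \<in> rad (msum M N)" using p M.rad_carrier N.rad_carrier by simp
 qed
qed

lemma msum_dims:
 assumes M: "right_module R M" "fin_gen R M" and N: "right_module R N" "fin_gen R N"
 shows "fin_gen R (msum M N)" "dd (msum M N) i = dd M i + dd N i"
  "rr (msum M N) i = rr M i + rr N i" "ss (msum M N) i = ss M i + ss N i"
proof -
 interpret M: rsz_module R V E src tgt ec xc M by (rule rsz_moduleI[OF M(1)])
 interpret N: rsz_module R V E src tgt ec xc N by (rule rsz_moduleI[OF N(1)])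
 interpret S: rsz_module R V E src tgt ec xc "msum M N" by (rule rsz_moduleI[OF right_module_msum[OF M(1) N(1)]])
 note K = kdim_Times[OF M N] and P = msum_parts[OF M(1) N(1)]
 show "fin_gen R (msum M N)"
  using K(2)[OF M.K.ksub_carrier N.K.ksub_carrier] by (intro S.fin_genI) simp
 show "dd (msum M N) i = dd M i + dd N i"
  unfolding dd_def P by (rule K(3)[OF M.ksub_comp N.ksub_comp])
 show "rr (msum M N) i = rr M i + rr N i"
  unfolding rr_def P Times_Int_Times
  by (rule K(3)) (intro M.K.ksub_Int M.ksub_rad M.ksub_comp N.K.ksub_Int N.ksub_rad N.ksub_comp)+
 show "ss (msum M N) i = ss M i + ss N i"
  unfolding ss_def P Times_Int_Times
  by (rule K(3)) (intro M.K.ksub_Int M.ksub_soc M.ksub_comp N.K.ksub_Int N.ksub_soc N.ksub_comp)+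
qed

subsection \<open>Transport to the universe of \<open>fgmod\<close>\<close>

lemma sc_inj: "sc c = sc d \<Longrightarrow> c = d"
 using V_ne coords(5) by (metis ex_in_conv)

lemma transport:
 fixes M :: "('a, 'b) module" and h :: "'b \<Rightarrow> nat \<Rightarrow> 'a"
 assumes M: "right_module R M" "fin_gen R M" and h: "inj_on h (carrier M)"
 shows "\<exists>M'\<in>fgmod R. miso R M M'"
proof -
 interpret M: rsz_module R V E src tgt ec xc M by (rule rsz_moduleI[OF M(1)])
 define g where "g = inv_into (carrier M) h"
 have g [simp]: "g (h y) = y" if "y \<in> carrier M" for y using h that by (simp add: g_def)
 define M' :: "('a, nat \<Rightarrow> 'a) module" where "M' = \<lparr>carrier = h ` carrier M, monoid.mult = undefined,
  monoid.one = undefined, ring.zero = h \<zero>\<^bsub>M\<^esub>, ring.add = (\<lambda>u v. h (g u \<oplus>\<^bsub>M\<^esub> g v)),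
  module.smult = (\<lambda>a u. h (g u \<triangleleft>\<^bsub>M\<^esub> a))\<rparr>"
 have s [simp]: "carrier M' = h ` carrier M" "\<zero>\<^bsub>M'\<^esub> = h \<zero>\<^bsub>M\<^esub>"
  "u \<oplus>\<^bsub>M'\<^esub> v = h (g u \<oplus>\<^bsub>M\<^esub> g v)" "u \<triangleleft>\<^bsub>M'\<^esub> a = h (g u \<triangleleft>\<^bsub>M\<^esub> a)" for u v a
  by (simp_all add: M'_def)
 have "abelian_group M'"
 proof (rule abelian_groupI)
  fix u assume "u \<in> carrier M'"
  then obtain y where y: "u = h y" "y \<in> carrier M" by auto
  then show "\<exists>v\<in>carrier M'. v \<oplus>\<^bsub>M'\<^esub> u = \<zero>\<^bsub>M'\<^esub>"
   by (intro bexI[of _ "h (\<ominus>\<^bsub>M\<^esub> y)"]) (simp_all add: M.l_neg)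
 qed (auto simp: M.a_ac)
 then have rm: "right_module R M'"
  by (intro right_module.intro R.ring_axioms right_module_axioms.intro)
   (auto simp: M.ract_add_left M.ract_add_right M.ract_assoc M.ract_one)
 have "h \<in> mhom R M M'" by (auto simp: mhom_def hom_def)
 then have iso: "miso R M M'" using h by (auto simp: miso_def bij_betw_def)
 then show ?thesis using miso_dims(4)[OF M rm iso] rm by (auto simp: fgmod_def)
qed

text \<open>The modules in \<open>fgmod\<close> consist of functions from numbers to the algebra, so
  an element is encoded by its coordinates in a finite basis, each of them turned into an algebra
  element by \<open>sc\<close>. Modules built on any other type can thus be moved into
  \<open>fgmod\<close>.\<close>

lemma ex_umod:
 fixes M :: "('a, 'b) module"
 assumes M: "right_module R M" "fin_gen R M"
 shows "\<exists>M'\<in>fgmod R. miso R M M'"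
proof -
 interpret M: rsz_module R V E src tgt ec xc M by (rule rsz_moduleI[OF M(1)])
 obtain G where G: "finite G" "G \<subseteq> carrier M"
  "\<And>w. w \<in> carrier M \<Longrightarrow> \<exists>u\<in>{\<zero>\<^bsub>M\<^esub>}. \<exists>c. w = u \<oplus>\<^bsub>M\<^esub> M.K.kl c G"
  by (rule M.K.complement_exists[OF M.K.ksub_zero M.K.ksub_carrier M.kfin_carrier[OF M(2)]])
   (auto intro: that)
 obtain b :: "nat \<Rightarrow> 'b" and m where b: "G = b ` {i. i < m}"
  using finite_imp_nat_seg_image_inj_on[OF G(1)] by blast
 define c where "c y = (SOME c. y = M.K.kl c G)" for y
 have c: "y = M.K.kl (c y) G" if "y \<in> carrier M" for y
 proof -
  have "\<exists>c. y = M.K.kl c G" using G(3)[OF that] M.K.kl_closed[OF G(2)] by auto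
  then show ?thesis unfolding c_def by (rule someI_ex)
 qed
 have "inj_on (\<lambda>y n. sc (c y (b n))) (carrier M)"
 proof (rule inj_onI)
  fix y z assume y: "y \<in> carrier M" and z: "z \<in> carrier M"
   and eq: "(\<lambda>n. sc (c y (b n))) = (\<lambda>n. sc (c z (b n)))"
  have "c y g = c z g" if "g \<in> G" for g
   using that b fun_cong[OF eq] sc_inj by auto
  then have "M.K.kl (c y) G = M.K.kl (c z) G" by (intro M.K.kl_cong[OF G(2)])
  then show "y = z" using c[OF y] c[OF z] by simp
 qed
 then show ?thesis by (rule transport[OF M])
qed

subsection \<open>Modules with an explicit basis\<close>

text \<open>\<open>S a b b'\<close> means that the arrow \<open>a\<close> maps the basis vector \<open>b\<close> to a sum containing \<open>b'\<close>.\<close>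

definition bmod :: "'i set \<Rightarrow> ('i \<Rightarrow> 'v) \<Rightarrow> ('e \<Rightarrow> 'i \<Rightarrow> 'i \<Rightarrow> bool) \<Rightarrow> ('a, 'i \<Rightarrow> 'k) module"
 where "bmod I lb S = \<lparr>carrier = {f. \<forall>b. b \<notin> I --> f b = 0}, monoid.mult = undefined,
  monoid.one = undefined, ring.zero = (\<lambda>_. 0), ring.add = (\<lambda>f g b. f b + g b),
  module.smult = (\<lambda>r f b. if b \<in> I then
   ec r (lb b) * f b + (\<Sum>a\<in>E. xc r a * (\<Sum>b'\<in>{b'\<in>I. S a b' b}. f b')) else 0)\<rparr>"

text \<open>The last condition says that a basis vector moved by an arrow is never hit by one; it
  makes the product of any two arrows act as zero, as J^2 = 0 demands.\<close>

definition bgood :: "'i set \<Rightarrow> ('i \<Rightarrow> 'v) \<Rightarrow> ('e \<Rightarrow> 'i \<Rightarrow> 'i \<Rightarrow> bool) \<Rightarrow> bool"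
 where "bgood I lb S \<longleftrightarrow> finite I \<and> lb ` I \<subseteq> V \<and>
  (\<forall>a\<in>E. \<forall>b\<in>I. \<forall>b'\<in>I. S a b b' --> lb b = src a \<and> lb b' = tgt a \<and> (\<forall>a'\<in>E. \<forall>b''\<in>I. \<not> S a' b'' b))"

lemma bmod_simps:
 "f \<in> carrier (bmod I lb S) \<longleftrightarrow> (\<forall>b. b \<notin> I --> f b = 0)" "\<zero>\<^bsub>bmod I lb S\<^esub> = (\<lambda>_. 0)"
 "f \<oplus>\<^bsub>bmod I lb S\<^esub> g = (\<lambda>b. f b + g b)"
 "f \<triangleleft>\<^bsub>bmod I lb S\<^esub> r = (\<lambda>b. if b \<in> I then
   ec r (lb b) * f b + (\<Sum>a\<in>E. xc r a * (\<Sum>b'\<in>{b'\<in>I. S a b' b}. f b')) else 0)"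
 by (simp_all add: bmod_def)

lemma bmod_module:
 assumes "bgood I lb S"
 shows "right_module R (bmod I lb S)"
proof -
 have lb: "b \<in> I \<Longrightarrow> lb b \<in> V" for b using assms by (auto simp: bgood_def)
 have "abelian_group (bmod I lb S)"
 proof (rule abelian_groupI)
  fix f assume "f \<in> carrier (bmod I lb S)"
  then show "\<exists>g\<in>carrier (bmod I lb S). g \<oplus>\<^bsub>bmod I lb S\<^esub> f = \<zero>\<^bsub>bmod I lb S\<^esub>"
   by (intro bexI[of _ "\<lambda>b. - f b"]) (simp_all add: bmod_simps)
 qed (simp_all add: bmod_simps algebra_simps)
 moreover have "right_module_axioms R (bmod I lb S)"
 proof
  fix f r assume f: "f \<in> carrier (bmod I lb S)" and r: "r \<in> carrier R"
  show "f \<triangleleft>\<^bsub>bmod I lb S\<^esub> r \<in> carrier (bmod I lb S)" by (simp add: bmod_simps)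
  show "(f \<oplus>\<^bsub>bmod I lb S\<^esub> g) \<triangleleft>\<^bsub>bmod I lb S\<^esub> r = f \<triangleleft>\<^bsub>bmod I lb S\<^esub> r \<oplus>\<^bsub>bmod I lb S\<^esub> g \<triangleleft>\<^bsub>bmod I lb S\<^esub> r" for g
   by (auto simp: bmod_simps fun_eq_iff algebra_simps sum.distrib)
  fix s assume s: "s \<in> carrier R"
  show "f \<triangleleft>\<^bsub>bmod I lb S\<^esub> (r \<oplus>\<^bsub>R\<^esub> s) = f \<triangleleft>\<^bsub>bmod I lb S\<^esub> r \<oplus>\<^bsub>bmod I lb S\<^esub> f \<triangleleft>\<^bsub>bmod I lb S\<^esub> s"
   using r s by (auto simp: bmod_simps fun_eq_iff ec_add xc_add lb algebra_simps sum.distrib)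
  show "f \<triangleleft>\<^bsub>bmod I lb S\<^esub> (r \<otimes>\<^bsub>R\<^esub> s) = f \<triangleleft>\<^bsub>bmod I lb S\<^esub> r \<triangleleft>\<^bsub>bmod I lb S\<^esub> s"
  proof
   fix b
   show "(f \<triangleleft>\<^bsub>bmod I lb S\<^esub> (r \<otimes>\<^bsub>R\<^esub> s)) b = (f \<triangleleft>\<^bsub>bmod I lb S\<^esub> r \<triangleleft>\<^bsub>bmod I lb S\<^esub> s) b"
   proof (cases "b \<in> I")
    case b: True
    let ?s = "\<lambda>a. \<Sum>b'\<in>{b'\<in>I. S a b' b}. f b'"
    \<comment> \<open>A vector moved by an arrow receives nothing itself, so \<open>r\<close> only
      rescales its coordinate.\<close>
    have 1: "(\<Sum>b'\<in>{b'\<in>I. S a b' b}. (f \<triangleleft>\<^bsub>bmod I lb S\<^esub> r) b') = ec r (src a) * ?s a" if a: "a \<in> E" for a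
     unfolding sum_distrib_left
    proof (rule sum.cong[OF refl])
     fix b' assume b': "b' \<in> {b'\<in>I. S a b' b}"
     then have "{b''\<in>I. S a' b'' b'} = {}" if "a' \<in> E" for a'
      using assms a b that unfolding bgood_def by blast
     then have "(\<Sum>a\<in>E. xc r a * (\<Sum>b''\<in>{b''\<in>I. S a b'' b'}. f b'')) = 0"
      by (intro sum.neutral) (metis mult_zero_right sum.empty)
     moreover have "lb b' = src a" using assms a b b' by (auto simp: bgood_def)
     ultimately show "(f \<triangleleft>\<^bsub>bmod I lb S\<^esub> r) b' = ec r (src a) * f b'" using b' by (simp add: bmod_simps)
    qed
    \<comment> \<open>If \<open>a\<close> sends some vector to \<open>b\<close>, then
      \<open>b\<close> sits at the target of \<open>a\<close>; otherwise the sum is empty and both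
      sides vanish.\<close>
    have 2: "ec s (tgt a) * ?s a = ec s (lb b) * ?s a" if a: "a \<in> E" for a
    proof (cases "{b'\<in>I. S a b' b} = {}")
     case True show ?thesis unfolding True by simp
    next
     case False
     then obtain b' where "b' \<in> I" "S a b' b" by blast
     then have "lb b = tgt a" using assms a b unfolding bgood_def by blast
     then show ?thesis by simp
    qed
    have "(f \<triangleleft>\<^bsub>bmod I lb S\<^esub> r \<triangleleft>\<^bsub>bmod I lb S\<^esub> s) b
     = ec s (lb b) * (f \<triangleleft>\<^bsub>bmod I lb S\<^esub> r) b + (\<Sum>a\<in>E. xc s a * (\<Sum>b'\<in>{b'\<in>I. S a b' b}. (f \<triangleleft>\<^bsub>bmod I lb S\<^esub> r) b'))"
     using b by (simp add: bmod_simps(4)[where f = "f \<triangleleft>\<^bsub>bmod I lb S\<^esub> r"])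
    also have "\<dots> = ec s (lb b) * (ec r (lb b) * f b + (\<Sum>a\<in>E. xc r a * ?s a))
      + (\<Sum>a\<in>E. xc s a * (ec r (src a) * ?s a))"
    proof -
     have 3: "(\<Sum>a\<in>E. xc s a * (\<Sum>b'\<in>{b'\<in>I. S a b' b}. (f \<triangleleft>\<^bsub>bmod I lb S\<^esub> r) b'))
       = (\<Sum>a\<in>E. xc s a * (ec r (src a) * ?s a))"
      by (rule sum.cong) (simp_all only: 1)
     show ?thesis unfolding 3 using b by (simp add: bmod_simps)
    qed
    also have "\<dots> = ec r (lb b) * ec s (lb b) * f b
      + (\<Sum>a\<in>E. xc r a * (ec s (lb b) * ?s a) + ec r (src a) * xc s a * ?s a)"
     by (simp add: sum.distrib sum_distrib_left algebra_simps)
    also have "(\<Sum>a\<in>E. xc r a * (ec s (lb b) * ?s a) + ec r (src a) * xc s a * ?s a)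
      = (\<Sum>a\<in>E. xc (r \<otimes>\<^bsub>R\<^esub> s) a * ?s a)"
    proof (rule sum.cong[OF refl])
     fix a assume a: "a \<in> E"
     show "xc r a * (ec s (lb b) * ?s a) + ec r (src a) * xc s a * ?s a = xc (r \<otimes>\<^bsub>R\<^esub> s) a * ?s a"
      by (simp only: 2[OF a, symmetric] xc_mult[OF r s a]) (simp only: algebra_simps)
    qed
    finally show ?thesis using b r s by (simp add: bmod_simps ec_mult lb)
   qed (simp add: bmod_simps)
  qed
 next
  fix f assume f: "f \<in> carrier (bmod I lb S)"
  show "f \<triangleleft>\<^bsub>bmod I lb S\<^esub> \<one>\<^bsub>R\<^esub> = f" using f by (auto simp: bmod_simps fun_eq_iff ec_one lb xc_one)
 qed
 ultimately show ?thesis by (intro right_module.intro R.ring_axioms)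
qed

lemma bmod_acts:
 assumes "bgood I lb S" "f \<in> carrier (bmod I lb S)"
 shows "kact (bmod I lb S) c f = (\<lambda>b. c * f b)"
  "f \<triangleleft>\<^bsub>bmod I lb S\<^esub> e i = (\<lambda>b. if lb b = i then f b else 0)"
  "a \<in> E \<Longrightarrow> f \<triangleleft>\<^bsub>bmod I lb S\<^esub> ar a = (\<lambda>b. if b \<in> I then \<Sum>b'\<in>{b'\<in>I. S a b' b}. f b' else 0)"
proof -
 have lb: "b \<in> I \<Longrightarrow> lb b \<in> V" for b using assms by (auto simp: bgood_def)
 show "kact (bmod I lb S) c f = (\<lambda>b. c * f b)"
  "f \<triangleleft>\<^bsub>bmod I lb S\<^esub> e i = (\<lambda>b. if lb b = i then f b else 0)"
  using assms by (auto simp: kact_def bmod_simps fun_eq_iff lb)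
 assume a: "a \<in> E"
 have "(\<Sum>a'\<in>E. xc (ar a) a' * (\<Sum>b'\<in>{b'\<in>I. S a' b' b}. f b'))
   = (\<Sum>a'\<in>E. if a' = a then \<Sum>b'\<in>{b'\<in>I. S a b' b}. f b' else 0)" for b
  by (rule sum.cong) auto
 then show "f \<triangleleft>\<^bsub>bmod I lb S\<^esub> ar a = (\<lambda>b. if b \<in> I then \<Sum>b'\<in>{b'\<in>I. S a b' b}. f b' else 0)"
  using assms a finE by (auto simp: bmod_simps fun_eq_iff lb)
qed

text \<open>Induction on \<open>J\<close>: resetting the coordinate at \<open>b\<close> is linear,
  its image consists of the functions on the smaller set and its kernel is a line.\<close>

lemma bmod_kdim:
 assumes g: "bgood I lb S" and J: "J \<subseteq> I"
 defines "W \<equiv> \<lambda>J. {f. \<forall>b. b \<notin> J --> f b = (0::'k)}"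
 shows "kdim (bmod I lb S) (kact (bmod I lb S)) (W J) = card J"
  "ksub (bmod I lb S) (kact (bmod I lb S)) (W J)" "kfin (bmod I lb S) (kact (bmod I lb S)) (W J)"
proof -
 let ?M = "bmod I lb S"
 interpret M: rsz_module R V E src tgt ec xc ?M by (rule rsz_moduleI[OF bmod_module[OF g]])
 have Wc: "f \<in> carrier ?M" if "f \<in> W J" "J \<subseteq> I" for f J using that by (auto simp: bmod_simps W_def)
 have sub: "ksub ?M (kact ?M) (W J)" if "J \<subseteq> I" for J
  using that Wc[OF _ that] by (auto simp: ksub_def bmod_acts[OF g] bmod_simps W_def)
 have "finite J" using J g finite_subset by (auto simp: bgood_def)
 then have "kfin ?M (kact ?M) (W J) \<and> kdim ?M (kact ?M) (W J) = card J" using J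
 proof (induct J)
  case empty
  have "W {} = {\<zero>\<^bsub>?M\<^esub>}" by (auto simp: W_def bmod_simps)
  then show ?case using M.K.kfin_zero M.K.kdim_zero by simp
 next
  case (insert b J)
  let ?d = "\<lambda>x. if x = b then 1 else (0::'k)"
  have d: "?d \<in> carrier ?M" "?d \<noteq> \<zero>\<^bsub>?M\<^esub>" using insert by (auto simp: bmod_simps fun_eq_iff)
  have sb: "ksub ?M (kact ?M) (W (insert b J))" by (rule sub[OF insert.prems])
  have ln: "range (\<lambda>c. kact ?M c ?d) = {f \<in> W (insert b J). f(b := 0) = \<zero>\<^bsub>?M\<^esub>}"
  proof (intro equalityI subsetI)
   fix f assume f: "f \<in> {f \<in> W (insert b J). f(b := 0) = \<zero>\<^bsub>?M\<^esub>}"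
   have z: "f(b := 0) = (\<lambda>_. 0)" using f by (simp add: bmod_simps)
   have "f x = f b * ?d x" for x
    using fun_cong[OF z, of x] by (cases "x = b") simp_all
   then have "f = kact ?M (f b) ?d" unfolding bmod_acts(1)[OF g d(1)] by (rule ext)
   then show "f \<in> range (\<lambda>c. kact ?M c ?d)" by (rule range_eqI)
  next
   fix f assume "f \<in> range (\<lambda>c. kact ?M c ?d)"
   then obtain c where "f = (\<lambda>x. c * ?d x)" by (auto simp: bmod_acts[OF g d(1)])
   then show "f \<in> {f \<in> W (insert b J). f(b := 0) = \<zero>\<^bsub>?M\<^esub>}"
    by (auto simp: W_def bmod_simps fun_eq_iff)
  qed
  have im: "(\<lambda>f. f(b := 0)) ` W (insert b J) = W J"
  proof (intro equalityI subsetI)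
   fix f assume f: "f \<in> W J"
   then have "f = f(b := 0)" using insert.hyps by (auto simp: W_def)
   moreover have "f \<in> W (insert b J)" using f by (auto simp: W_def)
   ultimately show "f \<in> (\<lambda>f. f(b := 0)) ` W (insert b J)" by (rule image_eqI)
  qed (auto simp: W_def)
  obtain X where X: "finite X" "X \<subseteq> W J" "\<And>Z. ksub ?M (kact ?M) Z \<Longrightarrow> X \<subseteq> Z \<Longrightarrow> W J \<subseteq> Z"
   by (rule kfinE[of ?M "kact ?M" "W J"]) (use insert in simp, rule that)
  have "W (insert b J) \<subseteq> Z" if Z: "ksub ?M (kact ?M) Z" "insert ?d X \<subseteq> Z" for Z
  proof
   fix f assume f: "f \<in> W (insert b J)"
   have "f(b := 0) \<in> Z" using X(3)[OF Z(1)] Z(2) im f by blast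
   moreover have "kact ?M (f b) ?d \<in> Z" using M.K.ksubD(4)[OF Z(1)] Z(2) by simp
   ultimately have "f(b := 0) \<oplus>\<^bsub>?M\<^esub> kact ?M (f b) ?d \<in> Z" by (rule M.K.ksubD(3)[OF Z(1)])
   moreover have "f(b := 0) \<oplus>\<^bsub>?M\<^esub> kact ?M (f b) ?d = f" by (auto simp: bmod_simps bmod_acts[OF g d(1)])
   ultimately show "f \<in> Z" by simp
  qed
  moreover have "insert ?d X \<subseteq> W (insert b J)" using X(2) by (auto simp: W_def)
  ultimately have fd: "kfin ?M (kact ?M) (W (insert b J))"
   unfolding kfin_def using X(1) by (intro exI[of _ "insert ?d X"]) simp
  have "kdim ?M (kact ?M) ((\<lambda>f. f(b := 0)) ` W (insert b J))
    + kdim ?M (kact ?M) {f \<in> W (insert b J). f(b := 0) = \<zero>\<^bsub>?M\<^esub>} = kdim ?M (kact ?M) (W (insert b J))"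
  proof (rule kdim_rank_nullity[OF M.kspace_kact M.kspace_kact sb fd])
   show "(\<lambda>f. f(b := 0)) \<in> W (insert b J) \<rightarrow> carrier ?M"
    using Wc[OF _ insert.prems] by (auto simp: bmod_simps)
  next
   fix c f assume "f \<in> W (insert b J)"
   then have f: "f \<in> carrier ?M" by (rule Wc[OF _ insert.prems])
   then have "f(b := 0) \<in> carrier ?M" by (auto simp: bmod_simps)
   then show "(kact ?M c f)(b := 0) = kact ?M c (f(b := 0))" using f by (auto simp: bmod_acts[OF g])
  qed (auto simp: bmod_simps)
  then show ?case using fd insert ln im M.K.kdim_line(1)[OF d] by simp
 qed
 then show "kdim ?M (kact ?M) (W J) = card J" "kfin ?M (kact ?M) (W J)" by auto
 show "ksub ?M (kact ?M) (W J)" by (rule sub[OF J])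
qed

lemma bmod_comp: "bgood I lb S \<Longrightarrow> comp (bmod I lb S) i = {f. \<forall>b. b \<notin> {b\<in>I. lb b = i} --> f b = 0}"
proof (intro equalityI subsetI)
 fix f assume g: "bgood I lb S" and f: "f \<in> comp (bmod I lb S) i"
 have c: "f \<in> carrier (bmod I lb S)" "f \<triangleleft>\<^bsub>bmod I lb S\<^esub> e i = f" using f by (auto simp: comp_def)
 have "f b = 0" if "b \<notin> {b\<in>I. lb b = i}" for b
  using that c(1) fun_cong[OF c(2)[unfolded bmod_acts(2)[OF g c(1)]], of b]
  by (auto simp: bmod_simps(1) split: if_splits)
 then show "f \<in> {f. \<forall>b. b \<notin> {b\<in>I. lb b = i} --> f b = 0}" by simp
next
 fix f :: "_ \<Rightarrow> 'k" assume g: "bgood I lb S" and f: "f \<in> {f. \<forall>b. b \<notin> {b\<in>I. lb b = i} --> f b = 0}"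
 then have c: "f \<in> carrier (bmod I lb S)" by (auto simp: bmod_simps)
 then show "f \<in> comp (bmod I lb S) i" using f by (auto simp: comp_def bmod_acts[OF g c] fun_eq_iff)
qed

lemma bmod_fin_gen: "bgood I lb S \<Longrightarrow> fin_gen R (bmod I lb S)"
proof -
 assume g: "bgood I lb S"
 interpret M: rsz_module R V E src tgt ec xc "bmod I lb S" by (rule rsz_moduleI[OF bmod_module[OF g]])
 have "carrier (bmod I lb S) = {f. \<forall>b. b \<notin> I --> f b = 0}" by (auto simp: bmod_simps)
 then show ?thesis using bmod_kdim(3)[OF g order_refl] by (intro M.fin_genI) simp
qed

lemma bmod_dd: "bgood I lb S \<Longrightarrow> dd (bmod I lb S) i = card {b\<in>I. lb b = i}"
 unfolding dd_def using bmod_kdim(1)[of I lb S "{b\<in>I. lb b = i}"] by (simp add: bmod_comp)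

end

section \<open>Projective covers and syzygies\<close>

context kspace begin

lemma ksub_sum:
 assumes U: "ksub M s U" and W: "ksub M s W"
 shows "ksub M s {u \<oplus> w | u w. u \<in> U \<and> w \<in> W}" (is "ksub M s ?Z")
 unfolding ksub_def
proof (intro conjI ballI allI)
 note UD = ksubD[OF U] and WD = ksubD[OF W]
 show "?Z \<subseteq> carrier M" using UD(1) WD(1) by auto
 show "\<zero> \<in> ?Z" using UD(2) WD(2) by (intro CollectI exI[of _ "\<zero>"]) simp
 fix x assume "x \<in> ?Z"
 then obtain u w where x: "x = u \<oplus> w" "u \<in> U" "w \<in> W" by auto
 have "s c x = s c u \<oplus> s c w" for c using x UD(1) WD(1) by (simp add: s_add)
 then show "s c x \<in> ?Z" for c using x UD(4) WD(4) by blast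
 fix y assume "y \<in> ?Z"
 then obtain u' w' where y: "y = u' \<oplus> w'" "u' \<in> U" "w' \<in> W" by auto
 have "x \<oplus> y = (u \<oplus> u') \<oplus> (w \<oplus> w')" using x y UD(1) WD(1) by (simp add: a_ac)
 then show "x \<oplus> y \<in> ?Z" using x y UD(3) WD(3) by blast
qed

text \<open>The component in \<open>W\<close> is well defined because the intersection is trivial;
  as a linear map it has image \<open>W\<close> and kernel \<open>U\<close>.\<close>

lemma kdim_internal_sum:
 assumes U: "ksub M s U" "kfin M s U" and W: "ksub M s W" "kfin M s W" and dis: "U \<inter> W = {\<zero>}"
 defines "Z \<equiv> {u \<oplus> w | u w. u \<in> U \<and> w \<in> W}"
 shows "kfin M s Z" "kdim M s Z = kdim M s U + kdim M s W"
proof -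
 note UD = ksubD[OF U(1)] and WD = ksubD[OF W(1)]
 have add: "(u \<oplus> w) \<oplus> (u' \<oplus> w') = (u \<oplus> u') \<oplus> (w \<oplus> w')" if "u \<in> U" "u' \<in> U" "w \<in> W" "w' \<in> W" for u u' w w'
  using that UD(1) WD(1) by (simp add: a_ac)
 have sc: "s c (u \<oplus> w) = s c u \<oplus> s c w" if "u \<in> U" "w \<in> W" for u w c
  using that UD(1) WD(1) by (simp add: s_add)
 have Z: "ksub M s Z" unfolding Z_def by (rule ksub_sum[OF U(1) W(1)])
 obtain X where X: "finite X" "X \<subseteq> U" "\<And>Z. ksub M s Z \<Longrightarrow> X \<subseteq> Z \<Longrightarrow> U \<subseteq> Z"
  by (rule kfinE[OF U(2)]) (rule that)
 obtain Y where Y: "finite Y" "Y \<subseteq> W" "\<And>Z. ksub M s Z \<Longrightarrow> Y \<subseteq> Z \<Longrightarrow> W \<subseteq> Z"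
  by (rule kfinE[OF W(2)]) (rule that)
 have sub: "U \<subseteq> Z" "W \<subseteq> Z"
 proof -
  show "U \<subseteq> Z"
  proof
   fix u assume u: "u \<in> U"
   then have "u = u \<oplus> \<zero>" using UD(1) by simp
   then show "u \<in> Z" using u WD(2) unfolding Z_def by blast
  qed
  show "W \<subseteq> Z"
  proof
   fix u assume u: "u \<in> W"
   then have "u = \<zero> \<oplus> u" using WD(1) by simp
   then show "u \<in> Z" using u UD(2) unfolding Z_def by blast
  qed
 qed
 have "Z \<subseteq> Z'" if Z': "ksub M s Z'" "X \<union> Y \<subseteq> Z'" for Z'
 proof -
  have "U \<subseteq> Z'" "W \<subseteq> Z'" using X(3)[OF Z'(1)] Y(3)[OF Z'(1)] Z'(2) by auto
  then show ?thesis using ksubD(3)[OF Z'(1)] by (auto simp: Z_def)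
 qed
 then show fd: "kfin M s Z"
  unfolding kfin_def using X(1,2) Y(1,2) sub by (intro exI[of _ "X \<union> Y"]) auto
 define T where "T v = (THE w. w \<in> W \<and> (\<exists>u\<in>U. v = u \<oplus> w))" for v
 have T: "T (u \<oplus> w) = w" if "u \<in> U" "w \<in> W" for u w
  unfolding T_def
 proof (rule the_equality)
  fix w' assume "w' \<in> W \<and> (\<exists>u'\<in>U. u \<oplus> w = u' \<oplus> w')"
  then obtain u' where w': "w' \<in> W" "u' \<in> U" "u \<oplus> w = u' \<oplus> w'" by blast
  note c = UD(1)[OF that(1)] UD(1)[OF w'(2)] WD(1)[OF that(2)] WD(1)[OF w'(1)]
  have "w' \<ominus> w = \<ominus> u' \<oplus> (u' \<oplus> w') \<oplus> \<ominus> w" using c by (simp add: a_minus_def r_neg1)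
  also have "\<dots> = u \<ominus> u'" using c a_lcomm[of w "\<ominus> u'" "\<ominus> w"] unfolding w'(3)[symmetric] by (simp add: a_minus_def a_ac r_neg r_neg1 r_neg2)
  finally have "w' \<ominus> w \<in> U \<inter> W" using UD(6)[OF that(1) w'(2)] WD(6)[OF w'(1) that(2)] by simp
  then show "w' = w" using dis c by auto
 qed (use that in blast)
 have im: "T ` Z = W"
 proof (intro equalityI subsetI)
  fix w assume w: "w \<in> W"
  then have "w = T (\<zero> \<oplus> w)" using T[OF UD(2)] by simp
  then show "w \<in> T ` Z" using w UD(2) unfolding Z_def by blast
 qed (auto simp: Z_def T)
 have ker: "{v\<in>Z. T v = \<zero>} = U"
 proof (intro equalityI subsetI)
  fix v assume "v \<in> U"
  then show "v \<in> {v\<in>Z. T v = \<zero>}" using sub T[of v \<zero>] WD(2) UD(1)[of v] by auto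
 next
  fix v assume "v \<in> {v\<in>Z. T v = \<zero>}"
  then show "v \<in> U" using UD(1) by (auto simp: Z_def T)
 qed
 have "kdim M s (T ` Z) + kdim M s {v\<in>Z. T v = \<zero>} = kdim M s Z"
 proof (rule kdim_rank_nullity[OF kspace_axioms kspace_axioms Z fd])
  show "T \<in> Z \<rightarrow> carrier M" using im WD(1) by auto
 next
  fix x y assume "x \<in> Z" "y \<in> Z"
  then show "T (x \<oplus> y) = T x \<oplus> T y" using UD(3) WD(3) by (auto simp: Z_def add T)
 next
  fix c x assume "x \<in> Z"
  then show "T (s c x) = s c (T x)" using UD(4) WD(4) by (auto simp: Z_def sc T)
 qed
 then show "kdim M s Z = kdim M s U + kdim M s W" by (simp add: im ker)
qed

end

context rsz begin

subsection \<open>Free modules on generators attached to vertices\<close>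

text \<open>The products of a generator with an arrow that can be nonzero. With this full set
  \<open>gmod\<close> is the direct sum of projectives \<open>e_i A\<close>, one for each generator
  at \<open>i\<close>; smaller sets give quotients.\<close>

definition fullD :: "'g set \<Rightarrow> ('g \<Rightarrow> 'v) \<Rightarrow> ('e \<times> 'g) set"
 where "fullD G v = {(a, g). a \<in> E \<and> g \<in> G \<and> src a = v g}"

text \<open>The module with generators \<open>G\<close>, the generator \<open>g\<close> at the vertex \<open>v g\<close>, in which the products
 of generators and arrows listed in \<open>D\<close> are independent and the other ones vanish.\<close>

definition gmod :: "'g set \<Rightarrow> ('g \<Rightarrow> 'v) \<Rightarrow> ('e \<times> 'g) set \<Rightarrow> ('a, 'g + 'e \<times> 'g \<Rightarrow> 'k) module"
 where "gmod G v D = bmod (Inl ` G \<union> Inr ` D) (case_sum v (\<lambda>(a, g). tgt a))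
  (\<lambda>a b b'. \<exists>g. b = Inl g \<and> b' = Inr (a, g))"

definition ggood :: "'g set \<Rightarrow> ('g \<Rightarrow> 'v) \<Rightarrow> ('e \<times> 'g) set \<Rightarrow> bool"
 where "ggood G v D \<longleftrightarrow> finite G \<and> v ` G \<subseteq> V \<and> D \<subseteq> fullD G v"

lemma bgood_gmod:
 assumes "ggood G v D"
 shows "bgood (Inl ` G \<union> Inr ` D) (case_sum v (\<lambda>(a, g). tgt a)) (\<lambda>a b b'. \<exists>g. b = Inl g \<and> b' = Inr (a, g))"
proof -
 have "D \<subseteq> E \<times> G" using assms by (auto simp: ggood_def fullD_def)
 then have "finite D" using assms finE by (auto simp: ggood_def intro: finite_subset)
 then show ?thesis using assms by (auto simp: bgood_def ggood_def fullD_def tgtV)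
qed

lemma ggood_D: "ggood G v D \<Longrightarrow> (a, g) \<in> D \<Longrightarrow> a \<in> E \<and> g \<in> G \<and> src a = v g"
 by (auto simp: ggood_def fullD_def)

lemma gmod_simps:
 "f \<in> carrier (gmod G v D) \<longleftrightarrow> (\<forall>g. g \<notin> G --> f (Inl g) = 0) \<and> (\<forall>d. d \<notin> D --> f (Inr d) = 0)"
 "\<zero>\<^bsub>gmod G v D\<^esub> = (\<lambda>_. 0)" "f \<oplus>\<^bsub>gmod G v D\<^esub> h = (\<lambda>b. f b + h b)"
proof -
 show "f \<in> carrier (gmod G v D) \<longleftrightarrow> (\<forall>g. g \<notin> G --> f (Inl g) = 0) \<and> (\<forall>d. d \<notin> D --> f (Inr d) = 0)"
  unfolding gmod_def bmod_simps split_sum_all by (auto simp: image_iff)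
qed (simp_all add: gmod_def bmod_simps)

lemma gmod_module: "ggood G v D \<Longrightarrow> right_module R (gmod G v D)"
 unfolding gmod_def by (intro bmod_module bgood_gmod)

lemma gmod_fin_gen: "ggood G v D \<Longrightarrow> fin_gen R (gmod G v D)"
 unfolding gmod_def by (intro bmod_fin_gen bgood_gmod)

lemma gmod_acts:
 assumes "ggood G v D" "f \<in> carrier (gmod G v D)"
 shows "kact (gmod G v D) c f = (\<lambda>b. c * f b)"
  "f \<triangleleft>\<^bsub>gmod G v D\<^esub> e i = (\<lambda>b. if case_sum v (\<lambda>(a, g). tgt a) b = i then f b else 0)"
  "a \<in> E \<Longrightarrow> f \<triangleleft>\<^bsub>gmod G v D\<^esub> ar a =
   (\<lambda>b. case b of Inl g \<Rightarrow> 0 | Inr (a', g) \<Rightarrow> if a' = a \<and> (a', g) \<in> D then f (Inl g) else 0)"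
proof -
 note A = bmod_acts[OF bgood_gmod[OF assms(1)] assms(2)[unfolded gmod_def]]
 show "kact (gmod G v D) c f = (\<lambda>b. c * f b)"
  "f \<triangleleft>\<^bsub>gmod G v D\<^esub> e i = (\<lambda>b. if case_sum v (\<lambda>(a, g). tgt a) b = i then f b else 0)"
  unfolding gmod_def by (rule A(1), rule A(2))
 assume a: "a \<in> E"
 show "f \<triangleleft>\<^bsub>gmod G v D\<^esub> ar a =
   (\<lambda>b. case b of Inl g \<Rightarrow> 0 | Inr (a', g) \<Rightarrow> if a' = a \<and> (a', g) \<in> D then f (Inl g) else 0)"
 proof
  fix b :: "'b + 'e \<times> 'b"
  show "(f \<triangleleft>\<^bsub>gmod G v D\<^esub> ar a) b =
   (case b of Inl g \<Rightarrow> 0 | Inr (a', g) \<Rightarrow> if a' = a \<and> (a', g) \<in> D then f (Inl g) else 0)"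
  proof (cases b)
   case (Inl g)
   then show ?thesis unfolding gmod_def A(3)[OF a] by simp
  next
   case (Inr d)
   obtain a' g where d: "d = (a', g)" by (cases d)
   have "{b' \<in> Inl ` G \<union> Inr ` D. \<exists>h. b' = Inl h \<and> b = Inr (a, h)} = (if a' = a \<and> g \<in> G then {Inl g} else {})"
    using Inr d by auto
   then show ?thesis
    unfolding gmod_def A(3)[OF a] using Inr d ggood_D[OF assms(1)] by auto
  qed
 qed
qed

lemma gmod_dd: "ggood G v D \<Longrightarrow> dd (gmod G v D) i = card {g\<in>G. v g = i} + card {d\<in>D. tgt (fst d) = i}"
proof -
 assume g: "ggood G v D"
 have "finite (Inl ` G \<union> Inr ` D :: ('b + 'e \<times> 'b) set)" using bgood_gmod[OF g] by (simp add: bgood_def)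
 then have fin: "finite G" "finite D" by (auto dest: finite_imageD)
 have "{b \<in> Inl ` G \<union> Inr ` D. case_sum v (\<lambda>(a, g). tgt a) b = i}
   = Inl ` {g\<in>G. v g = i} \<union> Inr ` {d\<in>D. tgt (fst d) = i}" by auto
 then have "dd (gmod G v D) i = card (Inl ` {g\<in>G. v g = i} \<union> Inr ` {d\<in>D. tgt (fst d) = i} :: ('b + 'e \<times> 'b) set)"
  unfolding gmod_def by (simp add: bmod_dd[OF bgood_gmod[OF g]])
 also have "\<dots> = card (Inl ` {g\<in>G. v g = i} :: ('b + 'e \<times> 'b) set) + card (Inr ` {d\<in>D. tgt (fst d) = i} :: ('b + 'e \<times> 'b) set)"
  using fin by (intro card_Un_disjoint) auto
 finally show ?thesis by (simp add: card_image)
qed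

lemma gmod_finsum:
 assumes "ggood G v D" "f \<in> A \<rightarrow> carrier (gmod G v D)"
 shows "finsum (gmod G v D) f A = (\<lambda>b. \<Sum>a\<in>A. f a b)"
proof -
 interpret M: rsz_module R V E src tgt ec xc "gmod G v D" by (rule rsz_moduleI[OF gmod_module[OF assms(1)]])
 show ?thesis using assms(2)
 proof (induct A rule: infinite_finite_induct)
  case (insert a A)
  have "finsum (gmod G v D) f (insert a A) = f a \<oplus>\<^bsub>gmod G v D\<^esub> finsum (gmod G v D) f A"
   using insert by (intro M.finsum_insert) auto
  also have "\<dots> = (\<lambda>b. f a b + (\<Sum>a\<in>A. f a b))"
   using insert by (simp add: gmod_simps(3) Pi_def)
  finally show ?case using insert.hyps by simp
 qed (auto simp: gmod_simps(2))
qed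

lemma gmod_rad:
 assumes g: "ggood G v D"
 shows "rad (gmod G v D) = {f\<in>carrier (gmod G v D). \<forall>g. f (Inl g) = 0}"
proof (intro equalityI subsetI)
 interpret M: rsz_module R V E src tgt ec xc "gmod G v D" by (rule rsz_moduleI[OF gmod_module[OF g]])
 {
  fix f assume f: "f \<in> rad (gmod G v D)"
  then obtain z where z: "z \<in> E \<rightarrow> carrier (gmod G v D)"
   and fz: "f = finsum (gmod G v D) (\<lambda>a. z a \<triangleleft>\<^bsub>gmod G v D\<^esub> ar a) E" by (auto simp: rad_def)
  have "(\<lambda>a. z a \<triangleleft>\<^bsub>gmod G v D\<^esub> ar a) \<in> E \<rightarrow> carrier (gmod G v D)" using z by auto
  then have "f = (\<lambda>b. \<Sum>a\<in>E. (z a \<triangleleft>\<^bsub>gmod G v D\<^esub> ar a) b)" unfolding fz by (rule gmod_finsum[OF g])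
  then have "f (Inl h) = 0" for h using z by (auto simp: gmod_acts[OF g] Pi_def)
  then show "f \<in> {f\<in>carrier (gmod G v D). \<forall>g. f (Inl g) = 0}" using M.rad_carrier[OF f] by simp
 }
 fix f assume f: "f \<in> {f\<in>carrier (gmod G v D). \<forall>g. f (Inl g) = 0}"
 then have fc: "f \<in> carrier (gmod G v D)" by simp
 \<comment> \<open>The coefficient at the product of \<open>g\<close> and \<open>a\<close> is moved
   back to the generator \<open>g\<close> and attached to the arrow \<open>a\<close>.\<close>
 define z :: "'e \<Rightarrow> 'b + 'e \<times> 'b \<Rightarrow> 'k" where "z a = (\<lambda>b. case b of Inl g \<Rightarrow> f (Inr (a, g)) | Inr _ \<Rightarrow> 0)" for a
 have "f (Inr (a, h)) = 0" if "h \<notin> G" for a h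
  using that fc ggood_D[OF g, of a h] by (auto simp: gmod_simps(1))
 then have z: "z \<in> E \<rightarrow> carrier (gmod G v D)"
  using fc by (auto simp: z_def gmod_simps(1))
 have "finsum (gmod G v D) (\<lambda>a. z a \<triangleleft>\<^bsub>gmod G v D\<^esub> ar a) E = (\<lambda>b. \<Sum>a\<in>E. (z a \<triangleleft>\<^bsub>gmod G v D\<^esub> ar a) b)"
  using z by (intro gmod_finsum[OF g]) auto
 also have "\<dots> = f"
 proof
  fix b
  show "(\<Sum>a\<in>E. (z a \<triangleleft>\<^bsub>gmod G v D\<^esub> ar a) b) = f b"
  proof (cases b)
   case (Inl h)
   then show ?thesis using f z by (auto simp: gmod_acts[OF g] Pi_def)
  next
   case (Inr d)
   obtain a' h where d: "d = (a', h)" by (cases d)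
   have "(\<Sum>a\<in>E. (z a \<triangleleft>\<^bsub>gmod G v D\<^esub> ar a) b) = (\<Sum>a\<in>E. if a = a' then (if (a', h) \<in> D then f (Inr (a', h)) else 0) else 0)"
    using z Inr d by (intro sum.cong) (auto simp: gmod_acts[OF g] Pi_def z_def)
   also have "\<dots> = f b" using Inr d fc ggood_D[OF g, of a' h] finE by (auto simp: gmod_simps(1))
   finally show ?thesis .
  qed
 qed
 finally show "f \<in> rad (gmod G v D)" using M.radI[OF z] by simp
qed

lemma gmod_rr: "ggood G v D \<Longrightarrow> rr (gmod G v D) i = card {d\<in>D. tgt (fst d) = i}"
proof -
 assume g: "ggood G v D"
 let ?J = "Inr ` {d\<in>D. tgt (fst d) = i} :: ('b + 'e \<times> 'b) set"
 have "rad (gmod G v D) \<inter> comp (gmod G v D) i = {f. \<forall>b. b \<notin> ?J --> f b = 0}"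
 proof (intro equalityI subsetI)
  fix f assume f: "f \<in> rad (gmod G v D) \<inter> comp (gmod G v D) i"
  then have c: "f \<in> carrier (gmod G v D)" "f \<triangleleft>\<^bsub>gmod G v D\<^esub> e i = f" by (auto simp: comp_def)
  show "f \<in> {f. \<forall>b. b \<notin> ?J --> f b = 0}"
  proof (intro CollectI allI impI)
   fix b assume b: "b \<notin> ?J"
   show "f b = 0"
   proof (cases b)
    case (Inl h) then show ?thesis using f by (simp add: gmod_rad[OF g])
   next
    case (Inr d)
    then show ?thesis using b c(1) fun_cong[OF c(2)[unfolded gmod_acts(2)[OF g c(1)]], of b]
     by (cases "d \<in> D") (auto simp: gmod_simps(1) split: if_splits prod.splits)
   qed
  qed
 next
  fix f :: "'b + 'e \<times> 'b \<Rightarrow> 'k" assume f: "f \<in> {f. \<forall>b. b \<notin> ?J --> f b = 0}"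
  then have c: "f \<in> carrier (gmod G v D)" by (auto simp: gmod_simps(1))
  have "f b = 0" if "case_sum v (\<lambda>(a, g). tgt a) b \<noteq> i" for b
  proof -
   have "b \<notin> ?J" using that by auto
   then show ?thesis using f by blast
  qed
  then have "f \<triangleleft>\<^bsub>gmod G v D\<^esub> e i = f" by (auto simp: gmod_acts(2)[OF g c] fun_eq_iff)
  then show "f \<in> rad (gmod G v D) \<inter> comp (gmod G v D) i" using c f by (auto simp: gmod_rad[OF g] comp_def)
 qed
 then have "rr (gmod G v D) i = card ?J"
  unfolding rr_def using bmod_kdim(1)[OF bgood_gmod[OF g], of ?J] by (auto simp: gmod_def)
 then show ?thesis by (simp add: card_image)
qed

text \<open>The universal property of sums of the \<open>e_i A\<close>: the homomorphism sending
  each generator \<open>g\<close> to \<open>n g\<close>, provided that \<open>n g\<close> lies in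
  the component of its vertex.\<close>

definition gext :: "'g set \<Rightarrow> ('a, 'c) module \<Rightarrow> ('g \<Rightarrow> 'c) \<Rightarrow> ('g + 'e \<times> 'g \<Rightarrow> 'k) \<Rightarrow> 'c"
 where "gext G N n f = finsum N (\<lambda>g. kact N (f (Inl g)) (n g) \<oplus>\<^bsub>N\<^esub>
  finsum N (\<lambda>a. kact N (f (Inr (a, g))) (n g \<triangleleft>\<^bsub>N\<^esub> ar a)) E) G"

lemma gext_mhom:
 assumes G: "ggood G v (fullD G v)" and N: "right_module R N" and n: "\<And>g. g \<in> G \<Longrightarrow> n g \<in> comp N (v g)"
 shows "gext G N n \<in> mhom R (gmod G v (fullD G v)) N"
proof -
 let ?F = "gmod G v (fullD G v)"
 interpret F: rsz_module R V E src tgt ec xc ?F by (rule rsz_moduleI[OF gmod_module[OF G]])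
 interpret N: rsz_module R V E src tgt ec xc N by (rule rsz_moduleI[OF N])
 let ?t = "\<lambda>f g. kact N (f (Inl g)) (n g) \<oplus>\<^bsub>N\<^esub> finsum N (\<lambda>a. kact N (f (Inr (a, g))) (n g \<triangleleft>\<^bsub>N\<^esub> ar a)) E"
 have nc: "n g \<in> carrier N" if "g \<in> G" for g using n[OF that] by (simp add: comp_def)
 have s: "(\<lambda>a. kact N (f (Inr (a, g))) (n g \<triangleleft>\<^bsub>N\<^esub> ar a)) \<in> E \<rightarrow> carrier N" if "g \<in> G" for f :: "'b + 'e \<times> 'b \<Rightarrow> 'k" and g
  using nc[OF that] by auto
 have sc: "finsum N (\<lambda>a. kact N (f (Inr (a, g))) (n g \<triangleleft>\<^bsub>N\<^esub> ar a)) E \<in> carrier N" if "g \<in> G" for f :: "'b + 'e \<times> 'b \<Rightarrow> 'k" and g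
  by (rule N.finsum_closed[OF s[OF that]])
 have t: "?t f g \<in> carrier N" if "g \<in> G" for f g using nc[OF that] sc[OF that] by simp
 show ?thesis
 proof (rule mhomI[OF gmod_module[OF G] N])
  fix f assume f: "f \<in> carrier ?F"
  show "gext G N n f \<in> carrier N" unfolding gext_def using t by (intro N.finsum_closed) auto
  {
   fix h assume h: "h \<in> carrier ?F"
   have "?t (f \<oplus>\<^bsub>?F\<^esub> h) g = ?t f g \<oplus>\<^bsub>N\<^esub> ?t h g" if g: "g \<in> G" for g
   proof -
    have "finsum N (\<lambda>a. kact N ((f \<oplus>\<^bsub>?F\<^esub> h) (Inr (a, g))) (n g \<triangleleft>\<^bsub>N\<^esub> ar a)) E
      = finsum N (\<lambda>a. kact N (f (Inr (a, g))) (n g \<triangleleft>\<^bsub>N\<^esub> ar a) \<oplus>\<^bsub>N\<^esub> kact N (h (Inr (a, g))) (n g \<triangleleft>\<^bsub>N\<^esub> ar a)) E"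
     using nc[OF g] by (intro N.finsum_cong') (auto simp: gmod_simps N.K.s_add_left)
    also have "\<dots> = finsum N (\<lambda>a. kact N (f (Inr (a, g))) (n g \<triangleleft>\<^bsub>N\<^esub> ar a)) E
      \<oplus>\<^bsub>N\<^esub> finsum N (\<lambda>a. kact N (h (Inr (a, g))) (n g \<triangleleft>\<^bsub>N\<^esub> ar a)) E"
     by (rule N.finsum_addf[OF s[OF g] s[OF g]])
    finally show ?thesis using nc[OF g] sc[OF g, of f] sc[OF g, of h]
     by (simp add: gmod_simps N.K.s_add_left N.a_ac)
   qed
   then have "gext G N n (f \<oplus>\<^bsub>?F\<^esub> h) = finsum N (\<lambda>g. ?t f g \<oplus>\<^bsub>N\<^esub> ?t h g) G"
    unfolding gext_def using t by (intro N.finsum_cong') auto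
   also have "\<dots> = gext G N n f \<oplus>\<^bsub>N\<^esub> gext G N n h"
    unfolding gext_def using t by (intro N.finsum_addf) auto
   finally show "gext G N n (f \<oplus>\<^bsub>?F\<^esub> h) = gext G N n f \<oplus>\<^bsub>N\<^esub> gext G N n h" .
  }
  show "gext G N n (kact ?F c f) = kact N c (gext G N n f)" for c
  proof -
   have "kact N c (gext G N n f) = finsum N (\<lambda>g. kact N c (?t f g)) G"
    unfolding gext_def using t by (intro N.K.s_finsum) auto
   also have "\<dots> = gext G N n (kact ?F c f)"
    unfolding gext_def
   proof (rule N.finsum_cong')
    fix g assume g: "g \<in> G"
    have "kact N c (finsum N (\<lambda>a. kact N (f (Inr (a, g))) (n g \<triangleleft>\<^bsub>N\<^esub> ar a)) E)
      = finsum N (\<lambda>a. kact N (kact ?F c f (Inr (a, g))) (n g \<triangleleft>\<^bsub>N\<^esub> ar a)) E"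
     unfolding N.K.s_finsum[OF s[OF g]] using nc[OF g]
     by (intro N.finsum_cong') (auto simp: gmod_acts[OF G f] N.K.s_mult)
    then show "kact N c (?t f g) = ?t (kact ?F c f) g"
     using nc[OF g] sc[OF g, of f] by (simp add: N.K.s_add N.K.s_mult gmod_acts[OF G f])
   qed (use t in auto)
   finally show ?thesis by simp
  qed
  show "gext G N n (f \<triangleleft>\<^bsub>?F\<^esub> e i) = gext G N n f \<triangleleft>\<^bsub>N\<^esub> e i" if i: "i \<in> V" for i
  proof -
   have "gext G N n f \<triangleleft>\<^bsub>N\<^esub> e i = finsum N (\<lambda>g. ?t f g \<triangleleft>\<^bsub>N\<^esub> e i) G"
    unfolding gext_def using t by (intro N.ract_finsum_left) auto
   also have "\<dots> = gext G N n (f \<triangleleft>\<^bsub>?F\<^esub> e i)"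
    unfolding gext_def
   proof (rule N.finsum_cong')
    fix g assume g: "g \<in> G"
    have "n g \<triangleleft>\<^bsub>N\<^esub> e i = (if v g = i then n g else \<zero>\<^bsub>N\<^esub>)"
     using N.comp_e_other[OF n[OF g] i] n[OF g] by (auto simp: comp_def)
    then have 1: "kact N (f (Inl g)) (n g) \<triangleleft>\<^bsub>N\<^esub> e i = kact N ((f \<triangleleft>\<^bsub>?F\<^esub> e i) (Inl g)) (n g)"
     using nc[OF g] by (simp add: N.kact_ract gmod_acts[OF G f])
    have 2: "finsum N (\<lambda>a. kact N (f (Inr (a, g))) (n g \<triangleleft>\<^bsub>N\<^esub> ar a)) E \<triangleleft>\<^bsub>N\<^esub> e i
      = finsum N (\<lambda>a. kact N ((f \<triangleleft>\<^bsub>?F\<^esub> e i) (Inr (a, g))) (n g \<triangleleft>\<^bsub>N\<^esub> ar a)) E"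
     unfolding N.ract_finsum_left[OF s[OF g] e_closed] using nc[OF g]
     by (intro N.finsum_cong') (auto simp: gmod_acts[OF G f] N.kact_ract N.x_e_act)
    show "?t f g \<triangleleft>\<^bsub>N\<^esub> e i = ?t (f \<triangleleft>\<^bsub>?F\<^esub> e i) g"
     using 1 2 nc[OF g] sc[OF g, of f] by (simp add: N.ract_add_left)
   qed (use t in auto)
   finally show ?thesis by simp
  qed
  show "gext G N n (f \<triangleleft>\<^bsub>?F\<^esub> ar b) = gext G N n f \<triangleleft>\<^bsub>N\<^esub> ar b" if b: "b \<in> E" for b
  proof -
   have "gext G N n f \<triangleleft>\<^bsub>N\<^esub> ar b = finsum N (\<lambda>g. ?t f g \<triangleleft>\<^bsub>N\<^esub> ar b) G"
    unfolding gext_def using t by (intro N.ract_finsum_left) auto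
   also have "\<dots> = gext G N n (f \<triangleleft>\<^bsub>?F\<^esub> ar b)"
    unfolding gext_def
   proof (rule N.finsum_cong')
    fix g assume g: "g \<in> G"
    have z: "n g \<triangleleft>\<^bsub>N\<^esub> ar b = \<zero>\<^bsub>N\<^esub>" if "(b, g) \<notin> fullD G v"
     using N.comp_x[OF n[OF g] b] that b g by (auto simp: fullD_def)
    have "finsum N (\<lambda>a. kact N (f (Inr (a, g))) (n g \<triangleleft>\<^bsub>N\<^esub> ar a)) E \<triangleleft>\<^bsub>N\<^esub> ar b = \<zero>\<^bsub>N\<^esub>"
     unfolding N.ract_finsum_left[OF s[OF g] ar_closed] using nc[OF g] b
     by (intro N.finsum_zero') (auto simp: N.kact_ract N.x_x_act)
    then have 1: "?t f g \<triangleleft>\<^bsub>N\<^esub> ar b = kact N (f (Inl g)) (n g \<triangleleft>\<^bsub>N\<^esub> ar b)"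
     using nc[OF g] sc[OF g, of f] by (simp add: N.ract_add_left N.kact_ract)
    have "finsum N (\<lambda>a. kact N ((f \<triangleleft>\<^bsub>?F\<^esub> ar b) (Inr (a, g))) (n g \<triangleleft>\<^bsub>N\<^esub> ar a)) E
      = finsum N (\<lambda>a. if a = b then kact N (f (Inl g)) (n g \<triangleleft>\<^bsub>N\<^esub> ar a) else \<zero>\<^bsub>N\<^esub>) E"
     using nc[OF g] b z by (intro N.finsum_cong') (auto simp: gmod_acts[OF G f])
    also have "\<dots> = kact N (f (Inl g)) (n g \<triangleleft>\<^bsub>N\<^esub> ar b)"
     using nc[OF g] b finE by (intro N.finsum_single) auto
    finally have "?t (f \<triangleleft>\<^bsub>?F\<^esub> ar b) g = kact N (f (Inl g)) (n g \<triangleleft>\<^bsub>N\<^esub> ar b)"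
     using nc[OF g] b by (simp add: gmod_acts[OF G f])
    then show "?t f g \<triangleleft>\<^bsub>N\<^esub> ar b = ?t (f \<triangleleft>\<^bsub>?F\<^esub> ar b) g" using 1 by simp
   qed (use t in auto)
   finally show ?thesis by simp
  qed
 qed
qed

definition gen :: "'g \<Rightarrow> ('g + 'e \<times> 'g \<Rightarrow> 'k)"
 where "gen g = (\<lambda>b. if b = Inl g then 1 else 0)"

lemma gen_simps [simp]: "gen g (Inl h) = (if h = g then 1 else 0)" "gen g (Inr d) = 0"
 by (auto simp: gen_def)

lemma gen_comp:
 assumes "ggood G v D" "g \<in> G"
 shows "gen g \<in> comp (gmod G v D) (v g)" "gen g \<in> carrier (gmod G v D)"
proof -
 show c: "gen g \<in> carrier (gmod G v D)" using assms by (auto simp: gmod_simps(1) gen_def)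
 have "gen g \<triangleleft>\<^bsub>gmod G v D\<^esub> e (v g) = gen g"
  unfolding gmod_acts(2)[OF assms(1) c] by (auto simp: gen_def fun_eq_iff)
 then show "gen g \<in> comp (gmod G v D) (v g)" using c by (simp add: comp_def)
qed

text \<open>Together with \<open>mhom_gext\<close> this shows that a homomorphism out of the module
  is determined by its values on the generators.\<close>

lemma gext_gen:
 assumes G: "ggood G v (fullD G v)" and f: "f \<in> carrier (gmod G v (fullD G v))"
 shows "gext G (gmod G v (fullD G v)) gen f = f"
proof -
 let ?F = "gmod G v (fullD G v)"
 interpret F: rsz_module R V E src tgt ec xc ?F by (rule rsz_moduleI[OF gmod_module[OF G]])
 have gc: "gen g \<in> carrier ?F" if "g \<in> G" for g using gen_comp(2)[OF G that] .
 have fin: "finite G" using G by (simp add: ggood_def)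
 have t: "kact ?F (f (Inl g)) (gen g) \<oplus>\<^bsub>?F\<^esub> finsum ?F (\<lambda>a. kact ?F (f (Inr (a, g))) (gen g \<triangleleft>\<^bsub>?F\<^esub> ar a)) E
   = (\<lambda>b. case b of Inl h \<Rightarrow> if h = g then f b else 0 | Inr (a, h) \<Rightarrow> if h = g then f b else 0)" if g: "g \<in> G" for g
 proof -
  have c: "(\<lambda>a. kact ?F (f (Inr (a, g))) (gen g \<triangleleft>\<^bsub>?F\<^esub> ar a)) \<in> E \<rightarrow> carrier ?F" using gc[OF g] by auto
  have ka: "kact ?F k (gen g \<triangleleft>\<^bsub>?F\<^esub> ar a) b = k * (case b of Inl h \<Rightarrow> 0
    | Inr (a', h) \<Rightarrow> if a' = a \<and> (a', h) \<in> fullD G v then gen g (Inl h) else 0)" if "a \<in> E" for a b k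
   unfolding gmod_acts(1)[OF G F.ract_closed[OF gc[OF g] ar_closed]]
   unfolding gmod_acts(3)[OF G gc[OF g] that] by (rule refl)
  have "(\<Sum>a\<in>E. kact ?F (f (Inr (a, g))) (gen g \<triangleleft>\<^bsub>?F\<^esub> ar a) b) = (case b of Inl h \<Rightarrow> 0 | Inr (a, h) \<Rightarrow> if h = g then f b else 0)" for b
  proof (cases b)
   case (Inl h)
   then show ?thesis by (simp add: ka)
  next
   case (Inr d)
   obtain a' h where d: "d = (a', h)" by (cases d)
   have "(\<Sum>a\<in>E. kact ?F (f (Inr (a, g))) (gen g \<triangleleft>\<^bsub>?F\<^esub> ar a) b)
     = (\<Sum>a\<in>E. if a = a' then (if h = g \<and> (a', g) \<in> fullD G v then f (Inr (a', g)) else 0) else 0)"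
    using Inr d by (intro sum.cong) (auto simp: ka)
   also have "\<dots> = (if h = g then f b else 0)"
    using Inr d f finE ggood_D[OF G, of a' g] by (auto simp: gmod_simps(1))
   finally show ?thesis using Inr d by simp
  qed
  then show ?thesis
   unfolding gmod_finsum[OF G c] gmod_simps(3)
   unfolding gmod_acts(1)[OF G gc[OF g]] by (auto simp: fun_eq_iff split: sum.splits)
 qed
 have tc: "(\<lambda>g. kact ?F (f (Inl g)) (gen g) \<oplus>\<^bsub>?F\<^esub> finsum ?F (\<lambda>a. kact ?F (f (Inr (a, g))) (gen g \<triangleleft>\<^bsub>?F\<^esub> ar a)) E) \<in> G \<rightarrow> carrier ?F"
  using gc by (auto intro!: F.finsum_closed)
 have "gext G ?F gen f = (\<lambda>b. \<Sum>g\<in>G. case b of Inl h \<Rightarrow> if h = g then f b else 0 | Inr (a, h) \<Rightarrow> if h = g then f b else 0)"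
  unfolding gext_def gmod_finsum[OF G tc] by (intro ext sum.cong) (auto simp: t)
 also have "\<dots> = f"
 proof
  fix b
  show "(\<Sum>g\<in>G. case b of Inl h \<Rightarrow> if h = g then f b else 0 | Inr (a, h) \<Rightarrow> if h = g then f b else 0) = f b"
   using f fin by (cases b) (auto simp: gmod_simps(1) fullD_def)
 qed
 finally show ?thesis .
qed

lemma mhom_gext:
 assumes N: "right_module R N" "right_module R N'" and h: "h \<in> mhom R N N'" and n: "\<And>g. g \<in> G \<Longrightarrow> n g \<in> carrier N"
 shows "h (gext G N n f) = gext G N' (\<lambda>g. h (n g)) f"
proof -
 interpret N: rsz_module R V E src tgt ec xc N by (rule rsz_moduleI[OF N(1)])
 interpret N': rsz_module R V E src tgt ec xc N' by (rule rsz_moduleI[OF N(2)])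
 note H = mhomD[OF h]
 have s: "(\<lambda>a. kact N (f (Inr (a, g))) (n g \<triangleleft>\<^bsub>N\<^esub> ar a)) \<in> E \<rightarrow> carrier N" if "g \<in> G" for g
  using n[OF that] by auto
 note sc = N.finsum_closed[OF s]
 have "h (gext G N n f) = finsum N' (\<lambda>g. h (kact N (f (Inl g)) (n g) \<oplus>\<^bsub>N\<^esub>
   finsum N (\<lambda>a. kact N (f (Inr (a, g))) (n g \<triangleleft>\<^bsub>N\<^esub> ar a)) E)) G"
  unfolding gext_def using sc n by (intro mhom_finsum[OF N h]) auto
 also have "\<dots> = gext G N' (\<lambda>g. h (n g)) f"
  unfolding gext_def
 proof (rule N'.finsum_cong')
  fix g assume g: "g \<in> G"
  have "h (finsum N (\<lambda>a. kact N (f (Inr (a, g))) (n g \<triangleleft>\<^bsub>N\<^esub> ar a)) E)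
    = finsum N' (\<lambda>a. h (kact N (f (Inr (a, g))) (n g \<triangleleft>\<^bsub>N\<^esub> ar a))) E"
   by (rule mhom_finsum[OF N h s[OF g]])
  also have "\<dots> = finsum N' (\<lambda>a. kact N' (f (Inr (a, g))) (h (n g) \<triangleleft>\<^bsub>N'\<^esub> ar a)) E"
   using n[OF g] by (intro N'.finsum_cong') (auto simp: H)
  finally show "h (kact N (f (Inl g)) (n g) \<oplus>\<^bsub>N\<^esub> finsum N (\<lambda>a. kact N (f (Inr (a, g))) (n g \<triangleleft>\<^bsub>N\<^esub> ar a)) E)
    = kact N' (f (Inl g)) (h (n g)) \<oplus>\<^bsub>N'\<^esub> finsum N' (\<lambda>a. kact N' (f (Inr (a, g))) (h (n g) \<triangleleft>\<^bsub>N'\<^esub> ar a)) E"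
   using n[OF g] sc[OF g] by (simp add: H)
 qed (use n H in \<open>auto intro!: N'.finsum_closed\<close>)
 finally show ?thesis .
qed

text \<open>Preimages of the images of the generators are cut down to the right vertex component by
  an idempotent and then extended by \<open>gext\<close>.\<close>

lemma gmod_lift:
 assumes G: "ggood G v (fullD G v)" and M: "right_module R M" and N: "right_module R N"
  and g: "g \<in> mhom R M N" "g ` carrier M = carrier N" and f: "f \<in> mhom R (gmod G v (fullD G v)) N"
 shows "\<exists>h\<in>mhom R (gmod G v (fullD G v)) M. \<forall>y\<in>carrier (gmod G v (fullD G v)). g (h y) = f y"
proof -
 let ?F = "gmod G v (fullD G v)"
 interpret M: rsz_module R V E src tgt ec xc M by (rule rsz_moduleI[OF M])
 have "\<exists>y. y \<in> comp M (v b) \<and> g y = f (gen b)" if b: "b \<in> G" for b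
 proof -
  have fb: "f (gen b) \<in> comp N (v b)" by (rule mhom_comp[OF f gen_comp(1)[OF G b]])
  then obtain y where y: "y \<in> carrier M" "g y = f (gen b)" using g(2) by (auto simp: comp_def) (metis imageE)
  have "v b \<in> V" using G b by (auto simp: ggood_def)
  then show ?thesis using y fb mhomD(3)[OF g(1) y(1), of "e (v b)"]
   by (intro exI[of _ "y \<triangleleft>\<^bsub>M\<^esub> e (v b)"]) (auto simp: comp_def M.e_act)
 qed
 then obtain n where n: "\<And>b. b \<in> G \<Longrightarrow> n b \<in> comp M (v b)" "\<And>b. b \<in> G \<Longrightarrow> g (n b) = f (gen b)" by metis
 have nc: "n b \<in> carrier M" if "b \<in> G" for b using n(1)[OF that] by (simp add: comp_def)
 interpret N: rsz_module R V E src tgt ec xc N by (rule rsz_moduleI[OF N])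
 have "g (gext G M n y) = f y" if y: "y \<in> carrier ?F" for y
 proof -
  have "g (gext G M n y) = gext G N (\<lambda>b. g (n b)) y" by (rule mhom_gext[OF M N g(1) nc])
  also have "\<dots> = gext G N (\<lambda>b. f (gen b)) y"
   unfolding gext_def using n(2) mhomD(1)[OF f] gen_comp(2)[OF G]
   by (intro N.finsum_cong') (auto intro!: N.finsum_closed)
  also have "\<dots> = f (gext G ?F gen y)"
   by (rule mhom_gext[OF gmod_module[OF G] N f gen_comp(2)[OF G], symmetric])
  finally show ?thesis by (simp add: gext_gen[OF G y])
 qed
 then show ?thesis using gext_mhom[OF G M n(1)] by blast
qed

text \<open>Says that the multiplication map from (P/PJ) tensor J to P is injective, that is,
  Tor_1(P, A/J) = 0. Being linear and stable under retracts, it serves in place of a classification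
  of the projectives.\<close>

definition jflat :: "('a, 'b) module \<Rightarrow> bool"
 where "jflat P \<longleftrightarrow> (\<forall>z. (\<forall>a\<in>E. z a \<in> comp P (src a)) -->
  finsum P (\<lambda>a. z a \<triangleleft>\<^bsub>P\<^esub> ar a) E = \<zero>\<^bsub>P\<^esub> --> (\<forall>a\<in>E. z a \<in> rad P))"

text \<open>The coordinate of the sum at the product of \<open>g\<close> and \<open>b\<close> is the
  coordinate of \<open>z b\<close> at the generator \<open>g\<close>; so all of the latter vanish
  and \<open>z b\<close> has no generator part.\<close>

lemma jflat_gmod:
 assumes G: "ggood G v (fullD G v)"
 shows "jflat (gmod G v (fullD G v))"
 unfolding jflat_def
proof (intro allI impI ballI)
 let ?F = "gmod G v (fullD G v)"
 interpret F: rsz_module R V E src tgt ec xc ?F by (rule rsz_moduleI[OF gmod_module[OF G]])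
 fix z b assume z: "\<forall>a\<in>E. z a \<in> comp ?F (src a)" and 0: "finsum ?F (\<lambda>a. z a \<triangleleft>\<^bsub>?F\<^esub> ar a) E = \<zero>\<^bsub>?F\<^esub>"
  and b: "b \<in> E"
 have zc: "z a \<in> carrier ?F" if "a \<in> E" for a using z that by (auto simp: comp_def)
 have "(\<lambda>a. z a \<triangleleft>\<^bsub>?F\<^esub> ar a) \<in> E \<rightarrow> carrier ?F" using zc by auto
 note s = gmod_finsum[OF G this, unfolded 0 gmod_simps(2)]
 have "z b (Inl g) = 0" for g
 proof (cases "(b, g) \<in> fullD G v")
  case True
  have "(\<Sum>a\<in>E. (z a \<triangleleft>\<^bsub>?F\<^esub> ar a) (Inr (b, g))) = (\<Sum>a\<in>E. if a = b then z b (Inl g) else 0)"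
   using zc True by (intro sum.cong) (auto simp: gmod_acts[OF G])
  then show ?thesis using fun_cong[OF s, of "Inr (b, g)"] b finE by simp
 next
  case False
  have "z b \<triangleleft>\<^bsub>?F\<^esub> e (src b) = z b" using z b by (auto simp: comp_def)
  note zz = fun_cong[OF this[unfolded gmod_acts(2)[OF G zc[OF b]]], of "Inl g"]
  show ?thesis
  proof (cases "g \<in> G")
   case True
   then have "v g \<noteq> src b" using False b by (auto simp: fullD_def)
   then show ?thesis using zz by simp
  next
   case False
   then show ?thesis using zc[OF b] by (simp add: gmod_simps(1))
  qed
 qed
 then show "z b \<in> rad ?F" using zc[OF b] by (simp add: gmod_rad[OF G])
qed

lemma jflat_retract:
 assumes P: "right_module R P" and F: "right_module R F" and s: "s \<in> mhom R P F" and g: "g \<in> mhom R F P"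
  and gs: "\<And>y. y \<in> carrier P \<Longrightarrow> g (s y) = y" and fl: "jflat F"
 shows "jflat P"
 unfolding jflat_def
proof (intro allI impI ballI)
 interpret P: rsz_module R V E src tgt ec xc P by (rule rsz_moduleI[OF P])
 interpret F: rsz_module R V E src tgt ec xc F by (rule rsz_moduleI[OF F])
 fix z b assume z: "\<forall>a\<in>E. z a \<in> comp P (src a)" and 0: "finsum P (\<lambda>a. z a \<triangleleft>\<^bsub>P\<^esub> ar a) E = \<zero>\<^bsub>P\<^esub>"
  and b: "b \<in> E"
 have zc: "z a \<in> carrier P" if "a \<in> E" for a using z that by (auto simp: comp_def)
 have "finsum F (\<lambda>a. s (z a) \<triangleleft>\<^bsub>F\<^esub> ar a) E = finsum F (\<lambda>a. s (z a \<triangleleft>\<^bsub>P\<^esub> ar a)) E"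
  using zc mhomD[OF s] by (intro F.finsum_cong') auto
 also have "\<dots> = s (finsum P (\<lambda>a. z a \<triangleleft>\<^bsub>P\<^esub> ar a) E)"
  using zc by (intro mhom_finsum[OF P F s, symmetric]) auto
 finally have f0: "finsum F (\<lambda>a. s (z a) \<triangleleft>\<^bsub>F\<^esub> ar a) E = \<zero>\<^bsub>F\<^esub>" by (simp add: 0 mhom_zero[OF P F s])
 have "s (z a) \<in> comp F (src a)" if "a \<in> E" for a using z that mhom_comp[OF s] by blast
 then have "s (z b) \<in> rad F"
  using fl[unfolded jflat_def, THEN spec, of "\<lambda>a. s (z a)"] f0 b by simp
 then have "g (s (z b)) \<in> rad P" by (rule mhom_rad[OF F P g])
 then show "z b \<in> rad P" by (simp add: gs zc b)
qed

text \<open>J annihilates PJ, so multiplying P = L + PJ by J gives PJ = LJ, which is inside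
  \<open>L\<close>.\<close>

lemma nakayama:
 assumes P: "right_module R P" and L: "submod R P L"
  and sum: "\<And>y. y \<in> carrier P \<Longrightarrow> \<exists>l\<in>L. \<exists>k\<in>rad P. y = l \<oplus>\<^bsub>P\<^esub> k"
 shows "L = carrier P"
proof -
 interpret P: rsz_module R V E src tgt ec xc P by (rule rsz_moduleI[OF P])
 note LD = P.submodD[OF L]
 note LK = P.K.ksubD[OF LD(1)]
 have yL: "y \<triangleleft>\<^bsub>P\<^esub> ar a \<in> L" if y: "y \<in> carrier P" and a: "a \<in> E" for y a
 proof -
  obtain l k where lk: "l \<in> L" "k \<in> rad P" "y = l \<oplus>\<^bsub>P\<^esub> k" using sum[OF y] by blast
  have "k \<triangleleft>\<^bsub>P\<^esub> ar a = \<zero>\<^bsub>P\<^esub>" using P.rad_soc[OF lk(2)] a by (simp add: soc_def)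
  then have "y \<triangleleft>\<^bsub>P\<^esub> ar a = l \<triangleleft>\<^bsub>P\<^esub> ar a" using lk LK(1) P.rad_carrier by (simp add: P.ract_add_left)
  then show ?thesis using LD(2)[OF lk(1)] by simp
 qed
 have kL: "k \<in> L" if k: "k \<in> rad P" for k
 proof -
  obtain z where z: "z \<in> E \<rightarrow> carrier P" "k = finsum P (\<lambda>a. z a \<triangleleft>\<^bsub>P\<^esub> ar a) E"
   using k by (auto simp: rad_def)
  show "k \<in> L" unfolding z(2) using z(1) by (intro P.K.ksub_finsum[OF LD(1)]) (auto intro: yL)
 qed
 have "carrier P \<subseteq> L"
 proof
  fix y assume "y \<in> carrier P"
  then obtain l k where "l \<in> L" "k \<in> rad P" "y = l \<oplus>\<^bsub>P\<^esub> k" using sum by metis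
  then show "y \<in> L" using kL LK(3) by simp
 qed
 then show ?thesis using LK(1) by auto
qed

section \<open>Projective covers and flatness of projectives\<close>

lemma fgD: "M \<in> fgmod R \<Longrightarrow> right_module R M" "M \<in> fgmod R \<Longrightarrow> fin_gen R M"
 by (simp_all add: fgmod_def)

lemma a_kernel_iff: "y \<in> a_kernel M N f \<longleftrightarrow> y \<in> carrier M \<and> f y = \<zero>\<^bsub>N\<^esub>"
 by (simp add: a_kernel_def kernel_def)

lemma mhom_image_submod:
 assumes M: "right_module R M" and N: "right_module R N" and f: "f \<in> mhom R M N" and L: "submod R M L"
 shows "submod R N (f ` L)"
proof -
 interpret M: rsz_module R V E src tgt ec xc M by (rule rsz_moduleI[OF M])
 interpret N: rsz_module R V E src tgt ec xc N by (rule rsz_moduleI[OF N])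
 note LD = M.submodD[OF L]
 note LK = M.K.ksubD[OF LD(1)]
 have act: "f y \<triangleleft>\<^bsub>N\<^esub> r \<in> f ` L" if "y \<in> L" "r \<in> carrier R" for y r
  using mhomD(3)[OF f LK(1)[OF that(1)] that(2)] LD(2)[OF that] by (metis imageI)
 show ?thesis
 proof (rule N.submodI)
  show "ksub N (kact N) (f ` L)"
   by (rule ksub_image(1)[OF M.kspace_kact N.kspace_kact LD(1)]) (auto simp: mhomD[OF f] LK(1))
 qed (use act in auto)
qed

lemma submod_carrier: "right_module R M \<Longrightarrow> submod R M (carrier M)"
proof -
 assume M: "right_module R M"
 interpret M: rsz_module R V E src tgt ec xc M by (rule rsz_moduleI[OF M])
 show ?thesis by (rule M.submodI[OF M.K.ksub_carrier]) auto
qed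

lemma mhom_kernel_submod:
 assumes M: "right_module R M" and N: "right_module R N" and f: "f \<in> mhom R M N"
 shows "submod R M (a_kernel M N f)"
proof -
 interpret M: rsz_module R V E src tgt ec xc M by (rule rsz_moduleI[OF M])
 interpret N: rsz_module R V E src tgt ec xc N by (rule rsz_moduleI[OF N])
 show ?thesis
 proof (rule M.submodI)
  show "ksub M (kact M) (a_kernel M N f)"
   unfolding ksub_def a_kernel_iff
   using mhomD[OF f] mhom_zero[OF M N f] by (auto simp: a_kernel_iff)
 qed (auto simp: a_kernel_iff mhomD[OF f])
qed

text \<open>At each vertex the generators are a basis of a complement of MJ. They span the top, so
  the map is onto by \<open>nakayama\<close>; they are independent modulo MJ, so a kernel element
  has no generator part.\<close>

lemma gmod_cover:
 fixes M :: "('a, 'b) module"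
 assumes M: "right_module R M" "fin_gen R M"
 obtains G :: "('v \<times> 'b) set" and p where "ggood G fst (fullD G fst)"
  "p \<in> mhom R (gmod G fst (fullD G fst)) M" "p ` carrier (gmod G fst (fullD G fst)) = carrier M"
  "a_kernel (gmod G fst (fullD G fst)) M p \<subseteq> rad (gmod G fst (fullD G fst))"
proof -
 interpret M: rsz_module R V E src tgt ec xc M by (rule rsz_moduleI[OF M(1)])
 have "\<forall>i. \<exists>G. finite G \<and> G \<subseteq> comp M i \<and>
   (\<forall>w\<in>comp M i. \<exists>u\<in>rad M \<inter> comp M i. \<exists>c. w = u \<oplus>\<^bsub>M\<^esub> M.K.kl c G) \<and>
   (\<forall>c g. M.K.kl c G \<in> rad M \<inter> comp M i --> g \<in> G --> c g = 0)"
 proof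
  fix i
  obtain G where "finite G" "G \<subseteq> comp M i" "\<And>w. w \<in> comp M i \<Longrightarrow> \<exists>u\<in>rad M \<inter> comp M i. \<exists>c. w = u \<oplus>\<^bsub>M\<^esub> M.K.kl c G"
   "\<And>c g. M.K.kl c G \<in> rad M \<inter> comp M i \<Longrightarrow> g \<in> G \<Longrightarrow> c g = 0"
   by (rule M.K.complement_exists[OF M.K.ksub_Int[OF M.ksub_rad M.ksub_comp] M.ksub_comp
     M.kfin_any[OF M(2) M.ksub_comp] Int_lower2]) (rule that)
  then show "\<exists>G. finite G \<and> G \<subseteq> comp M i \<and>
   (\<forall>w\<in>comp M i. \<exists>u\<in>rad M \<inter> comp M i. \<exists>c. w = u \<oplus>\<^bsub>M\<^esub> M.K.kl c G) \<and>
   (\<forall>c g. M.K.kl c G \<in> rad M \<inter> comp M i --> g \<in> G --> c g = 0)"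
   by (intro exI[of _ G]) simp
 qed
 then obtain H where H: "\<And>i. finite (H i)" "\<And>i. H i \<subseteq> comp M i"
  "\<And>i w. w \<in> comp M i \<Longrightarrow> \<exists>u\<in>rad M \<inter> comp M i. \<exists>c. w = u \<oplus>\<^bsub>M\<^esub> M.K.kl c (H i)"
  "\<And>i c g. M.K.kl c (H i) \<in> rad M \<inter> comp M i \<Longrightarrow> g \<in> H i \<Longrightarrow> c g = 0"
  unfolding choice_iff by metis
 define G where "G = Sigma V H"
 have G: "ggood G fst (fullD G fst)" using H(1) finV by (auto simp: ggood_def G_def)
 let ?F = "gmod G fst (fullD G fst)"
 interpret F: rsz_module R V E src tgt ec xc ?F by (rule rsz_moduleI[OF gmod_module[OF G]])
 have n: "snd g \<in> comp M (fst g)" if "g \<in> G" for g using that by (auto simp: G_def dest: subsetD[OF H(2)])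
 then have nc: "snd g \<in> carrier M" if "g \<in> G" for g using that by (auto simp: comp_def)
 define p where "p = gext G M snd"
 have p: "p \<in> mhom R ?F M" unfolding p_def by (rule gext_mhom[OF G M(1) n])
 \<comment> \<open>\<open>A f\<close> collects the contribution of the generators and
   \<open>B f\<close>, a radical element, that of their products with arrows.\<close>
 define A where "A f = finsum M (\<lambda>g. kact M (f (Inl g)) (snd g)) G" for f :: "('v \<times> 'b) + 'e \<times> 'v \<times> 'b \<Rightarrow> 'k"
 define B where "B f = finsum M (\<lambda>g. finsum M (\<lambda>a. kact M (f (Inr (a, g))) (snd g \<triangleleft>\<^bsub>M\<^esub> ar a)) E) G"
  for f :: "('v \<times> 'b) + 'e \<times> 'v \<times> 'b \<Rightarrow> 'k"
 have B: "B f \<in> rad M" for f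
  unfolding B_def
  by (intro M.K.ksub_finsum[OF M.ksub_rad] funcsetI M.K.ksubD(4)[OF M.ksub_rad] M.x_in_rad nc)
 have Ac: "A f \<in> carrier M" for f unfolding A_def using nc by (intro M.finsum_closed) auto
 have pAB: "p f = A f \<oplus>\<^bsub>M\<^esub> B f" for f
  unfolding p_def gext_def A_def B_def using nc by (intro M.finsum_addf) (auto intro!: M.finsum_closed)
 have filt: "finsum M (\<lambda>g. if fst g = i then kact M (c (snd g)) (snd g) else \<zero>\<^bsub>M\<^esub>) G = M.K.kl c (H i)"
  if i: "i \<in> V" for i c
 proof -
  have "finsum M (\<lambda>g. if fst g = i then kact M (c (snd g)) (snd g) else \<zero>\<^bsub>M\<^esub>) G
    = finsum M (\<lambda>g. kact M (c (snd g)) (snd g)) {g\<in>G. fst g = i}"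
   using nc G by (intro M.finsum_filter) (auto simp: ggood_def)
  also have "{g\<in>G. fst g = i} = Pair i ` H i" using i by (auto simp: G_def)
  also have "finsum M (\<lambda>g. kact M (c (snd g)) (snd g)) (Pair i ` H i) = finsum M (\<lambda>x. kact M (c x) x) (H i)"
   using H(2)[of i] by (subst M.finsum_reindex) (auto simp: comp_def inj_on_def)
  finally show ?thesis by (simp add: M.K.kl_def)
 qed
 have im: "submod R M (p ` carrier ?F)"
  by (rule mhom_image_submod[OF gmod_module[OF G] M(1) p submod_carrier[OF gmod_module[OF G]]])
 have "p ` carrier ?F = carrier M"
 proof (rule nakayama[OF M(1) im])
  let ?Z = "{u \<oplus>\<^bsub>M\<^esub> w | u w. u \<in> p ` carrier ?F \<and> w \<in> rad M}"
  have Z: "ksub M (kact M) ?Z" by (rule M.K.ksub_sum[OF M.submodD(1)[OF im] M.ksub_rad])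
  have "w \<in> ?Z" if i: "i \<in> V" and w: "w \<in> comp M i" for i w
  proof -
   obtain u c where u: "u \<in> rad M" and wu: "w = u \<oplus>\<^bsub>M\<^esub> M.K.kl c (H i)" using H(3)[OF w] by blast
   define f :: "('v \<times> 'b) + 'e \<times> 'v \<times> 'b \<Rightarrow> 'k"
    where "f = (\<lambda>b. case b of Inl g \<Rightarrow> if g \<in> G \<and> fst g = i then c (snd g) else 0 | Inr d \<Rightarrow> 0)"
   have fF: "f \<in> carrier ?F" by (auto simp: gmod_simps(1) f_def)
   have "A f = finsum M (\<lambda>g. if fst g = i then kact M (c (snd g)) (snd g) else \<zero>\<^bsub>M\<^esub>) G"
    unfolding A_def using nc by (intro M.finsum_cong') (auto simp: f_def)
   then have Af: "A f = M.K.kl c (H i)" using filt[OF i] by simp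
   have k: "M.K.kl c (H i) \<in> carrier M" using Ac[of f] Af by simp
   note c = M.rad_carrier[OF u] M.rad_carrier[OF B[of f]] k
   have "w = p f \<oplus>\<^bsub>M\<^esub> (u \<ominus>\<^bsub>M\<^esub> B f)"
    unfolding wu pAB Af using c M.a_lcomm[of "B f" u "\<ominus>\<^bsub>M\<^esub> B f"] by (simp add: a_minus_def M.a_ac M.r_neg M.r_neg1 M.r_neg2)
   moreover have "u \<ominus>\<^bsub>M\<^esub> B f \<in> rad M" by (rule M.K.ksubD(6)[OF M.ksub_rad u B])
   ultimately show ?thesis using fF by blast
  qed
  then have "y \<in> ?Z" if "y \<in> carrier M" for y
   by (intro M.mem_by_comps[OF Z that]) (use that M.e_in_comp in auto)
  then show "\<And>y. y \<in> carrier M \<Longrightarrow> \<exists>l\<in>p ` carrier ?F. \<exists>k\<in>rad M. y = l \<oplus>\<^bsub>M\<^esub> k" by blast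
 qed
 moreover have "a_kernel ?F M p \<subseteq> rad ?F"
 proof
  fix f assume "f \<in> a_kernel ?F M p"
  then have f: "f \<in> carrier ?F" "p f = \<zero>\<^bsub>M\<^esub>" by (auto simp: a_kernel_iff)
  have "f (Inl g) = 0" for g
  proof (cases "g \<in> G")
   case False then show ?thesis using f by (cases g) (auto simp: gmod_simps(1))
  next
   case True
   then obtain i h where g: "g = (i, h)" "i \<in> V" "h \<in> H i" by (auto simp: G_def)
   have "A f = \<ominus>\<^bsub>M\<^esub> B f" using f(2) Ac B M.rad_carrier by (simp add: pAB M.minus_equality)
   then have "A f \<in> rad M" using M.K.ksubD(5)[OF M.ksub_rad B] by simp
   then have r: "A f \<triangleleft>\<^bsub>M\<^esub> e i \<in> rad M \<inter> comp M i" using M.rad_e Ac g by simp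
   have "A f \<triangleleft>\<^bsub>M\<^esub> e i = finsum M (\<lambda>g. kact M (f (Inl g)) (snd g) \<triangleleft>\<^bsub>M\<^esub> e i) G"
    unfolding A_def using nc by (intro M.ract_finsum_left) auto
   also have "\<dots> = finsum M (\<lambda>g. if fst g = i then kact M (f (Inl (i, snd g))) (snd g) else \<zero>\<^bsub>M\<^esub>) G"
   proof (rule M.finsum_cong')
    fix g' assume g': "g' \<in> G"
    have "snd g' \<triangleleft>\<^bsub>M\<^esub> e i = (if fst g' = i then snd g' else \<zero>\<^bsub>M\<^esub>)"
     using M.comp_e_other[OF n[OF g'] g(2)] n[OF g'] by (auto simp: comp_def)
    then show "kact M (f (Inl g')) (snd g') \<triangleleft>\<^bsub>M\<^esub> e i = (if fst g' = i then kact M (f (Inl (i, snd g'))) (snd g') else \<zero>\<^bsub>M\<^esub>)"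
     using nc[OF g'] by (auto simp: M.kact_ract)
   qed (use nc in auto)
   also have "\<dots> = M.K.kl (\<lambda>h. f (Inl (i, h))) (H i)" by (rule filt[OF g(2)])
   finally show ?thesis using H(4)[of "\<lambda>h. f (Inl (i, h))" i h] r g by simp
  qed
  then show "f \<in> rad ?F" using f(1) by (simp add: gmod_rad[OF G])
 qed
 ultimately show thesis by (rule that[OF G p])
qed

lemma projective_lift:
 assumes "projective R P" "M \<in> fgmod R" "N \<in> fgmod R" "g \<in> mhom R M N" "g ` carrier M = carrier N" "f \<in> mhom R P N"
 obtains h where "h \<in> mhom R P M" "\<And>y. y \<in> carrier P \<Longrightarrow> g (h y) = f y"
proof -
 have "\<exists>h\<in>mhom R P M. \<forall>y\<in>carrier P. g (h y) = f y"
  using assms(1)[unfolded projective_def, THEN conjunct2, rule_format, OF assms(2-4,6,5)] .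
 then obtain h where "h \<in> mhom R P M" "\<forall>y\<in>carrier P. g (h y) = f y" ..
 then show thesis by (intro that[of h]) simp_all
qed

lemma superfluousI:
 assumes P: "right_module R P" and L: "submod R P L" and K: "K \<subseteq> rad P" and s: "L <+>\<^bsub>P\<^esub> K = carrier P"
 shows "L = carrier P"
proof (rule nakayama[OF P L])
 fix y assume "y \<in> carrier P"
 then have "y \<in> L <+>\<^bsub>P\<^esub> K" using s by simp
 then show "\<exists>l\<in>L. \<exists>k\<in>rad P. y = l \<oplus>\<^bsub>P\<^esub> k" using K unfolding set_add_def' by blast
qed

text \<open>Moves the explicit cover into \<open>fgmod\<close> while keeping two facts about it:
  flatness and a kernel inside PJ.\<close>

lemma cover_exists:
 assumes M: "M \<in> fgmod R"
 obtains P p where "projective_cover R P p M" "jflat P" "a_kernel P M p \<subseteq> rad P"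
proof -
 obtain G :: "('v \<times> (nat \<Rightarrow> 'a)) set" and q where G: "ggood G fst (fullD G fst)"
  and q: "q \<in> mhom R (gmod G fst (fullD G fst)) M" "q ` carrier (gmod G fst (fullD G fst)) = carrier M"
  "a_kernel (gmod G fst (fullD G fst)) M q \<subseteq> rad (gmod G fst (fullD G fst))"
  by (rule gmod_cover[OF fgD(1,2)[OF M]]) (rule that)
 let ?F = "gmod G fst (fullD G fst)"
 note F = gmod_module[OF G] gmod_fin_gen[OF G]
 obtain P where P: "P \<in> fgmod R" "miso R ?F P" using ex_umod[OF F] by blast
 then obtain \<theta> where t: "\<theta> \<in> mhom R ?F P" "bij_betw \<theta> (carrier ?F) (carrier P)" by (auto simp: miso_def)
 define \<eta> where "\<eta> = inv_into (carrier ?F) \<theta>"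
 have h: "\<eta> \<in> mhom R P ?F" unfolding \<eta>_def by (rule mhom_inv[OF F(1) t])
 have th: "\<theta> (\<eta> y) = y" if "y \<in> carrier P" for y
  using t(2) that unfolding \<eta>_def by (auto simp: bij_betw_def f_inv_into_f)
 have ht: "\<eta> (\<theta> y) = y" if "y \<in> carrier ?F" for y
  using t(2) that unfolding \<eta>_def by (auto simp: bij_betw_def)
 have Pr: "projective R P"
  unfolding projective_def
 proof (intro conjI ballI impI)
  fix A B g f assume A: "A \<in> fgmod R" and B: "B \<in> fgmod R" and g: "g \<in> mhom R A B" and f: "f \<in> mhom R P B"
   and s: "g ` carrier A = carrier B"
  obtain k where k: "k \<in> mhom R ?F A" "\<forall>y\<in>carrier ?F. g (k y) = f (\<theta> y)"
   by (rule bexE[OF gmod_lift[OF G fgD(1)[OF A] fgD(1)[OF B] g s mhom_compose[OF t(1) f]]]) (rule that)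
  have "\<forall>y\<in>carrier P. g (k (\<eta> y)) = f y" using k(2) mhomD(1)[OF h] th by simp
  then show "\<exists>h\<in>mhom R P A. \<forall>y\<in>carrier P. g (h y) = f y"
   by (rule bexI[OF _ mhom_compose[OF h k(1)]])
 qed (rule P(1))
 have fl: "jflat P" by (rule jflat_retract[OF fgD(1)[OF P(1)] F(1) h t(1) th jflat_gmod[OF G]])
 define p where "p y = q (\<eta> y)" for y
 have p: "p \<in> mhom R P M" unfolding p_def by (rule mhom_compose[OF h q(1)])
 have ker: "a_kernel P M p \<subseteq> rad P"
 proof
  fix y assume "y \<in> a_kernel P M p"
  then have y: "y \<in> carrier P" "q (\<eta> y) = \<zero>\<^bsub>M\<^esub>" by (auto simp: a_kernel_iff p_def)
  then have "\<eta> y \<in> rad ?F" using q(3) mhomD(1)[OF h] by (auto simp: a_kernel_iff)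
  then have "\<theta> (\<eta> y) \<in> rad P" by (rule mhom_rad[OF F(1) fgD(1)[OF P(1)] t(1)])
  then show "y \<in> rad P" using th y by simp
 qed
 have sur: "p ` carrier P = carrier M"
 proof -
  have "p ` carrier P \<subseteq> carrier M" using mhomD(1)[OF p] by auto
  moreover have "w \<in> p ` carrier P" if w: "w \<in> carrier M" for w
  proof -
   have "w \<in> q ` carrier ?F" using q(2) w by simp
   then obtain f where "f \<in> carrier ?F" "w = q f" by auto
   then show ?thesis using mhomD(1)[OF t(1)] ht by (intro image_eqI[of _ _ "\<theta> f"]) (auto simp: p_def)
  qed
  ultimately show ?thesis by blast
 qed
 have sf: "L = carrier P" if "submod R P L" "L <+>\<^bsub>P\<^esub> a_kernel P M p = carrier P" for L
  by (rule superfluousI[OF fgD(1)[OF P(1)] that(1) ker that(2)])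
 have "projective_cover R P p M"
  unfolding projective_cover_def
  by (rule conjI[OF Pr conjI[OF p conjI[OF sur]]]) (rule allI, rule impI, erule conjE, rule sf)
 then show thesis using fl ker by (rule that)
qed

lemma coverD:
 assumes "projective_cover R P p M"
 shows "projective R P" "P \<in> fgmod R" "p \<in> mhom R P M" "p ` carrier P = carrier M"
  "\<And>L. submod R P L \<Longrightarrow> L <+>\<^bsub>P\<^esub> a_kernel P M p = carrier P \<Longrightarrow> L = carrier P"
proof -
 note A = assms[unfolded projective_cover_def]
 show 1: "projective R P" "p \<in> mhom R P M" "p ` carrier P = carrier M" using A by simp_all
 show "P \<in> fgmod R" using 1(1) by (simp add: projective_def)
 show "\<And>L. submod R P L \<Longrightarrow> L <+>\<^bsub>P\<^esub> a_kernel P M p = carrier P \<Longrightarrow> L = carrier P"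
  using A by simp
qed

lemma mhom_id: "(\<lambda>y. y) \<in> mhom R M M" by (auto simp: mhom_def hom_def)

text \<open>Lifting the identity along a cover exhibits \<open>P\<close> as a retract of a module
  for which the condition is known.\<close>

lemma projective_jflat:
 assumes "projective R P"
 shows "jflat P"
proof -
 have P: "P \<in> fgmod R" using assms by (simp add: projective_def)
 obtain F p where F: "projective_cover R F p P" "jflat F" by (rule cover_exists[OF P]) (rule that)
 obtain s where s: "s \<in> mhom R P F" "\<And>y. y \<in> carrier P \<Longrightarrow> p (s y) = y"
  by (rule projective_lift[OF assms coverD(2)[OF F(1)] P coverD(3,4)[OF F(1)] mhom_id]) (rule that)
 show ?thesis
  by (rule jflat_retract[OF fgD(1)[OF P] fgD(1)[OF coverD(2)[OF F(1)]] s(1) coverD(3)[OF F(1)] s(2) F(2)])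
qed

lemma surj_endo_inj:
 assumes P: "right_module R P" "fin_gen R P" and f: "f \<in> mhom R P P" and s: "f ` carrier P = carrier P"
 shows "inj_on f (carrier P)"
proof -
 interpret P: rsz_module R V E src tgt ec xc P by (rule rsz_moduleI[OF P(1)])
 have k: "ksub P (kact P) (a_kernel P P f)" by (rule P.submodD(1)[OF mhom_kernel_submod[OF P(1) P(1) f]])
 have "kdim P (kact P) (f ` carrier P) + kdim P (kact P) {x\<in>carrier P. f x = \<zero>\<^bsub>P\<^esub>} = kdim P (kact P) (carrier P)"
  by (rule kdim_rank_nullity[OF P.kspace_kact P.kspace_kact P.K.ksub_carrier P.kfin_carrier[OF P(2)]])
   (auto simp: mhomD[OF f])
 moreover have "{x\<in>carrier P. f x = \<zero>\<^bsub>P\<^esub>} = a_kernel P P f" by (auto simp: a_kernel_iff)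
 ultimately have "a_kernel P P f = {\<zero>\<^bsub>P\<^esub>}"
  using s P.K.kdim_eq_0[OF k P.kfin_any[OF P(2) k]] by simp
 then have z: "x \<in> carrier P \<Longrightarrow> f x = \<zero>\<^bsub>P\<^esub> \<Longrightarrow> x = \<zero>\<^bsub>P\<^esub>" for x by (auto simp: a_kernel_iff set_eq_iff)
 show ?thesis
 proof (rule inj_onI)
  fix x y assume xy: "x \<in> carrier P" "y \<in> carrier P" "f x = f y"
  have "f (x \<ominus>\<^bsub>P\<^esub> y) = \<zero>\<^bsub>P\<^esub>" using mhom_minus[OF P(1) P(1) f xy(1,2)] xy mhomD(1)[OF f] by simp
  then show "x = y" using z[of "x \<ominus>\<^bsub>P\<^esub> y"] xy by simp
 qed
qed

lemma cover_endo_surj: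
 assumes M: "M \<in> fgmod R" and C: "projective_cover R P p M" and f: "f \<in> mhom R P P"
  and pf: "\<And>y. y \<in> carrier P \<Longrightarrow> p (f y) = p y"
 shows "f ` carrier P = carrier P"
proof -
 note CD = coverD[OF C]
 note P = fgD[OF CD(2)] and M' = fgD[OF M]
 interpret P: rsz_module R V E src tgt ec xc P by (rule rsz_moduleI[OF P(1)])
 interpret M: rsz_module R V E src tgt ec xc M by (rule rsz_moduleI[OF M'(1)])
 show ?thesis
 proof (rule CD(5)[OF mhom_image_submod[OF P(1) P(1) f submod_carrier[OF P(1)]]])
  have "y \<in> f ` carrier P <+>\<^bsub>P\<^esub> a_kernel P M p" if y: "y \<in> carrier P" for y
  proof -
   have fy: "f y \<in> carrier P" using mhomD(1)[OF f y] .
   have "p (y \<ominus>\<^bsub>P\<^esub> f y) = \<zero>\<^bsub>M\<^esub>"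
    using mhom_minus[OF P(1) M'(1) CD(3) y fy] pf[OF y] mhomD(1)[OF CD(3) y] by simp
   then have "y \<ominus>\<^bsub>P\<^esub> f y \<in> a_kernel P M p" using y fy by (simp add: a_kernel_iff)
   moreover have "y = f y \<oplus>\<^bsub>P\<^esub> (y \<ominus>\<^bsub>P\<^esub> f y)" using y fy P.a_lcomm[of "f y" y "\<ominus>\<^bsub>P\<^esub> f y"] by (simp add: a_minus_def P.r_neg)
   ultimately show ?thesis using y unfolding set_add_def' by blast
  qed
  moreover have "f ` carrier P <+>\<^bsub>P\<^esub> a_kernel P M p \<subseteq> carrier P"
   using mhomD(1)[OF f] by (auto simp: set_add_def' a_kernel_iff)
  ultimately show "f ` carrier P <+>\<^bsub>P\<^esub> a_kernel P M p = carrier P" by blast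
 qed
qed

text \<open>Comparison with the cover constructed above: the composite of the two lifts is a
 surjective, hence bijective, endomorphism of \<open>P\<close>.\<close>

lemma cover_kernel_rad:
 assumes M: "M \<in> fgmod R" and C: "projective_cover R P p M"
 shows "a_kernel P M p \<subseteq> rad P"
proof
 note CD = coverD[OF C]
 fix y assume "y \<in> a_kernel P M p"
 then have y: "y \<in> carrier P" "p y = \<zero>\<^bsub>M\<^esub>" by (auto simp: a_kernel_iff)
 obtain F q where F: "projective_cover R F q M" "a_kernel F M q \<subseteq> rad F" by (rule cover_exists[OF M]) (rule that)
 note FD = coverD[OF F(1)]
 obtain h where h: "h \<in> mhom R P F" "\<And>y. y \<in> carrier P \<Longrightarrow> q (h y) = p y"
  by (rule projective_lift[OF CD(1) FD(2) M FD(3,4) CD(3)]) (rule that)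
 obtain k where k: "k \<in> mhom R F P" "\<And>y. y \<in> carrier F \<Longrightarrow> p (k y) = q y"
  by (rule projective_lift[OF FD(1) CD(2) M CD(3,4) FD(3)]) (rule that)
 define f where "f y = k (h y)" for y
 have f: "f \<in> mhom R P P" unfolding f_def by (rule mhom_compose[OF h(1) k(1)])
 have pf: "p (f y) = p y" if "y \<in> carrier P" for y using that h k mhomD(1)[OF h(1)] by (simp add: f_def)
 have s: "f ` carrier P = carrier P" by (rule cover_endo_surj[OF M C f pf])
 note P = fgD[OF CD(2)] and F' = fgD[OF FD(2)]
 interpret P: rsz_module R V E src tgt ec xc P by (rule rsz_moduleI[OF P(1)])
 have inj: "inj_on f (carrier P)" by (rule surj_endo_inj[OF P f s])
 have "h y \<in> a_kernel F M q" using y h mhomD(1)[OF h(1)] by (simp add: a_kernel_iff)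
 then have "h y \<in> rad F" using F(2) by blast
 then have fy: "f y \<in> rad P" unfolding f_def by (rule mhom_rad[OF F'(1) P(1) k(1)])
 have iv: "inv_into (carrier P) f \<in> mhom R P P"
  by (rule mhom_inv[OF P(1) f]) (use s inj in \<open>simp add: bij_betw_def\<close>)
 have "inv_into (carrier P) f (f y) \<in> rad P" by (rule mhom_rad[OF P(1) P(1) iv fy])
 then show "y \<in> rad P" using y inj by simp
qed

text \<open>The component of PJ at \<open>j\<close> is the direct sum, over the arrows
  \<open>a\<close> into \<open>j\<close>, of the images of multiplication by \<open>a\<close>, and
  flatness identifies each image with the top of \<open>P\<close> at \<open>src a\<close>. The sum
  is built up by induction on the set of arrows.\<close>

lemma jflat_rr:
 assumes P: "right_module R P" "fin_gen R P" and fl: "jflat P"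
 shows "rr P j = (\<Sum>a\<in>{a\<in>E. tgt a = j}. dd P (src a) - rr P (src a))"
proof -
 interpret P: rsz_module R V E src tgt ec xc P by (rule rsz_moduleI[OF P(1)])
 define S where "S B = {finsum P (\<lambda>a. z a \<triangleleft>\<^bsub>P\<^esub> ar a) B | z. \<forall>a\<in>E. z a \<in> comp P (src a)}" for B
 have zc: "z a \<in> carrier P" if "\<forall>a\<in>E. z a \<in> comp P (src a)" "a \<in> E" for z a using that by (auto simp: comp_def)
 have ind: "ksub P (kact P) (S B) \<and> kdim P (kact P) (S B) = (\<Sum>a\<in>B. dd P (src a) - rr P (src a))"
  if "finite B" "B \<subseteq> E" for B
  using that
 proof (induct B)
  case empty
  have "S {} = {\<zero>\<^bsub>P\<^esub>}" unfolding S_def using P.comp_zero by (auto intro!: exI[of _ "\<lambda>_. \<zero>\<^bsub>P\<^esub>"])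
  then show ?case using P.K.kdim_zero P.K.ksub_zero by simp
 next
  case (insert b B)
  have b: "b \<in> E" and BE: "B \<subseteq> E" and bB: "b \<notin> B" using insert by auto
  note IH = insert.hyps(3)[OF BE]
  define D where "D = (\<lambda>y. y \<triangleleft>\<^bsub>P\<^esub> ar b) ` comp P (src b)"
  have lin: "(\<lambda>y. y \<triangleleft>\<^bsub>P\<^esub> ar b) \<in> comp P (src b) \<rightarrow> carrier P"
   "\<And>x y. x \<in> comp P (src b) \<Longrightarrow> y \<in> comp P (src b) \<Longrightarrow> (x \<oplus>\<^bsub>P\<^esub> y) \<triangleleft>\<^bsub>P\<^esub> ar b = x \<triangleleft>\<^bsub>P\<^esub> ar b \<oplus>\<^bsub>P\<^esub> y \<triangleleft>\<^bsub>P\<^esub> ar b"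
   "\<And>c x. x \<in> comp P (src b) \<Longrightarrow> kact P c x \<triangleleft>\<^bsub>P\<^esub> ar b = kact P c (x \<triangleleft>\<^bsub>P\<^esub> ar b)"
   by (auto simp: comp_def P.ract_add_left P.kact_ract)
  have D: "ksub P (kact P) D" unfolding D_def
   by (rule ksub_image(1)[of P "kact P" P "kact P" "comp P (src b)" "\<lambda>y. y \<triangleleft>\<^bsub>P\<^esub> ar b",
     OF P.kspace_kact P.kspace_kact P.ksub_comp lin])
  \<comment> \<open>\<open>y\<close> is attached to \<open>b\<close> and the negated coefficients to
    the arrows in \<open>B\<close>; the total is zero, so flatness applies to this family.\<close>
  have one: "y \<in> rad P" if y: "y \<in> comp P (src b)"
   and eq: "y \<triangleleft>\<^bsub>P\<^esub> ar b = finsum P (\<lambda>a. z a \<triangleleft>\<^bsub>P\<^esub> ar a) B" and z: "\<forall>a\<in>E. z a \<in> comp P (src a)" for y z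
  proof -
   let ?w = "\<lambda>a. if a = b then y else if a \<in> B then \<ominus>\<^bsub>P\<^esub> z a else \<zero>\<^bsub>P\<^esub>"
   have w: "\<forall>a\<in>E. ?w a \<in> comp P (src a)"
    using y z P.comp_zero P.K.ksubD(5)[OF P.ksub_comp] by auto
   have fs: "(\<lambda>a. ?w a \<triangleleft>\<^bsub>P\<^esub> ar a) \<in> E \<rightarrow> carrier P" using w zc by (auto simp: comp_def)
   have "finsum P (\<lambda>a. ?w a \<triangleleft>\<^bsub>P\<^esub> ar a) E = finsum P (\<lambda>a. if a \<in> insert b B then ?w a \<triangleleft>\<^bsub>P\<^esub> ar a else \<zero>\<^bsub>P\<^esub>) E"
    using fs w by (intro P.finsum_cong') (auto simp: comp_def)
   also have "\<dots> = finsum P (\<lambda>a. ?w a \<triangleleft>\<^bsub>P\<^esub> ar a) {a\<in>E. a \<in> insert b B}"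
    by (rule P.finsum_filter[OF finE fs])
   also have "{a\<in>E. a \<in> insert b B} = insert b B" using b BE by auto
   also have "finsum P (\<lambda>a. ?w a \<triangleleft>\<^bsub>P\<^esub> ar a) (insert b B)
     = y \<triangleleft>\<^bsub>P\<^esub> ar b \<oplus>\<^bsub>P\<^esub> finsum P (\<lambda>a. ?w a \<triangleleft>\<^bsub>P\<^esub> ar a) B"
    using fs b BE insert.hyps(1) bB y by (subst P.finsum_insert) (auto simp: comp_def subset_iff)
   also have "finsum P (\<lambda>a. ?w a \<triangleleft>\<^bsub>P\<^esub> ar a) B = finsum P (\<lambda>a. kact P (- 1) (z a \<triangleleft>\<^bsub>P\<^esub> ar a)) B"
    using bB BE zc[OF z] by (intro P.finsum_cong') (auto simp: P.ract_minus P.K.s_minus_one subset_iff)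
   also have "\<dots> = kact P (- 1) (finsum P (\<lambda>a. z a \<triangleleft>\<^bsub>P\<^esub> ar a) B)"
    using BE zc[OF z] by (intro P.K.s_finsum[symmetric]) auto
   also have "\<dots> = \<ominus>\<^bsub>P\<^esub> (y \<triangleleft>\<^bsub>P\<^esub> ar b)"
    unfolding eq[symmetric] using y by (intro P.K.s_minus_one) (auto simp: comp_def)
   also have "y \<triangleleft>\<^bsub>P\<^esub> ar b \<oplus>\<^bsub>P\<^esub> \<ominus>\<^bsub>P\<^esub> (y \<triangleleft>\<^bsub>P\<^esub> ar b) = \<zero>\<^bsub>P\<^esub>"
    using y by (intro P.r_neg) (auto simp: comp_def)
   finally have "\<forall>a\<in>E. ?w a \<in> rad P" using fl[unfolded jflat_def, THEN spec, of ?w] w by simp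
   then show ?thesis using b by force
  qed
  have ker: "{y\<in>comp P (src b). y \<triangleleft>\<^bsub>P\<^esub> ar b = \<zero>\<^bsub>P\<^esub>} = rad P \<inter> comp P (src b)"
  proof (intro equalityI subsetI)
   fix y assume y: "y \<in> {y\<in>comp P (src b). y \<triangleleft>\<^bsub>P\<^esub> ar b = \<zero>\<^bsub>P\<^esub>}"
   have "finsum P (\<lambda>a. (\<lambda>_. \<zero>\<^bsub>P\<^esub>) a \<triangleleft>\<^bsub>P\<^esub> ar a) B = \<zero>\<^bsub>P\<^esub>" by (rule P.finsum_zero') simp
   then show "y \<in> rad P \<inter> comp P (src b)"
    using one[of y "\<lambda>_. \<zero>\<^bsub>P\<^esub>"] y P.comp_zero by simp
  next
   fix y assume "y \<in> rad P \<inter> comp P (src b)"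
   then show "y \<in> {y\<in>comp P (src b). y \<triangleleft>\<^bsub>P\<^esub> ar b = \<zero>\<^bsub>P\<^esub>}"
    using P.rad_soc[of y] b by (simp add: soc_def)
  qed
  have "kdim P (kact P) D + rr P (src b) = dd P (src b)"
   unfolding D_def dd_def rr_def ker[symmetric]
   by (rule kdim_rank_nullity[of P "kact P" P "kact P" "comp P (src b)" "\<lambda>y. y \<triangleleft>\<^bsub>P\<^esub> ar b",
     OF P.kspace_kact P.kspace_kact P.ksub_comp P.kfin_any[OF P(2) P.ksub_comp] lin])
  then have dimD: "kdim P (kact P) D = dd P (src b) - rr P (src b)" by simp
  have dis: "D \<inter> S B = {\<zero>\<^bsub>P\<^esub>}"
  proof (intro equalityI subsetI)
   fix v assume v: "v \<in> D \<inter> S B"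
   then obtain y where y: "y \<in> comp P (src b)" "v = y \<triangleleft>\<^bsub>P\<^esub> ar b" by (auto simp: D_def)
   obtain z where z: "\<forall>a\<in>E. z a \<in> comp P (src a)" "v = finsum P (\<lambda>a. z a \<triangleleft>\<^bsub>P\<^esub> ar a) B"
    using v by (auto simp: S_def)
   have "y \<in> rad P" using one[OF y(1) _ z(1)] y(2) z(2) by simp
   then have "v = \<zero>\<^bsub>P\<^esub>" using P.rad_soc[of y] b y(2) by (simp add: soc_def)
   then show "v \<in> {\<zero>\<^bsub>P\<^esub>}" by simp
  qed (use P.K.ksubD(2)[OF D] P.K.ksubD(2)[OF IH[THEN conjunct1]] in simp)
  have SI: "S (insert b B) = {u \<oplus>\<^bsub>P\<^esub> w | u w. u \<in> D \<and> w \<in> S B}"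
  proof (intro equalityI subsetI)
   fix v assume "v \<in> S (insert b B)"
   then obtain z where z: "\<forall>a\<in>E. z a \<in> comp P (src a)" "v = finsum P (\<lambda>a. z a \<triangleleft>\<^bsub>P\<^esub> ar a) (insert b B)"
    by (auto simp: S_def)
   have "v = z b \<triangleleft>\<^bsub>P\<^esub> ar b \<oplus>\<^bsub>P\<^esub> finsum P (\<lambda>a. z a \<triangleleft>\<^bsub>P\<^esub> ar a) B"
    unfolding z(2) using insert.hyps(1) bB zc[OF z(1)] b BE by (intro P.finsum_insert) auto
   moreover have "z b \<triangleleft>\<^bsub>P\<^esub> ar b \<in> D" using z(1) b by (auto simp: D_def)
   moreover have "finsum P (\<lambda>a. z a \<triangleleft>\<^bsub>P\<^esub> ar a) B \<in> S B" using z(1) by (auto simp: S_def)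
   ultimately show "v \<in> {u \<oplus>\<^bsub>P\<^esub> w | u w. u \<in> D \<and> w \<in> S B}" by blast
  next
   fix v assume "v \<in> {u \<oplus>\<^bsub>P\<^esub> w | u w. u \<in> D \<and> w \<in> S B}"
   then obtain y z where v: "v = y \<triangleleft>\<^bsub>P\<^esub> ar b \<oplus>\<^bsub>P\<^esub> finsum P (\<lambda>a. z a \<triangleleft>\<^bsub>P\<^esub> ar a) B"
    and y: "y \<in> comp P (src b)" and z: "\<forall>a\<in>E. z a \<in> comp P (src a)"
    by (auto simp: S_def D_def)
   let ?z = "z(b := y)"
   have z': "\<forall>a\<in>E. ?z a \<in> comp P (src a)" using y z by auto
   have "finsum P (\<lambda>a. ?z a \<triangleleft>\<^bsub>P\<^esub> ar a) (insert b B) = ?z b \<triangleleft>\<^bsub>P\<^esub> ar b \<oplus>\<^bsub>P\<^esub> finsum P (\<lambda>a. ?z a \<triangleleft>\<^bsub>P\<^esub> ar a) B"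
    using insert.hyps(1) bB zc[OF z'] b BE P.compD(1)[OF y]
    by (intro P.finsum_insert) auto
   also have "finsum P (\<lambda>a. ?z a \<triangleleft>\<^bsub>P\<^esub> ar a) B = finsum P (\<lambda>a. z a \<triangleleft>\<^bsub>P\<^esub> ar a) B"
    using bB BE zc[OF z] by (intro P.finsum_cong') auto
   finally have "v = finsum P (\<lambda>a. ?z a \<triangleleft>\<^bsub>P\<^esub> ar a) (insert b B)" using v by simp
   then show "v \<in> S (insert b B)" using z' unfolding S_def by blast
  qed
  have "ksub P (kact P) (S (insert b B))"
   unfolding SI by (rule P.K.ksub_sum[OF D IH[THEN conjunct1]])
  moreover have "kdim P (kact P) (S (insert b B)) = kdim P (kact P) D + kdim P (kact P) (S B)"
   unfolding SI using IH
   by (intro P.K.kdim_internal_sum(2) D P.kfin_any[OF P(2)] dis) auto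
  ultimately show ?case using IH dimD insert.hyps(1) bB by simp
 qed
 have "rad P \<inter> comp P j = S {a\<in>E. tgt a = j}"
 proof (intro equalityI subsetI)
  fix y assume y: "y \<in> rad P \<inter> comp P j"
  obtain z where z: "\<And>a. a \<in> E \<Longrightarrow> z a \<in> comp P (src a)"
   "y = finsum P (\<lambda>a. z a \<triangleleft>\<^bsub>P\<^esub> ar a) {a\<in>E. tgt a = j}" by (rule P.rad_compE[OF y]) (rule that)
  then show "y \<in> S {a\<in>E. tgt a = j}" unfolding S_def by blast
 next
  fix y assume "y \<in> S {a\<in>E. tgt a = j}"
  then obtain z where z: "\<forall>a\<in>E. z a \<in> comp P (src a)"
   "y = finsum P (\<lambda>a. z a \<triangleleft>\<^bsub>P\<^esub> ar a) {a\<in>E. tgt a = j}" by (auto simp: S_def)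
  have "z a \<triangleleft>\<^bsub>P\<^esub> ar a \<in> rad P \<inter> comp P j" if "a \<in> {a\<in>E. tgt a = j}" for a
   using that zc[OF z(1)] P.x_in_comp P.x_in_rad by auto
  then show "y \<in> rad P \<inter> comp P j"
   unfolding z(2) by (intro P.K.ksub_finsum[OF P.K.ksub_Int[OF P.ksub_rad P.ksub_comp]]) auto
 qed
 then show ?thesis unfolding rr_def using ind[of "{a\<in>E. tgt a = j}"] finE by (simp add: rr_def)
qed

section \<open>The dimension vector of a syzygy\<close>

lemma short_exactD:
 assumes "short_exact R L f M g N"
 shows "f \<in> mhom R L M" "inj_on f (carrier L)" "g \<in> mhom R M N" "g ` carrier M = carrier N"
  "f ` carrier L = a_kernel M N g"
 using assms by (auto simp: short_exact_def)

text \<open>The syzygy lies inside PJ, so both \<open>dd\<close> and \<open>rr\<close> of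
  \<open>P\<close> exceed those of \<open>M\<close> by \<open>dd N\<close>, and the tops agree. With
  \<open>jflat_rr\<close> for \<open>P\<close> this expresses the syzygy by \<open>M\<close> alone.
  The term \<open>rr M j\<close> stands on the left to avoid a truncated subtraction.\<close>

lemma syzygy_dims_aux:
 assumes M: "M \<in> fgmod R" and N: "N \<in> fgmod R" and C: "projective_cover R P p M" and S: "short_exact R N i P p M"
 shows "soc N = carrier N" "rad N = {\<zero>\<^bsub>N\<^esub>}"
  "j \<in> V \<Longrightarrow> dd N j + rr M j = (\<Sum>a\<in>{a\<in>E. tgt a = j}. dd M (src a) - rr M (src a))"
proof -
 note CD = coverD[OF C] and SD = short_exactD[OF S]
 note P' = fgD[OF CD(2)] and M' = fgD[OF M] and N' = fgD[OF N]
 interpret P: rsz_module R V E src tgt ec xc P by (rule rsz_moduleI[OF P'(1)])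
 interpret M: rsz_module R V E src tgt ec xc M by (rule rsz_moduleI[OF M'(1)])
 interpret N: rsz_module R V E src tgt ec xc N by (rule rsz_moduleI[OF N'(1)])
 note i = mhomD[OF SD(1)] and p = mhomD[OF CD(3)]
 have iz: "i \<zero>\<^bsub>N\<^esub> = \<zero>\<^bsub>P\<^esub>" by (rule mhom_zero[OF N'(1) P'(1) SD(1)])
 have inj: "x \<in> carrier N \<Longrightarrow> y \<in> carrier N \<Longrightarrow> i x = i y \<Longrightarrow> x = y" for x y using SD(2) by (auto simp: inj_on_def)
 have ir: "i y \<in> rad P" if "y \<in> carrier N" for y
  using that SD(5) cover_kernel_rad[OF M C] by blast
 have "y \<triangleleft>\<^bsub>N\<^esub> ar a = \<zero>\<^bsub>N\<^esub>" if y: "y \<in> carrier N" and a: "a \<in> E" for y a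
 proof -
  have "i (y \<triangleleft>\<^bsub>N\<^esub> ar a) = i y \<triangleleft>\<^bsub>P\<^esub> ar a" by (rule i(3)[OF y ar_closed])
  also have "\<dots> = \<zero>\<^bsub>P\<^esub>" using P.rad_soc[OF ir[OF y]] a by (simp add: soc_def)
  finally have "i (y \<triangleleft>\<^bsub>N\<^esub> ar a) = i \<zero>\<^bsub>N\<^esub>" by (simp add: iz)
  then show ?thesis using y by (intro inj[of "y \<triangleleft>\<^bsub>N\<^esub> ar a" "\<zero>\<^bsub>N\<^esub>"]) auto
 qed
 then show sN: "soc N = carrier N" by (auto simp: soc_def)
 show "rad N = {\<zero>\<^bsub>N\<^esub>}"
 proof (intro equalityI subsetI)
  fix y assume "y \<in> rad N"
  then obtain z where z: "z \<in> E \<rightarrow> carrier N" "y = finsum N (\<lambda>a. z a \<triangleleft>\<^bsub>N\<^esub> ar a) E" by (auto simp: rad_def)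
  then show "y \<in> {\<zero>\<^bsub>N\<^esub>}" using sN by (auto simp: soc_def intro!: N.finsum_zero')
 qed (use N.K.ksubD(2)[OF N.ksub_rad] in simp)
 have comp_im: "p ` comp P j = comp M j" if "j \<in> V" for j
 proof (intro equalityI subsetI)
  fix w assume w: "w \<in> comp M j"
  then obtain y where y: "y \<in> carrier P" "p y = w" using CD(4) by (auto simp: comp_def) (metis imageE)
  then have "p (y \<triangleleft>\<^bsub>P\<^esub> e j) = w" using w p(3)[OF y(1)] by (simp add: comp_def)
  then show "w \<in> p ` comp P j" using P.e_in_comp[OF y(1) that] by blast
 qed (use mhom_comp[OF CD(3)] in blast)
 have rad_im: "p ` (rad P \<inter> comp P j) = rad M \<inter> comp M j" for j
 proof (intro equalityI subsetI)
  fix w assume w: "w \<in> rad M \<inter> comp M j"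
  obtain z where z: "\<And>a. a \<in> E \<Longrightarrow> z a \<in> comp M (src a)"
   "w = finsum M (\<lambda>a. z a \<triangleleft>\<^bsub>M\<^esub> ar a) {a\<in>E. tgt a = j}" by (rule M.rad_compE[OF w]) (rule that)
  have "\<forall>a\<in>E. \<exists>y. y \<in> carrier P \<and> p y = z a" using z(1) CD(4) by (auto simp: comp_def) (metis imageE)
  then obtain u where u: "\<And>a. a \<in> E \<Longrightarrow> u a \<in> carrier P" "\<And>a. a \<in> E \<Longrightarrow> p (u a) = z a" by metis
  let ?y = "finsum P (\<lambda>a. u a \<triangleleft>\<^bsub>P\<^esub> ar a) {a\<in>E. tgt a = j}"
  have "p ?y = finsum M (\<lambda>a. p (u a \<triangleleft>\<^bsub>P\<^esub> ar a)) {a\<in>E. tgt a = j}"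
   using u by (intro mhom_finsum[OF P'(1) M'(1) CD(3)]) auto
  also have "\<dots> = w" unfolding z(2)
   using u z(1) p by (intro M.finsum_cong') (auto simp: comp_def)
  finally have "p ?y = w" .
  moreover have "?y \<in> rad P \<inter> comp P j"
   using u P.x_in_rad P.x_in_comp
   by (intro P.K.ksub_finsum[OF P.K.ksub_Int[OF P.ksub_rad P.ksub_comp]]) auto
  ultimately show "w \<in> p ` (rad P \<inter> comp P j)" by blast
 qed (use mhom_comp[OF CD(3)] mhom_rad[OF P'(1) M'(1) CD(3)] in blast)
 have iker: "i ` comp N j = {y\<in>comp P j. p y = \<zero>\<^bsub>M\<^esub>}" for j
 proof (intro equalityI subsetI)
  fix w assume "w \<in> i ` comp N j"
  then obtain y where y: "y \<in> comp N j" "w = i y" by auto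
  have "w \<in> a_kernel P M p" using y SD(5) by (auto simp: comp_def)
  then show "w \<in> {y\<in>comp P j. p y = \<zero>\<^bsub>M\<^esub>}" using y mhom_comp[OF SD(1)] by (auto simp: a_kernel_iff)
 next
  fix w assume w: "w \<in> {y\<in>comp P j. p y = \<zero>\<^bsub>M\<^esub>}"
  then have "w \<in> a_kernel P M p" by (auto simp: a_kernel_iff comp_def)
  then obtain y where y: "y \<in> carrier N" "w = i y" using SD(5) by blast
  have "i (y \<triangleleft>\<^bsub>N\<^esub> e j) = i y" using i(3)[OF y(1)] w y(2) by (simp add: comp_def)
  then have "y \<triangleleft>\<^bsub>N\<^esub> e j = y" using y by (intro inj[of "y \<triangleleft>\<^bsub>N\<^esub> e j" y]) auto
  then show "w \<in> i ` comp N j" using y by (auto simp: comp_def)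
 qed
 \<comment> \<open>As the kernel of the cover lies in PJ, it is also the kernel of the restriction
   to the radical; this yields the second dimension formula \<open>d2\<close>.\<close>
 have iker': "i ` comp N j = {y\<in>rad P \<inter> comp P j. p y = \<zero>\<^bsub>M\<^esub>}" for j
  unfolding iker using cover_kernel_rad[OF M C] by (auto simp: a_kernel_iff comp_def)
 have idim: "kdim P (kact P) (i ` comp N j) = dd N j" for j
  unfolding dd_def
  by (rule kdim_inj[OF N.kspace_kact P.kspace_kact N.ksub_comp N.kfin_any[OF N'(2) N.ksub_comp]])
   (use i inj[of _ "\<zero>\<^bsub>N\<^esub>"] iz in \<open>auto simp: comp_def\<close>)
 have d1: "dd M j + dd N j = dd P j" if "j \<in> V" for j
 proof -
  have "kdim M (kact M) (p ` comp P j) + kdim P (kact P) {y\<in>comp P j. p y = \<zero>\<^bsub>M\<^esub>} = kdim P (kact P) (comp P j)"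
   by (rule kdim_rank_nullity[OF P.kspace_kact M.kspace_kact P.ksub_comp P.kfin_any[OF P'(2) P.ksub_comp]])
    (auto simp: comp_def p)
  then show ?thesis using idim[of j] by (simp add: comp_im[OF that] iker dd_def)
 qed
 have d2: "rr M j + dd N j = rr P j" for j
 proof -
  note k = P.K.ksub_Int[OF P.ksub_rad P.ksub_comp]
  have "kdim M (kact M) (p ` (rad P \<inter> comp P j)) + kdim P (kact P) {y\<in>rad P \<inter> comp P j. p y = \<zero>\<^bsub>M\<^esub>}
    = kdim P (kact P) (rad P \<inter> comp P j)"
   by (rule kdim_rank_nullity[OF P.kspace_kact M.kspace_kact k P.kfin_any[OF P'(2) k]])
    (auto simp: comp_def p)
  then show ?thesis using idim[of j] unfolding rad_im iker'[symmetric] rr_def by simp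
 qed
 show "dd N j + rr M j = (\<Sum>a\<in>{a\<in>E. tgt a = j}. dd M (src a) - rr M (src a))" if "j \<in> V"
 proof -
  have "dd N j + rr M j = (\<Sum>a\<in>{a\<in>E. tgt a = j}. dd P (src a) - rr P (src a))"
   using d2[of j] jflat_rr[OF P' projective_jflat[OF CD(1)], of j] by simp
  also have "\<dots> = (\<Sum>a\<in>{a\<in>E. tgt a = j}. dd M (src a) - rr M (src a))"
  proof (rule sum.cong[OF refl])
   fix a assume "a \<in> {a\<in>E. tgt a = j}"
   then show "dd P (src a) - rr P (src a) = dd M (src a) - rr M (src a)"
    using d1[OF srcV, of a] d2[of "src a"] by simp
  qed
  finally show ?thesis .
 qed
qed

text \<open>The kernel of a cover, with its inclusion, is a witness for the choice in
  \<open>syzygy\<close>; nothing else about the chosen module is used later.\<close>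

lemma syzygy_spec:
 assumes M: "M \<in> fgmod R"
 shows "syzygy R M \<in> fgmod R \<and> (\<exists>P i p. projective_cover R P p M \<and> short_exact R (syzygy R M) i P p M)"
 unfolding syzygy_def
proof (rule someI_ex)
 obtain P p where C: "projective_cover R P p M" by (rule cover_exists[OF M]) (rule that)
 note CD = coverD[OF C]
 let ?K = "P\<lparr>carrier := a_kernel P M p\<rparr>"
 have "?K \<in> fgmod R"
  by (rule fgmod_submod[OF CD(2) mhom_kernel_submod[OF fgD(1)[OF CD(2)] fgD(1)[OF M] CD(3)]])
 moreover have "short_exact R ?K (\<lambda>y. y) P p M"
  unfolding short_exact_def using CD by (auto simp: mhom_def hom_def a_kernel_iff)
 ultimately show "\<exists>N. N \<in> fgmod R \<and> (\<exists>P i p. projective_cover R P p M \<and> short_exact R N i P p M)"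
  using C by blast
qed

lemma syzygy_fg: "M \<in> fgmod R \<Longrightarrow> syzygy R M \<in> fgmod R"
 using syzygy_spec by blast

section \<open>The Grothendieck group\<close>

subsection \<open>Semisimple modules\<close>

text \<open>Semisimplicity is the condition MJ = 0, here in the form that the socle is
  everything.\<close>

definition semis :: "('a, 'b) module \<Rightarrow> bool"
 where "semis N \<longleftrightarrow> right_module R N \<and> fin_gen R N \<and> soc N = carrier N"

lemma semis_rad:
 assumes "semis N"
 shows "rad N = {\<zero>\<^bsub>N\<^esub>}" "rr N j = 0" "ss N j = dd N j"
proof -
 interpret N: rsz_module R V E src tgt ec xc N using assms by (intro rsz_moduleI) (simp add: semis_def)
 show r: "rad N = {\<zero>\<^bsub>N\<^esub>}"
 proof (intro equalityI subsetI)
  fix y assume "y \<in> rad N"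
  then obtain z where z: "z \<in> E \<rightarrow> carrier N" "y = finsum N (\<lambda>a. z a \<triangleleft>\<^bsub>N\<^esub> ar a) E" by (auto simp: rad_def)
  have "z a \<triangleleft>\<^bsub>N\<^esub> ar a = \<zero>\<^bsub>N\<^esub>" if "a \<in> E" for a
  proof -
   have "z a \<in> soc N" using z(1) that assms by (auto simp: semis_def)
   then show ?thesis using that by (simp add: soc_def)
  qed
  then show "y \<in> {\<zero>\<^bsub>N\<^esub>}" unfolding z(2) by (simp add: N.finsum_zero')
 qed (use N.K.ksubD(2)[OF N.ksub_rad] in simp)
 have "rad N \<inter> comp N j = {\<zero>\<^bsub>N\<^esub>}" using r N.comp_zero by auto
 then show "rr N j = 0" by (simp add: rr_def N.K.kdim_zero)
 have "soc N \<inter> comp N j = comp N j" using assms by (auto simp: semis_def comp_def)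
 then show "ss N j = dd N j" by (simp add: ss_def dd_def)
qed

lemma semis_miso:
 assumes N: "semis N" and N': "right_module R N'" and iso: "miso R N N'"
 shows "semis N'"
proof -
 have M: "right_module R N" "fin_gen R N" using N by (auto simp: semis_def)
 obtain f where f: "f \<in> mhom R N N'" "bij_betw f (carrier N) (carrier N')" using iso by (auto simp: miso_def)
 have "carrier N' \<subseteq> soc N'"
 proof
  fix y assume "y \<in> carrier N'"
  then obtain x where "x \<in> carrier N" "y = f x" using f(2) by (auto simp: bij_betw_def)
  then show "y \<in> soc N'" using mhom_soc[OF M(1) N' f(1), of x] N by (simp add: semis_def)
 qed
 then have "soc N' = carrier N'" by (auto simp: soc_def)
 then show ?thesis using miso_dims(4)[OF M N' iso] N' by (simp add: semis_def)
qed

lemma semis_msum: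
 assumes "right_module R M" "fin_gen R M" "right_module R N" "fin_gen R N"
 shows "semis (msum M N) \<longleftrightarrow> semis M \<and> semis N"
proof
 interpret M: rsz_module R V E src tgt ec xc M by (rule rsz_moduleI[OF assms(1)])
 interpret N: rsz_module R V E src tgt ec xc N by (rule rsz_moduleI[OF assms(3)])
 assume "semis (msum M N)"
 then have e: "soc M \<times> soc N = carrier M \<times> carrier N" by (simp add: semis_def msum_parts[OF assms(1,3)])
 have "soc M = carrier M" "soc N = carrier N"
  using e M.zero_closed N.zero_closed unfolding times_eq_iff by auto
 then show "semis M \<and> semis N" using assms by (simp add: semis_def)
next
 assume "semis M \<and> semis N"
 then show "semis (msum M N)"
  using assms right_module_msum[OF assms(1,3)] msum_dims(1)[OF assms] msum_parts[OF assms(1,3)]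
  by (simp add: semis_def)
qed

lemma syzygy_semis: "M \<in> fgmod R \<Longrightarrow> semis (syzygy R M)"
proof -
 assume M: "M \<in> fgmod R"
 note s = syzygy_spec[OF M]
 obtain P i p where "projective_cover R P p M" "short_exact R (syzygy R M) i P p M" using s by blast
 then show ?thesis using syzygy_dims_aux(1)[OF M] s fgD by (simp add: semis_def)
qed

lemma syzygy_dims:
 "M \<in> fgmod R \<Longrightarrow> j \<in> V \<Longrightarrow>
  dd (syzygy R M) j + rr M j = (\<Sum>a\<in>{a\<in>E. tgt a = j}. dd M (src a) - rr M (src a))"
 using syzygy_spec[of M] syzygy_dims_aux(3)[of M "syzygy R M"] by blast

subsection \<open>The simple modules\<close>

text \<open>One generator whose products with arrows are all declared zero: the simple module at
  \<open>i\<close>, on an explicit type before it is moved to \<open>fgmod\<close> as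
  \<open>sg\<close>.\<close>

definition pt :: "'v \<Rightarrow> ('a, unit + 'e \<times> unit \<Rightarrow> 'k) module"
 where "pt i = gmod {()} (\<lambda>_. i) {}"

lemma pt:
 assumes "i \<in> V"
 shows "ggood {()} (\<lambda>_. i) {}" "right_module R (pt i)" "fin_gen R (pt i)" "semis (pt i)"
  "dd (pt i) j = (if j = i then 1 else 0)"
proof -
 show g: "ggood {()} (\<lambda>_. i) {}" using assms by (simp add: ggood_def)
 show rm: "right_module R (pt i)" "fin_gen R (pt i)"
  unfolding pt_def by (rule gmod_module[OF g], rule gmod_fin_gen[OF g])
 have "soc (pt i) = carrier (pt i)"
  unfolding pt_def soc_def by (auto simp: gmod_acts[OF g] gmod_simps fun_eq_iff split: sum.splits)
 then show "semis (pt i)" using rm by (simp add: semis_def)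
 show "dd (pt i) j = (if j = i then 1 else 0)" unfolding pt_def by (simp add: gmod_dd[OF g])
qed

definition sg :: "'v \<Rightarrow> 'a umod"
 where "sg i = (SOME S. S \<in> fgmod R \<and> miso R (pt i) S)"

lemma sg:
 assumes "i \<in> V"
 shows "sg i \<in> fgmod R" "miso R (pt i) (sg i)" "semis (sg i)" "dd (sg i) j = (if j = i then 1 else 0)"
proof -
 have "sg i \<in> fgmod R \<and> miso R (pt i) (sg i)"
  unfolding sg_def by (rule someI_ex) (use ex_umod[OF pt(2,3)[OF assms]] in blast)
 then show 1: "sg i \<in> fgmod R" "miso R (pt i) (sg i)" by auto
 show "semis (sg i)" by (rule semis_miso[OF pt(4)[OF assms] fgD(1)[OF 1(1)] 1(2)])
 show "dd (sg i) j = (if j = i then 1 else 0)"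
  using miso_dims(1)[OF pt(2,3)[OF assms] fgD(1)[OF 1(1)] 1(2)] pt(5)[OF assms] by simp
qed

lemma projective_transport:
 assumes G: "ggood G v (fullD G v)" and P: "P \<in> fgmod R" and iso: "miso R (gmod G v (fullD G v)) P"
 shows "projective R P"
proof -
 let ?F = "gmod G v (fullD G v)"
 note F = gmod_module[OF G] gmod_fin_gen[OF G]
 obtain \<theta> where t: "\<theta> \<in> mhom R ?F P" "bij_betw \<theta> (carrier ?F) (carrier P)" using iso by (auto simp: miso_def)
 define \<eta> where "\<eta> = inv_into (carrier ?F) \<theta>"
 have h: "\<eta> \<in> mhom R P ?F" unfolding \<eta>_def by (rule mhom_inv[OF F(1) t])
 have th: "\<theta> (\<eta> y) = y" if "y \<in> carrier P" for y
  using t(2) that unfolding \<eta>_def by (auto simp: bij_betw_def f_inv_into_f)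
 show ?thesis
  unfolding projective_def
 proof (intro conjI ballI impI)
  fix A B g f assume A: "A \<in> fgmod R" and B: "B \<in> fgmod R" and g: "g \<in> mhom R A B" and f: "f \<in> mhom R P B"
   and s: "g ` carrier A = carrier B"
  obtain k where k: "k \<in> mhom R ?F A" "\<forall>y\<in>carrier ?F. g (k y) = f (\<theta> y)"
   by (rule bexE[OF gmod_lift[OF G fgD(1)[OF A] fgD(1)[OF B] g s mhom_compose[OF t(1) f]]]) (rule that)
  have "\<forall>y\<in>carrier P. g (k (\<eta> y)) = f y" using k(2) mhomD(1)[OF h] th by simp
  then show "\<exists>h\<in>mhom R P A. \<forall>y\<in>carrier P. g (h y) = f y"
   by (rule bexI[OF _ mhom_compose[OF h k(1)]])
 qed (rule P)
qed

text \<open>The vertices that are not sinks, equivalently those whose simple module is not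
  projective; these are the coordinates that K0 sees.\<close>

definition NS :: "'v set" where "NS = {i\<in>V. \<exists>a\<in>E. src a = i}"

lemma sg_projective: "i \<in> V \<Longrightarrow> i \<notin> NS \<Longrightarrow> projective R (sg i)"
proof -
 assume i: "i \<in> V" "i \<notin> NS"
 then have D: "fullD {()} (\<lambda>_. i) = {}" by (auto simp: fullD_def NS_def)
 show ?thesis
  by (rule projective_transport[of "{()}" "\<lambda>_. i"]) (use pt(1)[OF i(1)] sg(1,2)[OF i(1)] in \<open>simp_all add: D pt_def\<close>)
qed

text \<open>A functional on the component at \<open>i\<close> with value 1 at \<open>y\<close>,
  extended by zero to the other components, has a submodule as kernel because arrows act by zero.
  Sending \<open>z\<close> to its value and to \<open>z\<close> minus that multiple of
  \<open>y\<close> splits off the line of \<open>y\<close>.\<close>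

lemma semis_split:
 assumes N: "N \<in> fgmod R" "semis N" and i: "i \<in> V" and S: "S \<in> fgmod R" "semis S"
  and Sd: "\<And>j. j \<in> V \<Longrightarrow> dd S j = (if j = i then 1 else 0)" and pos: "dd N i > 0"
 obtains N' where "N' \<in> fgmod R" "miso R N (msum S N')"
proof -
 note N' = fgD[OF N(1)] and S' = fgD[OF S(1)]
 interpret N: rsz_module R V E src tgt ec xc N by (rule rsz_moduleI[OF N'(1)])
 interpret S: rsz_module R V E src tgt ec xc S by (rule rsz_moduleI[OF S'(1)])
 obtain y where y: "y \<in> comp N i" "y \<noteq> \<zero>\<^bsub>N\<^esub>" using pos dd_pos_iff[OF N'] by auto
 have yc: "y \<in> carrier N" using y(1) by (simp add: comp_def)
 obtain f where f: "f y = 1" "\<And>u v. u \<in> comp N i \<Longrightarrow> v \<in> comp N i \<Longrightarrow> f (u \<oplus>\<^bsub>N\<^esub> v) = f u + f v"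
  "\<And>c u. u \<in> comp N i \<Longrightarrow> f (kact N c u) = c * f u"
  by (rule N.K.functional_exists[OF N.ksub_comp N.kfin_any[OF N'(2) N.ksub_comp] y]) (rule that)
 have f0: "f \<zero>\<^bsub>N\<^esub> = 0" using f(3)[OF N.comp_zero, of 0] by simp
 define g where "g z = f (z \<triangleleft>\<^bsub>N\<^esub> e i)" for z
 have g: "g (u \<oplus>\<^bsub>N\<^esub> v) = g u + g v" "g (kact N c u) = c * g u" "j \<in> V \<Longrightarrow> g (u \<triangleleft>\<^bsub>N\<^esub> e j) = (if j = i then g u else 0)"
  if "u \<in> carrier N" "v \<in> carrier N" for u v c j
  using that i f f0 by (auto simp: g_def N.ract_add_left N.kact_ract N.e_act)
 have gy: "g y = 1" using y f by (simp add: g_def comp_def)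
 have g0: "g \<zero>\<^bsub>N\<^esub> = 0" by (simp add: g_def f0)
 define L where "L = {z\<in>carrier N. g z = 0}"
 have xz: "z \<triangleleft>\<^bsub>N\<^esub> ar a = \<zero>\<^bsub>N\<^esub>" if "z \<in> carrier N" "a \<in> E" for z a
 proof -
  have "z \<in> soc N" using that N(2) by (simp add: semis_def)
  then show ?thesis using that by (simp add: soc_def)
 qed
 have L: "submod R N L"
 proof (rule N.submodI)
  show "ksub N (kact N) L" using g g0 by (auto simp: ksub_def L_def)
 qed (use g g0 xz in \<open>auto simp: L_def\<close>)
 let ?L = "N\<lparr>carrier := L\<rparr>"
 have Lfg: "?L \<in> fgmod R" by (rule fgmod_submod[OF N(1) L])
 obtain t where t: "t \<in> comp S i" "t \<noteq> \<zero>\<^bsub>S\<^esub>" using Sd[OF i] dd_pos_iff[OF S', of i] by auto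
 have tc: "t \<in> carrier S" using t(1) by (simp add: comp_def)
 have te: "t \<triangleleft>\<^bsub>S\<^esub> e j = (if j = i then t else \<zero>\<^bsub>S\<^esub>)" if "j \<in> V" for j
  using t(1) S.comp_e_other[OF t(1) that] by (auto simp: comp_def)
 have tx: "t \<triangleleft>\<^bsub>S\<^esub> ar a = \<zero>\<^bsub>S\<^esub>" if "a \<in> E" for a
 proof -
  have "t \<in> soc S" using tc S(2) by (simp add: semis_def)
  then show ?thesis using that by (simp add: soc_def)
 qed
 have "range (\<lambda>c. kact S c t) = comp S i"
 proof (rule S.K.kdim_sub_eq[OF S.K.ksub_line[OF tc] S.ksub_comp S.kfin_any[OF S'(2) S.ksub_comp]])
  show "range (\<lambda>c. kact S c t) \<subseteq> comp S i" using S.K.ksubD(4)[OF S.ksub_comp t(1)] by auto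
  show "kdim S (kact S) (range (\<lambda>c. kact S c t)) = kdim S (kact S) (comp S i)"
   using S.K.kdim_line(1)[OF tc t(2)] Sd[OF i] by (simp add: dd_def)
 qed
 then have Sline: "\<exists>c. w = kact S c t" if w: "w \<in> carrier S" for w
 proof -
  have "w \<in> comp S i"
  proof (rule S.mem_by_comps[OF S.ksub_comp w])
   fix j assume j: "j \<in> V"
   show "w \<triangleleft>\<^bsub>S\<^esub> e j \<in> comp S i"
   proof (cases "j = i")
    case False
    then have "\<not> dd S j > 0" using Sd[OF j] by simp
    then have "w \<triangleleft>\<^bsub>S\<^esub> e j = \<zero>\<^bsub>S\<^esub>" using dd_pos_iff[OF S', of j] S.e_in_comp[OF w j] by auto
    then show ?thesis by (simp add: S.comp_zero)
   qed (use w j S.e_in_comp in auto)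
  qed
  then show ?thesis using \<open>range (\<lambda>c. kact S c t) = comp S i\<close> by blast
 qed
 define F where "F z = (kact S (g z) t, z \<ominus>\<^bsub>N\<^esub> kact N (g z) y)" for z
 have snd_in: "z \<ominus>\<^bsub>N\<^esub> kact N (g z) y \<in> L" if z: "z \<in> carrier N" for z
 proof -
  have "z \<ominus>\<^bsub>N\<^esub> kact N (g z) y = z \<oplus>\<^bsub>N\<^esub> kact N (- g z) y" using z yc by (simp add: a_minus_def N.K.s_minus)
  then show ?thesis using z yc g gy by (simp add: L_def)
 qed
 have Falt: "F z = (kact S (g z) t, z \<oplus>\<^bsub>N\<^esub> kact N (- g z) y)" for z
  using yc by (simp add: F_def a_minus_def N.K.s_minus)
 have "F \<in> mhom R N (msum S ?L)"
 proof (rule mhomI[OF N'(1) right_module_msum[OF S'(1) fgD(1)[OF Lfg]]])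
  fix z assume z: "z \<in> carrier N"
  show "F z \<in> carrier (msum S ?L)" using snd_in[OF z] tc by (simp add: F_def)
  show "F (kact N c z) = kact (msum S ?L) c (F z)" for c
   using z yc tc g by (simp add: Falt S.K.s_mult[symmetric] N.K.s_mult[symmetric] N.K.s_add)
  show "F (z \<triangleleft>\<^bsub>N\<^esub> ar a) = F z \<triangleleft>\<^bsub>msum S ?L\<^esub> ar a" if a: "a \<in> E" for a
   using z yc tc xz[OF _ a] tx[OF a] g0 a by (simp add: Falt N.ract_add_left N.kact_ract S.kact_ract)
  show "F (z \<triangleleft>\<^bsub>N\<^esub> e j) = F z \<triangleleft>\<^bsub>msum S ?L\<^esub> e j" if j: "j \<in> V" for j
  proof -
   have "y \<triangleleft>\<^bsub>N\<^esub> e j = (if j = i then y else \<zero>\<^bsub>N\<^esub>)"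
    using y(1) N.comp_e_other[OF y(1) j] by (auto simp: comp_def)
   then show ?thesis
    using z yc tc te[OF j] g(3)[OF z z j] j by (auto simp: Falt N.ract_add_left N.kact_ract S.kact_ract)
  qed
  fix z' assume z': "z' \<in> carrier N"
  have kN: "kact N (- (g z + g z')) y = kact N (- g z) y \<oplus>\<^bsub>N\<^esub> kact N (- g z') y"
   using N.K.s_add_left[OF yc, of "- g z" "- g z'"] by simp
  have kS: "kact S (g z + g z') t = kact S (g z) t \<oplus>\<^bsub>S\<^esub> kact S (g z') t" by (rule S.K.s_add_left[OF tc])
  have c: "kact N (- g z) y \<in> carrier N" "kact N (- g z') y \<in> carrier N" using yc by auto
  show "F (z \<oplus>\<^bsub>N\<^esub> z') = F z \<oplus>\<^bsub>msum S ?L\<^esub> F z'"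
   unfolding Falt g(1)[OF z z'] kN kS msum_simps using z z' c by (simp add: N.a_ac)
 qed
 moreover have "bij_betw F (carrier N) (carrier (msum S ?L))"
  unfolding bij_betw_def
 proof
  show "inj_on F (carrier N)"
  proof (rule inj_onI)
   fix z w assume zw: "z \<in> carrier N" "w \<in> carrier N" "F z = F w"
   have 1: "kact S (g z) t = kact S (g w) t" and 2: "z \<oplus>\<^bsub>N\<^esub> kact N (- g z) y = w \<oplus>\<^bsub>N\<^esub> kact N (- g w) y"
    using zw(3) by (auto simp: Falt)
   have "g z = g w"
   proof (rule ccontr)
    assume ne: "g z \<noteq> g w"
    have "kact S (g z - g w) t = \<zero>\<^bsub>S\<^esub>"
     using S.K.s_add_left[OF tc, of "g z" "- g w"] 1 tc by (simp add: S.K.s_minus S.r_neg)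
    then have "kact S (inverse (g z - g w) * (g z - g w)) t = \<zero>\<^bsub>S\<^esub>" by (simp only: S.K.s_mult[OF tc] S.K.s_zero)
    then show False using ne t S.K.s_one[OF tc] by simp
   qed
   then show "z = w" using 2 zw yc by simp
  qed
  show "F ` carrier N = carrier (msum S ?L)"
  proof (intro equalityI subsetI)
   fix q assume "q \<in> carrier (msum S ?L)"
   then obtain w l where q: "q = (w, l)" "w \<in> carrier S" "l \<in> L" by auto
   obtain c where c: "w = kact S c t" using Sline[OF q(2)] by blast
   have lc: "l \<in> carrier N" "g l = 0" using q(3) by (auto simp: L_def)
   have gz: "g (kact N c y \<oplus>\<^bsub>N\<^esub> l) = c" using lc yc g gy by simp
   have "(kact N c y \<oplus>\<^bsub>N\<^esub> l) \<oplus>\<^bsub>N\<^esub> kact N (- c) y = l"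
    using lc yc by (simp add: N.K.s_minus N.a_ac N.r_neg1 N.r_neg2 N.r_neg)
   then have "F (kact N c y \<oplus>\<^bsub>N\<^esub> l) = q" unfolding Falt gz using q c by simp
   moreover have "kact N c y \<oplus>\<^bsub>N\<^esub> l \<in> carrier N" using lc yc by simp
   ultimately show "q \<in> F ` carrier N" by blast
  qed (use snd_in tc in \<open>auto simp: F_def\<close>)
 qed
 ultimately have "miso R N (msum S ?L)" by (auto simp: miso_def)
 then show thesis by (rule that[OF Lfg])
qed

subsection \<open>Homomorphisms out of and into the Grothendieck group\<close>

abbreviation ic :: "'a umod \<Rightarrow> 'a umod set" where "ic \<equiv> iso_class R"
abbreviation GG where "GG \<equiv> K0_gens R"
abbreviation HH where "HH \<equiv> K0_rels R"
definition q :: "('a umod set \<Rightarrow>\<^sub>0 int) \<Rightarrow> ('a umod set \<Rightarrow>\<^sub>0 int) set" where "q f = HH #>\<^bsub>GG\<^esub> f"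

lemma GG: "group GG" "comm_group GG" "x \<in> carrier GG \<longleftrightarrow> Poly_Mapping.keys x \<subseteq> ic ` fgmod R"
 "\<one>\<^bsub>GG\<^esub> = 0" "x \<otimes>\<^bsub>GG\<^esub> y = x + y"
 unfolding K0_gens_def by (simp_all add: abelian_free_Abelian_group)

lemma GG_closed: "x \<in> carrier GG \<Longrightarrow> y \<in> carrier GG \<Longrightarrow> x + y \<in> carrier GG"
 "x \<in> carrier GG \<Longrightarrow> - x \<in> carrier GG" "x \<in> carrier GG \<Longrightarrow> y \<in> carrier GG \<Longrightarrow> x - y \<in> carrier GG"
 "0 \<in> carrier GG" "M \<in> fgmod R \<Longrightarrow> frag_of (ic M) \<in> carrier GG"
 "x \<in> carrier GG \<Longrightarrow> frag_cmul c x \<in> carrier GG"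
 using keys_add[of x y] keys_diff[of x y] keys_cmul[of c x] unfolding GG(3) by (auto simp: keys_minus)

lemma GG_inv: "x \<in> carrier GG \<Longrightarrow> inv\<^bsub>GG\<^esub> x = - x"
 unfolding K0_gens_def by simp

definition Rels :: "('a umod set \<Rightarrow>\<^sub>0 int) set"
 where "Rels = {frag_of (ic M) - frag_of (ic M') - frag_of (ic M'') | M M' M''.
    M \<in> fgmod R \<and> M' \<in> fgmod R \<and> M'' \<in> fgmod R \<and> miso R M (msum M' M'')}
   \<union> {frag_of (ic P) | P. projective R P}"

lemma HH_gen: "HH = generate GG Rels" by (simp add: K0_rels_def Rels_def)

lemma Rels_sub: "Rels \<subseteq> carrier GG"
 unfolding Rels_def by (auto intro!: GG_closed simp: projective_def)

lemma HH_normal: "HH \<lhd> GG" "subgroup HH GG"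
proof -
 show s: "subgroup HH GG" unfolding HH_gen by (rule group.generate_is_subgroup[OF GG(1) Rels_sub])
 show "HH \<lhd> GG" by (rule comm_group.normal_iff_subgroup[OF GG(2), THEN iffD2, OF s])
qed

lemma K0_group: "group (K0 R)" unfolding K0_def by (rule normal.factorgroup_is_group[OF HH_normal(1)])

lemma K0_carrier: "X \<in> carrier (K0 R) \<longleftrightarrow> (\<exists>f\<in>carrier GG. X = q f)"
 unfolding K0_def FactGroup_def RCOSETS_def q_def by auto

lemma q_closed: "f \<in> carrier GG \<Longrightarrow> q f \<in> carrier (K0 R)" using K0_carrier by blast

lemma q_add: "f \<in> carrier GG \<Longrightarrow> g \<in> carrier GG \<Longrightarrow> q (f + g) = q f \<otimes>\<^bsub>K0 R\<^esub> q g"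
 unfolding K0_def FactGroup_def q_def using normal.rcos_sum[OF HH_normal(1), of f g] by (simp add: GG)

lemma q_one: "q 0 = \<one>\<^bsub>K0 R\<^esub>"
 unfolding K0_def FactGroup_def q_def
 using group.coset_mult_one[OF GG(1), of HH] subgroup.subset[OF HH_normal(2)] by (simp add: GG)

lemma q_eq_one: "f \<in> carrier GG \<Longrightarrow> q f = \<one>\<^bsub>K0 R\<^esub> \<longleftrightarrow> f \<in> HH"
proof -
 assume f: "f \<in> carrier GG"
 have o: "\<one>\<^bsub>K0 R\<^esub> = HH" by (simp add: K0_def FactGroup_def)
 show ?thesis unfolding o q_def
  using group.coset_join1[OF GG(1), of HH f] group.coset_join2[OF GG(1), of f HH] f HH_normal(2) by blast
qed

lemma q_hom: "q \<in> hom GG (K0 R)" by (auto simp: hom_def q_closed q_add GG(5))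

lemma q_minus: "f \<in> carrier GG \<Longrightarrow> q (- f) = inv\<^bsub>K0 R\<^esub> q f"
 using group_hom.hom_inv[OF group_hom.intro[OF GG(1) K0_group group_hom_axioms.intro[OF q_hom]], of f]
 by (simp add: GG_inv)

lemma q_eq_iff:
 assumes "f \<in> carrier GG" "g \<in> carrier GG"
 shows "q f = q g \<longleftrightarrow> f - g \<in> HH"
proof -
 interpret K: group "K0 R" by (rule K0_group)
 have "q (f - g) = q f \<otimes>\<^bsub>K0 R\<^esub> inv\<^bsub>K0 R\<^esub> q g"
  using q_add[of f "- g"] q_minus assms GG_closed(2) by simp
 then have "f - g \<in> HH \<longleftrightarrow> q f \<otimes>\<^bsub>K0 R\<^esub> inv\<^bsub>K0 R\<^esub> q g = \<one>\<^bsub>K0 R\<^esub>"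
  using q_eq_one[of "f - g"] assms GG_closed(3) by simp
 also have "\<dots> \<longleftrightarrow> q f = q g"
  using q_closed assms K.inv_closed K.inv_equality K.inv_inv K.r_inv by (metis K.inv_solve_right' K.l_one K.one_closed)
 finally show ?thesis by simp
qed

lemma cls_q: "K0_class R M = q (frag_of (ic M))" by (simp add: K0_class_def q_def)

lemma cls_closed: "M \<in> fgmod R \<Longrightarrow> K0_class R M \<in> carrier (K0 R)"
 by (simp add: cls_q q_closed GG_closed)

lemma cls_msum:
 assumes "M \<in> fgmod R" "M' \<in> fgmod R" "M'' \<in> fgmod R" "miso R M (msum M' M'')"
 shows "K0_class R M = K0_class R M' \<otimes>\<^bsub>K0 R\<^esub> K0_class R M''"
proof -
 have "frag_of (ic M) - (frag_of (ic M') + frag_of (ic M'')) \<in> Rels"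
  unfolding Rels_def using assms by (auto simp: algebra_simps)
 then have "frag_of (ic M) - (frag_of (ic M') + frag_of (ic M'')) \<in> HH"
  unfolding HH_gen by (rule generate.incl)
 then show ?thesis unfolding cls_q
  using q_eq_iff[of "frag_of (ic M)" "frag_of (ic M') + frag_of (ic M'')"] q_add assms GG_closed by simp
qed

text \<open>An additive invariant of modules is extended to the Grothendieck group by evaluating it on
 representatives.\<close>

definition ainv :: "('a umod \<Rightarrow> int) \<Rightarrow> bool"
 where "ainv \<mu> \<longleftrightarrow> (\<forall>M\<in>fgmod R. \<forall>N\<in>fgmod R. miso R M N --> \<mu> M = \<mu> N) \<and>
  (\<forall>M\<in>fgmod R. \<forall>N\<in>fgmod R. \<forall>N'\<in>fgmod R. miso R M (msum N N') --> \<mu> M = \<mu> N + \<mu> N') \<and>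
  (\<forall>P. projective R P --> \<mu> P = 0)"

text \<open>The target of \<open>frag_extend\<close> is a free abelian group; the one on a single
  generator stands for the integers, and \<open>lookup\<close> reads off the number.\<close>

definition evf :: "('a umod \<Rightarrow> int) \<Rightarrow> ('a umod set \<Rightarrow>\<^sub>0 int) \<Rightarrow> int"
 where "evf \<mu> f = Poly_Mapping.lookup
  (frag_extend (\<lambda>C. frag_cmul (\<mu> (SOME M. M \<in> C)) (frag_of ())) f) ()"

lemma evf: "evf \<mu> (f + g) = evf \<mu> f + evf \<mu> g" "evf \<mu> (- f) = - evf \<mu> f" "evf \<mu> 0 = 0"
 "evf \<mu> (f - g) = evf \<mu> f - evf \<mu> g"
 by (simp_all add: evf_def frag_extend_add frag_extend_minus frag_extend_diff lookup_add lookup_minus)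

lemma evf_cls: "ainv \<mu> \<Longrightarrow> M \<in> fgmod R \<Longrightarrow> evf \<mu> (frag_of (ic M)) = \<mu> M"
proof -
 assume a: "ainv \<mu>" and M: "M \<in> fgmod R"
 define N where "N = (SOME N. N \<in> ic M)"
 have "N \<in> ic M" unfolding N_def by (rule someI[of _ M]) (simp add: iso_class_def M miso_refl)
 then have "N \<in> fgmod R" "miso R M N" by (auto simp: iso_class_def)
 then have "\<mu> M = \<mu> N" using a M unfolding ainv_def by simp
 then have "\<mu> (SOME N. N \<in> ic M) = \<mu> M" by (simp add: N_def)
 then show ?thesis by (simp add: evf_def)
qed

lemma evf_HH: "ainv \<mu> \<Longrightarrow> h \<in> HH \<Longrightarrow> evf \<mu> h = 0"
proof -
 assume a: "ainv \<mu>" and h: "h \<in> HH"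
 have R0: "evf \<mu> h = 0" if "h \<in> Rels" for h
  using that a evf_cls[OF a] by (auto simp: Rels_def evf ainv_def projective_def)
 from h have "h \<in> generate GG Rels" by (simp add: HH_gen)
 then show ?thesis
 proof (induct rule: generate.induct)
  case (inv h) then show ?case using Rels_sub R0 GG_inv[of h] by (auto simp: evf)
 qed (auto simp: GG evf R0)
qed

definition klift :: "('a umod \<Rightarrow> int) \<Rightarrow> ('a umod set \<Rightarrow>\<^sub>0 int) set \<Rightarrow> int"
 where "klift \<mu> X = evf \<mu> (SOME f. f \<in> carrier GG \<and> X = q f)"

lemma klift_q: "ainv \<mu> \<Longrightarrow> f \<in> carrier GG \<Longrightarrow> klift \<mu> (q f) = evf \<mu> f"
proof -
 assume a: "ainv \<mu>" and f: "f \<in> carrier GG"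
 define g where "g = (SOME g. g \<in> carrier GG \<and> q f = q g)"
 have g: "g \<in> carrier GG \<and> q f = q g" unfolding g_def by (rule someI[of _ f]) (simp add: f)
 then have "f - g \<in> HH" using q_eq_iff f by blast
 then have "evf \<mu> (f - g) = 0" by (rule evf_HH[OF a])
 then show ?thesis by (simp add: klift_def g_def evf)
qed

lemma klift_mult:
 "ainv \<mu> \<Longrightarrow> X \<in> carrier (K0 R) \<Longrightarrow> Y \<in> carrier (K0 R) \<Longrightarrow> klift \<mu> (X \<otimes>\<^bsub>K0 R\<^esub> Y) = klift \<mu> X + klift \<mu> Y"
 unfolding K0_carrier by (auto simp: q_add[symmetric] klift_q GG_closed evf)

lemma klift_cls: "ainv \<mu> \<Longrightarrow> M \<in> fgmod R \<Longrightarrow> klift \<mu> (K0_class R M) = \<mu> M"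
 by (simp add: cls_q klift_q GG_closed evf_cls)

text \<open>\<open>om\<close> measures one step of Omega. \<open>mu j\<close> is the dimension of
  soc M modulo MJ at \<open>j\<close>, the multiplicity of the simple module at \<open>j\<close> as
  a direct summand. The first describes Omega-bar, the second separates the classes of simple
  modules.\<close>

definition om :: "'v \<Rightarrow> 'a umod \<Rightarrow> int" where "om j M = int (dd (syzygy R M) j)"
definition mu :: "'v \<Rightarrow> 'a umod \<Rightarrow> int" where "mu j M = int (ss M j) - int (rr M j)"

lemma om_eq:
 assumes "M \<in> fgmod R" "j \<in> V"
 shows "om j M = (\<Sum>a\<in>{a\<in>E. tgt a = j}. int (dd M (src a)) - int (rr M (src a))) - int (rr M j)"
proof -
 have "int (dd (syzygy R M) j) + int (rr M j) = int (\<Sum>a\<in>{a\<in>E. tgt a = j}. dd M (src a) - rr M (src a))"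
  using syzygy_dims[OF assms] by (metis of_nat_add)
 also have "\<dots> = (\<Sum>a\<in>{a\<in>E. tgt a = j}. int (dd M (src a)) - int (rr M (src a)))"
  using rr_le_dd(1)[OF fgD[OF assms(1)]] by (simp add: of_nat_diff)
 finally show ?thesis by (simp add: om_def)
qed

text \<open>By \<open>om_eq\<close> the dimension of the syzygy is linear in \<open>dd\<close> and
  \<open>rr\<close>, hence additive, and its vanishing on projectives is
  \<open>jflat_rr\<close>.\<close>

lemma ainv_om: "j \<in> V \<Longrightarrow> ainv (om j)"
 unfolding ainv_def
proof (intro conjI ballI allI impI)
 assume j: "j \<in> V"
 {
  fix M N assume "M \<in> fgmod R" "N \<in> fgmod R" "miso R M N"
  then show "om j M = om j N" using miso_dims[OF fgD, of M N] fgD(1)[of N] by (simp add: om_eq j)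
 next
  fix M N N' assume a: "M \<in> fgmod R" "N \<in> fgmod R" "N' \<in> fgmod R" "miso R M (msum N N')"
  have d: "dd M i = dd N i + dd N' i" "rr M i = rr N i + rr N' i" for i
   using miso_dims(1,2)[OF fgD[OF a(1)] right_module_msum[OF fgD(1)[OF a(2)] fgD(1)[OF a(3)]] a(4)]
    msum_dims(2,3)[OF fgD[OF a(2)] fgD[OF a(3)]] by simp_all
  show "om j M = om j N + om j N'" using a(1-3) j
   by (simp add: om_eq d sum.distrib[symmetric] algebra_simps)
 next
  fix P assume P: "projective R P"
  then have fg: "P \<in> fgmod R" by (simp add: projective_def)
  have "int (rr P j) = int (\<Sum>a\<in>{a\<in>E. tgt a = j}. dd P (src a) - rr P (src a))"
   using jflat_rr[OF fgD[OF fg] projective_jflat[OF P], of j] by simp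
  also have "\<dots> = (\<Sum>a\<in>{a\<in>E. tgt a = j}. int (dd P (src a)) - int (rr P (src a)))"
   using rr_le_dd(1)[OF fgD[OF fg]] by (simp add: of_nat_diff)
  finally show "om j P = 0" using om_eq[OF fg j] by simp
 }
qed

text \<open>In a projective, an element of the socle at \<open>j\<close> is killed by an arrow
  starting at \<open>j\<close>, so flatness puts it into the radical. At a sink the simple module is
  projective and would give the value 1.\<close>

lemma ainv_mu: "j \<in> NS \<Longrightarrow> ainv (mu j)"
 unfolding ainv_def
proof (intro conjI ballI allI impI)
 assume j: "j \<in> NS"
 {
  fix M N assume "M \<in> fgmod R" "N \<in> fgmod R" "miso R M N"
  then show "mu j M = mu j N" using miso_dims[OF fgD, of M N] fgD(1)[of N] by (simp add: mu_def)
 next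
  fix M N N' assume a: "M \<in> fgmod R" "N \<in> fgmod R" "N' \<in> fgmod R" "miso R M (msum N N')"
  have d: "ss M i = ss N i + ss N' i" "rr M i = rr N i + rr N' i" for i
   using miso_dims(2,3)[OF fgD[OF a(1)] right_module_msum[OF fgD(1)[OF a(2)] fgD(1)[OF a(3)]] a(4)]
    msum_dims(3,4)[OF fgD[OF a(2)] fgD[OF a(3)]] by simp_all
  show "mu j M = mu j N + mu j N'" by (simp add: mu_def d)
 next
  fix P assume P: "projective R P"
  then have fg: "P \<in> fgmod R" by (simp add: projective_def)
  interpret P: rsz_module R V E src tgt ec xc P by (rule fg_rsz_module[OF fg])
  obtain b where b: "b \<in> E" "src b = j" using j by (auto simp: NS_def)
  have "y \<in> rad P" if y: "y \<in> soc P" "y \<in> comp P j" for y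
  proof -
   let ?z = "\<lambda>a. if a = b then y else \<zero>\<^bsub>P\<^esub>"
   have "finsum P (\<lambda>a. ?z a \<triangleleft>\<^bsub>P\<^esub> ar a) E = \<zero>\<^bsub>P\<^esub>"
    using y(1) by (intro P.finsum_zero') (auto simp: soc_def)
   moreover have "\<forall>a\<in>E. ?z a \<in> comp P (src a)" using y(2) b P.comp_zero by simp
   ultimately have "\<forall>a\<in>E. ?z a \<in> rad P" using projective_jflat[OF P, unfolded jflat_def, THEN spec, of ?z] by simp
   then show ?thesis using b by force
  qed
  then have "soc P \<inter> comp P j = rad P \<inter> comp P j" using P.rad_soc by auto
  then show "mu j P = 0" by (simp add: mu_def ss_def rr_def)
 }
qed

section \<open>Coordinates with respect to the classes of the simple modules\<close>

definition sig :: "('v \<Rightarrow> int) \<Rightarrow> ('a umod set \<Rightarrow>\<^sub>0 int) set"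
 where "sig a = q (\<Sum>j\<in>V. frag_cmul (a j) (frag_of (ic (sg j))))"

definition omv :: "('a umod set \<Rightarrow>\<^sub>0 int) set \<Rightarrow> 'v \<Rightarrow> int"
 where "omv X = (\<lambda>j. if j \<in> V then klift (om j) X else 0)"

text \<open>The transposed adjacency matrix, arrows counted with multiplicity, still on all
  vertices; the sinks are removed later in \<open>Tr\<close>.\<close>

definition Tv :: "('v \<Rightarrow> int) \<Rightarrow> 'v \<Rightarrow> int"
 where "Tv f = (\<lambda>j. if j \<in> V then \<Sum>a\<in>{a\<in>E. tgt a = j}. f (src a) else 0)"

lemma sig_in: "(\<Sum>j\<in>J. frag_cmul (a j) (frag_of (ic (sg j)))) \<in> carrier GG" if "J \<subseteq> V"
 unfolding K0_gens_def using that GG_closed(5,6)[unfolded K0_gens_def] sg(1)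
 by (intro sum_closed_free_Abelian_group) auto

lemma sig_closed: "sig a \<in> carrier (K0 R)" by (simp add: sig_def q_closed sig_in)

lemma sig_add: "sig (\<lambda>j. a j + b j) = sig a \<otimes>\<^bsub>K0 R\<^esub> sig b"
 unfolding sig_def by (subst q_add[symmetric]) (simp_all add: sig_in frag_cmul_distrib sum.distrib)

lemma sig_cong: "(\<And>j. j \<in> V \<Longrightarrow> a j = b j) \<Longrightarrow> sig a = sig b" by (simp add: sig_def)

lemma sig_zero: "sig (\<lambda>_. 0) = \<one>\<^bsub>K0 R\<^esub>" by (simp add: sig_def q_one)

lemma klift_sig:
 assumes "ainv \<mu>"
 shows "klift \<mu> (sig a) = (\<Sum>j\<in>V. a j * \<mu> (sg j))"
proof -
 have "evf \<mu> (\<Sum>j\<in>J. frag_cmul (a j) (frag_of (ic (sg j)))) = (\<Sum>j\<in>J. a j * \<mu> (sg j))" if "finite J" "J \<subseteq> V" for J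
  using that
 proof (induct J)
  case (insert j J)
  have "evf \<mu> (frag_cmul (a j) (frag_of (ic (sg j)))) = a j * evf \<mu> (frag_of (ic (sg j)))"
   by (simp add: evf_def frag_extend_cmul)
  then show ?case using insert assms sg(1)[of j] by (simp add: evf evf_cls)
 qed (simp add: evf)
 then show ?thesis unfolding sig_def using assms sig_in[OF order_refl] finV by (simp add: klift_q)
qed

lemma mu_sig: "i \<in> NS \<Longrightarrow> klift (mu i) (sig a) = a i"
proof -
 assume i: "i \<in> NS"
 then have iV: "i \<in> V" by (simp add: NS_def)
 have "(\<Sum>j\<in>V. a j * mu i (sg j)) = (\<Sum>j\<in>V. if j = i then a j else 0)"
  by (rule sum.cong) (auto simp: mu_def semis_rad[OF sg(3)] sg(4))
 then show ?thesis using iV finV by (simp add: klift_sig[OF ainv_mu[OF i]])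
qed

lemma omv_sig: "omv (sig a) = Tv a"
proof
 fix i
 have "(\<Sum>j\<in>V. a j * om i (sg j)) = (\<Sum>b\<in>{b\<in>E. tgt b = i}. a (src b))" if i: "i \<in> V"
 proof -
  have "(\<Sum>j\<in>V. a j * om i (sg j)) = (\<Sum>j\<in>V. \<Sum>b\<in>{b\<in>E. tgt b = i}. if src b = j then a j else 0)"
  proof (rule sum.cong[OF refl])
   fix j assume j: "j \<in> V"
   have "om i (sg j) = (\<Sum>b\<in>{b\<in>E. tgt b = i}. int (if src b = j then 1 else 0))"
    by (simp only: om_eq[OF sg(1)[OF j] i] semis_rad(2)[OF sg(3)[OF j]] sg(4)[OF j] of_nat_0 diff_zero)
   then have "a j * om i (sg j) = (\<Sum>b\<in>{b\<in>E. tgt b = i}. a j * int (if src b = j then 1 else 0))"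
    by (simp only: sum_distrib_left)
   also have "\<dots> = (\<Sum>b\<in>{b\<in>E. tgt b = i}. if src b = j then a j else 0)"
    by (rule sum.cong) auto
   finally show "a j * om i (sg j) = (\<Sum>b\<in>{b\<in>E. tgt b = i}. if src b = j then a j else 0)" .
  qed
  also have "\<dots> = (\<Sum>b\<in>{b\<in>E. tgt b = i}. \<Sum>j\<in>V. if src b = j then a j else 0)" by (rule sum.swap)
  also have "\<dots> = (\<Sum>b\<in>{b\<in>E. tgt b = i}. a (src b))"
   using finV srcV by (intro sum.cong) auto
  finally show ?thesis .
 qed
 then show "omv (sig a) i = Tv a i" by (simp add: omv_def Tv_def klift_sig[OF ainv_om])
qed

lemma dd_outside: "M \<in> fgmod R \<Longrightarrow> j \<notin> V \<Longrightarrow> dd M j = 0"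
proof -
 assume M: "M \<in> fgmod R" and j: "j \<notin> V"
 interpret M: rsz_module R V E src tgt ec xc M by (rule fg_rsz_module[OF M])
 have "e j = \<zero>\<^bsub>R\<^esub>" using j by (intro coord_inj) auto
 then have "comp M j = {\<zero>\<^bsub>M\<^esub>}" by (auto simp: comp_def)
 then show ?thesis by (simp add: dd_def M.K.kdim_zero)
qed

text \<open>Simple modules are split off one at a time, with the total dimension as measure.\<close>

lemma semis_cls:
 assumes "N \<in> fgmod R" "semis N"
 shows "K0_class R N = sig (\<lambda>j. int (dd N j))"
 using assms
proof (induct "\<Sum>j\<in>V. dd N j" arbitrary: N rule: less_induct)
 case less
 show ?case
 proof (cases "\<forall>j\<in>V. dd N j = 0")
  case True
  then have "carrier N = {\<zero>\<^bsub>N\<^esub>}" using carrier_zero_iff fgD less by blast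
  \<comment> \<open>The zero module is isomorphic to its double, so its class is idempotent and
    hence trivial.\<close>
  then have z: "miso R N (msum N N)"
   using mhom_msum(3)[OF fgD(1) fgD(1), OF less.prems(1) less.prems(1)]
   unfolding miso_def by (intro bexI) (auto simp: bij_betw_def)
  interpret K: group "K0 R" by (rule K0_group)
  have "K0_class R N = K0_class R N \<otimes>\<^bsub>K0 R\<^esub> K0_class R N" using cls_msum[OF _ _ _ z] less.prems(1) by simp
  then have "K0_class R N = \<one>\<^bsub>K0 R\<^esub>" using cls_closed[OF less.prems(1)] K.r_cancel_one' by metis
  moreover have "sig (\<lambda>j. int (dd N j)) = sig (\<lambda>_. 0)" using True by (intro sig_cong) simp
  ultimately show ?thesis by (simp add: sig_zero)
 next
  case False
  then obtain i where i: "i \<in> V" "dd N i > 0" by auto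
  obtain N' where N': "N' \<in> fgmod R" "miso R N (msum (sg i) N')"
   by (rule semis_split[OF less.prems i(1) sg(1,3)[OF i(1)] sg(4)[OF i(1)] i(2)]) (rule that)
  note s = sg[OF i(1)]
  have sm: "semis (msum (sg i) N')"
   by (rule semis_miso[OF less.prems(2) right_module_msum[OF fgD(1)[OF s(1)] fgD(1)[OF N'(1)]] N'(2)])
  then have sN: "semis N'" using semis_msum[OF fgD[OF s(1)] fgD[OF N'(1)]] by simp
  have d: "dd N j = (if j = i then 1 else 0) + dd N' j" for j
   using miso_dims(1)[OF fgD[OF less.prems(1)] right_module_msum[OF fgD(1)[OF s(1)] fgD(1)[OF N'(1)]] N'(2), of j]
    msum_dims(2)[OF fgD[OF s(1)] fgD[OF N'(1)], of j] s(4)[of j] by simp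
  have "(\<Sum>j\<in>V. dd N' j) < (\<Sum>j\<in>V. dd N j)" using i(1) finV by (simp add: d sum.distrib)
  then have IH: "K0_class R N' = sig (\<lambda>j. int (dd N' j))" using less.hyps N'(1) sN by blast
  have "K0_class R (sg i) = sig (\<lambda>j. if j = i then 1 else 0)"
  proof -
   have "(\<Sum>j\<in>V. frag_cmul (if j = i then 1 else 0) (frag_of (ic (sg j)))) = (\<Sum>j\<in>V. if j = i then frag_of (ic (sg j)) else 0)"
    by (rule sum.cong) auto
   then show ?thesis using i(1) finV by (simp add: sig_def cls_q)
  qed
  then have "K0_class R N = sig (\<lambda>j. (if j = i then 1 else 0) + int (dd N' j))"
   using cls_msum[OF less.prems(1) s(1) N'] IH by (simp add: sig_add)
  also have "\<dots> = sig (\<lambda>j. int (dd N j))" by (rule sig_cong) (simp add: d)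
  finally show ?thesis .
 qed
qed

text \<open>The simple modules at sinks are projective, so their multiples lie in the relations and
  drop out.\<close>

lemma sig_NS_cong:
 assumes "\<And>i. i \<in> NS \<Longrightarrow> a i = b i"
 shows "sig a = sig b"
proof -
 have NSV: "NS \<subseteq> V" by (auto simp: NS_def)
 have split: "q (\<Sum>j\<in>V. frag_cmul (a j) (frag_of (ic (sg j)))) = q (\<Sum>j\<in>NS. frag_cmul (a j) (frag_of (ic (sg j))))" for a
 proof -
  have "frag_of (ic (sg j)) \<in> HH" if "j \<in> V - NS" for j
   using that sg_projective[of j] unfolding HH_gen by (intro generate.incl) (auto simp: Rels_def)
  note rel = this
  have HHs: "x \<in> HH \<Longrightarrow> y \<in> HH \<Longrightarrow> x + y \<in> HH" "x \<in> HH \<Longrightarrow> - x \<in> HH" "0 \<in> HH" for x y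
   using subgroup.m_closed[OF HH_normal(2), of x y] subgroup.m_inv_closed[OF HH_normal(2), of x]
    subgroup.one_closed[OF HH_normal(2)] GG_inv[of x] subgroup.mem_carrier[OF HH_normal(2), of x] by (auto simp: GG)
  have cm: "frag_cmul c x \<in> HH" if "x \<in> HH" for c x
  proof -
   have n: "frag_cmul (int n) x \<in> HH" for n
    by (induct n) (use that HHs in \<open>auto simp: frag_cmul_distrib\<close>)
   show ?thesis
   proof (cases "c \<ge> 0")
    case True then show ?thesis using n[of "nat c"] by simp
   next
    case False then show ?thesis using HHs(2)[OF n[of "nat (- c)"]] by simp
   qed
  qed
  have "(\<Sum>j\<in>J. frag_cmul (a j) (frag_of (ic (sg j)))) \<in> HH" if "finite J" "J \<subseteq> V - NS" for J
   using that by (induct J) (auto intro!: HHs cm rel)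
  from this[of "V - NS"] have "(\<Sum>j\<in>V - NS. frag_cmul (a j) (frag_of (ic (sg j)))) \<in> HH" using finV by simp
  moreover have "(\<Sum>j\<in>V. frag_cmul (a j) (frag_of (ic (sg j)))) - (\<Sum>j\<in>NS. frag_cmul (a j) (frag_of (ic (sg j))))
    = (\<Sum>j\<in>V - NS. frag_cmul (a j) (frag_of (ic (sg j))))"
   using sum.subset_diff[OF NSV finV] by (simp add: algebra_simps)
  ultimately show ?thesis using q_eq_iff sig_in NSV by simp
 qed
 show ?thesis unfolding sig_def split using assms by (metis (no_types, lifting) sum.cong)
qed

text \<open>The classes of the simple modules at nonsinks are independent, since \<open>mu i\<close>
  recovers their coefficients. From here on Omega-bar is studied on integer vectors over
  \<open>NS\<close>.\<close>

lemma sig_eq_iff: "sig a = sig b \<longleftrightarrow> (\<forall>i\<in>NS. a i = b i)"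
 using mu_sig sig_NS_cong by metis

lemma K0_hom_eq:
 assumes h: "h \<in> hom (K0 R) (K0 R)" and g: "g \<in> hom (K0 R) (K0 R)"
  and eq: "\<And>M. M \<in> fgmod R \<Longrightarrow> h (K0_class R M) = g (K0_class R M)" and X: "X \<in> carrier (K0 R)"
 shows "h X = g X"
proof -
 interpret K: group "K0 R" by (rule K0_group)
 interpret h: group_hom "K0 R" "K0 R" h by unfold_locales (rule h)
 interpret g: group_hom "K0 R" "K0 R" g by unfold_locales (rule g)
 obtain f where f: "f \<in> carrier GG" "X = q f" using X K0_carrier by blast
 have "Poly_Mapping.keys f \<subseteq> ic ` fgmod R" using f(1) by (simp add: GG(3))
 then have "h (q f) = g (q f)"
 proof (induct rule: free_Abelian_group_induct[consumes 1, case_names zero diff gen])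
  case zero show ?case by (simp add: q_one)
 next
  case (diff x y)
  then have c: "x \<in> carrier GG" "y \<in> carrier GG" unfolding GG(3) by blast+
  have "q (x - y) = q x \<otimes>\<^bsub>K0 R\<^esub> inv\<^bsub>K0 R\<^esub> q y" using q_add[OF c(1) GG_closed(2)[OF c(2)]] q_minus[OF c(2)] by simp
  then show ?case using diff c q_closed by simp
 next
  case (gen a) then show ?case using eq by (auto simp: cls_q)
 qed
 then show ?thesis by (simp add: f)
qed

text \<open>The explicit map is a homomorphism with the required values, so the choice defining
  \<open>Omega_bar\<close> can be met; homomorphisms agreeing on the classes of modules are equal
  because these classes generate.\<close>

lemma Omega_bar_eq:
 "X \<in> carrier (K0 R) \<Longrightarrow> Omega_bar R X = sig (omv X)"
proof -
 let ?h = "\<lambda>X. sig (omv X)"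
 have h: "?h \<in> hom (K0 R) (K0 R)"
  unfolding hom_def
 proof (intro CollectI conjI ballI funcsetI)
  fix X Y assume XY: "X \<in> carrier (K0 R)" "Y \<in> carrier (K0 R)"
  have "sig (omv (X \<otimes>\<^bsub>K0 R\<^esub> Y)) = sig (\<lambda>j. omv X j + omv Y j)"
   using XY by (intro sig_cong) (simp add: omv_def klift_mult[OF ainv_om])
  then show "sig (omv (X \<otimes>\<^bsub>K0 R\<^esub> Y)) = sig (omv X) \<otimes>\<^bsub>K0 R\<^esub> sig (omv Y)" by (simp add: sig_add)
 qed (simp add: sig_closed)
 have hc: "?h (K0_class R M) = K0_class R (syzygy R M)" if M: "M \<in> fgmod R" for M
 proof -
  have "K0_class R (syzygy R M) = sig (\<lambda>j. int (dd (syzygy R M) j))"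
   by (rule semis_cls[OF syzygy_fg[OF M] syzygy_semis[OF M]])
  also have "\<dots> = ?h (K0_class R M)"
   using M by (intro sig_cong) (simp add: omv_def klift_cls[OF ainv_om] om_def)
  finally show ?thesis by simp
 qed
 have O: "Omega_bar R \<in> hom (K0 R) (K0 R) \<and> (\<forall>M\<in>fgmod R. Omega_bar R (K0_class R M) = K0_class R (syzygy R M))"
  unfolding Omega_bar_def by (rule someI[of _ ?h]) (use h hc in blast)
 assume X: "X \<in> carrier (K0 R)"
 show ?thesis by (rule K0_hom_eq[where g = ?h, OF conjunct1[OF O] h _ X]) (use O hc in simp)
qed

text \<open>The first application needs \<open>omv\<close>, because the class may belong to a module
  that is not semisimple; afterwards the value is a combination of simple classes and
  \<open>Tv\<close> takes over. This shift is the origin of the extra one in the bound for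
  phi.\<close>

lemma Omega_pow: "X \<in> carrier (K0 R) \<Longrightarrow> (Omega_bar R ^^ Suc n) X = sig ((Tv ^^ n) (omv X))"
 by (induct n) (simp_all add: Omega_bar_eq sig_closed omv_sig)

section \<open>Projective dimension and walks in the quiver\<close>

definition adj :: "('v \<times> 'v) set" where "adj = {(src a, tgt a) | a. a \<in> E}"

lemma adj_sub: "adj \<subseteq> V \<times> V" using srcV tgtV by (auto simp: adj_def)

lemma NS_eq: "NS = {i\<in>V. i \<in> Domain adj}" by (auto simp: NS_def adj_def)

text \<open>Nonnegative entries cannot cancel, so the support after \<open>n\<close> steps is
  exactly what walks of length \<open>n\<close> reach, whatever the multiplicities of the
  arrows.\<close>

lemma Tv_pow_pos:
 assumes f: "\<And>i. f i \<ge> 0"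
 shows "(Tv ^^ n) f j \<ge> 0" "(Tv ^^ n) f j > 0 \<longleftrightarrow> (\<exists>i. f i > 0 \<and> (i, j) \<in> adj ^^ n)"
proof (induct n arbitrary: j)
 case 0 { case 1 show ?case using f by simp next case 2 show ?case by auto }
next
 case (Suc n)
 have s: "(Tv ^^ Suc n) f j = (if j \<in> V then \<Sum>a\<in>{a\<in>E. tgt a = j}. (Tv ^^ n) f (src a) else 0)" for j
  by (simp add: Tv_def)
 have nn: "(\<Sum>a\<in>{a\<in>E. tgt a = j}. (Tv ^^ n) f (src a)) \<ge> 0" for j by (intro sum_nonneg Suc)
 { case 1 show ?case unfolding s using nn by simp
 next
  case 2
  have "(\<Sum>a\<in>{a\<in>E. tgt a = j}. (Tv ^^ n) f (src a)) > 0 \<longleftrightarrow> (\<exists>a\<in>{a\<in>E. tgt a = j}. (Tv ^^ n) f (src a) > 0)"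
  proof
   assume p: "(\<Sum>a\<in>{a\<in>E. tgt a = j}. (Tv ^^ n) f (src a)) > 0"
   show "\<exists>a\<in>{a\<in>E. tgt a = j}. (Tv ^^ n) f (src a) > 0"
   proof (rule ccontr)
    assume "\<not> (\<exists>a\<in>{a\<in>E. tgt a = j}. (Tv ^^ n) f (src a) > 0)"
    then have "(\<Sum>a\<in>{a\<in>E. tgt a = j}. (Tv ^^ n) f (src a)) \<le> 0" by (intro sum_nonpos) force
    then show False using p by simp
   qed
  next
   assume "\<exists>a\<in>{a\<in>E. tgt a = j}. (Tv ^^ n) f (src a) > 0"
   then obtain a where a: "a \<in> {a\<in>E. tgt a = j}" "(Tv ^^ n) f (src a) > 0" by blast
   have "(Tv ^^ n) f (src a) \<le> (\<Sum>a\<in>{a\<in>E. tgt a = j}. (Tv ^^ n) f (src a))"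
    using a(1) finE Suc(1) by (intro member_le_sum) auto
   then show "(\<Sum>a\<in>{a\<in>E. tgt a = j}. (Tv ^^ n) f (src a)) > 0" using a(2) by linarith
  qed
  also have "\<dots> \<longleftrightarrow> (\<exists>i. f i > 0 \<and> (i, j) \<in> adj ^^ Suc n)"
   unfolding Suc(2) by (auto simp: adj_def)
  finally show ?case unfolding s using adj_sub by auto }
qed

definition dv :: "'a umod \<Rightarrow> 'v \<Rightarrow> int" where "dv M = (\<lambda>j. int (dd M j))"

lemma dv_syzygy: "N \<in> fgmod R \<Longrightarrow> semis N \<Longrightarrow> dv (syzygy R N) = Tv (dv N)"
proof
 fix j assume N: "N \<in> fgmod R" "semis N"
 show "dv (syzygy R N) j = Tv (dv N) j"
  using om_eq[OF N(1), of j] dd_outside[OF syzygy_fg[OF N(1)], of j]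
  by (simp add: dv_def Tv_def om_def semis_rad[OF N(2)])
qed

lemma syz_pow_fg: "M \<in> fgmod R \<Longrightarrow> (syzygy R ^^ n) M \<in> fgmod R"
 by (induct n) (simp_all add: syzygy_fg)

lemma syz_pow_semis: "M \<in> fgmod R \<Longrightarrow> n > 0 \<Longrightarrow> semis ((syzygy R ^^ n) M)"
 by (cases n) (simp_all add: syzygy_semis syz_pow_fg)

lemma dv_pow: "N \<in> fgmod R \<Longrightarrow> semis N \<Longrightarrow> dv ((syzygy R ^^ n) N) = (Tv ^^ n) (dv N)"
proof (induct n)
 case (Suc n)
 have "semis ((syzygy R ^^ n) N)" using Suc by (cases n) (simp_all add: syzygy_semis syz_pow_fg)
 then show ?case using Suc by (simp add: dv_syzygy syz_pow_fg)
qed simp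

lemma dd_pow_semis:
 assumes "N \<in> fgmod R" "semis N"
 shows "dd ((syzygy R ^^ n) N) j > 0 \<longleftrightarrow> (\<exists>i. dd N i > 0 \<and> (i, j) \<in> adj ^^ n)"
proof -
 have "dd ((syzygy R ^^ n) N) j > 0 \<longleftrightarrow> (Tv ^^ n) (dv N) j > 0"
  unfolding dv_pow[OF assms, symmetric] by (simp add: dv_def)
 also have "\<dots> \<longleftrightarrow> (\<exists>i. dd N i > 0 \<and> (i, j) \<in> adj ^^ n)"
  by (subst Tv_pow_pos(2)) (simp_all add: dv_def)
 finally show ?thesis .
qed

text \<open>The module itself may fail to be semisimple, so walks are counted from the support of
  its first syzygy.\<close>

lemma dd_pow:
 assumes "M \<in> fgmod R"
 shows "dd ((syzygy R ^^ Suc n) M) j > 0 \<longleftrightarrow> (\<exists>i. dd (syzygy R M) i > 0 \<and> (i, j) \<in> adj ^^ n)"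
 using dd_pow_semis[OF syzygy_fg[OF assms] syzygy_semis[OF assms], of n j] by (simp add: funpow_swap1)

text \<open>Supplies one more arrow in front of the walks of \<open>dd_pow\<close>; thanks to it the
  walk in \<open>psi_big\<close> has length phi and not phi minus one.\<close>

lemma dd_syzygy_pred: "M \<in> fgmod R \<Longrightarrow> dd (syzygy R M) j > 0 \<Longrightarrow> \<exists>u. (u, j) \<in> adj"
proof -
 assume M: "M \<in> fgmod R" and p: "dd (syzygy R M) j > 0"
 have "j \<in> V" using p dd_outside[OF syzygy_fg[OF M], of j] by (cases "j \<in> V") auto
 then have "(\<Sum>a\<in>{a\<in>E. tgt a = j}. dd M (src a) - rr M (src a)) > 0" using syzygy_dims[OF M, of j] p by linarith
 then have "{a\<in>E. tgt a = j} \<noteq> {}" by (metis less_irrefl sum.empty)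
 then show ?thesis by (auto simp: adj_def)
qed

section \<open>Projective resolutions and the walks that they bound\<close>

lemma proj_resD:
 assumes "projective_resolution R M d X f"
 shows "X 0 = M" "\<And>i. i \<le> d \<Longrightarrow> projective R (X (Suc i))" "\<And>i. i \<le> d \<Longrightarrow> f i \<in> mhom R (X (Suc i)) (X i)"
  "f 0 ` carrier (X 1) = carrier (X 0)"
  "\<And>i. i < d \<Longrightarrow> f (Suc i) ` carrier (X (Suc (Suc i))) = a_kernel (X (Suc i)) (X i) (f i)"
  "inj_on (f d) (carrier (X (Suc d)))"
 using assms by (simp_all add: projective_resolution_def)

text \<open>The walks issuing from the support of the first syzygy are bounded by the length of any
 projective resolution: along a walk one finds, in the successive kernels \<open>K\<close>, elements of the socle
 of the ambient module that do not lie in \<open>K J\<close>.\<close>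

lemma resolution_bounds_walks:
 assumes M: "M \<in> fgmod R" and res: "projective_resolution R M d X f"
  and i: "dd (syzygy R M) i > 0"
 shows "(i, j) \<notin> adj ^^ d"
proof -
 note Rs = proj_resD[OF res]
 have Xfg: "X k \<in> fgmod R" if "k \<le> Suc d" for k
  using that Rs(1) M Rs(2)[of "k - 1"] by (cases k) (auto simp: projective_def)
 define K where "K k = a_kernel (X (Suc k)) (X k) (f k)" for k
 \<comment> \<open>\<open>bad k y\<close> says that \<open>y\<close> lies in \<open>K k\<close>
   times J. The invariant \<open>Pr\<close> carried along the walk asks for an element of
   \<open>K k\<close> at the vertex \<open>i\<close> that J kills and that is not of this
   form.\<close>
 define bad where "bad k y \<longleftrightarrow> (\<exists>z. (\<forall>a\<in>E. z a \<in> K k) \<and> y = finsum (X (Suc k)) (\<lambda>a. z a \<triangleleft>\<^bsub>X (Suc k)\<^esub> ar a) E)" for k y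
 define Pr where "Pr k i \<longleftrightarrow> (\<exists>y\<in>K k. y \<in> comp (X (Suc k)) i \<and> y \<in> soc (X (Suc k)) \<and> \<not> bad k y)" for k i
 \<comment> \<open>The resolution need not be minimal, so it is compared with the cover. The lifts
   \<open>h\<close> and \<open>g\<close> compose to a map that fixes PJ, since it differs from the
   identity by a map into the kernel, which J annihilates. Thus \<open>g\<close> recovers
   \<open>y1\<close> from \<open>y\<close>, whereas it would send a bad element to zero.\<close>
 have base: "Pr 0 i"
 proof -
  note s = syzygy_spec[OF M]
  obtain P \<iota> p where C: "projective_cover R P p M" and S: "short_exact R (syzygy R M) \<iota> P p M" using s by blast
  note CD = coverD[OF C] and SD = short_exactD[OF S] and kr = cover_kernel_rad[OF M C]
  have X1: "X 1 \<in> fgmod R" "projective R (X 1)" "f 0 \<in> mhom R (X 1) M" "f 0 ` carrier (X 1) = carrier M"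
   using Xfg[of 1] Rs(1) Rs(2)[of 0] Rs(3)[of 0] Rs(4) by auto
  note P' = fgD[OF CD(2)] and M' = fgD[OF M] and X1' = fgD[OF X1(1)] and Z' = fgD[OF syzygy_fg[OF M]]
  interpret P: rsz_module R V E src tgt ec xc P by (rule rsz_moduleI[OF P'(1)])
  interpret M: rsz_module R V E src tgt ec xc M by (rule rsz_moduleI[OF M'(1)])
  interpret X1: rsz_module R V E src tgt ec xc "X 1" by (rule rsz_moduleI[OF X1'(1)])
  obtain y0 where y0: "y0 \<in> comp (syzygy R M) i" "y0 \<noteq> \<zero>\<^bsub>syzygy R M\<^esub>" using i dd_pos_iff[OF Z'] by blast
  have y0c: "y0 \<in> carrier (syzygy R M)" using y0(1) by (simp add: comp_def)
  define y1 where "y1 = \<iota> y0"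
  interpret Z: rsz_module R V E src tgt ec xc "syzygy R M" by (rule rsz_moduleI[OF Z'(1)])
  have y1: "y1 \<in> a_kernel P M p" "y1 \<in> comp P i" "y1 \<noteq> \<zero>\<^bsub>P\<^esub>"
  proof -
   show "y1 \<in> a_kernel P M p" using SD(5) y0c unfolding y1_def by blast
   show "y1 \<in> comp P i" unfolding y1_def by (rule mhom_comp[OF SD(1) y0(1)])
   show "y1 \<noteq> \<zero>\<^bsub>P\<^esub>"
   proof
    assume "y1 = \<zero>\<^bsub>P\<^esub>"
    then have "\<iota> y0 = \<iota> \<zero>\<^bsub>syzygy R M\<^esub>" using mhom_zero[OF Z'(1) P'(1) SD(1)] by (simp add: y1_def)
    then show False using SD(2) y0 y0c by (auto simp: inj_on_def)
   qed
  qed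
  have y1c: "y1 \<in> carrier P" "p y1 = \<zero>\<^bsub>M\<^esub>" using y1(1) by (auto simp: a_kernel_iff)
  obtain h where h: "h \<in> mhom R P (X 1)" "\<And>y. y \<in> carrier P \<Longrightarrow> f 0 (h y) = p y"
   by (rule projective_lift[OF CD(1) X1(1) M X1(3,4) CD(3)]) (rule that)
  obtain g where g: "g \<in> mhom R (X 1) P" "\<And>y. y \<in> carrier (X 1) \<Longrightarrow> p (g y) = f 0 y"
   by (rule projective_lift[OF X1(2) CD(2) M CD(3,4) X1(3)]) (rule that)
  define y where "y = h y1"
  have yK: "y \<in> K 0" using mhomD(1)[OF h(1) y1c(1)] h(2)[OF y1c(1)] y1c(2) Rs(1)
   by (simp add: K_def a_kernel_iff y_def)
  have y1r: "y1 \<in> rad P" using kr y1(1) by blast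
  have yr: "y \<in> rad (X 1)" unfolding y_def by (rule mhom_rad[OF P'(1) X1'(1) h(1) y1r])
  have "\<not> bad 0 y"
  proof
   assume "bad 0 y"
   then obtain z where z: "\<And>a. a \<in> E \<Longrightarrow> z a \<in> K 0" "y = finsum (X 1) (\<lambda>a. z a \<triangleleft>\<^bsub>X 1\<^esub> ar a) E"
    by (auto simp: bad_def)
   have zc: "z a \<in> carrier (X 1)" "f 0 (z a) = \<zero>\<^bsub>M\<^esub>" if "a \<in> E" for a
    using z(1)[OF that] Rs(1) by (auto simp: K_def a_kernel_iff)
   have "g y = finsum P (\<lambda>a. g (z a \<triangleleft>\<^bsub>X 1\<^esub> ar a)) E"
    unfolding z(2) using zc(1) X1.ract_closed[OF zc(1) ar_closed]
    by (intro mhom_finsum[OF X1'(1) P'(1) g(1)]) blast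
   also have "\<dots> = \<zero>\<^bsub>P\<^esub>"
   proof (rule P.finsum_zero')
    fix a assume a: "a \<in> E"
    have "g (z a) \<in> a_kernel P M p" using zc[OF a] g mhomD(1)[OF g(1)] by (simp add: a_kernel_iff)
    then have "g (z a) \<in> soc P" using kr P.rad_soc by blast
    then show "g (z a \<triangleleft>\<^bsub>X 1\<^esub> ar a) = \<zero>\<^bsub>P\<^esub>" using mhomD(3)[OF g(1) zc(1)[OF a] ar_closed] a by (simp add: soc_def)
   qed
   finally have gy: "g y = \<zero>\<^bsub>P\<^esub>" .
   obtain u where u: "u \<in> E \<rightarrow> carrier P" "y1 = finsum P (\<lambda>a. u a \<triangleleft>\<^bsub>P\<^esub> ar a) E"
    using y1r by (auto simp: rad_def)
   define gh where "gh w = g (h w)" for w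
   have gh: "gh \<in> mhom R P P" unfolding gh_def by (rule mhom_compose[OF h(1) g(1)])
   have "gh y1 = finsum P (\<lambda>a. gh (u a \<triangleleft>\<^bsub>P\<^esub> ar a)) E"
    unfolding u(2) using u(1) by (intro mhom_finsum[OF P'(1) P'(1) gh]) auto
   also have "\<dots> = finsum P (\<lambda>a. u a \<triangleleft>\<^bsub>P\<^esub> ar a) E"
   proof (rule P.finsum_cong')
    fix a assume a: "a \<in> E"
    then have uc: "u a \<in> carrier P" using u(1) by auto
    have ghc: "gh (u a) \<in> carrier P" by (rule mhomD(1)[OF gh uc])
    have "p (gh (u a)) = p (u a)" using h g uc mhomD(1)[OF h(1) uc] by (simp add: gh_def)
    then have "gh (u a) \<ominus>\<^bsub>P\<^esub> u a \<in> a_kernel P M p"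
     using mhom_minus[OF P'(1) M'(1) CD(3) ghc uc] uc ghc mhomD(1)[OF CD(3) uc]
     by (simp add: a_kernel_iff M.r_neg a_minus_def)
    then have "gh (u a) \<ominus>\<^bsub>P\<^esub> u a \<in> soc P" using kr P.rad_soc by blast
    then have "(gh (u a) \<ominus>\<^bsub>P\<^esub> u a) \<triangleleft>\<^bsub>P\<^esub> ar a = \<zero>\<^bsub>P\<^esub>" using a by (simp add: soc_def)
    then have "gh (u a) \<triangleleft>\<^bsub>P\<^esub> ar a \<ominus>\<^bsub>P\<^esub> u a \<triangleleft>\<^bsub>P\<^esub> ar a = \<zero>\<^bsub>P\<^esub>"
     using uc ghc by (simp add: a_minus_def P.ract_add_left P.ract_minus)
    then show "gh (u a \<triangleleft>\<^bsub>P\<^esub> ar a) = u a \<triangleleft>\<^bsub>P\<^esub> ar a"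
     using uc ghc mhomD(3)[OF gh uc ar_closed] by simp
   qed (use u(1) in auto)
   finally have "gh y1 = y1" by (simp add: u(2))
   then show False using gy y1(3) by (simp add: gh_def y_def)
  qed
  then show ?thesis unfolding Pr_def using yK X1.rad_soc[OF yr] mhom_comp[OF h(1) y1(2)]
   by (intro bexI[of _ y]) (auto simp: y_def)
 qed
 \<comment> \<open>A preimage \<open>u\<close> of \<open>y\<close> is multiplied by the arrow. If
   the product were bad, flatness would place \<open>u\<close> minus a kernel element into the
   radical, and applying the map of the resolution would make \<open>y\<close> bad.\<close>
 have step: "Pr (Suc k) t" if k: "k < d" and pr: "Pr k s" and st: "(s, t) \<in> adj" for k s t
 proof -
  let ?A = "X (Suc k)" and ?B = "X (Suc (Suc k))" and ?f = "f (Suc k)"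
  have A: "right_module R ?A" and B: "right_module R ?B" using fgD(1) Xfg k by auto
  have fl: "jflat ?B" using Rs(2)[of "Suc k"] k by (intro projective_jflat) simp
  have ff: "?f \<in> mhom R ?B ?A" using Rs(3)[of "Suc k"] k by simp
  interpret A: rsz_module R V E src tgt ec xc ?A by (rule rsz_moduleI[OF A])
  interpret B: rsz_module R V E src tgt ec xc ?B by (rule rsz_moduleI[OF B])
  obtain a where a: "a \<in> E" "s = src a" "t = tgt a" using st by (auto simp: adj_def)
  obtain y where y: "y \<in> K k" "y \<in> comp ?A s" "y \<in> soc ?A" "\<not> bad k y" using pr by (auto simp: Pr_def)
  have im: "?f ` carrier ?B = K k" using Rs(5)[OF k] by (simp add: K_def)
  then obtain u' where u': "u' \<in> carrier ?B" "?f u' = y" using y(1) by (metis imageE)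
  define u where "u = u' \<triangleleft>\<^bsub>?B\<^esub> e s"
  have sV: "s \<in> V" using a srcV by simp
  have u: "u \<in> carrier ?B" "u \<in> comp ?B s" "?f u = y"
   using u' sV mhomD(3)[OF ff u'(1) e_closed] y(2) by (auto simp: u_def comp_def B.e_act)
  define w where "w = u \<triangleleft>\<^bsub>?B\<^esub> ar a"
  have "?f w = \<zero>\<^bsub>?A\<^esub>" using mhomD(3)[OF ff u(1) ar_closed] u(3) y(3) a by (simp add: w_def soc_def)
  then have wK: "w \<in> K (Suc k)" using u(1) by (simp add: K_def a_kernel_iff w_def)
  have wc: "w \<in> comp ?B t" unfolding w_def a(3) by (rule B.x_in_comp[OF u(1) a(1)])
  have ws: "w \<in> soc ?B" unfolding w_def using B.rad_soc[OF B.x_in_rad[OF u(1) a(1)]] .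
  have "\<not> bad (Suc k) w"
  proof
   assume "bad (Suc k) w"
   then obtain z where z: "\<And>b. b \<in> E \<Longrightarrow> z b \<in> K (Suc k)" "w = finsum ?B (\<lambda>b. z b \<triangleleft>\<^bsub>?B\<^esub> ar b) E"
    by (auto simp: bad_def)
   have zc: "z b \<in> carrier ?B" "?f (z b) = \<zero>\<^bsub>?A\<^esub>" if "b \<in> E" for b
    using z(1)[OF that] by (auto simp: K_def a_kernel_iff)
   define zz where "zz b = (if b = a then u else \<zero>\<^bsub>?B\<^esub>) \<ominus>\<^bsub>?B\<^esub> z b \<triangleleft>\<^bsub>?B\<^esub> e (src b)" for b
   have zzc: "zz b \<in> comp ?B (src b)" if b: "b \<in> E" for b
    unfolding zz_def using zc(1)[OF b] u(2) a b srcV[OF b] B.comp_zero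
    by (intro B.K.ksubD(6)[OF B.ksub_comp]) auto
   have "finsum ?B (\<lambda>b. zz b \<triangleleft>\<^bsub>?B\<^esub> ar b) E
     = finsum ?B (\<lambda>b. (if b = a then w else \<zero>\<^bsub>?B\<^esub>) \<oplus>\<^bsub>?B\<^esub> kact ?B (- 1) (z b \<triangleleft>\<^bsub>?B\<^esub> ar b)) E"
   proof (rule B.finsum_cong')
    fix b assume b: "b \<in> E"
    show "zz b \<triangleleft>\<^bsub>?B\<^esub> ar b = (if b = a then w else \<zero>\<^bsub>?B\<^esub>) \<oplus>\<^bsub>?B\<^esub> kact ?B (- 1) (z b \<triangleleft>\<^bsub>?B\<^esub> ar b)"
     using zc(1)[OF b] u(1) b srcV[OF b]
     by (auto simp: zz_def w_def a_minus_def B.ract_add_left B.ract_minus B.e_x_act B.K.s_minus_one)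
   qed (use zc u a in \<open>auto simp: w_def\<close>)
   also have "\<dots> = finsum ?B (\<lambda>b. if b = a then w else \<zero>\<^bsub>?B\<^esub>) E \<oplus>\<^bsub>?B\<^esub> finsum ?B (\<lambda>b. kact ?B (- 1) (z b \<triangleleft>\<^bsub>?B\<^esub> ar b)) E"
    using zc u a by (intro B.finsum_addf) (auto simp: w_def)
   also have "finsum ?B (\<lambda>b. if b = a then w else \<zero>\<^bsub>?B\<^esub>) E = w"
    using B.finsum_single[OF finE a(1), of "\<lambda>_. w"] u(1) by (simp add: w_def)
   also have "finsum ?B (\<lambda>b. kact ?B (- 1) (z b \<triangleleft>\<^bsub>?B\<^esub> ar b)) E = kact ?B (- 1) w"
    unfolding z(2) using zc by (intro B.K.s_finsum[symmetric]) auto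
   also have "w \<oplus>\<^bsub>?B\<^esub> kact ?B (- 1) w = \<zero>\<^bsub>?B\<^esub>" using u(1) by (simp add: w_def B.K.s_minus_one B.r_neg)
   finally have "\<forall>b\<in>E. zz b \<in> rad ?B" using fl[unfolded jflat_def, THEN spec, of zz] zzc by simp
   then have "zz a \<in> rad ?B" using a by simp
   then obtain v where v: "v \<in> E \<rightarrow> carrier ?B" "zz a = finsum ?B (\<lambda>b. v b \<triangleleft>\<^bsub>?B\<^esub> ar b) E" by (auto simp: rad_def)
   have "?f (zz a) = ?f u \<ominus>\<^bsub>?A\<^esub> ?f (z a \<triangleleft>\<^bsub>?B\<^esub> e (src a))"
    using mhom_minus[OF B A ff u(1), of "z a \<triangleleft>\<^bsub>?B\<^esub> e (src a)"] zc(1)[OF a(1)] by (simp add: zz_def)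
   also have "\<dots> = y"
    using mhomD(3)[OF ff zc(1)[OF a(1)] e_closed] zc(2)[OF a(1)] u(3) A.compD(1)[OF y(2)] by (simp add: a_minus_def)
   finally have "y = ?f (zz a)" by simp
   also have "\<dots> = finsum ?A (\<lambda>b. ?f (v b \<triangleleft>\<^bsub>?B\<^esub> ar b)) E"
    unfolding v(2) using v(1) by (intro mhom_finsum[OF B A ff]) auto
   also have "\<dots> = finsum ?A (\<lambda>b. ?f (v b) \<triangleleft>\<^bsub>?A\<^esub> ar b) E"
    using v(1) mhomD[OF ff] by (intro A.finsum_cong') (auto simp: Pi_def)
   finally have ye: "y = finsum ?A (\<lambda>b. ?f (v b) \<triangleleft>\<^bsub>?A\<^esub> ar b) E" .
   have "?f (v b) \<in> K k" if "b \<in> E" for b using v(1) that im by blast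
   then have "bad k y" unfolding bad_def using ye by (intro exI[of _ "\<lambda>b. ?f (v b)"]) simp
   then show False using y(4) by simp
  qed
  then show ?thesis unfolding Pr_def using wK wc ws by blast
 qed
 have "Pr k s" if "k \<le> d" "(i, s) \<in> adj ^^ k" for k s
  using that
 proof (induct k arbitrary: s)
  case 0 then show ?case using base by simp
 next
  case (Suc k)
  then obtain t where "(i, t) \<in> adj ^^ k" "(t, s) \<in> adj" by auto
  then show ?case using Suc step[of k t s] by simp
 qed
 \<comment> \<open>The last map is injective, so \<open>K d\<close> is zero, and zero is bad; hence
   no walk reaches length \<open>d\<close>.\<close>
 moreover have "\<not> Pr d s" for s
 proof
  assume "Pr d s"
  then obtain y where y: "y \<in> K d" "\<not> bad d y" by (auto simp: Pr_def)
  have D: "right_module R (X (Suc d))" "right_module R (X d)" using fgD(1) Xfg by auto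
  interpret D: rsz_module R V E src tgt ec xc "X (Suc d)" by (rule rsz_moduleI[OF D(1)])
  have f0: "f d \<zero>\<^bsub>X (Suc d)\<^esub> = \<zero>\<^bsub>X d\<^esub>" by (rule mhom_zero[OF D Rs(3)[OF order_refl]])
  have "y = \<zero>\<^bsub>X (Suc d)\<^esub>"
   using Rs(6) y(1) f0 unfolding inj_on_def K_def a_kernel_iff by (metis D.zero_closed)
  moreover have "finsum (X (Suc d)) (\<lambda>a. \<zero>\<^bsub>X (Suc d)\<^esub> \<triangleleft>\<^bsub>X (Suc d)\<^esub> ar a) E = \<zero>\<^bsub>X (Suc d)\<^esub>"
   by (rule D.finsum_zero') simp
  ultimately have "bad d y" unfolding bad_def
   using f0 by (intro exI[of _ "\<lambda>_. \<zero>\<^bsub>X (Suc d)\<^esub>"]) (simp add: K_def a_kernel_iff)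
  then show False using y(2) by simp
 qed
 ultimately show ?thesis by blast
qed

text \<open>Splices the covers of the successive syzygies; the last map is injective because the
  following syzygy is zero.\<close>

lemma resolution_exists:
 assumes M: "M \<in> fgmod R" and z: "\<And>j. j \<in> V \<Longrightarrow> dd ((syzygy R ^^ Suc d) M) j = 0"
 shows "\<exists>X f. projective_resolution R M d X f"
proof -
 let ?O = "\<lambda>k. (syzygy R ^^ k) M"
 have "\<forall>k. \<exists>P i p. projective_cover R P p (?O k) \<and> short_exact R (?O (Suc k)) i P p (?O k)"
  using syzygy_spec[OF syz_pow_fg[OF M]] by simp
 then obtain P i p where C: "\<And>k. projective_cover R (P k) (p k) (?O k)"
  and S: "\<And>k. short_exact R (?O (Suc k)) (i k) (P k) (p k) (?O k)" by metis
 \<comment> \<open>Index shift: \<open>X 0\<close> is the module itself, so the projective over the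
   syzygy of order \<open>k\<close> is \<open>X (Suc k)\<close>. The connecting maps are a cover
   followed by the inclusion of the preceding kernel.\<close>
 define X where "X k = (case k of 0 \<Rightarrow> M | Suc k \<Rightarrow> P k)" for k
 define f where "f k = (case k of 0 \<Rightarrow> p 0 | Suc k \<Rightarrow> (\<lambda>y. i k (p (Suc k) y)))" for k
 note CD = coverD[OF C] and SD = short_exactD[OF S]
 have rm: "right_module R (?O k)" "right_module R (P k)" for k using fgD(1) syz_pow_fg[OF M] CD(2) by blast+
 have ker: "a_kernel (X (Suc k)) (X k) (f k) = a_kernel (P k) (?O k) (p k)" for k
 proof (cases k)
  case (Suc l)
  have *: "i l (p k y) = \<zero>\<^bsub>P l\<^esub> \<longleftrightarrow> p k y = \<zero>\<^bsub>?O k\<^esub>" if y: "y \<in> carrier (P k)" for y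
  proof -
   interpret O: rsz_module R V E src tgt ec xc "?O k" by (rule rsz_moduleI[OF rm(1)])
   have iz: "i l \<zero>\<^bsub>?O k\<^esub> = \<zero>\<^bsub>P l\<^esub>" using mhom_zero[OF rm(1) rm(2) SD(1)[of l]] Suc by simp
   have pc: "p k y \<in> carrier (?O k)" by (rule mhomD(1)[OF CD(3) y])
   show ?thesis using SD(2)[of l] iz pc O.zero_closed unfolding Suc inj_on_def by metis
  qed
  have "X (Suc k) = P k" "X k = P l" "f k = (\<lambda>y. i l (p k y))" by (simp_all add: X_def f_def Suc)
  then show ?thesis using * by (simp add: set_eq_iff a_kernel_iff cong: conj_cong)
 qed (simp add: X_def f_def)
 have "projective_resolution R M d X f"
  unfolding projective_resolution_def
 proof (intro conjI allI impI)
  show "X 0 = M" by (simp add: X_def)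
  show "projective R (X (Suc k))" for k using CD(1) by (simp add: X_def)
  show fX: "f k \<in> mhom R (X (Suc k)) (X k)" for k
  proof (cases k)
   case (Suc l)
   then show ?thesis using mhom_compose[OF CD(3)[of "Suc l"] SD(1)[of l]] by (simp add: X_def f_def)
  qed (use CD(3)[of 0] in \<open>simp add: X_def f_def\<close>)
  show "f 0 ` carrier (X 1) = carrier (X 0)" using CD(4)[of 0] by (simp add: X_def f_def)
  show "f (Suc k) ` carrier (X (Suc (Suc k))) = a_kernel (X (Suc k)) (X k) (f k)" for k
  proof -
   have "f (Suc k) ` carrier (X (Suc (Suc k))) = i k ` (p (Suc k) ` carrier (P (Suc k)))"
    by (simp add: X_def f_def image_image)
   also have "\<dots> = a_kernel (P k) (?O k) (p k)" unfolding CD(4) by (rule SD(5))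
   finally show ?thesis unfolding ker .
  qed
  show "inj_on (f d) (carrier (X (Suc d)))"
  proof -
   interpret D: rsz_module R V E src tgt ec xc "X (Suc d)" using rm(2)[of d] by (intro rsz_moduleI) (simp add: X_def)
   have Xd: "right_module R (X d)" using rm(2) fgD(1)[OF M] by (cases d) (simp_all add: X_def)
   interpret D': rsz_module R V E src tgt ec xc "X d" by (rule rsz_moduleI[OF Xd])
   note fd = fX[of d]
   have "carrier (?O (Suc d)) = {\<zero>\<^bsub>?O (Suc d)\<^esub>}"
    using carrier_zero_iff[OF fgD[OF syz_pow_fg[OF M]], of "Suc d"] z by blast
   then have "a_kernel (P d) (?O d) (p d) = {\<zero>\<^bsub>P d\<^esub>}"
    using SD(5)[of d] mhom_zero[OF rm(1) rm(2) SD(1)[of d]] by simp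
   then have k0: "a_kernel (X (Suc d)) (X d) (f d) = {\<zero>\<^bsub>X (Suc d)\<^esub>}" unfolding ker by (simp add: X_def)
   show ?thesis
   proof (rule inj_onI)
    fix x y assume xy: "x \<in> carrier (X (Suc d))" "y \<in> carrier (X (Suc d))" "f d x = f d y"
    have "x \<ominus>\<^bsub>X (Suc d)\<^esub> y \<in> a_kernel (X (Suc d)) (X d) (f d)"
     using mhom_minus[OF D.right_module_axioms Xd fd xy(1,2)] xy mhomD(1)[OF fd xy(2)]
     by (simp add: a_kernel_iff)
    then show "x = y" using k0 xy by simp
   qed
  qed
 qed
 then show ?thesis by blast
qed

section \<open>Values of the projective dimension\<close>

lemma pd_le: "projective_resolution R M d X f \<Longrightarrow> pd R M \<le> enat d"
 unfolding pd_def by (rule Inf_lower) blast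

text \<open>A finite value is a minimum because the extended naturals are well ordered; the infimum
  of the empty set is infinite.\<close>

lemma pd_finite: "pd R M = enat d \<Longrightarrow> \<exists>X f. projective_resolution R M d X f"
proof -
 assume p: "pd R M = enat d"
 let ?S = "{enat d | d. \<exists>X f. projective_resolution R M d X f}"
 have "?S \<noteq> {}"
 proof
  assume "?S = {}"
  then have "pd R M = \<infinity>" unfolding pd_def by (simp only: Inf_empty top_enat_def)
  then show False using p by simp
 qed
 then have "Inf ?S \<in> ?S" using wellorder_InfI[of _ ?S] by fast
 then show ?thesis using p unfolding pd_def by force
qed

text \<open>A walk of \<open>card V\<close> arrows from the support of the first syzygy would reach
  a cycle and so lead to walks of every length, against the resolution. The bound is crude; its
  purpose is that only finitely many values occur in the supremum defining psi.\<close>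

lemma pd_le_card:
 assumes N: "N \<in> fgmod R" and p: "pd R N = enat d"
 shows "d \<le> card V"
proof -
 obtain X f where res: "projective_resolution R N d X f" using pd_finite[OF p] by blast
 have nw: "(i, j) \<notin> adj ^^ card V" if i: "dd (syzygy R N) i > 0" for i j
 proof
  assume w: "(i, j) \<in> adj ^^ card V"
  have "i \<in> V" using i dd_outside[OF syzygy_fg[OF N], of i] by (cases "i \<in> V") auto
  then obtain z where z: "(i, z) \<in> adj\<^sup>*" "(z, z) \<in> adj\<^sup>+" using relpow_cycle[OF finV adj_sub w] by blast
  obtain k where k: "(i, z) \<in> adj ^^ k" using z(1) rtrancl_imp_relpow by blast
  obtain y where "(z, y) \<in> adj ^^ d" using cycle_relpow_from[OF z(2)] by blast
  then have "(i, y) \<in> adj ^^ (d + k)" using k unfolding add.commute[of d k] relpow_add by blast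
  then obtain y' where "(i, y') \<in> adj ^^ d" unfolding relpow_add by blast
  then show False using resolution_bounds_walks[OF N res i] by blast
 qed
 have "dd ((syzygy R ^^ Suc (card V)) N) j = 0" for j
  using dd_pow[OF N, of "card V" j] nw by (metis gr0I)
 then obtain X f where "projective_resolution R N (card V) X f" using resolution_exists[OF N] by blast
 then show ?thesis using pd_le p by (metis enat_ord_simps(1))
qed

text \<open>Walks from the support have length at most \<open>d\<close>:
  \<open>resolution_bounds_walks\<close> counts from the first syzygy, hence the shift to
  \<open>Suc d\<close>. If none had length \<open>d\<close>, there would be a resolution of length
  \<open>d - 1\<close>.\<close>

lemma pd_semis:
 assumes N: "N \<in> fgmod R" "semis N" and p: "pd R N = enat d"
 shows "dd N i > 0 \<Longrightarrow> (i, j) \<notin> adj ^^ Suc d" "d > 0 \<Longrightarrow> \<exists>i j. dd N i > 0 \<and> (i, j) \<in> adj ^^ d"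
proof -
 obtain X f where res: "projective_resolution R N d X f" using pd_finite[OF p] by blast
 show "(i, j) \<notin> adj ^^ Suc d" if i: "dd N i > 0"
 proof
  assume "(i, j) \<in> adj ^^ Suc d"
  then obtain k where k: "(i, k) \<in> adj" "(k, j) \<in> adj ^^ d" by (meson relpow_Suc_D2)
  have "dd (syzygy R N) k > 0" using dd_pow_semis[OF N, of 1 k] i k(1) by auto
  then show False using resolution_bounds_walks[OF N(1) res] k(2) by blast
 qed
 show "\<exists>i j. dd N i > 0 \<and> (i, j) \<in> adj ^^ d" if "d > 0"
 proof (rule ccontr)
  assume "\<not> (\<exists>i j. dd N i > 0 \<and> (i, j) \<in> adj ^^ d)"
  then have "\<not> dd ((syzygy R ^^ d) N) j > 0" for j unfolding dd_pow_semis[OF N] by blast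
  then have "dd ((syzygy R ^^ d) N) j = 0" for j by blast
  then obtain X f where "projective_resolution R N (d - 1) X f"
   using resolution_exists[OF N(1), of "d - 1"] \<open>d > 0\<close> by auto
  then show False using pd_le[of N "d - 1" X f] p \<open>d > 0\<close> by simp
 qed
qed

lemma pd_semis_le:
 assumes N: "N \<in> fgmod R" "semis N" and b: "\<And>i j. dd N i > 0 \<Longrightarrow> (i, j) \<notin> adj ^^ Suc d"
 shows "pd R N \<le> enat d"
proof -
 have "dd ((syzygy R ^^ Suc d) N) j = 0" for j using dd_pow_semis[OF N, of "Suc d" j] b by (metis gr0I)
 then show ?thesis using resolution_exists[OF N(1)] pd_le by blast
qed

section \<open>The Igusa-Todorov functions\<close>

text \<open>\<open>Tv\<close> on the coordinates that K0 sees, with real entries so that linear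
  independence is available.\<close>

definition Tr :: "('v \<Rightarrow> real) \<Rightarrow> 'v \<Rightarrow> real"
 where "Tr f = (\<lambda>j. if j \<in> NS then \<Sum>a\<in>{a\<in>E. tgt a = j}. f (src a) else 0)"

definition res :: "('v \<Rightarrow> int) \<Rightarrow> 'v \<Rightarrow> real"
 where "res a = (\<lambda>j. if j \<in> NS then real_of_int (a j) else 0)"

text \<open>Arrows start at nonsinks, so discarding the sinks before applying the matrix loses
  nothing.\<close>

lemma res_Tv: "res (Tv a) = Tr (res a)"
proof
 fix j
 have "src b \<in> NS" if "b \<in> E" for b using that srcV by (auto simp: NS_def)
 then have "(\<Sum>b\<in>{b\<in>E. tgt b = j}. res a (src b)) = (\<Sum>b\<in>{b\<in>E. tgt b = j}. real_of_int (a (src b)))"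
  by (intro sum.cong) (auto simp: res_def)
 then show "res (Tv a) j = Tr (res a) j"
  by (cases "j \<in> NS") (simp_all add: res_def[of "Tv a"] Tr_def, simp add: Tv_def NS_def)
qed

lemma res_Tv_pow: "res ((Tv ^^ k) a) = (Tr ^^ k) (res a)"
 by (induct k) (simp_all add: res_Tv)

lemma Tv_pow_diff: "(Tv ^^ k) (\<lambda>j. a j - b j) = (\<lambda>j. (Tv ^^ k) a j - (Tv ^^ k) b j)"
 by (induct k) (simp_all add: Tv_def fun_eq_iff sum_subtractf)

lemma nilpotent_Tr:
 assumes "\<And>x. x \<notin> NS \<Longrightarrow> f x = 0" "(Tr ^^ k) f \<noteq> 0" "(Tr ^^ Suc k) f = 0"
 shows "nilpotent_vector Tr NS f k"
 by unfold_locales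
  (use assms finV in \<open>auto simp: NS_def Tr_def fscale_def fun_eq_iff sum.distrib sum_distrib_left\<close>)

text \<open>A walk of length \<open>Suc n\<close> leaves each vertex on a cycle; the vertex that it
  reaches after \<open>n\<close> steps has an outgoing arrow and is therefore a coordinate of
  \<open>Tr\<close>.\<close>

lemma Tr_cycle:
 assumes "(z, z) \<in> adj\<^sup>+"
 shows "(Tr ^^ n) (res (\<lambda>j. if j = z then 1 else 0)) \<noteq> 0"
proof -
 obtain y where "(z, y) \<in> adj ^^ Suc n" using cycle_relpow_from[OF assms] by blast
 then obtain t where t: "(z, t) \<in> adj ^^ n" "(t, y) \<in> adj" by auto
 let ?d = "\<lambda>j. if j = z then 1 else (0::int)"
 have "(Tv ^^ n) ?d t > 0" using t(1) by (subst Tv_pow_pos(2)) auto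
 moreover have "t \<in> NS" using t(2) adj_sub by (auto simp: NS_eq)
 ultimately have "(Tr ^^ n) (res ?d) t \<noteq> 0" unfolding res_Tv_pow[symmetric] by (simp add: res_def)
 then show ?thesis by auto
qed

section \<open>Bounds for the first Igusa-Todorov function\<close>

lemma add_span_sub: "X \<in> add_span R M \<Longrightarrow> X \<in> carrier (K0 R)"
 "\<one>\<^bsub>K0 R\<^esub> \<in> add_span R M"
proof -
 interpret K: group "K0 R" by (rule K0_group)
 show "X \<in> add_span R M \<Longrightarrow> X \<in> carrier (K0 R)"
  using K.generate_incl[of "{K0_class R N | N. indecomposable R N \<and> direct_summand R N M}"] cls_closed
  by (auto simp: add_span_def direct_summand_def)
 show "\<one>\<^bsub>K0 R\<^esub> \<in> add_span R M" unfolding add_span_def by (rule generate.one)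
qed

text \<open>Two elements with equal image give a difference vector killed by \<open>l + s\<close>
  steps of \<open>Tr\<close>. If it survived one step fewer, its index would be exactly
  \<open>l + s\<close>, beyond what \<open>idx\<close> allows.\<close>

lemma phi_inj:
 assumes l: "l > 0" and idx: "\<And>f k. (\<And>x. x \<notin> NS \<Longrightarrow> f x = 0) \<Longrightarrow> (Tr ^^ k) f \<noteq> 0 \<Longrightarrow> (Tr ^^ Suc k) f = 0 \<Longrightarrow> Suc k < l"
 shows "inj_on (Omega_bar R) ((Omega_bar R ^^ (l + s)) ` add_span R M)"
proof (rule inj_onI)
 fix x y assume "x \<in> (Omega_bar R ^^ (l + s)) ` add_span R M" "y \<in> (Omega_bar R ^^ (l + s)) ` add_span R M"
  and eq: "Omega_bar R x = Omega_bar R y"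
 then obtain X Y where X: "X \<in> carrier (K0 R)" "x = (Omega_bar R ^^ (l + s)) X"
  and Y: "Y \<in> carrier (K0 R)" "y = (Omega_bar R ^^ (l + s)) Y" using add_span_sub by blast
 obtain k where k: "l + s = Suc k" using l by (cases "l + s") auto
 have xy: "x = sig ((Tv ^^ k) (omv X))" "y = sig ((Tv ^^ k) (omv Y))"
  using X Y Omega_pow unfolding k by blast+
 have "sig ((Tv ^^ Suc k) (omv X)) = Omega_bar R x" "sig ((Tv ^^ Suc k) (omv Y)) = Omega_bar R y"
  unfolding Omega_pow[OF X(1), symmetric] Omega_pow[OF Y(1), symmetric] X(2) Y(2) k by simp_all
 then have "sig ((Tv ^^ Suc k) (omv X)) = sig ((Tv ^^ Suc k) (omv Y))" using eq by simp
 then have 1: "\<forall>i\<in>NS. (Tv ^^ Suc k) (omv X) i = (Tv ^^ Suc k) (omv Y) i" unfolding sig_eq_iff .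
 define f where "f = res (\<lambda>j. omv X j - omv Y j)"
 have f: "(Tr ^^ m) f = res (\<lambda>j. (Tv ^^ m) (omv X) j - (Tv ^^ m) (omv Y) j)" for m
  unfolding f_def res_Tv_pow[symmetric] Tv_pow_diff ..
 have z: "(Tr ^^ Suc k) f = 0" unfolding f
 proof
  fix i show "res (\<lambda>j. (Tv ^^ Suc k) (omv X) j - (Tv ^^ Suc k) (omv Y) j) i = 0 i"
   using 1 by (cases "i \<in> NS") (simp_all only: res_def if_True if_False diff_self of_int_0 zero_fun_apply)
 qed
 have supp: "f x = 0" if "x \<notin> NS" for x using that by (simp add: f_def res_def)
 have f0: "(Tr ^^ k) f = 0"
 proof (rule ccontr)
  assume "(Tr ^^ k) f \<noteq> 0"
  from idx[OF supp this z] show False using k by simp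
 qed
 have "\<forall>i\<in>NS. (Tv ^^ k) (omv X) i = (Tv ^^ k) (omv Y) i"
 proof
  fix i assume i: "i \<in> NS"
  have "res (\<lambda>j. (Tv ^^ k) (omv X) j - (Tv ^^ k) (omv Y) j) i = 0"
   using fun_cong[OF f0, of i] unfolding f by simp
  then show "(Tv ^^ k) (omv X) i = (Tv ^^ k) (omv Y) i" using i by (simp add: res_def)
 qed
 then show "x = y" unfolding xy sig_eq_iff .
qed

text \<open>Indices are at most \<open>card NS\<close>; the strict inequality in
  \<open>phi_inj\<close> accounts for the successor.\<close>

lemma phi_le: "IT_phi R M \<le> Suc (card NS)"
 unfolding IT_phi_def
 by (intro Least_le allI phi_inj le_imp_less_Suc nilpotent_vector.index_le[OF nilpotent_Tr]) simp_all

lemma phi_le_cycle: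
 assumes z: "(z, z) \<in> adj\<^sup>+"
 shows "IT_phi R M \<le> card NS"
proof -
 obtain y where "(z, y) \<in> adj" using z by (meson tranclD)
 then have "z \<in> NS" using adj_sub by (auto simp: NS_eq)
 then have 0: "card NS > 0" using finV by (auto simp: card_gt_0_iff NS_def)
 have "Suc k < card NS" if "\<And>x. x \<notin> NS \<Longrightarrow> f x = 0" "(Tr ^^ k) f \<noteq> 0" "(Tr ^^ Suc k) f = 0" for f k
  by (rule nilpotent_vector.index_less[OF nilpotent_Tr[OF that], OF _ _ Tr_cycle[OF z]]) (auto simp: res_def)
 then show ?thesis unfolding IT_phi_def by (intro Least_le allI phi_inj[OF 0]) blast
qed

text \<open>An element that becomes trivial exactly at step \<open>Suc p\<close> destroys
  injectivity on the image under \<open>p\<close> steps, since the trivial class lies in that image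
  too.\<close>

lemma phi_ge:
 assumes X: "X \<in> add_span R M" "(Omega_bar R ^^ p) X \<noteq> \<one>\<^bsub>K0 R\<^esub>" "(Omega_bar R ^^ Suc p) X = \<one>\<^bsub>K0 R\<^esub>"
 shows "Suc p \<le> IT_phi R M"
proof (rule ccontr)
 assume "\<not> Suc p \<le> IT_phi R M"
 then have p: "IT_phi R M \<le> p" by simp
 \<comment> \<open>The least number has the defining property because some number has it, namely the
   bound of \<open>phi_le\<close>.\<close>
 have "\<forall>s. inj_on (Omega_bar R) ((Omega_bar R ^^ (IT_phi R M + s)) ` add_span R M)"
  unfolding IT_phi_def
  by (rule LeastI[of _ "Suc (card NS)"],
   intro allI phi_inj le_imp_less_Suc nilpotent_vector.index_le[OF nilpotent_Tr]) simp_all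
 then have i: "inj_on (Omega_bar R) ((Omega_bar R ^^ p) ` add_span R M)"
  using p by (metis le_add_diff_inverse)
 have "omv \<one>\<^bsub>K0 R\<^esub> = (\<lambda>_. 0)" unfolding sig_zero[symmetric] omv_sig by (simp add: Tv_def fun_eq_iff)
 then have 1: "Omega_bar R \<one>\<^bsub>K0 R\<^esub> = \<one>\<^bsub>K0 R\<^esub>"
  using Omega_bar_eq[of "\<one>\<^bsub>K0 R\<^esub>"] sig_closed[of "\<lambda>_. 0"] by (simp add: sig_zero)
 have "(Omega_bar R ^^ k) \<one>\<^bsub>K0 R\<^esub> = \<one>\<^bsub>K0 R\<^esub>" for k by (induct k) (simp_all add: 1)
 then have 2: "\<one>\<^bsub>K0 R\<^esub> \<in> (Omega_bar R ^^ p) ` add_span R M"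
  by (intro image_eqI[of _ _ "\<one>\<^bsub>K0 R\<^esub>"] add_span_sub(2)) simp
 have "Omega_bar R ((Omega_bar R ^^ p) X) = Omega_bar R \<one>\<^bsub>K0 R\<^esub>" using X(3) 1 by simp
 from inj_onD[OF i this imageI[OF X(1)] 2] show False using X(2) by simp
qed

text \<open>A sink lowers \<open>card NS\<close>, and a cycle saves the successor in
  \<open>phi_le\<close>. A finite quiver without sinks has a cycle, so at least one of the two
  savings occurs.\<close>

lemma phi_bounds: "IT_phi R M \<le> card V"
 "(z, z) \<in> adj\<^sup>+ \<Longrightarrow> s \<in> V \<Longrightarrow> s \<notin> Domain adj \<Longrightarrow> IT_phi R M \<le> card V - 1"
proof -
 have less: "card NS < card V" if "s \<in> V" "s \<notin> Domain adj" for s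
  using that finV by (intro psubset_card_mono) (auto simp: NS_eq)
 show "(z, z) \<in> adj\<^sup>+ \<Longrightarrow> s \<in> V \<Longrightarrow> s \<notin> Domain adj \<Longrightarrow> IT_phi R M \<le> card V - 1"
  using less[of s] phi_le_cycle[of z M] by linarith
 show "IT_phi R M \<le> card V"
 proof (cases "NS = V")
  case True
  obtain u where u: "u \<in> V" using V_ne by blast
  have "\<exists>y. (u, y) \<in> adj ^^ k" for k
  proof (induct k)
   case (Suc k)
   then obtain y where y: "(u, y) \<in> adj ^^ k" by blast
   have "y \<in> V" using y u adj_sub by (cases k) auto
   then obtain y' where "(y, y') \<in> adj" using True NS_eq by blast
   then show ?case using y by auto
  qed auto
  then obtain y where "(u, y) \<in> adj ^^ card V" by blast
  then obtain z where "(z, z) \<in> adj\<^sup>+" using relpow_cycle[OF finV adj_sub _ u] by blast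
  then show ?thesis using phi_le_cycle[of z M] True by simp
 next
  case False
  then obtain s where "s \<in> V" "s \<notin> Domain adj" unfolding NS_eq by blast
  then show ?thesis using less[of s] phi_le[of M] by linarith
 qed
qed

text \<open>The relevant projective dimensions are bounded by \<open>pd_le_card\<close>, so the
  supremum runs over a finite set and is attained; over the empty set it is zero and psi equals
  phi.\<close>

lemma psi_attained:
 assumes "IT_psi R M \<noteq> enat (IT_phi R M)"
 obtains N d where "direct_summand R N ((syzygy R ^^ IT_phi R M) M)" "pd R N = enat d" "d \<le> card V"
  "IT_psi R M = enat (IT_phi R M + d)"
proof -
 let ?S = "{pd R N | N. direct_summand R N ((syzygy R ^^ IT_phi R M) M) \<and> pd R N < \<infinity>}"
 have sub: "?S \<subseteq> enat ` {..card V}"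
 proof
  fix x assume "x \<in> ?S"
  then obtain N where N: "direct_summand R N ((syzygy R ^^ IT_phi R M) M)" "x = pd R N" "pd R N < \<infinity>" by blast
  then obtain d where d: "pd R N = enat d" by (cases "pd R N") auto
  have "N \<in> fgmod R" using N(1) by (simp add: direct_summand_def)
  from pd_le_card[OF this d] show "x \<in> enat ` {..card V}" using N(2) d by simp
 qed
 then have fin: "finite ?S" by (rule finite_subset) simp
 have psi: "IT_psi R M = enat (IT_phi R M) + Sup ?S" by (simp add: IT_psi_def)
 have ne: "?S \<noteq> {}"
 proof
  assume "?S = {}"
  then have "Sup ?S = 0" by (simp only: Sup_enat_def) simp
  then show False using assms unfolding psi by simp
 qed
 then have "Sup ?S = Max ?S" using fin by (simp only: Sup_enat_def) simp
 then have "Sup ?S \<in> ?S" using Max_in[OF fin ne] by simp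
 then obtain N where N: "Sup ?S = pd R N" "direct_summand R N ((syzygy R ^^ IT_phi R M) M)" "pd R N < \<infinity>" by blast
 then obtain d where d: "pd R N = enat d" by (cases "pd R N") auto
 have "N \<in> fgmod R" using N(2) by (simp add: direct_summand_def)
 from pd_le_card[OF this d] show ?thesis using that[OF N(2) d] N(1) d psi by simp
qed

text \<open>A summand \<open>N\<close> realising psi has a vertex \<open>i\<close> from which a
  longest walk of length \<open>d\<close> starts. Since \<open>N\<close> sits in the syzygy of order
  phi, \<open>dd_pow\<close> and one extra arrow give a walk of length phi ending at
  \<open>i\<close>. The combinatorial lemma then yields both the shape of the quiver and the fact
  that psi cannot exceed the bound.\<close>

lemma psi_big:
 assumes M: "M \<in> fgmod R" and n: "card V = n" "n > 3" and big: "IT_psi R M \<ge> enat (2 * n - 3)"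
 shows "IT_psi R M = enat (2 * n - 3)" "\<exists>c w. chain_form adj V n c w"
proof -
 have "IT_psi R M \<noteq> enat (IT_phi R M)"
 proof
  assume "IT_psi R M = enat (IT_phi R M)"
  then have "2 * n - 3 \<le> IT_phi R M" using big by simp
  then show False using phi_bounds(1)[of M] n by linarith
 qed
 then obtain N d where N: "direct_summand R N ((syzygy R ^^ IT_phi R M) M)" "pd R N = enat d" "d \<le> card V"
  "IT_psi R M = enat (IT_phi R M + d)" by (rule psi_attained) (rule that)
 have ge: "2 * n - 3 \<le> IT_phi R M + d" using big N(4) by simp
 have pn: "IT_phi R M \<le> n" using phi_bounds(1)[of M] unfolding n(1) .
 have dn: "d \<le> n" using N(3) unfolding n(1) .
 have "IT_phi R M \<noteq> 0" using ge dn n(2) by linarith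
 then obtain p where p: "IT_phi R M = Suc p" using not0_implies_Suc by blast
 have d: "d > 0" using ge pn n(2) by linarith
 let ?O = "(syzygy R ^^ Suc p) M"
 have O: "?O \<in> fgmod R" "semis ?O" using syz_pow_fg[OF M] syz_pow_semis[OF M] by blast+
 obtain N' where N': "N' \<in> fgmod R" "miso R ?O (msum N N')" and Nf: "N \<in> fgmod R"
  using N(1) unfolding p direct_summand_def by blast
 note ms = right_module_msum[OF fgD(1)[OF Nf] fgD(1)[OF N'(1)]]
 have "semis (msum N N')" by (rule semis_miso[OF O(2) ms N'(2)])
 then have Ns: "semis N" using semis_msum[OF fgD[OF Nf] fgD[OF N'(1)]] by simp
 obtain i x where ix: "dd N i > 0" "(i, x) \<in> adj ^^ d" using pd_semis(2)[OF Nf Ns N(2) d] by blast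
 have "dd ?O i > 0"
  using miso_dims(1)[OF fgD[OF O(1)] ms N'(2), of i] msum_dims(2)[OF fgD[OF Nf] fgD[OF N'(1)], of i] ix(1) by simp
 then obtain u' where u': "dd (syzygy R M) u' > 0" "(u', i) \<in> adj ^^ p" using dd_pow[OF M] by blast
 obtain u where "(u, u') \<in> adj" using dd_syzygy_pred[OF M u'(1)] by blast
 then have u: "(u, i) \<in> adj ^^ Suc p" using u'(2) by (rule relpow_Suc_I2)
 have "Suc p = n - 1 \<and> d = n - 2 \<and> (\<exists>c w. chain_form adj V n c w)"
 proof (rule chain_formI_walk[OF finV adj_sub n u ix(2)])
  show "(i, y) \<notin> adj ^^ Suc d" for y by (rule pd_semis(1)[OF Nf Ns N(2) ix(1)])
  show "2 * n - 3 \<le> Suc p + d" "Suc p \<le> n" using ge pn p by simp_all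
  show "Suc p \<le> n - 1" if "(z, z) \<in> adj\<^sup>+" "s \<in> V" "s \<notin> Domain adj" for z s
   using phi_bounds(2)[OF that, of M] p n by simp
 qed
 then show "IT_psi R M = enat (2 * n - 3)" "\<exists>c w. chain_form adj V n c w" using N(4) p n by auto
qed

text \<open>If the top vanishes at every vertex, the radical is everything, and
  \<open>nakayama\<close> applies to the zero submodule.\<close>

lemma top_zero:
 assumes N: "N \<in> fgmod R" and eq: "\<And>i. i \<in> V \<Longrightarrow> dd N i = rr N i"
 shows "carrier N = {\<zero>\<^bsub>N\<^esub>}"
proof -
 interpret N: rsz_module R V E src tgt ec xc N by (rule fg_rsz_module[OF N])
 have c: "y \<triangleleft>\<^bsub>N\<^esub> e i \<in> rad N" if "y \<in> carrier N" "i \<in> V" for y i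
 proof -
  have "rad N \<inter> comp N i = comp N i"
   by (rule N.K.kdim_sub_eq[OF N.K.ksub_Int[OF N.ksub_rad N.ksub_comp] N.ksub_comp
     N.kfin_any[OF fgD(2)[OF N] N.ksub_comp]]) (use eq[OF that(2)] in \<open>auto simp: rr_def dd_def\<close>)
  then show ?thesis using N.e_in_comp[OF that] by blast
 qed
 have "{\<zero>\<^bsub>N\<^esub>} = carrier N"
 proof (rule nakayama[OF fgD(1)[OF N]])
  show "submod R N {\<zero>\<^bsub>N\<^esub>}" by (rule N.submodI[OF N.K.ksub_zero]) auto
  fix y assume y: "y \<in> carrier N"
  have "y \<in> rad N" by (rule N.mem_by_comps[OF N.ksub_rad y]) (rule c[OF y])
  then show "\<exists>l\<in>{\<zero>\<^bsub>N\<^esub>}. \<exists>k\<in>rad N. y = l \<oplus>\<^bsub>N\<^esub> k" using y by force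
 qed
 then show ?thesis by simp
qed

text \<open>The quotient of \<open>e\<^sub>c A\<close> by the arrow \<open>a\<close>.\<close>

lemma quotient_by_arrow:
 assumes a: "a \<in> E"
 obtains M where "M \<in> fgmod R" "indecomposable R M" "\<And>j. j \<in> V \<Longrightarrow> om j M = (if j = tgt a then 1 else 0)"
proof -
 let ?c = "src a" and ?G = "{()}"
 \<comment> \<open>Only the product with \<open>a\<close> is made zero, so the syzygy is the line
   spanned by this product in \<open>e_c A\<close>, a simple module at the target of
   \<open>a\<close>.\<close>
 let ?D = "fullD ?G (\<lambda>_. ?c) - {(a, ())}"
 have g: "ggood ?G (\<lambda>_. ?c) ?D" using srcV[OF a] by (auto simp: ggood_def)
 note F = gmod_module[OF g] gmod_fin_gen[OF g]
 obtain M where M: "M \<in> fgmod R" "miso R (gmod ?G (\<lambda>_. ?c) ?D) M" using ex_umod[OF F] by blast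
 note md = miso_dims[OF F fgD(1)[OF M(1)] M(2)]
 have dims: "int (dd M i) - int (rr M i) = (if i = ?c then 1 else 0)" for i
  by (simp add: md gmod_dd[OF g] gmod_rr[OF g])
 have rc: "int (rr M j) = int (card {b\<in>E. tgt b = j \<and> src b = ?c}) - (if j = tgt a then 1 else 0)" for j
 proof -
  let ?B = "{b\<in>E. tgt b = j \<and> src b = ?c}"
  have eq: "{d\<in>?D. tgt (fst d) = j} = (\<lambda>b. (b, ())) ` (?B - {a})" by (auto simp: fullD_def)
  have "rr M j = card (?B - {a})" unfolding md gmod_rr[OF g] eq by (rule card_image) (simp add: inj_on_def)
  moreover have "card (?B - {a}) = card ?B - 1 \<and> card ?B > 0" if "j = tgt a"
   using that a finE by (subst card_Diff_singleton) (auto simp: card_gt_0_iff)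
  moreover have "?B - {a} = ?B" if "j \<noteq> tgt a" using that by auto
  ultimately show ?thesis by (cases "j = tgt a") auto
 qed
 have om: "om j M = (if j = tgt a then 1 else 0)" if "j \<in> V" for j
 proof -
  have "(\<Sum>b\<in>{b\<in>E. tgt b = j}. int (dd M (src b)) - int (rr M (src b)))
    = (\<Sum>b\<in>{b\<in>E. tgt b = j}. if src b = ?c then 1 else 0)" unfolding dims ..
  also have "\<dots> = (\<Sum>b\<in>{b\<in>{b\<in>E. tgt b = j}. src b = ?c}. 1)" using finE by (subst sum.inter_filter) auto
  also have "\<dots> = int (card {b\<in>E. tgt b = j \<and> src b = ?c})" by (simp add: conj_assoc)
  finally show ?thesis using om_eq[OF M(1) that] rc[of j] by simp
 qed
 \<comment> \<open>The top is one-dimensional, so in any decomposition one summand has zero top and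
   vanishes by \<open>top_zero\<close>.\<close>
 have "indecomposable R M"
  unfolding indecomposable_def
 proof (intro conjI ballI impI)
  show "M \<in> fgmod R" by (rule M(1))
  have "dd M ?c \<noteq> 0" using dims[of ?c] by simp
  then show "carrier M \<noteq> {\<zero>\<^bsub>M\<^esub>}" using carrier_zero_iff[OF fgD[OF M(1)]] srcV[OF a] by metis
  fix X Y assume X: "X \<in> fgmod R" and Y: "Y \<in> fgmod R" and iso: "miso R M (msum X Y)"
  note ms = right_module_msum[OF fgD(1)[OF X] fgD(1)[OF Y]]
  have sums: "dd X i + dd Y i = dd M i" "rr X i + rr Y i = rr M i" for i
   using miso_dims(1,2)[OF fgD[OF M(1)] ms iso, of i] msum_dims(2,3)[OF fgD[OF X] fgD[OF Y], of i] by simp_all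
  have s: "int (dd X i) - int (rr X i) + (int (dd Y i) - int (rr Y i)) = (if i = ?c then 1 else 0)" for i
  proof -
   have "int (dd X i) + int (dd Y i) = int (dd M i)" "int (rr X i) + int (rr Y i) = int (rr M i)"
    using sums[of i] by linarith+
   then show ?thesis using dims[of i] by linarith
  qed
  have le: "rr X i \<le> dd X i" "rr Y i \<le> dd Y i" for i using rr_le_dd(1) fgD X Y by blast+
  show "carrier X = {\<zero>\<^bsub>X\<^esub>} \<or> carrier Y = {\<zero>\<^bsub>Y\<^esub>}"
  proof (cases "dd X ?c = rr X ?c")
   case True
   have "dd X i = rr X i" for i using s[of i] le[of i] True by (cases "i = ?c") auto
   then show ?thesis using top_zero[OF X] by blast
  next
   case False
   have "dd Y i = rr Y i" for i using s[of i] le[of i] False by (cases "i = ?c") auto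
   then show ?thesis using top_zero[OF Y] by blast
  qed
 qed
 then show ?thesis using that M(1) om by blast
qed

text \<open>The two summands of the witness have different tasks. The syzygy of \<open>M1\<close> is
  the simple module at \<open>w 0\<close>, whose class survives until it reaches the sink at the end
  of the chain; this makes phi at least \<open>n - 1\<close>. The loop at \<open>c\<close> ensures,
  through \<open>sg c\<close>, that the simple module at \<open>w 0\<close>, of projective dimension
  \<open>n - 2\<close>, is a summand of the syzygy of order \<open>n - 1\<close>.\<close>

lemma psi_chain:
 assumes cf: "chain_form adj V n c w" and n: "n > 3" "card V = n"
 shows "\<exists>M\<in>fgmod R. IT_psi R M \<ge> enat (2 * n - 3)"
proof -
 have V: "V = insert c (w ` {..<n - 1})" and wi: "inj_on w {..<n - 1}" and cw: "c \<notin> w ` {..<n - 1}"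
  and cc: "(c, c) \<in> adj" and c0: "(c, w 0) \<in> adj" and ws: "\<And>k. Suc k < n - 1 \<Longrightarrow> (w k, w (Suc k)) \<in> adj"
  using cf by (auto simp: chain_form_def)
 have wV: "w k \<in> V" if "k < n - 1" for k using V that by blast
 have cV: "c \<in> V" using V by blast
 obtain a where a: "a \<in> E" "src a = c" "tgt a = w 0" using c0 by (auto simp: adj_def)
 obtain M1 where M1: "M1 \<in> fgmod R" "indecomposable R M1"
  and om1: "\<And>j. j \<in> V \<Longrightarrow> om j M1 = (if j = w 0 then 1 else 0)"
  using quotient_by_arrow[OF a(1)] unfolding a(3) by blast
 note m1 = fgD[OF M1(1)] and sc' = fgD[OF sg(1)[OF cV]]
 note ms = right_module_msum[OF m1(1) sc'(1)] msum_dims(1)[OF m1 sc']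
 obtain M where M: "M \<in> fgmod R" "miso R (msum M1 (sg c)) M" using ex_umod[OF ms] by blast
 have iso: "miso R M (msum M1 (sg c))" by (rule miso_sym[OF ms(1) M(2)])
 have "direct_summand R M1 M" using iso M1(1) sg(1)[OF cV] by (auto simp: direct_summand_def)
 then have X: "K0_class R M1 \<in> add_span R M" unfolding add_span_def using M1(2) by (intro generate.incl) blast
 have Xc: "K0_class R M1 \<in> carrier (K0 R)" by (rule cls_closed[OF M1(1)])
 let ?d = "\<lambda>j. if j = w 0 then 1 else (0::int)"
 have om: "omv (K0_class R M1) = ?d"
  using om1 wV[of 0] n by (auto simp: omv_def klift_cls[OF ainv_om M1(1)] fun_eq_iff)
 have walk: "(w 0, w k) \<in> adj ^^ k" if "k < n - 1" for k
  using that
 proof (induct k)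
  case (Suc k)
  then show ?case using ws[of k] by auto
 qed simp
 have short: "(w 0, y) \<notin> adj ^^ Suc (n - 2)" for y
 proof
  assume "(w 0, y) \<in> adj ^^ Suc (n - 2)"
  then have "y \<in> w ` {0 + Suc (n - 2)..<n - 1}" by (rule chain_form_walks[OF cf adj_sub, rotated]) (use n in simp)
  then show False using n(1) by auto
 qed
 have "Suc (n - 2) \<le> IT_phi R M"
 proof (rule phi_ge[OF X])
  \<comment> \<open>\<open>w (n - 3)\<close> is the chain vertex before the sink
    \<open>w (n - 2)\<close>. After \<open>n - 2\<close> applications of Omega-bar the class still
    has a positive coordinate there; one more application leaves nothing on
    \<open>NS\<close>.\<close>
  have n2: "n - 2 = Suc (n - 3)" and n3: "Suc (n - 3) < n - 1" using n(1) by linarith+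
  have w3: "w (n - 3) \<in> NS" unfolding NS_eq using DomainI[OF ws[OF n3]] wV[OF Suc_lessD[OF n3]] by simp
  have pos: "(Tv ^^ (n - 3)) ?d (w (n - 3)) > 0"
   by (subst Tv_pow_pos(2)) (use walk[OF Suc_lessD[OF n3]] in auto)
  have "(Omega_bar R ^^ (n - 2)) (K0_class R M1) = sig ((Tv ^^ (n - 3)) ?d)"
   using Omega_pow[OF Xc, of "n - 3"] unfolding n2 om .
  moreover have "sig ((Tv ^^ (n - 3)) ?d) \<noteq> sig (\<lambda>_. 0)"
  proof
   assume "sig ((Tv ^^ (n - 3)) ?d) = sig (\<lambda>_. 0)"
   from bspec[OF this[unfolded sig_eq_iff] w3] show False using pos by linarith
  qed
  ultimately show "(Omega_bar R ^^ (n - 2)) (K0_class R M1) \<noteq> \<one>\<^bsub>K0 R\<^esub>" unfolding sig_zero by simp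
  have "(Tv ^^ (n - 2)) ?d i = 0" if i: "i \<in> NS" for i
  proof (rule ccontr)
   assume "(Tv ^^ (n - 2)) ?d i \<noteq> 0"
   moreover have "(Tv ^^ (n - 2)) ?d i \<ge> 0" by (rule Tv_pow_pos(1)) simp
   ultimately have "(Tv ^^ (n - 2)) ?d i > 0" by linarith
   then have "(w 0, i) \<in> adj ^^ (n - 2)" by (subst (asm) Tv_pow_pos(2)) (auto split: if_splits)
   moreover obtain y where "(i, y) \<in> adj" using i by (auto simp: NS_eq)
   ultimately have "(w 0, y) \<in> adj ^^ Suc (n - 2)" by auto
   then show False using short by blast
  qed
  then have "sig ((Tv ^^ (n - 2)) ?d) = sig (\<lambda>_. 0)" unfolding sig_eq_iff by blast
  then show "(Omega_bar R ^^ Suc (n - 2)) (K0_class R M1) = \<one>\<^bsub>K0 R\<^esub>" unfolding Omega_pow[OF Xc] om sig_zero .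
 qed
 \<comment> \<open>The loop is a cycle and the end of the chain is a sink, so the sharper bound
   applies and phi is known exactly; this fixes the syzygy whose summands count for psi.\<close>
 moreover have "IT_phi R M \<le> card V - 1"
 proof (rule phi_bounds(2))
  show "(c, c) \<in> adj\<^sup>+" using cc by blast
  show "w (n - 2) \<in> V" using wV n by simp
  show "w (n - 2) \<notin> Domain adj"
  proof
   assume "w (n - 2) \<in> Domain adj"
   then obtain y where "(w (n - 2), y) \<in> adj ^^ 1" by auto
   then have "y \<in> w ` {n - 2 + 1..<n - 1}" by (rule chain_form_walks[OF cf adj_sub, rotated]) (use n in simp)
   then show False by auto
  qed
 qed
 ultimately have phi: "IT_phi R M = Suc (n - 2)" using n by simp
 let ?O = "(syzygy R ^^ Suc (n - 2)) M"
 have O: "?O \<in> fgmod R" "semis ?O" using syz_pow_fg[OF M(1)] syz_pow_semis[OF M(1)] by blast+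
 have "dd (syzygy R M) c > 0"
 proof -
  have "om c M = om c M1 + om c (sg c)"
   using ainv_om[OF cV] M(1) M1(1) sg(1)[OF cV] iso unfolding ainv_def by blast
  moreover have "om c (sg c) > 0"
  proof -
   have "dd ((syzygy R ^^ 1) (sg c)) c > 0" unfolding dd_pow_semis[OF sg(1,3)[OF cV]]
    by (rule exI[of _ c]) (use cc sg(4)[OF cV] in simp)
   then show ?thesis by (simp add: om_def)
  qed
  ultimately show ?thesis by (simp add: om_def)
 qed
 moreover have "(c, w 0) \<in> adj ^^ (n - 2)"
 proof -
  have "(c, c) \<in> adj ^^ k" for k using cc by (induct k) auto
  then have "(c, w 0) \<in> adj ^^ Suc (n - 3)" using c0 by auto
  moreover have "n - 2 = Suc (n - 3)" using n by simp
  ultimately show ?thesis by simp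
 qed
 ultimately have pos: "dd ?O (w 0) > 0" using dd_pow[OF M(1)] by blast
 have w0: "w 0 \<in> V" using wV n by simp
 obtain N' where N': "N' \<in> fgmod R" "miso R ?O (msum (sg (w 0)) N')"
  by (rule semis_split[OF O w0 sg(1,3)[OF w0] sg(4)[OF w0] pos]) (rule that)
 have ds: "direct_summand R (sg (w 0)) ?O" using N' sg(1)[OF w0] by (auto simp: direct_summand_def)
 have sgw: "dd (sg (w 0)) i > 0 \<longleftrightarrow> i = w 0" for i using sg(4)[OF w0, of i] by simp
 have le: "pd R (sg (w 0)) \<le> enat (n - 2)"
 proof (rule pd_semis_le[OF sg(1,3)[OF w0]])
  fix i j assume "dd (sg (w 0)) i > 0"
  then have i: "i = w 0" by (simp add: sgw)
  show "(i, j) \<notin> adj ^^ Suc (n - 2)" unfolding i by (rule short)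
 qed
 then obtain d where d: "pd R (sg (w 0)) = enat d" by (cases "pd R (sg (w 0))") auto
 have "n - 2 \<le> d"
 proof (rule ccontr)
  assume "\<not> n - 2 \<le> d"
  then have "Suc d < n - 1" by simp
  from walk[OF this] show False using pd_semis(1)[OF sg(1,3)[OF w0] d, of "w 0"] sgw by blast
 qed
 then have "enat (n - 2) \<le> pd R (sg (w 0))" by (simp add: d)
 also have "pd R (sg (w 0)) \<le> Sup {pd R N | N. direct_summand R N ?O \<and> pd R N < \<infinity>}"
  by (intro Sup_upper CollectI exI[of _ "sg (w 0)"] conjI refl ds) (simp add: d)
 finally have "enat (n - 2) \<le> Sup {pd R N | N. direct_summand R N ?O \<and> pd R N < \<infinity>}" .
 then have "enat (Suc (n - 2)) + enat (n - 2) \<le> IT_psi R M" unfolding IT_psi_def phi by (rule add_left_mono)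
 moreover have "enat (Suc (n - 2)) + enat (n - 2) = enat (2 * n - 3)" using n by simp
 ultimately have "enat (2 * n - 3) \<le> IT_psi R M" by (simp only:)
 then show ?thesis using M(1) by (rule bexI)
qed

text \<open>A finite supremum of extended naturals is attained, so the maximal value comes from one
  module and \<open>psi_big\<close> applies. Conversely \<open>psi_big\<close> also shows that no
  module exceeds \<open>2 * n - 3\<close>.\<close>

theorem psi_dim_iff:
 assumes n: "card V = n" "n > 3"
 shows "psi_dim R = enat (2 * n - 3) \<longleftrightarrow> (\<exists>c w. chain_form adj V n c w)"
proof
 assume p: "psi_dim R = enat (2 * n - 3)"
 let ?S = "IT_psi R ` fgmod R"
 have S: "Sup ?S = enat (2 * n - 3)" using p by (simp add: psi_dim_def)
 have ne: "?S \<noteq> {}" using sg(1) V_ne by blast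
 have "?S \<subseteq> {x. x \<le> enat (2 * n - 3)}" using Sup_upper[of _ ?S] S by auto
 then have fin: "finite ?S" using finite_enat_bounded[of ?S "2 * n - 3"] by auto
 have "Sup ?S = Max ?S" using fin ne by (simp only: Sup_enat_def) simp
 then have "enat (2 * n - 3) \<in> ?S" using Max_in[OF fin ne] S by simp
 then obtain M where "M \<in> fgmod R" "IT_psi R M = enat (2 * n - 3)" by (metis imageE)
 then show "\<exists>c w. chain_form adj V n c w" using psi_big(2)[OF _ n] by simp
next
 assume "\<exists>c w. chain_form adj V n c w"
 then obtain M where M: "M \<in> fgmod R" "IT_psi R M \<ge> enat (2 * n - 3)" using psi_chain n by blast
 have "IT_psi R N \<le> enat (2 * n - 3)" if "N \<in> fgmod R" for N
  using psi_big(1)[OF that n] linear[of "IT_psi R N" "enat (2 * n - 3)"] by fastforce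
 then have "psi_dim R \<le> enat (2 * n - 3)" unfolding psi_dim_def by (intro Sup_least) auto
 moreover have "IT_psi R M \<le> psi_dim R" unfolding psi_dim_def using M(1) by (intro Sup_upper) auto
 ultimately show "psi_dim R = enat (2 * n - 3)" using M(2) by (meson order_antisym order_trans)
qed

section \<open>Cosyzygies of semisimple modules\<close>

lemma semisD: "semis N \<Longrightarrow> right_module R N" "semis N \<Longrightarrow> fin_gen R N"
 "semis N \<Longrightarrow> y \<in> carrier N \<Longrightarrow> a \<in> E \<Longrightarrow> y \<triangleleft>\<^bsub>N\<^esub> ar a = \<zero>\<^bsub>N\<^esub>"
 by (auto simp: semis_def soc_def)

text \<open>The coinduced module of the semisimple module \<open>N\<close>: as a set of linear maps from the algebra to
 \<open>N\<close>, each of them given by its value at \<open>1\<close> and its values at the arrows.\<close>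

definition coind :: "('a, 'b) module \<Rightarrow> ('a, 'b \<times> ('e \<Rightarrow> 'b)) module"
 where "coind N = \<lparr>carrier = carrier N \<times> (\<Pi>\<^sub>E a\<in>E. comp N (tgt a)), monoid.mult = undefined, monoid.one = undefined,
  ring.zero = (\<zero>\<^bsub>N\<^esub>, \<lambda>a\<in>E. \<zero>\<^bsub>N\<^esub>),
  ring.add = (\<lambda>(y, z) (y', z'). (y \<oplus>\<^bsub>N\<^esub> y', \<lambda>a\<in>E. z a \<oplus>\<^bsub>N\<^esub> z' a)),
  module.smult = (\<lambda>r (y, z). (y \<triangleleft>\<^bsub>N\<^esub> r \<oplus>\<^bsub>N\<^esub> finsum N (\<lambda>a. kact N (xc r a) (z a)) E, \<lambda>a\<in>E. kact N (ec r (src a)) (z a)))\<rparr>"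

text \<open>The quotient of the coinduced module by \<open>N\<close>. The value at an arrow lies in
  the component of \<open>N\<close> at its target, but behaves as a vector at its source; this is
  why cosyzygies follow the arrows backwards.\<close>

definition coker :: "('a, 'b) module \<Rightarrow> ('a, 'e \<Rightarrow> 'b) module"
 where "coker N = \<lparr>carrier = (\<Pi>\<^sub>E a\<in>E. comp N (tgt a)), monoid.mult = undefined, monoid.one = undefined,
  ring.zero = (\<lambda>a\<in>E. \<zero>\<^bsub>N\<^esub>), ring.add = (\<lambda>z z'. \<lambda>a\<in>E. z a \<oplus>\<^bsub>N\<^esub> z' a),
  module.smult = (\<lambda>r z. \<lambda>a\<in>E. kact N (ec r (src a)) (z a))\<rparr>"

lemma coind_simps:
 "carrier (coind N) = carrier N \<times> carrier (coker N)" "carrier (coker N) = (\<Pi>\<^sub>E a\<in>E. comp N (tgt a))"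
 "\<zero>\<^bsub>coind N\<^esub> = (\<zero>\<^bsub>N\<^esub>, \<zero>\<^bsub>coker N\<^esub>)" "\<zero>\<^bsub>coker N\<^esub> = (\<lambda>a\<in>E. \<zero>\<^bsub>N\<^esub>)"
 "(y, z) \<oplus>\<^bsub>coind N\<^esub> (y', z') = (y \<oplus>\<^bsub>N\<^esub> y', z \<oplus>\<^bsub>coker N\<^esub> z')" "z \<oplus>\<^bsub>coker N\<^esub> z' = (\<lambda>a\<in>E. z a \<oplus>\<^bsub>N\<^esub> z' a)"
 "(y, z) \<triangleleft>\<^bsub>coind N\<^esub> r = (y \<triangleleft>\<^bsub>N\<^esub> r \<oplus>\<^bsub>N\<^esub> finsum N (\<lambda>a. kact N (xc r a) (z a)) E, z \<triangleleft>\<^bsub>coker N\<^esub> r)"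
 "z \<triangleleft>\<^bsub>coker N\<^esub> r = (\<lambda>a\<in>E. kact N (ec r (src a)) (z a))"
 by (simp_all add: coind_def coker_def)

end

section \<open>The coinduced module of a semisimple module and its universal property\<close>

locale semis_module = rsz_module R V E src tgt ec xc N
 for R :: "('a, 'r) ring_scheme" and V :: "'v set" and E :: "'e set" and src tgt :: "'e \<Rightarrow> 'v"
  and ec :: "'a \<Rightarrow> 'v \<Rightarrow> 'k::field" and xc :: "'a \<Rightarrow> 'e \<Rightarrow> 'k"
  and N :: "('a, 'b) module" (structure) +
 assumes ss: "semis N"
begin

lemma comp_act: "y \<in> comp N i \<Longrightarrow> i \<in> V \<Longrightarrow> r \<in> carrier R \<Longrightarrow> y \<triangleleft> r = kact N (ec r i) y"
proof -
 assume y: "y \<in> comp N i" and i: "i \<in> V" and r: "r \<in> carrier R"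
 have yc: "y \<in> carrier N" by (rule compD(1)[OF y])
 have "y \<triangleleft> r = (\<Oplus>j\<in>V. kact N (ec r j) (y \<triangleleft> e j)) \<oplus> (\<Oplus>a\<in>E. kact N (xc r a) (y \<triangleleft> ar a))"
  by (rule ract_expand[OF yc r])
 also have "(\<Oplus>a\<in>E. kact N (xc r a) (y \<triangleleft> ar a)) = \<zero>"
  by (rule finsum_zero') (simp add: semisD(3)[OF ss yc])
 also have "(\<Oplus>j\<in>V. kact N (ec r j) (y \<triangleleft> e j)) = (\<Oplus>j\<in>V. if j = i then kact N (ec r i) y else \<zero>)"
  using yc compD(2)[OF y] comp_e_other[OF y] by (intro finsum_cong') auto
 also have "\<dots> = kact N (ec r i) y" using finsum_single[OF finV i, of "\<lambda>_. kact N (ec r i) y"] yc by simp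
 finally show ?thesis using yc by simp
qed

lemma coker_mem: "z \<in> carrier (coker N) \<Longrightarrow> a \<in> E \<Longrightarrow> z a \<in> comp N (tgt a)"
 "z \<in> carrier (coker N) \<Longrightarrow> a \<in> E \<Longrightarrow> z a \<in> carrier N"
 by (auto simp: coind_simps PiE_def Pi_def comp_def)

lemma coker_eqI: "z \<in> carrier (coker N) \<Longrightarrow> z' \<in> carrier (coker N) \<Longrightarrow> (\<And>a. a \<in> E \<Longrightarrow> z a = z' a) \<Longrightarrow> z = z'"
 unfolding coind_simps by (rule PiE_ext)

lemma coker_restrict: "(\<And>a. a \<in> E \<Longrightarrow> z a \<in> comp N (tgt a)) \<Longrightarrow> (\<lambda>a\<in>E. z a) \<in> carrier (coker N)"
 unfolding coind_simps by auto

lemmas compK = K.ksubD[OF ksub_comp]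

lemma abelian_coker: "abelian_group (coker N)"
proof (rule abelian_groupI)
 fix z assume z: "z \<in> carrier (coker N)"
 show "\<exists>z'\<in>carrier (coker N). z' \<oplus>\<^bsub>coker N\<^esub> z = \<zero>\<^bsub>coker N\<^esub>"
  by (rule bexI[of _ "\<lambda>a\<in>E. \<ominus> z a"])
   (use z coker_mem[OF z] compK in \<open>auto simp: coind_simps(4,6) fun_eq_iff l_neg intro!: coker_restrict\<close>)
 show "\<zero>\<^bsub>coker N\<^esub> \<oplus>\<^bsub>coker N\<^esub> z = z"
  by (rule coker_eqI[OF _ z]) (use coker_mem[OF z] compK in \<open>auto simp: coind_simps(4,6) intro!: coker_restrict\<close>)
 fix z' assume z': "z' \<in> carrier (coker N)"
 show "z \<oplus>\<^bsub>coker N\<^esub> z' \<in> carrier (coker N)"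
  unfolding coind_simps(6) using coker_mem[OF z] coker_mem[OF z'] compK by (intro coker_restrict) auto
 show "z \<oplus>\<^bsub>coker N\<^esub> z' = z' \<oplus>\<^bsub>coker N\<^esub> z"
  using coker_mem[OF z] coker_mem[OF z'] by (auto simp: coind_simps(6) fun_eq_iff a_comm)
 fix z'' assume z'': "z'' \<in> carrier (coker N)"
 show "z \<oplus>\<^bsub>coker N\<^esub> z' \<oplus>\<^bsub>coker N\<^esub> z'' = z \<oplus>\<^bsub>coker N\<^esub> (z' \<oplus>\<^bsub>coker N\<^esub> z'')"
  using coker_mem[OF z] coker_mem[OF z'] coker_mem[OF z''] by (auto simp: coind_simps(6) fun_eq_iff a_assoc)
next
 show "\<zero>\<^bsub>coker N\<^esub> \<in> carrier (coker N)" unfolding coind_simps(4) by (intro coker_restrict comp_zero)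
qed

lemma module_coker: "right_module R (coker N)"
proof (intro right_module.intro right_module_axioms.intro R.ring_axioms abelian_coker)
 fix z r assume z: "z \<in> carrier (coker N)" and r: "r \<in> carrier R"
 show "z \<triangleleft>\<^bsub>coker N\<^esub> r \<in> carrier (coker N)"
  unfolding coind_simps(8) using coker_mem[OF z] compK by (intro coker_restrict) auto
 fix r' assume r': "r' \<in> carrier R"
 show "z \<triangleleft>\<^bsub>coker N\<^esub> (r \<oplus>\<^bsub>R\<^esub> r') = z \<triangleleft>\<^bsub>coker N\<^esub> r \<oplus>\<^bsub>coker N\<^esub> z \<triangleleft>\<^bsub>coker N\<^esub> r'"
  using coker_mem[OF z] r r' by (auto simp: coind_simps(6,8) fun_eq_iff ec_add srcV K.s_add_left)
 show "z \<triangleleft>\<^bsub>coker N\<^esub> (r \<otimes>\<^bsub>R\<^esub> r') = (z \<triangleleft>\<^bsub>coker N\<^esub> r) \<triangleleft>\<^bsub>coker N\<^esub> r'"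
  using coker_mem[OF z] r r'
  by (auto simp: coind_simps(8) fun_eq_iff ec_mult srcV K.s_mult[symmetric] mult.commute)
next
 fix z z' r assume z: "z \<in> carrier (coker N)" and z': "z' \<in> carrier (coker N)" and r: "r \<in> carrier R"
 show "(z \<oplus>\<^bsub>coker N\<^esub> z') \<triangleleft>\<^bsub>coker N\<^esub> r = z \<triangleleft>\<^bsub>coker N\<^esub> r \<oplus>\<^bsub>coker N\<^esub> z' \<triangleleft>\<^bsub>coker N\<^esub> r"
  using coker_mem[OF z] coker_mem[OF z'] by (auto simp: coind_simps(6,8) fun_eq_iff K.s_add)
next
 fix z assume z: "z \<in> carrier (coker N)"
 show "z \<triangleleft>\<^bsub>coker N\<^esub> \<one>\<^bsub>R\<^esub> = z"
  by (rule coker_eqI[OF _ z])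
   (use coker_mem[OF z] in \<open>auto simp: coind_simps(8) ec_one srcV K.s_one intro!: coker_restrict\<close>)
qed

sublocale Z: rsz_module R V E src tgt ec xc "coker N" by (rule rsz_moduleI[OF module_coker])

lemma xsum_closed: "z \<in> carrier (coker N) \<Longrightarrow> (\<Oplus>a\<in>E. kact N (f a) (z a)) \<in> carrier N"
 using coker_mem by (intro M.finsum_closed) auto

lemma module_coind: "right_module R (coind N)"
proof (intro right_module.intro right_module_axioms.intro R.ring_axioms)
 show "abelian_group (coind N)"
 proof (rule abelian_groupI)
  fix u assume "u \<in> carrier (coind N)"
  then obtain y z where u: "u = (y, z)" "y \<in> carrier N" "z \<in> carrier (coker N)" by (auto simp: coind_simps(1))
  show "\<exists>u'\<in>carrier (coind N). u' \<oplus>\<^bsub>coind N\<^esub> u = \<zero>\<^bsub>coind N\<^esub>"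
   by (rule bexI[of _ "(\<ominus> y, \<ominus>\<^bsub>coker N\<^esub> z)"]) (use u in \<open>auto simp: coind_simps(1,3,5) l_neg Z.l_neg\<close>)
 qed (auto simp: coind_simps(1,3,5) a_ac Z.a_ac)
 fix u r assume "u \<in> carrier (coind N)" and r: "r \<in> carrier R"
 then obtain y z where u: "u = (y, z)" "y \<in> carrier N" "z \<in> carrier (coker N)" by (auto simp: coind_simps(1))
 note zc = coker_mem[OF u(3)]
 show "u \<triangleleft>\<^bsub>coind N\<^esub> r \<in> carrier (coind N)" using u r xsum_closed by (simp add: coind_simps(1,7))
 fix r' assume r': "r' \<in> carrier R"
 have "(\<Oplus>a\<in>E. kact N (xc (r \<oplus>\<^bsub>R\<^esub> r') a) (z a)) = (\<Oplus>a\<in>E. kact N (xc r a) (z a) \<oplus> kact N (xc r' a) (z a))"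
  using zc r r' by (intro finsum_cong') (auto simp: xc_add K.s_add_left)
 also have "\<dots> = (\<Oplus>a\<in>E. kact N (xc r a) (z a)) \<oplus> (\<Oplus>a\<in>E. kact N (xc r' a) (z a))"
  using zc by (intro M.finsum_addf) auto
 finally show "u \<triangleleft>\<^bsub>coind N\<^esub> (r \<oplus>\<^bsub>R\<^esub> r') = u \<triangleleft>\<^bsub>coind N\<^esub> r \<oplus>\<^bsub>coind N\<^esub> u \<triangleleft>\<^bsub>coind N\<^esub> r'"
  using u r r' xsum_closed[OF u(3)] by (simp add: coind_simps(5,7) Z.ract_add_right ract_add_right a_ac)
 \<comment> \<open>The two terms of \<open>xc_mult\<close>: the arrow part of \<open>r\<close>
   followed by the idempotent part of \<open>r'\<close>, and the idempotent part of \<open>r\<close>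
   at the source followed by the arrow part of \<open>r'\<close>.\<close>
 have "(\<Oplus>a\<in>E. kact N (xc (r \<otimes>\<^bsub>R\<^esub> r') a) (z a))
   = (\<Oplus>a\<in>E. kact N (xc r a) (z a) \<triangleleft> r' \<oplus> kact N (xc r' a) (kact N (ec r (src a)) (z a)))"
 proof (rule finsum_cong')
  fix a assume a: "a \<in> E"
  have "kact N (xc r a) (z a) \<triangleleft> r' = kact N (xc r a) (kact N (ec r' (tgt a)) (z a))"
   using kact_ract[OF zc(2)[OF a] r'] comp_act[OF zc(1)[OF a] tgtV[OF a] r'] by simp
  then show "kact N (xc (r \<otimes>\<^bsub>R\<^esub> r') a) (z a)
    = kact N (xc r a) (z a) \<triangleleft> r' \<oplus> kact N (xc r' a) (kact N (ec r (src a)) (z a))"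
   using zc(2)[OF a] xc_mult[OF r r' a] by (simp add: K.s_mult[symmetric] K.s_add_left[symmetric] algebra_simps)
 qed (use zc r' in auto)
 also have "\<dots> = (\<Oplus>a\<in>E. kact N (xc r a) (z a) \<triangleleft> r') \<oplus> (\<Oplus>a\<in>E. kact N (xc r' a) (kact N (ec r (src a)) (z a)))"
  using zc r' by (intro M.finsum_addf) auto
 also have "(\<Oplus>a\<in>E. kact N (xc r a) (z a) \<triangleleft> r') = (\<Oplus>a\<in>E. kact N (xc r a) (z a)) \<triangleleft> r'"
  using zc r' by (intro ract_finsum_left[symmetric]) auto
 also have "(\<Oplus>a\<in>E. kact N (xc r' a) (kact N (ec r (src a)) (z a))) = (\<Oplus>a\<in>E. kact N (xc r' a) ((z \<triangleleft>\<^bsub>coker N\<^esub> r) a))"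
  using zc by (intro finsum_cong') (auto simp: coind_simps(8))
 finally show "u \<triangleleft>\<^bsub>coind N\<^esub> (r \<otimes>\<^bsub>R\<^esub> r') = (u \<triangleleft>\<^bsub>coind N\<^esub> r) \<triangleleft>\<^bsub>coind N\<^esub> r'"
  using u r r' xsum_closed[OF u(3)] xsum_closed[OF Z.ract_closed[OF u(3) r]]
  by (simp add: coind_simps(5,7) Z.ract_assoc ract_assoc ract_add_left a_ac)
next
 fix u v r assume "u \<in> carrier (coind N)" "v \<in> carrier (coind N)" and r: "r \<in> carrier R"
 then obtain y z y' z' where u: "u = (y, z)" "y \<in> carrier N" "z \<in> carrier (coker N)"
  and v: "v = (y', z')" "y' \<in> carrier N" "z' \<in> carrier (coker N)" by (auto simp: coind_simps(1))
 note zc = coker_mem[OF u(3)] coker_mem[OF v(3)]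
 have "(\<Oplus>a\<in>E. kact N (xc r a) ((z \<oplus>\<^bsub>coker N\<^esub> z') a)) = (\<Oplus>a\<in>E. kact N (xc r a) (z a) \<oplus> kact N (xc r a) (z' a))"
  using zc by (intro finsum_cong') (auto simp: coind_simps(6) K.s_add)
 also have "\<dots> = (\<Oplus>a\<in>E. kact N (xc r a) (z a)) \<oplus> (\<Oplus>a\<in>E. kact N (xc r a) (z' a))"
  using zc by (intro M.finsum_addf) auto
 finally show "(u \<oplus>\<^bsub>coind N\<^esub> v) \<triangleleft>\<^bsub>coind N\<^esub> r = u \<triangleleft>\<^bsub>coind N\<^esub> r \<oplus>\<^bsub>coind N\<^esub> v \<triangleleft>\<^bsub>coind N\<^esub> r"
  using u v r xsum_closed[OF u(3)] xsum_closed[OF v(3)]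
  by (simp add: coind_simps(5,7) Z.ract_add_left ract_add_left a_ac)
next
 fix u assume "u \<in> carrier (coind N)"
 then obtain y z where u: "u = (y, z)" "y \<in> carrier N" "z \<in> carrier (coker N)" by (auto simp: coind_simps(1))
 have "(\<Oplus>a\<in>E. kact N (xc \<one>\<^bsub>R\<^esub> a) (z a)) = \<zero>"
  using coker_mem[OF u(3)] by (intro finsum_zero') (simp add: xc_one)
 then show "u \<triangleleft>\<^bsub>coind N\<^esub> \<one>\<^bsub>R\<^esub> = u" using u by (simp add: coind_simps(7) ract_one Z.ract_one)
qed

sublocale I: rsz_module R V E src tgt ec xc "coind N" by (rule rsz_moduleI[OF module_coind])

lemma coker_acts:
 assumes z: "z \<in> carrier (coker N)"
 shows "kact (coker N) c z = (\<lambda>a\<in>E. kact N c (z a))" "z \<triangleleft>\<^bsub>coker N\<^esub> e i = (\<lambda>a\<in>E. if src a = i then z a else \<zero>)"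
  "b \<in> E \<Longrightarrow> z \<triangleleft>\<^bsub>coker N\<^esub> ar b = \<zero>\<^bsub>coker N\<^esub>"
 using coker_mem[OF z] by (auto simp: kact_def[of "coker N"] coind_simps(4,8) fun_eq_iff srcV K.s_one)

lemma coind_acts:
 assumes y: "y \<in> carrier N" and z: "z \<in> carrier (coker N)"
 shows "kact (coind N) c (y, z) = (kact N c y, kact (coker N) c z)"
  "(y, z) \<triangleleft>\<^bsub>coind N\<^esub> e i = (y \<triangleleft> e i, z \<triangleleft>\<^bsub>coker N\<^esub> e i)"
  "b \<in> E \<Longrightarrow> (y, z) \<triangleleft>\<^bsub>coind N\<^esub> ar b = (z b, \<zero>\<^bsub>coker N\<^esub>)"
proof -
 note zc = coker_mem[OF z]
 have "(\<Oplus>a\<in>E. kact N (xc (sc c) a) (z a)) = \<zero>" "(\<Oplus>a\<in>E. kact N (xc (e i) a) (z a)) = \<zero>"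
  using zc by (auto intro!: finsum_zero')
 then show "kact (coind N) c (y, z) = (kact N c y, kact (coker N) c z)"
  "(y, z) \<triangleleft>\<^bsub>coind N\<^esub> e i = (y \<triangleleft> e i, z \<triangleleft>\<^bsub>coker N\<^esub> e i)"
  using y by (simp_all add: coind_simps(7) kact_def)
 assume b: "b \<in> E"
 have "(\<Oplus>a\<in>E. kact N (xc (ar b) a) (z a)) = (\<Oplus>a\<in>E. if a = b then z b else \<zero>)"
  using zc b by (intro finsum_cong') (auto simp: K.s_one)
 also have "\<dots> = z b" using finsum_single[OF finE b, of "\<lambda>_. z b"] zc b by simp
 finally show "(y, z) \<triangleleft>\<^bsub>coind N\<^esub> ar b = (z b, \<zero>\<^bsub>coker N\<^esub>)"
  using y b z zc(2)[OF b] by (simp add: coind_simps(7) coker_acts semisD(3)[OF ss])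
qed

lemma coind_fin_gen: "fin_gen R (coind N)"
proof -
 obtain X where X: "finite X" "X \<subseteq> carrier N" "\<And>W. ksub N (kact N) W \<Longrightarrow> X \<subseteq> W \<Longrightarrow> carrier N \<subseteq> W"
  by (rule kfinE[OF kfin_carrier[OF semisD(2)[OF ss]]]) (rule that)
 \<comment> \<open>The vector with a single value, at the arrow \<open>b\<close>; such vectors and
   \<open>N\<close> itself span the coinduced module.\<close>
 define s where "s b y = (\<lambda>a\<in>E. if a = b then y \<triangleleft> e (tgt b) else \<zero>)" for b y
 have s: "s b y \<in> carrier (coker N)" if "y \<in> carrier N" "b \<in> E" for b y
  unfolding s_def using that comp_zero tgtV by (intro coker_restrict) auto
 define Y where "Y = (\<lambda>y. (y, \<zero>\<^bsub>coker N\<^esub>)) ` X \<union> (\<Union>b\<in>E. (\<lambda>y. (\<zero>, s b y)) ` X)"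
 have "kfin (coind N) (kact (coind N)) (carrier (coind N))"
  unfolding kfin_def
 proof (intro exI conjI allI impI)
  show "finite Y" using X(1) finE by (simp add: Y_def)
  show "Y \<subseteq> carrier (coind N)" using X(2) s unfolding Y_def coind_simps(1) by auto
  fix W assume W: "ksub (coind N) (kact (coind N)) W \<and> Y \<subseteq> W"
  note WD = I.K.ksubD[OF conjunct1[OF W]]
  have 1: "(y, \<zero>\<^bsub>coker N\<^esub>) \<in> W" if y: "y \<in> carrier N" for y
  proof -
   have "carrier N \<subseteq> {y\<in>carrier N. (y, \<zero>\<^bsub>coker N\<^esub>) \<in> W}"
   proof (rule X(3))
    show "ksub N (kact N) {y\<in>carrier N. (y, \<zero>\<^bsub>coker N\<^esub>) \<in> W}"
     unfolding ksub_def
    proof (intro conjI ballI allI)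
     fix y y' assume yy: "y \<in> {y\<in>carrier N. (y, \<zero>\<^bsub>coker N\<^esub>) \<in> W}" "y' \<in> {y\<in>carrier N. (y, \<zero>\<^bsub>coker N\<^esub>) \<in> W}"
     show "y \<oplus> y' \<in> {y\<in>carrier N. (y, \<zero>\<^bsub>coker N\<^esub>) \<in> W}"
      using yy WD(3)[of "(y, \<zero>\<^bsub>coker N\<^esub>)" "(y', \<zero>\<^bsub>coker N\<^esub>)"] by (simp add: coind_simps(5))
    next
     fix c y assume yy: "y \<in> {y\<in>carrier N. (y, \<zero>\<^bsub>coker N\<^esub>) \<in> W}"
     show "kact N c y \<in> {y\<in>carrier N. (y, \<zero>\<^bsub>coker N\<^esub>) \<in> W}"
      using yy WD(4)[of "(y, \<zero>\<^bsub>coker N\<^esub>)" c] by (simp add: coind_acts(1))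
    qed (use WD(2) in \<open>auto simp: coind_simps(3)\<close>)
    show "X \<subseteq> {y\<in>carrier N. (y, \<zero>\<^bsub>coker N\<^esub>) \<in> W}" using X(2) W by (auto simp: Y_def)
   qed
   then show ?thesis using y by blast
  qed
  have 2: "(\<zero>, s b y) \<in> W" if y: "y \<in> carrier N" and b: "b \<in> E" for y b
  proof -
   have "carrier N \<subseteq> {y\<in>carrier N. (\<zero>, s b y) \<in> W}"
   proof (rule X(3))
    show "ksub N (kact N) {y\<in>carrier N. (\<zero>, s b y) \<in> W}"
     unfolding ksub_def
    proof (intro conjI ballI allI)
     have "s b \<zero> = \<zero>\<^bsub>coker N\<^esub>" by (simp add: s_def coind_simps(4) fun_eq_iff)
     then show "\<zero> \<in> {y\<in>carrier N. (\<zero>, s b y) \<in> W}" using WD(2) by (simp add: coind_simps(3))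
     fix y y' assume yy: "y \<in> {y\<in>carrier N. (\<zero>, s b y) \<in> W}" "y' \<in> {y\<in>carrier N. (\<zero>, s b y) \<in> W}"
     have "s b y \<oplus>\<^bsub>coker N\<^esub> s b y' = s b (y \<oplus> y')"
      using yy by (auto simp: s_def coind_simps(6) fun_eq_iff ract_add_left)
     then show "y \<oplus> y' \<in> {y\<in>carrier N. (\<zero>, s b y) \<in> W}"
      using yy WD(3)[of "(\<zero>, s b y)" "(\<zero>, s b y')"] by (simp add: coind_simps(5))
    next
     fix c y assume yy: "y \<in> {y\<in>carrier N. (\<zero>, s b y) \<in> W}"
     have "kact (coker N) c (s b y) = s b (kact N c y)"
      using yy s[OF _ b] by (auto simp: coker_acts s_def fun_eq_iff kact_ract)
     then show "kact N c y \<in> {y\<in>carrier N. (\<zero>, s b y) \<in> W}"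
      using yy WD(4)[of "(\<zero>, s b y)" c] s[OF _ b] by (simp add: coind_acts(1))
    qed auto
    show "X \<subseteq> {y\<in>carrier N. (\<zero>, s b y) \<in> W}" using X(2) W b unfolding Y_def by blast
   qed
   then show ?thesis using y by blast
  qed
  show "carrier (coind N) \<subseteq> W"
  proof
   fix u assume "u \<in> carrier (coind N)"
   then obtain y z where u: "u = (y, z)" "y \<in> carrier N" "z \<in> carrier (coker N)" by (auto simp: coind_simps(1))
   have "(\<zero>, \<lambda>a\<in>E. if a \<in> F then z a else \<zero>) \<in> W" if "finite F" "F \<subseteq> E" for F
    using that
   proof (induct F rule: finite_induct)
    case empty
    have "(\<lambda>a\<in>E. if a \<in> {} then z a else \<zero>) = \<zero>\<^bsub>coker N\<^esub>" by (simp add: coind_simps(4))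
    then show ?case using WD(2) by (simp only: coind_simps(3))
   next
    case (insert b F)
    have b: "b \<in> E" using insert by simp
    have "(\<zero>, s b (z b)) \<oplus>\<^bsub>coind N\<^esub> (\<zero>, \<lambda>a\<in>E. if a \<in> F then z a else \<zero>) \<in> W"
     by (rule WD(3)[OF 2[OF coker_mem(2)[OF u(3) b] b] insert(3)]) (use insert(4) in simp)
    moreover have "s b (z b) \<oplus>\<^bsub>coker N\<^esub> (\<lambda>a\<in>E. if a \<in> F then z a else \<zero>) = (\<lambda>a\<in>E. if a \<in> insert b F then z a else \<zero>)"
     using insert(2) coker_mem[OF u(3)] compD(2)[OF coker_mem(1)[OF u(3) b]]
     by (auto simp: s_def coind_simps(6) fun_eq_iff)
    ultimately show ?case by (simp only: coind_simps(5) l_zero zero_closed)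
   qed
   from this[OF finE order_refl] have "(\<zero>, \<lambda>a\<in>E. z a) \<in> W" by (simp cong: restrict_cong)
   moreover have "(\<lambda>a\<in>E. z a) = z" using u(3) by (simp add: coind_simps(2) PiE_restrict)
   ultimately have "(y, \<zero>\<^bsub>coker N\<^esub>) \<oplus>\<^bsub>coind N\<^esub> (\<zero>, z) \<in> W" using 1[OF u(2)] by (intro WD(3)) auto
   then show "u \<in> W" using u by (simp add: coind_simps(5))
  qed
 qed
 then show ?thesis by (rule I.fin_genI)
qed

lemma coind_maps: "(\<lambda>y. (y, \<zero>\<^bsub>coker N\<^esub>)) \<in> mhom R N (coind N)" "snd \<in> mhom R (coind N) (coker N)"
proof -
 show "(\<lambda>y. (y, \<zero>\<^bsub>coker N\<^esub>)) \<in> mhom R N (coind N)"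
  by (rule mhomI[OF right_module_axioms module_coind])
   (auto simp: coind_simps(1,5) coind_acts coind_simps(4) semisD(3)[OF ss] Z.K.s_zero[unfolded coind_simps(4)]
    Z.zero_closed[unfolded coind_simps(4)] Z.ract_zero_left[unfolded coind_simps(4)] Z.l_zero[unfolded coind_simps(4)])
 show "snd \<in> mhom R (coind N) (coker N)"
  by (rule mhomI[OF module_coind module_coker]) (auto simp: coind_simps(1,5) coind_acts coker_acts(3))
qed

lemma coker_fin_gen: "fin_gen R (coker N)"
proof (rule Z.fin_genI)
 have im: "snd ` carrier (coind N) = carrier (coker N)" by (force simp: coind_simps(1))
 have "kfin (coker N) (kact (coker N)) (snd ` carrier (coind N))"
  by (rule kfin_image[of "coind N" "kact (coind N)" "coker N" "kact (coker N)" "carrier (coind N)" snd,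
    OF I.kspace_kact Z.kspace_kact I.K.ksub_carrier I.kfin_carrier[OF coind_fin_gen]])
   (use mhomD[OF coind_maps(2)] in auto)
 then show "kfin (coker N) (kact (coker N)) (carrier (coker N))" unfolding im .
qed

text \<open>A homomorphism into the coinduced module is the same as a linear map into \<open>N\<close> that respects the
 decomposition by the vertices, and the latter can be extended along an inclusion.\<close>

lemma coind_extend:
 assumes A: "A \<in> fgmod R" and B: "B \<in> fgmod R" and g: "g \<in> mhom R A B" "inj_on g (carrier A)"
  and f: "f \<in> mhom R A (coind N)"
 shows "\<exists>h\<in>mhom R B (coind N). \<forall>y\<in>carrier A. h (g y) = f y"
proof -
 interpret A: rsz_module R V E src tgt ec xc A by (rule fg_rsz_module[OF A])
 interpret B: rsz_module R V E src tgt ec xc B by (rule fg_rsz_module[OF B])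
 note G = mhomD[OF g(1)] and F = mhomD[OF f]
 have ks: "ksub B (kact B) (g ` comp A i)" "g ` comp A i \<subseteq> comp B i" for i
  by (rule ksub_image(1)[of A "kact A" B "kact B" "comp A i" g, OF A.kspace_kact B.kspace_kact A.ksub_comp])
   (use G A.compD(1) mhom_comp[OF g(1)] in auto)
 \<comment> \<open>Each component of the image of \<open>A\<close> has a linear projection from the
   same component of \<open>B\<close>. This gives a retraction \<open>t\<close> of \<open>g\<close>
   that respects the vertices but in general not the arrows.\<close>
 have "\<exists>p. (\<forall>w\<in>comp B i. p w \<in> g ` comp A i) \<and> (\<forall>u\<in>g ` comp A i. p u = u)
   \<and> (\<forall>x\<in>comp B i. \<forall>y\<in>comp B i. p (x \<oplus>\<^bsub>B\<^esub> y) = p x \<oplus>\<^bsub>B\<^esub> p y) \<and> (\<forall>c. \<forall>x\<in>comp B i. p (kact B c x) = kact B c (p x))" for i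
  by (rule B.K.projection_exists[OF ks(1) B.ksub_comp B.kfin_any[OF fgD(2)[OF B] B.ksub_comp] ks(2)]) blast
 then obtain p where p: "\<And>i w. w \<in> comp B i \<Longrightarrow> p i w \<in> g ` comp A i" "\<And>i y. y \<in> comp A i \<Longrightarrow> p i (g y) = g y"
  "\<And>i x y. x \<in> comp B i \<Longrightarrow> y \<in> comp B i \<Longrightarrow> p i (x \<oplus>\<^bsub>B\<^esub> y) = p i x \<oplus>\<^bsub>B\<^esub> p i y"
  "\<And>i c x. x \<in> comp B i \<Longrightarrow> p i (kact B c x) = kact B c (p i x)" by (metis imageI)
 define t where "t i w = inv_into (carrier A) g (p i w)" for i w
 have t: "t i w \<in> comp A i" "g (t i w) = p i w" if w: "w \<in> comp B i" for i w
 proof -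
  obtain y where y: "y \<in> comp A i" "p i w = g y" using p(1)[OF w] by blast
  then have "t i w = y" using g(2) A.compD(1) by (simp add: t_def)
  then show "t i w \<in> comp A i" "g (t i w) = p i w" using y by simp_all
 qed
 have tI: "t i w = y" if "w \<in> comp B i" "y \<in> comp A i" "p i w = g y" for i w y
  using that t[OF that(1)] g(2) A.compD(1) by (metis inj_onD)
 have t_add: "t i (x \<oplus>\<^bsub>B\<^esub> y) = t i x \<oplus>\<^bsub>A\<^esub> t i y" if "x \<in> comp B i" "y \<in> comp B i" for i x y
  using that t[OF that(1)] t[OF that(2)] A.K.ksubD[OF A.ksub_comp] B.K.ksubD[OF B.ksub_comp]
  by (intro tI) (simp_all add: p(3) G(2))
 have t_k: "t i (kact B c x) = kact A c (t i x)" if "x \<in> comp B i" for i c x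
  using that t[OF that] A.K.ksubD[OF A.ksub_comp] B.K.ksubD[OF B.ksub_comp]
  by (intro tI) (simp_all add: p(4) G(4))
 have t_g: "t i (g y) = y" if "y \<in> comp A i" for i y
  by (rule tI) (use that p(2) mhom_comp[OF g(1)] in auto)
 define k where "k y = fst (f y)" for y
 have k: "k y \<in> carrier N" if "y \<in> carrier A" for y using F(1)[OF that] by (auto simp: k_def coind_simps(1))
 have kadd: "k (x \<oplus>\<^bsub>A\<^esub> y) = k x \<oplus> k y" if "x \<in> carrier A" "y \<in> carrier A" for x y
  using F(2)[OF that] by (cases "f x"; cases "f y") (simp add: k_def coind_simps(5))
 have kk: "k (kact A c x) = kact N c (k x)" if "x \<in> carrier A" for c x
  using F(4)[OF that, of c] F(1)[OF that] by (cases "f x") (simp add: k_def coind_acts coind_simps(1))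
 have ke: "k (x \<triangleleft>\<^bsub>A\<^esub> e i) = k x \<triangleleft> e i" if "x \<in> carrier A" for i x
  using F(3)[OF that e_closed, of i] F(1)[OF that] by (cases "f x") (simp add: k_def coind_acts coind_simps(1))
 have kx: "snd (f x) b = k (x \<triangleleft>\<^bsub>A\<^esub> ar b)" if "x \<in> carrier A" "b \<in> E" for b x
  using F(3)[OF that(1) ar_closed, of b] F(1)[OF that(1)] that(2)
  by (cases "f x") (simp add: k_def coind_acts coind_simps(1))
 \<comment> \<open>The \<open>N\<close>-component of \<open>f\<close>, extended to \<open>B\<close>
   along the retraction and assembled from the vertex components.\<close>
 define l where "l w = finsum N (\<lambda>i. k (t i (w \<triangleleft>\<^bsub>B\<^esub> e i))) V" for w
 have lt: "k (t i (w \<triangleleft>\<^bsub>B\<^esub> e i)) \<in> comp N i" if "w \<in> carrier B" "i \<in> V" for i w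
  using ke[of "t i (w \<triangleleft>\<^bsub>B\<^esub> e i)" i] k t(1)[OF B.e_in_comp[OF that]] by (simp add: comp_def)
 have lc: "l w \<in> carrier N" if "w \<in> carrier B" for w
  unfolding l_def using lt[OF that] compD(1) by (intro M.finsum_closed) blast
 have ladd: "l (x \<oplus>\<^bsub>B\<^esub> y) = l x \<oplus> l y" if "x \<in> carrier B" "y \<in> carrier B" for x y
 proof -
  have "l (x \<oplus>\<^bsub>B\<^esub> y) = finsum N (\<lambda>i. k (t i (x \<triangleleft>\<^bsub>B\<^esub> e i)) \<oplus> k (t i (y \<triangleleft>\<^bsub>B\<^esub> e i))) V"
   unfolding l_def
  proof (rule finsum_cong')
   fix i assume i: "i \<in> V"
   show "k (t i ((x \<oplus>\<^bsub>B\<^esub> y) \<triangleleft>\<^bsub>B\<^esub> e i)) = k (t i (x \<triangleleft>\<^bsub>B\<^esub> e i)) \<oplus> k (t i (y \<triangleleft>\<^bsub>B\<^esub> e i))"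
    using that i t(1)[OF B.e_in_comp[OF that(1) i]] t(1)[OF B.e_in_comp[OF that(2) i]]
    by (simp add: B.ract_add_left t_add kadd A.compD(1))
  qed (use that lt compD(1) in blast)+
  also have "\<dots> = l x \<oplus> l y" unfolding l_def using that lt compD(1) by (intro M.finsum_addf) blast+
  finally show ?thesis .
 qed
 have lk: "l (kact B c x) = kact N c (l x)" if "x \<in> carrier B" for c x
 proof -
  have "l (kact B c x) = finsum N (\<lambda>i. kact N c (k (t i (x \<triangleleft>\<^bsub>B\<^esub> e i)))) V"
   unfolding l_def
  proof (rule finsum_cong')
   fix i assume i: "i \<in> V"
   show "k (t i (kact B c x \<triangleleft>\<^bsub>B\<^esub> e i)) = kact N c (k (t i (x \<triangleleft>\<^bsub>B\<^esub> e i)))"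
    using that i t(1)[OF B.e_in_comp[OF that i]] by (simp add: B.kact_ract t_k kk A.compD(1))
  qed (use that lt[THEN compD(1)] in auto)
  also have "\<dots> = kact N c (l x)" unfolding l_def using that lt compD(1) by (intro K.s_finsum[symmetric]) blast
  finally show ?thesis .
 qed
 have lcomp: "l w = k (t i w)" if w: "w \<in> comp B i" and i: "i \<in> V" for w i
 proof -
  have kz: "k (t j \<zero>\<^bsub>B\<^esub>) = \<zero>" for j
   using t_k[OF B.comp_zero, of j 0] kk[of "t j \<zero>\<^bsub>B\<^esub>" 0] t(1)[OF B.comp_zero, of j] k by (simp add: A.compD(1))
  have "l w = finsum N (\<lambda>j. if j = i then k (t i w) else \<zero>) V"
   unfolding l_def
   using B.comp_e_other[OF w] B.compD[OF w] kz k t(1)[OF w] A.compD(1) by (intro finsum_cong') auto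
  also have "\<dots> = k (t i w)"
   using finsum_single[OF finV i, of "\<lambda>_. k (t i w)"] k t(1)[OF w] A.compD(1) by simp
  finally show ?thesis .
 qed
 have le: "l (w \<triangleleft>\<^bsub>B\<^esub> e i) = l w \<triangleleft> e i" if w: "w \<in> carrier B" and i: "i \<in> V" for w i
 proof -
  have "l w \<triangleleft> e i = finsum N (\<lambda>j. k (t j (w \<triangleleft>\<^bsub>B\<^esub> e j)) \<triangleleft> e i) V"
   unfolding l_def using w lt compD(1) by (intro ract_finsum_left) blast+
  also have "\<dots> = finsum N (\<lambda>j. if j = i then k (t i (w \<triangleleft>\<^bsub>B\<^esub> e i)) else \<zero>) V"
  proof (rule finsum_cong')
   fix j assume j: "j \<in> V"
   show "k (t j (w \<triangleleft>\<^bsub>B\<^esub> e j)) \<triangleleft> e i = (if j = i then k (t i (w \<triangleleft>\<^bsub>B\<^esub> e i)) else \<zero>)"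
    using compD[OF lt[OF w j]] comp_e_other[OF lt[OF w j] i] by auto
  qed (use lt[OF w, THEN compD(1)] i in auto)
  also have "\<dots> = k (t i (w \<triangleleft>\<^bsub>B\<^esub> e i))"
   using finsum_single[OF finV i, of "\<lambda>_. k (t i (w \<triangleleft>\<^bsub>B\<^esub> e i))"] lt[OF w i] compD(1) by simp
  finally show ?thesis using lcomp[OF B.e_in_comp[OF w i] i] by simp
 qed
 have lg: "l (g y) = k y" if y: "y \<in> carrier A" for y
 proof -
  have "l (g y) = finsum N (\<lambda>i. k (y \<triangleleft>\<^bsub>A\<^esub> e i)) V"
   unfolding l_def using y k t_g[OF A.e_in_comp[OF y]] G(3)[OF y e_closed] by (intro finsum_cong') auto
  also have "\<dots> = finsum N (\<lambda>i. k y \<triangleleft> e i) V" using ke[OF y] by simp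
  finally show ?thesis using sum_e[OF k[OF y]] by simp
 qed
 have lx: "l (w \<triangleleft>\<^bsub>B\<^esub> ar a) \<in> comp N (tgt a)" if "w \<in> carrier B" "a \<in> E" for w a
  using le[of "w \<triangleleft>\<^bsub>B\<^esub> ar a" "tgt a"] B.compD[OF B.x_in_comp[OF that]] lc that tgtV by (simp add: comp_def)
 \<comment> \<open>The values at the arrows are forced: they are the \<open>N\<close>-components
   after multiplication by the arrow.\<close>
 define h where "h w = (l w, \<lambda>a\<in>E. l (w \<triangleleft>\<^bsub>B\<^esub> ar a))" for w
 have sh: "(\<lambda>a\<in>E. l (w \<triangleleft>\<^bsub>B\<^esub> ar a)) \<in> carrier (coker N)" if "w \<in> carrier B" for w
  using lx[OF that] by (rule coker_restrict)
 have lz: "l \<zero>\<^bsub>B\<^esub> = \<zero>" using lk[of "\<zero>\<^bsub>B\<^esub>" 0] lc[of "\<zero>\<^bsub>B\<^esub>"] by simp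
 have "h \<in> mhom R B (coind N)"
 proof (rule mhomI[OF B.right_module_axioms module_coind])
  fix w assume w: "w \<in> carrier B"
  show "h w \<in> carrier (coind N)" using lc[OF w] sh[OF w] by (simp add: h_def coind_simps(1))
  show "h (kact B c w) = kact (coind N) c (h w)" for c
   using w lc sh by (auto simp: h_def coind_acts coker_acts lk B.kact_ract fun_eq_iff)
  show "h (w \<triangleleft>\<^bsub>B\<^esub> e i) = h w \<triangleleft>\<^bsub>coind N\<^esub> e i" if "i \<in> V" for i
   using w that lc sh by (auto simp: h_def coind_acts coker_acts le B.e_x_act lz fun_eq_iff)
  show "h (w \<triangleleft>\<^bsub>B\<^esub> ar b) = h w \<triangleleft>\<^bsub>coind N\<^esub> ar b" if "b \<in> E" for b
   using w that lc sh by (auto simp: h_def coind_acts coker_acts B.x_x_act lz fun_eq_iff coind_simps(4))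
  fix w' assume w': "w' \<in> carrier B"
  show "h (w \<oplus>\<^bsub>B\<^esub> w') = h w \<oplus>\<^bsub>coind N\<^esub> h w'"
   using w w' by (auto simp: h_def coind_simps(5,6) ladd B.ract_add_left fun_eq_iff)
 qed
 moreover have "h (g y) = f y" if y: "y \<in> carrier A" for y
 proof -
  obtain u v where uv: "f y = (u, v)" "v \<in> carrier (coker N)" using F(1)[OF y] by (auto simp: coind_simps(1))
  have "(\<lambda>a\<in>E. l (g y \<triangleleft>\<^bsub>B\<^esub> ar a)) = v"
   using sh[OF G(1)[OF y]] uv(2)
   by (rule coker_eqI) (use kx[OF y] y uv(1) lg in \<open>auto simp: G(3)[symmetric]\<close>)
  then show ?thesis using lg[OF y] uv by (simp add: h_def k_def)
 qed
 ultimately show ?thesis by blast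
qed

end

section \<open>Injective envelopes and iterated cosyzygies\<close>

context rsz begin

lemma semis_moduleI: "semis N \<Longrightarrow> semis_module R V E src tgt ec xc N"
 by (intro semis_module.intro rsz_moduleI semis_module_axioms.intro semisD)

lemma injective_coind:
 assumes N: "N \<in> fgmod R" "semis N" and I: "I \<in> fgmod R"
  and \<theta>: "\<theta> \<in> mhom R (coind N) I" "bij_betw \<theta> (carrier (coind N)) (carrier I)"
 shows "injective R I"
 unfolding injective_def
proof (intro conjI ballI impI)
 interpret N: semis_module R V E src tgt ec xc N by (rule semis_moduleI[OF N(2)])
 define \<theta>' where "\<theta>' = inv_into (carrier (coind N)) \<theta>"
 have t': "\<theta>' \<in> mhom R I (coind N)" unfolding \<theta>'_def by (rule mhom_inv[OF N.module_coind \<theta>])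
 fix A B g f assume A: "A \<in> fgmod R" "B \<in> fgmod R" "g \<in> mhom R A B" and f: "f \<in> mhom R A I" and g: "inj_on g (carrier A)"
 obtain h where h: "h \<in> mhom R B (coind N)" "\<And>y. y \<in> carrier A \<Longrightarrow> h (g y) = \<theta>' (f y)"
  using N.coind_extend[OF A(1,2,3) g mhom_compose[OF f t']] by blast
 have "\<theta> (h (g y)) = f y" if y: "y \<in> carrier A" for y
  unfolding h(2)[OF y] \<theta>'_def using mhomD(1)[OF f y] \<theta>(2) by (intro f_inv_into_f) (simp add: bij_betw_def)
 then show "\<exists>h\<in>mhom R B I. \<forall>y\<in>carrier A. h (g y) = f y"
  using mhom_compose[OF h(1) \<theta>(1)] by (intro bexI[of _ "\<lambda>y. \<theta> (h y)"]) auto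
qed (rule I)

lemma envelopeD:
 assumes "injective_envelope R M j I"
 shows "injective R I" "I \<in> fgmod R" "j \<in> mhom R M I" "inj_on j (carrier M)"
  "submod R I L \<Longrightarrow> L \<inter> j ` carrier M = {\<zero>\<^bsub>I\<^esub>} \<Longrightarrow> L = {\<zero>\<^bsub>I\<^esub>}"
 using assms by (auto simp: injective_envelope_def injective_def)

text \<open>The coinduced module is an essential extension: if a submodule meets \<open>N\<close>
  trivially, multiplying one of its elements by an arrow extracts the value at that arrow as an
  element of \<open>N\<close>, which must vanish; so the element itself lies in
  \<open>N\<close>.\<close>

lemma cosyzygy_spec:
 assumes N: "N \<in> fgmod R" "semis N"
 shows "cosyzygy R N \<in> fgmod R \<and> (\<exists>I j q. injective_envelope R N j I \<and> short_exact R N j I q (cosyzygy R N))"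
 unfolding cosyzygy_def
proof (rule someI_ex)
 interpret N: semis_module R V E src tgt ec xc N by (rule semis_moduleI[OF N(2)])
 obtain I \<theta> where I: "I \<in> fgmod R" and \<theta>: "\<theta> \<in> mhom R (coind N) I" "bij_betw \<theta> (carrier (coind N)) (carrier I)"
  using ex_umod[OF N.module_coind N.coind_fin_gen] by (auto simp: miso_def)
 obtain C \<zeta> where C: "C \<in> fgmod R" and \<zeta>: "\<zeta> \<in> mhom R (coker N) C" "bij_betw \<zeta> (carrier (coker N)) (carrier C)"
  using ex_umod[OF N.module_coker N.coker_fin_gen] by (auto simp: miso_def)
 note rm = fgD(1)[OF I] fgD(1)[OF C]
 interpret I: rsz_module R V E src tgt ec xc I by (rule rsz_moduleI[OF rm(1)])
 define \<theta>' where "\<theta>' = inv_into (carrier (coind N)) \<theta>"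
 have t': "\<theta>' \<in> mhom R I (coind N)" unfolding \<theta>'_def by (rule mhom_inv[OF N.module_coind \<theta>])
 have tt: "\<theta>' (\<theta> u) = u" if "u \<in> carrier (coind N)" for u
  using that \<theta>(2) by (simp add: \<theta>'_def bij_betw_def)
 have tt': "\<theta> (\<theta>' u) = u" if "u \<in> carrier I" for u
  using that \<theta>(2) by (simp add: \<theta>'_def bij_betw_def f_inv_into_f)
 define j where "j y = \<theta> (y, \<zero>\<^bsub>coker N\<^esub>)" for y
 define q where "q u = \<zeta> (snd (\<theta>' u))" for u
 have c0: "(y, \<zero>\<^bsub>coker N\<^esub>) \<in> carrier (coind N)" if "y \<in> carrier N" for y using that by (simp add: coind_simps(1))
 have j: "j \<in> mhom R N I" unfolding j_def by (rule mhom_compose[OF N.coind_maps(1) \<theta>(1)])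
 have ji: "inj_on j (carrier N)"
 proof (rule inj_onI)
  fix x y assume "x \<in> carrier N" "y \<in> carrier N" "j x = j y"
  then show "x = y" using tt[OF c0] unfolding j_def by (metis prod.inject)
 qed
 have q: "q \<in> mhom R I C"
  unfolding q_def by (rule mhom_compose[OF mhom_compose[OF t' N.coind_maps(2)] \<zeta>(1)])
 have jim: "j ` carrier N = {u\<in>carrier I. snd (\<theta>' u) = \<zero>\<^bsub>coker N\<^esub>}"
 proof (intro equalityI subsetI)
  fix u assume "u \<in> j ` carrier N"
  then show "u \<in> {u\<in>carrier I. snd (\<theta>' u) = \<zero>\<^bsub>coker N\<^esub>}" using mhomD(1)[OF j] tt[OF c0] by (auto simp: j_def)
 next
  fix u assume u: "u \<in> {u\<in>carrier I. snd (\<theta>' u) = \<zero>\<^bsub>coker N\<^esub>}"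
  then have "\<theta>' u = (fst (\<theta>' u), \<zero>\<^bsub>coker N\<^esub>)" "fst (\<theta>' u) \<in> carrier N"
   using mhomD(1)[OF t', of u] by (auto simp: coind_simps(1) prod_eq_iff mem_Times_iff)
  then show "u \<in> j ` carrier N" using tt'[of u] u unfolding j_def by (metis (no_types, lifting) image_eqI mem_Collect_eq)
 qed
 have "injective_envelope R N j I"
  unfolding injective_envelope_def
 proof (intro conjI allI impI j ji)
  show "injective R I" by (rule injective_coind[OF N I \<theta>])
  fix L assume L: "submod R I L \<and> L \<inter> j ` carrier N = {\<zero>\<^bsub>I\<^esub>}"
  note LD = I.submodD[OF conjunct1[OF L]]
  note Lk = I.K.ksubD[OF LD(1)]
  have "u = \<zero>\<^bsub>I\<^esub>" if u: "u \<in> L" for u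
  proof -
   have uc: "u \<in> carrier I" by (rule Lk(1)[OF u])
   obtain y z where yz: "\<theta>' u = (y, z)" "y \<in> carrier N" "z \<in> carrier (coker N)"
    using mhomD(1)[OF t' uc] by (auto simp: coind_simps(1))
   have "z a = \<zero>\<^bsub>coker N\<^esub> a" if a: "a \<in> E" for a
   proof -
    have "\<theta>' (u \<triangleleft>\<^bsub>I\<^esub> ar a) = (z a, \<zero>\<^bsub>coker N\<^esub>)"
     using mhomD(3)[OF t' uc ar_closed, of a] yz a by (simp add: N.coind_acts(3))
    moreover have "u \<triangleleft>\<^bsub>I\<^esub> ar a \<in> L" using conjunct1[OF L] u by (simp add: submod_def)
    ultimately have "u \<triangleleft>\<^bsub>I\<^esub> ar a = \<zero>\<^bsub>I\<^esub>" using L jim uc by auto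
    then have "(z a, \<zero>\<^bsub>coker N\<^esub>) = \<zero>\<^bsub>coind N\<^esub>"
     using \<open>\<theta>' (u \<triangleleft>\<^bsub>I\<^esub> ar a) = _\<close> mhom_zero[OF rm(1) N.module_coind t'] by simp
    then show ?thesis using a by (simp add: coind_simps(3,4))
   qed
   then have "z = \<zero>\<^bsub>coker N\<^esub>" by (intro N.coker_eqI[OF yz(3)]) auto
   then have "u \<in> j ` carrier N" using jim uc yz by simp
   then show ?thesis using L u by blast
  qed
  then show "L = {\<zero>\<^bsub>I\<^esub>}" using Lk(2) by blast
 qed
 moreover have "short_exact R N j I q C"
  unfolding short_exact_def
 proof (intro conjI j ji q)
  have "\<theta>' ` carrier I = carrier (coind N)"
   using bij_betw_inv_into[OF \<theta>(2)] by (simp add: \<theta>'_def bij_betw_def)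
  then have "q ` carrier I = \<zeta> ` (snd ` carrier (coind N))" unfolding q_def by (metis image_image)
  also have "snd ` carrier (coind N) = carrier (coker N)" by (force simp: coind_simps(1))
  finally show "q ` carrier I = carrier C" using \<zeta>(2) by (simp add: bij_betw_def)
  have "q u = \<zero>\<^bsub>C\<^esub> \<longleftrightarrow> snd (\<theta>' u) = \<zero>\<^bsub>coker N\<^esub>" if u: "u \<in> carrier I" for u
  proof -
   have "snd (\<theta>' u) \<in> carrier (coker N)" using mhomD(1)[OF t' u] by (auto simp: coind_simps(1))
   moreover have "\<zeta> \<zero>\<^bsub>coker N\<^esub> = \<zero>\<^bsub>C\<^esub>" by (rule mhom_zero[OF N.module_coker rm(2) \<zeta>(1)])
   ultimately show ?thesis using \<zeta>(2) unfolding q_def bij_betw_def inj_on_def by (metis N.Z.zero_closed)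
  qed
  then show "j ` carrier N = a_kernel I C q" unfolding jim by (auto simp: a_kernel_iff)
 qed
 ultimately show "\<exists>C. C \<in> fgmod R \<and> (\<exists>I j q. injective_envelope R N j I \<and> short_exact R N j I q C)" using C by blast
qed

text \<open>The envelope behind \<open>cosyzygy\<close> is an arbitrary one, so it is compared with
  the coinduced module in both directions: it embeds there by essentiality, and it receives a map
  from there because \<open>I\<close> is injective. The support is then read off from the values at
  the arrows starting at \<open>i\<close>.\<close>

lemma cosyzygy_semis:
 assumes N: "N \<in> fgmod R" "semis N"
 shows "cosyzygy R N \<in> fgmod R" "semis (cosyzygy R N)"
  "dd (cosyzygy R N) i > 0 \<longleftrightarrow> (\<exists>j. (i, j) \<in> adj \<and> dd N j > 0)"
proof -
 interpret N: semis_module R V E src tgt ec xc N by (rule semis_moduleI[OF N(2)])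
 let ?C = "cosyzygy R N"
 obtain I j q where env: "injective_envelope R N j I" and ex: "short_exact R N j I q ?C" and C: "?C \<in> fgmod R"
  using cosyzygy_spec[OF N] by blast
 show "?C \<in> fgmod R" by (rule C)
 note ED = envelopeD[OF env] and SD = short_exactD[OF ex]
 note rm = fgD(1)[OF ED(2)] fgD(1)[OF C]
 interpret I: rsz_module R V E src tgt ec xc I by (rule rsz_moduleI[OF rm(1)])
 interpret C: rsz_module R V E src tgt ec xc ?C by (rule rsz_moduleI[OF rm(2)])
 let ?i = "\<lambda>y. (y, \<zero>\<^bsub>coker N\<^esub>)"
 have jz: "j \<zero>\<^bsub>N\<^esub> = \<zero>\<^bsub>I\<^esub>" by (rule mhom_zero[OF N.right_module_axioms rm(1) ED(3)])
 obtain h where h: "h \<in> mhom R I (coind N)" "\<And>y. y \<in> carrier N \<Longrightarrow> h (j y) = ?i y"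
  using N.coind_extend[OF N(1) ED(2,3,4) N.coind_maps(1)] by blast
 have hz: "h \<zero>\<^bsub>I\<^esub> = \<zero>\<^bsub>coind N\<^esub>" by (rule mhom_zero[OF rm(1) N.module_coind h(1)])
 \<comment> \<open>On \<open>N\<close> the map \<open>h\<close> is the canonical inclusion, so its
   kernel meets \<open>N\<close> trivially and essentiality makes it zero.\<close>
 have ker: "a_kernel I (coind N) h = {\<zero>\<^bsub>I\<^esub>}"
 proof (rule ED(5))
  show "submod R I (a_kernel I (coind N) h)" by (rule mhom_kernel_submod[OF rm(1) N.module_coind h(1)])
  have "y = \<zero>\<^bsub>N\<^esub>" if "y \<in> carrier N" "h (j y) = \<zero>\<^bsub>coind N\<^esub>" for y
   using that h(2) by (simp add: coind_simps(3))
  then show "a_kernel I (coind N) h \<inter> j ` carrier N = {\<zero>\<^bsub>I\<^esub>}"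
   using jz hz by (auto simp: a_kernel_iff intro!: image_eqI[of _ _ "\<zero>\<^bsub>N\<^esub>"])
 qed
 have hinj: "u = v" if "u \<in> carrier I" "v \<in> carrier I" "h u = h v" for u v
 proof -
  have "u \<ominus>\<^bsub>I\<^esub> v \<in> a_kernel I (coind N) h"
   using mhom_minus[OF rm(1) N.module_coind h(1) that(1,2)] that mhomD(1)[OF h(1)]
   by (simp add: a_kernel_iff N.I.r_neg a_minus_def)
  then show ?thesis using ker that by simp
 qed
 have qz: "q u = \<zero>\<^bsub>?C\<^esub> \<longleftrightarrow> u \<in> j ` carrier N" if "u \<in> carrier I" for u
  using SD(5) that by (auto simp: a_kernel_iff)
 have inj: "u \<in> j ` carrier N" if u: "u \<in> carrier I" and z: "snd (h u) = \<zero>\<^bsub>coker N\<^esub>" for u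
 proof -
  obtain y where y: "h u = ?i y" "y \<in> carrier N"
   using mhomD(1)[OF h(1) u] z by (cases "h u") (auto simp: coind_simps(1))
  then have "u = j y" using hinj[OF u mhomD(1)[OF ED(3) y(2)]] h(2)[OF y(2)] by simp
  then show ?thesis using y(2) by simp
 qed
 have lift: "\<exists>u\<in>carrier I. q u = w" if "w \<in> carrier ?C" for w using SD(4) that by (metis imageE)
 have "w \<triangleleft>\<^bsub>?C\<^esub> ar a = \<zero>\<^bsub>?C\<^esub>" if w: "w \<in> carrier ?C" and a: "a \<in> E" for w a
 proof -
  obtain u where u: "u \<in> carrier I" "q u = w" using lift[OF w] by blast
  have "snd (h (u \<triangleleft>\<^bsub>I\<^esub> ar a)) = \<zero>\<^bsub>coker N\<^esub>"
   using mhomD(3)[OF h(1) u(1) ar_closed, of a] mhomD(1)[OF h(1) u(1)] a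
   by (cases "h u") (simp add: N.coind_acts(3) coind_simps(1))
  then have "q (u \<triangleleft>\<^bsub>I\<^esub> ar a) = \<zero>\<^bsub>?C\<^esub>" using inj[of "u \<triangleleft>\<^bsub>I\<^esub> ar a"] qz[of "u \<triangleleft>\<^bsub>I\<^esub> ar a"] u(1) by simp
  then show ?thesis using mhomD(3)[OF SD(3) u(1) ar_closed, of a] u(2) by simp
 qed
 then show sC: "semis ?C" using rm(2) fgD(2)[OF C] by (auto simp: semis_def soc_def)
 show "dd ?C i > 0 \<longleftrightarrow> (\<exists>j. (i, j) \<in> adj \<and> dd N j > 0)"
 proof
  assume i: "dd ?C i > 0"
  then have iV: "i \<in> V" using dd_outside[OF C, of i] by (cases "i \<in> V") auto
  obtain w where w: "w \<in> comp ?C i" "w \<noteq> \<zero>\<^bsub>?C\<^esub>" using i dd_pos_iff[OF fgD[OF C]] by blast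
  obtain u' where u': "u' \<in> carrier I" "q u' = w" using lift[OF C.compD(1)[OF w(1)]] by blast
  define u where "u = u' \<triangleleft>\<^bsub>I\<^esub> e i"
  have u: "u \<in> carrier I" "u \<triangleleft>\<^bsub>I\<^esub> e i = u" "q u = w"
   using u' mhomD(3)[OF SD(3) u'(1) e_closed, of i] C.compD(2)[OF w(1)] I.e_act[OF u'(1) iV, of i] by (simp_all add: u_def)
  obtain y z where yz: "h u = (y, z)" "y \<in> carrier N" "z \<in> carrier (coker N)"
   using mhomD(1)[OF h(1) u(1)] by (auto simp: coind_simps(1))
  have "z \<noteq> \<zero>\<^bsub>coker N\<^esub>" using inj[OF u(1)] qz[OF u(1)] u(3) w(2) yz by auto
  then obtain a where a: "a \<in> E" "z a \<noteq> \<zero>\<^bsub>N\<^esub>"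
   using N.coker_eqI[OF yz(3) N.Z.zero_closed] by (auto simp: coind_simps(4))
  have ze: "z \<triangleleft>\<^bsub>coker N\<^esub> e i = z"
   using mhomD(3)[OF h(1) u(1) e_closed, of i] u(2) yz by (simp add: N.coind_acts(2))
  have "(z \<triangleleft>\<^bsub>coker N\<^esub> e i) a = z a" unfolding ze ..
  then have "(if src a = i then z a else \<zero>\<^bsub>N\<^esub>) = z a"
   unfolding N.coker_acts(2)[OF yz(3)] restrict_apply'[OF a(1)] .
  then have "src a = i" using a(2) by (auto split: if_splits)
  then show "\<exists>j. (i, j) \<in> adj \<and> dd N j > 0"
   using a N.coker_mem(1)[OF yz(3) a(1)] dd_pos_iff[OF fgD[OF N(1)]] by (auto simp: adj_def)
 next
  assume "\<exists>j. (i, j) \<in> adj \<and> dd N j > 0"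
  then obtain a y where a: "a \<in> E" "src a = i" and y: "y \<in> comp N (tgt a)" "y \<noteq> \<zero>\<^bsub>N\<^esub>"
   using dd_pos_iff[OF fgD[OF N(1)]] by (auto simp: adj_def)
  have iV: "i \<in> V" using a srcV by auto
  have yc: "y \<in> carrier N" by (rule N.compD(1)[OF y(1)])
  obtain I1 \<theta> where I1: "I1 \<in> fgmod R" and \<theta>: "\<theta> \<in> mhom R (coind N) I1" "bij_betw \<theta> (carrier (coind N)) (carrier I1)"
   using ex_umod[OF N.module_coind N.coind_fin_gen] by (auto simp: miso_def)
  have "inj_on (\<lambda>y. \<theta> (?i y)) (carrier N)"
  proof (rule inj_onI)
   fix y y' assume yy: "y \<in> carrier N" "y' \<in> carrier N" "\<theta> (?i y) = \<theta> (?i y')"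
   have "?i y = ?i y'" by (rule inj_onD[OF bij_betw_imp_inj_on[OF \<theta>(2)] yy(3)]) (use yy in \<open>simp_all add: coind_simps(1)\<close>)
   then show "y = y'" by simp
  qed
  then have "\<exists>k\<in>mhom R I1 I. \<forall>y\<in>carrier N. k (\<theta> (?i y)) = j y"
   using ED(1) N(1) I1 mhom_compose[OF N.coind_maps(1) \<theta>(1)] ED(3) unfolding injective_def by blast
  then obtain k1 where k1: "k1 \<in> mhom R I1 I" "\<And>y. y \<in> carrier N \<Longrightarrow> k1 (\<theta> (?i y)) = j y" by blast
  define k where "k u = k1 (\<theta> u)" for u
  have k: "k \<in> mhom R (coind N) I" unfolding k_def by (rule mhom_compose[OF \<theta>(1) k1(1)])
  have ki: "k (?i y) = j y" using k1(2)[OF yc] by (simp add: k_def)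
  \<comment> \<open>The vector with the single value \<open>y\<close> at \<open>a\<close>.
    Multiplying its image in \<open>I\<close> by \<open>a\<close> returns \<open>j y\<close>, which
    is nonzero, so that image is outside \<open>N\<close>.\<close>
  define z where "z = (\<lambda>b\<in>E. if b = a then y else \<zero>\<^bsub>N\<^esub>)"
  have z: "z \<in> carrier (coker N)" unfolding z_def using y(1) N.comp_zero by (intro N.coker_restrict) auto
  have zi: "z \<triangleleft>\<^bsub>coker N\<^esub> e i = z" unfolding N.coker_acts(2)[OF z] using a by (auto simp: z_def fun_eq_iff)
  have c: "(\<zero>\<^bsub>N\<^esub>, z) \<in> carrier (coind N)" using z by (simp add: coind_simps(1))
  define u where "u = k (\<zero>\<^bsub>N\<^esub>, z)"
  have u: "u \<in> carrier I" "u \<triangleleft>\<^bsub>I\<^esub> e i = u"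
   using mhomD(1)[OF k c] mhomD(3)[OF k c e_closed, of i] z zi by (simp_all add: u_def N.coind_acts(2))
  have ua: "u \<triangleleft>\<^bsub>I\<^esub> ar a = j y"
   using mhomD(3)[OF k c ar_closed, of a] z a ki by (simp add: u_def N.coind_acts(3)) (simp add: z_def)
  have jy: "j y \<noteq> \<zero>\<^bsub>I\<^esub>" using inj_onD[OF ED(4), of y "\<zero>\<^bsub>N\<^esub>"] jz y(2) yc by auto
  have "u \<notin> j ` carrier N"
  proof
   assume "u \<in> j ` carrier N"
   then obtain y' where y': "y' \<in> carrier N" "u = j y'" by blast
   then have "u \<triangleleft>\<^bsub>I\<^esub> ar a = j (y' \<triangleleft>\<^bsub>N\<^esub> ar a)" using mhomD(3)[OF ED(3) y'(1) ar_closed, of a] by simp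
   then show False using semisD(3)[OF N(2) y'(1) a(1)] jz jy ua by simp
  qed
  then have "q u \<noteq> \<zero>\<^bsub>?C\<^esub>" using qz[OF u(1)] by simp
  moreover have "q u \<in> comp ?C i"
   using mhomD(1)[OF SD(3) u(1)] mhomD(3)[OF SD(3) u(1) e_closed, of i] u(2) by (simp add: comp_def)
  ultimately show "dd ?C i > 0" using dd_pos_iff[OF fgD[OF C]] by blast
 qed
qed

lemma cosyzygy_pow:
 assumes N: "N \<in> fgmod R" "semis N"
 shows "(cosyzygy R ^^ n) N \<in> fgmod R \<and> semis ((cosyzygy R ^^ n) N) \<and>
  (\<forall>i. dd ((cosyzygy R ^^ n) N) i > 0 \<longleftrightarrow> (\<exists>j. (i, j) \<in> adj ^^ n \<and> dd N j > 0))"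
proof (induct n)
 case (Suc n)
 let ?X = "(cosyzygy R ^^ n) N"
 have X: "?X \<in> fgmod R" "semis ?X" using Suc by blast+
 have "dd (cosyzygy R ?X) i > 0 \<longleftrightarrow> (\<exists>j. (i, j) \<in> adj O adj ^^ n \<and> dd N j > 0)" for i
  using cosyzygy_semis(3)[OF X, of i] Suc by blast
 then show ?case using cosyzygy_semis(1,2)[OF X] by (simp add: relpow_commute)
qed (use N in auto)

subsection \<open>Simple modules and supports\<close>

text \<open>The socle is a submodule containing the radical; were it zero, all arrows would act by
  zero and it would be everything. Hence simplicity makes the arrows act by zero, and then the line
  through a nonzero vector at \<open>i\<close> is a submodule and so the whole module.\<close>

lemma simple_dims:
 assumes S: "simple_mod R S" and x: "x \<in> carrier S" "x \<triangleleft>\<^bsub>S\<^esub> e i \<noteq> \<zero>\<^bsub>S\<^esub>" and i: "i \<in> V"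
 shows "S \<in> fgmod R" "semis S" "dd S j = (if j = i then 1 else 0)"
proof -
 show fg: "S \<in> fgmod R" using S by (simp add: simple_mod_def)
 interpret S: rsz_module R V E src tgt ec xc S by (rule fg_rsz_module[OF fg])
 have sm: "N = {\<zero>\<^bsub>S\<^esub>} \<or> N = carrier S" if "submod R S N" for N using S that by (simp add: simple_mod_def)
 have "submod R S (soc S)"
  by (rule S.submodI[OF S.ksub_soc]) (use S.soc_e S.K.ksubD(2)[OF S.ksub_soc] in \<open>auto simp: soc_def\<close>)
 moreover have "soc S \<noteq> {\<zero>\<^bsub>S\<^esub>}"
 proof
  assume 0: "soc S = {\<zero>\<^bsub>S\<^esub>}"
  have "y \<in> soc S" if y: "y \<in> carrier S" for y
  proof -
   have "y \<triangleleft>\<^bsub>S\<^esub> ar b = \<zero>\<^bsub>S\<^esub>" if "b \<in> E" for b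
    using S.rad_soc[OF S.x_in_rad[OF y that]] unfolding 0 by simp
   then show ?thesis using y by (simp add: soc_def)
  qed
  then show False using 0 x S.ract_closed[OF x(1) e_closed, of i] by blast
 qed
 ultimately show ss: "semis S" using sm fgD[OF fg] by (auto simp: semis_def)
 define y where "y = x \<triangleleft>\<^bsub>S\<^esub> e i"
 have y: "y \<in> comp S i" "y \<in> carrier S" "y \<noteq> \<zero>\<^bsub>S\<^esub>" using x i by (auto simp: y_def)
 let ?W = "range (\<lambda>c. kact S c y)"
 have z: "\<zero>\<^bsub>S\<^esub> \<in> ?W" using S.K.s_zero_left[OF y(2)] by (metis rangeI)
 have other: "kact S c y \<triangleleft>\<^bsub>S\<^esub> e j = \<zero>\<^bsub>S\<^esub>" if "j \<in> V" "j \<noteq> i" for c j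
  using S.comp_e_other[OF y(1) that] y(2) by (simp add: S.kact_ract)
 have "submod R S ?W"
 proof (rule S.submodI[OF S.K.ksub_line[OF y(2)]])
  show "w \<triangleleft>\<^bsub>S\<^esub> e j \<in> ?W" if "w \<in> ?W" "j \<in> V" for w j
   using that other z S.compD(2)[OF y(1)] y(2) by (cases "j = i") (auto simp: S.kact_ract)
  show "w \<triangleleft>\<^bsub>S\<^esub> ar a \<in> ?W" if "w \<in> ?W" "a \<in> E" for w a
   using that z semisD(3)[OF ss, of w a] y(2) by auto
 qed
 moreover have "?W \<noteq> {\<zero>\<^bsub>S\<^esub>}" using y(3) S.K.s_one[OF y(2)] by (metis rangeI singletonD)
 ultimately have W: "carrier S = ?W" using sm by blast
 show "dd S j = (if j = i then 1 else 0)"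
 proof (cases "j = i")
  case True
  have "comp S i = ?W" using W S.K.ksubD(4)[OF S.ksub_comp y(1)] by (auto simp: comp_def[of S i])
  then show ?thesis using True S.K.kdim_line[OF y(2,3)] by (simp add: dd_def)
 next
  case False
  have "comp S j = {\<zero>\<^bsub>S\<^esub>}" if j: "j \<in> V"
   using other[OF j False] W S.comp_zero[of j] by (auto simp: comp_def)
  then show ?thesis using False dd_outside[OF fg, of j] by (cases "j \<in> V") (simp_all add: dd_def S.K.kdim_zero)
 qed
qed

lemma line_module:
 assumes S: "S \<in> fgmod R" "semis S" and i: "i \<in> V" and d: "\<And>j. dd S j = (if j = i then 1 else 0)"
 obtains s where "s \<in> comp S i" "s \<noteq> \<zero>\<^bsub>S\<^esub>" "carrier S = range (\<lambda>c. kact S c s)"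
proof -
 interpret S: rsz_module R V E src tgt ec xc S by (rule fg_rsz_module[OF S(1)])
 obtain s where s: "s \<in> comp S i" "s \<noteq> \<zero>\<^bsub>S\<^esub>" using dd_pos_iff[OF fgD[OF S(1)], of i] d[of i] by auto
 have sc: "s \<in> carrier S" by (rule S.compD(1)[OF s(1)])
 have l: "range (\<lambda>c. kact S c s) \<subseteq> comp S i" using S.K.ksubD(4)[OF S.ksub_comp s(1)] by blast
 have "range (\<lambda>c. kact S c s) = comp S i"
  by (rule S.K.kdim_sub_eq[OF S.K.ksub_line[OF sc] S.ksub_comp S.kfin_any[OF fgD(2)[OF S(1)] S.ksub_comp] l])
   (use d[of i] S.K.kdim_line[OF sc s(2)] in \<open>simp add: dd_def\<close>)
 moreover have "w \<in> comp S i" if w: "w \<in> carrier S" for w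
 proof (rule S.mem_by_comps[OF S.ksub_comp w])
  fix j assume j: "j \<in> V"
  show "w \<triangleleft>\<^bsub>S\<^esub> e j \<in> comp S i"
  proof (cases "j = i")
   case False
   then have "w \<triangleleft>\<^bsub>S\<^esub> e j = \<zero>\<^bsub>S\<^esub>" using dd_pos_iff[OF fgD[OF S(1)], of j] d[of j] S.e_in_comp[OF w j] by auto
   then show ?thesis using S.comp_zero by simp
  qed (use S.e_in_comp[OF w j] in simp)
 qed
 ultimately have "carrier S = range (\<lambda>c. kact S c s)" using S.compD(1) by blast
 then show ?thesis using that s by blast
qed

text \<open>Serves as the witness for the choice in \<open>vertex_simple\<close>.\<close>

lemma simple_ex:
 assumes i: "i \<in> V"
 shows "simple_mod R (sg i) \<and> (\<exists>x\<in>carrier (sg i). x \<triangleleft>\<^bsub>sg i\<^esub> e i \<noteq> \<zero>\<^bsub>sg i\<^esub>)"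
proof -
 let ?S = "sg i"
 note S = sg[OF i]
 interpret S: rsz_module R V E src tgt ec xc ?S by (rule fg_rsz_module[OF S(1)])
 obtain s where s: "s \<in> comp ?S i" "s \<noteq> \<zero>\<^bsub>?S\<^esub>" "carrier ?S = range (\<lambda>c. kact ?S c s)"
  by (rule line_module[OF S(1,3) i S(4)]) (rule that)
 have sc: "s \<in> carrier ?S" by (rule S.compD(1)[OF s(1)])
 have "N = carrier ?S" if N: "submod R ?S N" "N \<noteq> {\<zero>\<^bsub>?S\<^esub>}" for N
 proof -
  note NK = S.K.ksubD[OF S.submodD(1)[OF N(1)]]
  obtain y where y: "y \<in> N" "y \<noteq> \<zero>\<^bsub>?S\<^esub>" using N(2) NK(2) by blast
  then obtain c where c: "y = kact ?S c s" using NK(1) s(3) by blast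
  then have "c \<noteq> 0" using y(2) S.K.s_zero_left[OF sc] by auto
  then have "kact ?S (inverse c) y = s" using S.K.s_mult[OF sc, of "inverse c" c] S.K.s_one[OF sc] c by simp
  then have sN: "s \<in> N" using NK(4)[OF y(1), of "inverse c"] by simp
  have "range (\<lambda>c. kact ?S c s) \<subseteq> N" by (rule image_subsetI) (rule NK(4)[OF sN])
  then have "carrier ?S \<subseteq> N" unfolding s(3)[symmetric] .
  moreover have "N \<subseteq> carrier ?S" by (rule subsetI) (rule NK(1))
  ultimately show ?thesis by (rule subset_antisym[rotated])
 qed
 moreover have "carrier ?S \<noteq> {\<zero>\<^bsub>?S\<^esub>}" using s(2) sc by (metis singletonD)
 ultimately have "simple_mod R ?S" unfolding simple_mod_def using S(1) by blast
 moreover have "s \<triangleleft>\<^bsub>?S\<^esub> e i \<noteq> \<zero>\<^bsub>?S\<^esub>" using S.compD(2)[OF s(1)] s(2) by simp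
 ultimately show ?thesis using sc by blast
qed

text \<open>Multiplying a preimage by \<open>e i\<close> produces a nonzero vector at
  \<open>i\<close>. Conversely such a vector splits off a copy of \<open>S\<close>, as
  \<open>M\<close> is semisimple, and the projection onto it exhibits the factor.\<close>

lemma in_support_iff:
 assumes S: "S \<in> fgmod R" "semis S" and i: "i \<in> V" and d: "\<And>j. dd S j = (if j = i then 1 else 0)"
  and M: "M \<in> fgmod R" "semis M"
 shows "in_support R S M \<longleftrightarrow> dd M i > 0"
proof
 assume "in_support R S M"
 then obtain N g where N: "submod R M N" and g: "g \<in> mhom R (M\<lparr>carrier := N\<rparr>) S" "g ` N = carrier S"
  by (auto simp: in_support_def)
 interpret M: rsz_module R V E src tgt ec xc M by (rule fg_rsz_module[OF M(1)])
 obtain y where y: "y \<in> comp S i" "y \<noteq> \<zero>\<^bsub>S\<^esub>" using dd_pos_iff[OF fgD[OF S(1)], of i] d[of i] by auto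
 obtain u where u: "u \<in> N" "g u = y" using g(2) y(1) by (metis (no_types, lifting) comp_def imageE mem_Collect_eq)
 have uc: "u \<in> carrier M" using M.K.ksubD(1)[OF M.submodD(1)[OF N] u(1)] .
 have "g (u \<triangleleft>\<^bsub>M\<^esub> e i) = y" using mhomD(3)[OF g(1), of u "e i"] u y(1) by (simp add: comp_def)
 moreover have "g \<zero>\<^bsub>M\<^esub> = \<zero>\<^bsub>S\<^esub>" using mhom_zero[OF M.right_module_submod[OF N] fgD(1)[OF S(1)] g(1)] by simp
 ultimately have "u \<triangleleft>\<^bsub>M\<^esub> e i \<noteq> \<zero>\<^bsub>M\<^esub>" using y(2) by auto
 then show "dd M i > 0" using dd_pos_iff[OF fgD[OF M(1)]] M.e_in_comp[OF uc i] by blast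
next
 assume p: "dd M i > 0"
 obtain N' where N': "N' \<in> fgmod R" "miso R M (msum S N')"
  by (rule semis_split[OF M i S d p]) (rule that)
 obtain \<theta> where \<theta>: "\<theta> \<in> mhom R M (msum S N')" "bij_betw \<theta> (carrier M) (carrier (msum S N'))" using N'(2) by (auto simp: miso_def)
 have "(\<lambda>y. fst (\<theta> y)) \<in> mhom R M S"
  by (rule mhom_compose[OF \<theta>(1) mhom_msum(1)[OF fgD(1)[OF S(1)] fgD(1)[OF N'(1)]]])
 moreover have "(\<lambda>y. fst (\<theta> y)) ` carrier M = carrier S"
 proof -
  interpret N': rsz_module R V E src tgt ec xc N' by (rule fg_rsz_module[OF N'(1)])
  have "(\<lambda>y. fst (\<theta> y)) ` carrier M = fst ` (\<theta> ` carrier M)" by (simp add: image_image)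
  also have "\<dots> = carrier S" using \<theta>(2) N'.zero_closed by (auto simp: bij_betw_def)
  finally show ?thesis .
 qed
 ultimately show "in_support R S M"
  unfolding in_support_def using submod_carrier[OF fgD(1)[OF M(1)]] by (intro exI[of _ "carrier M"]) auto
qed

text \<open>A product of lines, one at each vertex, has the explicit model with one basis vector per
  vertex and no action of arrows; the model links the product with \<open>fgmod\<close>.\<close>

lemma sum_of_lines:
 assumes S: "\<And>i. i \<in> V \<Longrightarrow> S i \<in> fgmod R" "\<And>i. i \<in> V \<Longrightarrow> semis (S i)"
  and d: "\<And>i j. i \<in> V \<Longrightarrow> dd (S i) j = (if j = i then 1 else 0)"
 shows "\<exists>A. A \<in> fgmod R \<and> miso R A (msum_fam V S)"
  "A \<in> fgmod R \<Longrightarrow> miso R A (msum_fam V S) \<Longrightarrow> semis A"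
  "A \<in> fgmod R \<Longrightarrow> miso R A (msum_fam V S) \<Longrightarrow> i \<in> V \<Longrightarrow> dd A i > 0"
proof -
 let ?B = "bmod V (\<lambda>i. i) (\<lambda>_ _ _. False)" and ?P = "msum_fam V S"
 have g: "bgood V (\<lambda>i. i) (\<lambda>_ _ _. False)" using finV by (auto simp: bgood_def)
 note B = bmod_module[OF g] bmod_fin_gen[OF g]
 have "\<forall>i. \<exists>s. i \<in> V --> s \<in> comp (S i) i \<and> s \<noteq> \<zero>\<^bsub>S i\<^esub> \<and> carrier (S i) = range (\<lambda>c. kact (S i) c s)"
 proof (intro allI)
  fix i show "\<exists>s. i \<in> V --> s \<in> comp (S i) i \<and> s \<noteq> \<zero>\<^bsub>S i\<^esub> \<and> carrier (S i) = range (\<lambda>c. kact (S i) c s)"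
  proof (cases "i \<in> V")
   case True
   show ?thesis by (rule line_module[OF S[OF True] True d[OF True]]) blast
  qed simp
 qed
 then obtain s where s: "\<And>i. i \<in> V \<Longrightarrow> s i \<in> comp (S i) i" "\<And>i. i \<in> V \<Longrightarrow> s i \<noteq> \<zero>\<^bsub>S i\<^esub>"
  "\<And>i. i \<in> V \<Longrightarrow> carrier (S i) = range (\<lambda>c. kact (S i) c (s i))" by metis
 have sm: "semis_module R V E src tgt ec xc (S i)" if "i \<in> V" for i by (rule semis_moduleI[OF S(2)[OF that]])
 have sc: "s i \<in> carrier (S i)" if "i \<in> V" for i using s(1)[OF that] by (simp add: comp_def)
 have K: "kspace (S i) (kact (S i))" if "i \<in> V" for i
  using rsz_module.kspace_kact[OF semis_module.axioms(1)[OF sm[OF that]]] .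
 define F where "F f = (\<lambda>i\<in>V. kact (S i) (f i) (s i))" for f
 have "F \<in> mhom R ?B ?P"
  unfolding mhom_def hom_def
 proof (intro CollectI conjI Pi_I ballI)
  fix f assume "f \<in> carrier (add_monoid ?B)"
  show "F f \<in> carrier (add_monoid ?P)" using s(3) by (auto simp: F_def msum_fam_def)
  fix f' assume "f' \<in> carrier (add_monoid ?B)"
  show "F (f \<otimes>\<^bsub>add_monoid ?B\<^esub> f') = F f \<otimes>\<^bsub>add_monoid ?P\<^esub> F f'"
   using kspace.s_add_left[OF K sc] by (auto simp: F_def msum_fam_def bmod_simps(3) fun_eq_iff)
 next
  fix f r assume f: "f \<in> carrier ?B" and r: "r \<in> carrier R"
  have "kact (S i) (f i) (s i) \<triangleleft>\<^bsub>S i\<^esub> r = kact (S i) (ec r i * f i) (s i)" if i: "i \<in> V" for i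
   using semis_module.comp_act[OF sm[OF i] s(1)[OF i] i r]
    rsz_module.kact_ract[OF semis_module.axioms(1)[OF sm[OF i]] sc[OF i] r] kspace.s_mult[OF K[OF i] sc[OF i]]
   by (simp add: mult.commute[of "ec r i"])
  then show "F (f \<triangleleft>\<^bsub>?B\<^esub> r) = F f \<triangleleft>\<^bsub>?P\<^esub> r"
   by (auto simp: F_def msum_fam_def bmod_simps(4) fun_eq_iff)
 qed
 moreover have "bij_betw F (carrier ?B) (carrier ?P)"
  unfolding bij_betw_def
 proof
  show "inj_on F (carrier ?B)"
  proof (rule inj_onI)
   fix f f' assume f: "f \<in> carrier ?B" "f' \<in> carrier ?B" "F f = F f'"
   show "f = f'"
   proof
    fix i show "f i = f' i"
    proof (cases "i \<in> V")
     case True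
     interpret S: kspace "S i" "kact (S i)" by (rule K[OF True])
     have eq: "kact (S i) (f i) (s i) = kact (S i) (f' i) (s i)" using fun_cong[OF f(3), of i] True by (simp add: F_def)
     have "kact (S i) (f i - f' i) (s i) = kact (S i) (f' i) (s i) \<oplus>\<^bsub>S i\<^esub> \<ominus>\<^bsub>S i\<^esub> kact (S i) (f' i) (s i)"
      using S.s_add_left[OF sc[OF True], of "f i" "- f' i"] S.s_minus[OF sc[OF True]] eq by simp
     then have 0: "kact (S i) (f i - f' i) (s i) = \<zero>\<^bsub>S i\<^esub>" using sc[OF True] by (simp add: S.r_neg)
     show ?thesis
     proof (rule ccontr)
      assume "f i \<noteq> f' i"
      then have "inverse (f i - f' i) * (f i - f' i) = 1" by simp
      then have "s i = kact (S i) (inverse (f i - f' i)) (kact (S i) (f i - f' i) (s i))"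
       using S.s_mult[OF sc[OF True], of "inverse (f i - f' i)" "f i - f' i"] S.s_one[OF sc[OF True]] by simp
      then show False using 0 s(2)[OF True] by simp
     qed
    qed (use f in \<open>simp add: bmod_simps\<close>)
   qed
  qed
  show "F ` carrier ?B = carrier ?P"
  proof (intro equalityI subsetI)
   fix u assume "u \<in> F ` carrier ?B"
   then show "u \<in> carrier ?P" using s(3) by (auto simp: F_def msum_fam_def)
  next
   fix u assume u: "u \<in> carrier ?P"
   have "\<forall>i\<in>V. \<exists>c. u i = kact (S i) c (s i)"
   proof
    fix i assume i: "i \<in> V"
    then have "u i \<in> carrier (S i)" using u by (auto simp: msum_fam_def PiE_def Pi_def)
    then show "\<exists>c. u i = kact (S i) c (s i)" unfolding s(3)[OF i] by blast
   qed
   then obtain c where c: "\<And>i. i \<in> V \<Longrightarrow> u i = kact (S i) (c i) (s i)" by metis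
   have "u = F (\<lambda>i. if i \<in> V then c i else 0)"
    using u c by (auto simp: F_def msum_fam_def fun_eq_iff PiE_def extensional_def)
   moreover have "(\<lambda>i. if i \<in> V then c i else 0) \<in> carrier ?B" by (simp add: bmod_simps(1))
   ultimately show "u \<in> F ` carrier ?B" by (simp only: imageI)
  qed
 qed
 ultimately have iso: "miso R ?B ?P" by (auto simp: miso_def)
 obtain A0 where A0: "A0 \<in> fgmod R" "miso R ?B A0" using ex_umod[OF B] by blast
 then show "\<exists>A. A \<in> fgmod R \<and> miso R A ?P" using miso_trans[OF miso_sym[OF B(1) A0(2)] iso] by blast
 have "soc ?B = carrier ?B" by (auto simp: soc_def bmod_acts[OF g] bmod_simps)
 then have sB: "semis ?B" using B by (simp add: semis_def)
 have dB: "dd ?B i > 0" if "i \<in> V" for i using that finV by (auto simp: bmod_dd[OF g] card_gt_0_iff)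
 assume A: "A \<in> fgmod R" "miso R A ?P"
 have "miso R A ?B" by (rule miso_trans[OF A(2) miso_sym[OF B(1) iso]])
 then have BA: "miso R ?B A" by (rule miso_sym[OF fgD(1)[OF A(1)]])
 show "semis A" by (rule semis_miso[OF sB fgD(1)[OF A(1)] BA])
 show "dd A i > 0" if "i \<in> V" using miso_dims(1)[OF B fgD(1)[OF A(1)] BA, of i] dB[OF that] by simp
qed

text \<open>The sum of the simples is semisimple with every vertex in its support, so the supports
  of its iterated syzygies and cosyzygies record just the ends and the starts of walks.\<close>

lemma supports_iff:
 assumes S: "\<And>i. i \<in> V \<Longrightarrow> simple_mod R (S i) \<and> (\<exists>x\<in>carrier (S i). x \<triangleleft>\<^bsub>S i\<^esub> e i \<noteq> \<zero>\<^bsub>S i\<^esub>)"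
  and A: "A \<in> fgmod R" "miso R A (msum_fam V S)" and i: "i \<in> V"
 shows "in_support R (S i) ((syzygy R ^^ n) A) \<longleftrightarrow> (\<exists>y. (y, i) \<in> adj ^^ n)"
  "in_support R (S i) ((cosyzygy R ^^ n) A) \<longleftrightarrow> (\<exists>y. (i, y) \<in> adj ^^ n)"
proof -
 have Sd: "S i \<in> fgmod R" "semis (S i)" "dd (S i) j = (if j = i then 1 else 0)" if "i \<in> V" for i j
  using S[OF that] simple_dims[OF _ _ _ that] by blast+
 have sA: "semis A" by (rule sum_of_lines(2)[OF Sd A])
 have dA: "dd A j > 0 \<longleftrightarrow> j \<in> V" for j
  using sum_of_lines(3)[OF Sd A, of j] dd_outside[OF A(1), of j] by (cases "j \<in> V") auto
 have V: "x \<in> V \<longleftrightarrow> y \<in> V" if xy: "(x, y) \<in> adj ^^ n" for x y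
 proof (cases n)
  case (Suc m)
  obtain z where "(z, y) \<in> adj" using xy unfolding Suc by auto
  moreover obtain z' where "(x, z') \<in> adj" using relpow_Suc_D2[OF xy[unfolded Suc]] by blast
  ultimately show ?thesis using adj_sub by blast
 qed (use xy in simp)
 have 1: "semis ((syzygy R ^^ n) A)" by (cases n) (use sA syz_pow_semis[OF A(1), of n] in auto)
 show "in_support R (S i) ((syzygy R ^^ n) A) \<longleftrightarrow> (\<exists>y. (y, i) \<in> adj ^^ n)"
  unfolding in_support_iff[OF Sd(1,2)[OF i] i Sd(3)[OF i] syz_pow_fg[OF A(1)] 1] dd_pow_semis[OF A(1) sA] dA
  using V i by blast
 note C = cosyzygy_pow[OF A(1) sA, of n]
 show "in_support R (S i) ((cosyzygy R ^^ n) A) \<longleftrightarrow> (\<exists>y. (i, y) \<in> adj ^^ n)"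
  unfolding in_support_iff[OF Sd(1,2)[OF i] i Sd(3)[OF i] C[THEN conjunct1] C[THEN conjunct2, THEN conjunct1]]
  using C dA V i by blast
qed

end

section \<open>The path algebra and its quotient\<close>

context fin_digraph begin

abbreviation PA :: "(('a, 'b) path \<Rightarrow> 'k::field) ring" where "PA \<equiv> path_algebra TYPE('k) G"

lemma awlast_simps: "awlast u [] = u" "awlast u (a # p) = awlast (head G a) p"
 by (cases p; simp)+

lemma awlast_app: "awlast u (p @ q) = awlast (awlast u p) q"
proof (induct p arbitrary: u)
 case (Cons a p)
 then show ?case by (simp only: append_Cons awlast_simps)
qed (simp only: append_Nil awlast_simps)

lemma qpaths_simps: "(u, []) \<in> qpaths G \<longleftrightarrow> u \<in> verts G"
 "(u, a # p) \<in> qpaths G \<longleftrightarrow> a \<in> arcs G \<and> u = tail G a \<and> (head G a, p) \<in> qpaths G"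
 by (auto simp: qpaths_def awalk_Nil_iff awalk_Cons_iff)

lemma qpaths_app: "(u, p) \<in> qpaths G \<Longrightarrow> (awlast u p, q) \<in> qpaths G \<Longrightarrow> (u, p @ q) \<in> qpaths G"
proof (induct p arbitrary: u)
 case (Cons a p)
 then show ?case using Cons(1)[of "head G a"] by (simp only: append_Cons awlast_simps qpaths_simps)
qed (simp only: append_Nil awlast_simps)

lemma qpaths_last: "(u, p) \<in> qpaths G \<Longrightarrow> awlast u p \<in> verts G"
proof (induct p arbitrary: u)
 case (Cons a p)
 then show ?case using Cons(1)[of "head G a"] by (simp only: awlast_simps qpaths_simps)
qed (simp only: awlast_simps qpaths_simps)

lemma PA_simps:
 "f \<in> carrier PA \<longleftrightarrow> finite {x. f x \<noteq> 0} \<and> (\<forall>x. f x \<noteq> 0 --> x \<in> qpaths G)"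
 "(f \<otimes>\<^bsub>PA\<^esub> g) (u, p) = (\<Sum>k\<le>length p. f (u, take k p) * g (awlast u (take k p), drop k p))"
 "\<one>\<^bsub>PA\<^esub> (u, p) = (if u \<in> verts G \<and> p = [] then 1 else 0)" "\<zero>\<^bsub>PA\<^esub> = (\<lambda>_. 0)"
 "f \<oplus>\<^bsub>PA\<^esub> g = (\<lambda>x. f x + g x)"
 by (auto simp: path_algebra_def)

lemma PA_carrier_sub:
 "f \<in> carrier PA \<Longrightarrow> g \<in> carrier PA \<Longrightarrow> (\<And>x. h x \<noteq> 0 \<Longrightarrow> f x \<noteq> 0 \<or> g x \<noteq> 0) \<Longrightarrow> h \<in> carrier PA"
 unfolding PA_simps(1)
proof (intro conjI)
 assume f: "finite {x. f x \<noteq> 0} \<and> (\<forall>x. f x \<noteq> 0 --> x \<in> qpaths G)"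
  and g: "finite {x. g x \<noteq> 0} \<and> (\<forall>x. g x \<noteq> 0 --> x \<in> qpaths G)"
  and h: "\<And>x. h x \<noteq> 0 \<Longrightarrow> f x \<noteq> 0 \<or> g x \<noteq> 0"
 have "{x. h x \<noteq> 0} \<subseteq> {x. f x \<noteq> 0} \<union> {x. g x \<noteq> 0}" using h by auto
 moreover have "finite ({x. f x \<noteq> 0} \<union> {x. g x \<noteq> 0})" using f g by simp
 ultimately show "finite {x. h x \<noteq> 0}" by (rule finite_subset)
 show "\<forall>x. h x \<noteq> 0 --> x \<in> qpaths G" using f g h by blast
qed

text \<open>The support of the product is contained in the concatenations of paths from the two
  finite supports.\<close>

lemma PA_mult_closed:
 fixes f g :: "('a, 'b) path \<Rightarrow> 'k::field"
 assumes f: "f \<in> carrier PA" and g: "g \<in> carrier PA"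
 shows "f \<otimes>\<^bsub>PA\<^esub> g \<in> carrier PA"
proof -
 have *: "\<exists>q r. p = q @ r \<and> f (u, q) \<noteq> 0 \<and> g (awlast u q, r) \<noteq> 0" if nz: "(f \<otimes>\<^bsub>PA\<^esub> g) (u, p) \<noteq> 0" for u p
 proof -
  from nz[unfolded PA_simps(2)] obtain k where "f (u, take k p) * g (awlast u (take k p), drop k p) \<noteq> 0"
   by (rule sum.not_neutral_contains_not_neutral)
  then show ?thesis by (intro exI[of _ "take k p"] exI[of _ "drop k p"]) auto
 qed
 have sub: "{x. (f \<otimes>\<^bsub>PA\<^esub> g) x \<noteq> 0} \<subseteq> (\<lambda>((u, q), (v, r)). (u, q @ r)) ` ({x. f x \<noteq> 0} \<times> {x. g x \<noteq> 0})"
 proof (clarify)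
  fix u p assume "(f \<otimes>\<^bsub>PA\<^esub> g) (u, p) \<noteq> 0"
  then obtain q r where "p = q @ r" "f (u, q) \<noteq> 0" "g (awlast u q, r) \<noteq> 0" using * by blast
  then show "(u, p) \<in> (\<lambda>((u, q), (v, r)). (u, q @ r)) ` ({x. f x \<noteq> 0} \<times> {x. g x \<noteq> 0})"
   by (intro image_eqI[of _ _ "((u, q), (awlast u q, r))"]) auto
 qed
 have "(u, p) \<in> qpaths G" if "(f \<otimes>\<^bsub>PA\<^esub> g) (u, p) \<noteq> 0" for u p
  using *[OF that] f g qpaths_app unfolding PA_simps(1) by blast
 moreover have "finite ({x. f x \<noteq> 0} \<times> {x. g x \<noteq> 0})" using f g unfolding PA_simps(1) by blast
 ultimately show ?thesis
  unfolding PA_simps(1) using finite_subset[OF sub finite_imageI] by (intro conjI) auto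
qed

text \<open>Both sides sum over the ways of cutting \<open>p\<close> into three pieces; the triangle
  reindexing matches the two orders of summation.\<close>

lemma PA_assoc:
 fixes f g h :: "('a, 'b) path \<Rightarrow> 'k::field"
 shows "f \<otimes>\<^bsub>PA\<^esub> g \<otimes>\<^bsub>PA\<^esub> h = f \<otimes>\<^bsub>PA\<^esub> (g \<otimes>\<^bsub>PA\<^esub> h)"
proof (rule ext, clarify)
 fix u and p :: "'b list"
 let ?n = "length p"
 define A where "A j m = f (u, take j p) * (g (awlast u (take j p), take m (drop j p))
  * h (awlast (awlast u (take j p)) (take m (drop j p)), drop m (drop j p)))" for j m
 have "(f \<otimes>\<^bsub>PA\<^esub> g \<otimes>\<^bsub>PA\<^esub> h) (u, p) = (\<Sum>k\<le>?n. \<Sum>j\<le>k. A j (k - j))"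
  unfolding PA_simps(2)[of _ h]
 proof (rule sum.cong[OF refl])
  fix k assume "k \<in> {..?n}"
  then have k: "length (take k p) = k" by simp
  have "(f \<otimes>\<^bsub>PA\<^esub> g) (u, take k p) * h (awlast u (take k p), drop k p)
    = (\<Sum>j\<le>k. f (u, take j (take k p)) * g (awlast u (take j (take k p)), drop j (take k p))
      * h (awlast u (take k p), drop k p))"
   unfolding PA_simps(2) k by (rule sum_distrib_right)
  also have "\<dots> = (\<Sum>j\<le>k. A j (k - j))"
  proof (rule sum.cong[OF refl])
   fix j assume "j \<in> {..k}"
   then have j: "j + (k - j) = k" and m: "min j k = j" by simp_all
   have t: "take k p = take j p @ take (k - j) (drop j p)" using take_add[of j "k - j" p] unfolding j .
   have d: "drop k p = drop (k - j) (drop j p)" using j by (simp add: add.commute)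
   have l: "awlast u (take k p) = awlast (awlast u (take j p)) (take (k - j) (drop j p))"
    unfolding t awlast_app ..
   show "f (u, take j (take k p)) * g (awlast u (take j (take k p)), drop j (take k p))
      * h (awlast u (take k p), drop k p) = A j (k - j)"
    unfolding l A_def d take_take m drop_take mult.assoc ..
  qed
  finally show "(f \<otimes>\<^bsub>PA\<^esub> g) (u, take k p) * h (awlast u (take k p), drop k p) = (\<Sum>j\<le>k. A j (k - j))" .
 qed
 also have "\<dots> = (\<Sum>(j, m)\<in>{(j, m). j + m \<le> ?n}. A j m)" by (rule sum.triangle_reindex_eq[symmetric])
 also have "{(j, m). j + m \<le> ?n} = Sigma {..?n} (\<lambda>j. {..?n - j})" by auto
 also have "(\<Sum>(j, m)\<in>Sigma {..?n} (\<lambda>j. {..?n - j}). A j m) = (\<Sum>j\<le>?n. \<Sum>m\<le>?n - j. A j m)"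
  by (rule sum.Sigma[symmetric]) auto
 also have "\<dots> = (f \<otimes>\<^bsub>PA\<^esub> (g \<otimes>\<^bsub>PA\<^esub> h)) (u, p)"
  unfolding PA_simps(2) A_def sum_distrib_left length_drop ..
 finally show "(f \<otimes>\<^bsub>PA\<^esub> g \<otimes>\<^bsub>PA\<^esub> h) (u, p) = (f \<otimes>\<^bsub>PA\<^esub> (g \<otimes>\<^bsub>PA\<^esub> h)) (u, p)" .
qed

lemma PA_one_closed: "\<one>\<^bsub>PA\<^esub> \<in> carrier (PA :: (('a, 'b) path \<Rightarrow> 'k::field) ring)"
proof -
 have "{x. \<one>\<^bsub>PA\<^esub> x \<noteq> (0::'k)} \<subseteq> verts G \<times> {[]}" by (auto simp: PA_simps(3) split: if_splits)
 moreover have "finite (verts G \<times> {[] :: 'b list})" by simp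
 ultimately have "finite {x. \<one>\<^bsub>PA\<^esub> x \<noteq> (0::'k)}" by (rule finite_subset)
 then show ?thesis unfolding PA_simps(1) by (auto simp: PA_simps(3) qpaths_simps split: if_splits)
qed

lemma ring_PA: "ring (PA :: (('a, 'b) path \<Rightarrow> 'k::field) ring)"
proof (rule ringI)
 show "abelian_group (PA :: (('a, 'b) path \<Rightarrow> 'k) ring)"
 proof (rule abelian_groupI)
  fix f :: "('a, 'b) path \<Rightarrow> 'k" assume f: "f \<in> carrier PA"
  have "(\<lambda>x. - f x) \<in> carrier PA" by (rule PA_carrier_sub[OF f f]) simp
  then show "\<exists>g\<in>carrier PA. g \<oplus>\<^bsub>PA\<^esub> f = \<zero>\<^bsub>PA\<^esub>" by (intro bexI[of _ "\<lambda>x. - f x"]) (simp add: PA_simps(4,5))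
  fix g :: "('a, 'b) path \<Rightarrow> 'k" assume g: "g \<in> carrier PA"
  show "f \<oplus>\<^bsub>PA\<^esub> g \<in> carrier PA" by (rule PA_carrier_sub[OF f g]) (auto simp: PA_simps(5))
 next
  show "\<zero>\<^bsub>PA\<^esub> \<in> carrier (PA :: (('a, 'b) path \<Rightarrow> 'k) ring)" by (simp add: PA_simps(1,4))
 qed (simp_all add: PA_simps(4,5) algebra_simps)
 show "monoid (PA :: (('a, 'b) path \<Rightarrow> 'k) ring)"
 proof (rule monoidI)
  fix f :: "('a, 'b) path \<Rightarrow> 'k" assume f: "f \<in> carrier PA"
  have supp: "f (u, p) = 0" if "u \<notin> verts G" for u p
  proof (rule ccontr)
   assume "f (u, p) \<noteq> 0"
   then have "(u, p) \<in> qpaths G" using f by (simp add: PA_simps(1))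
   then show False using that by (cases p) (auto simp: qpaths_simps)
  qed
  show "\<one>\<^bsub>PA\<^esub> \<otimes>\<^bsub>PA\<^esub> f = f"
  proof (rule ext, clarify)
   fix u p
   have "(\<one>\<^bsub>PA\<^esub> \<otimes>\<^bsub>PA\<^esub> f) (u, p) = (\<Sum>k\<le>length p. if k = 0 then f (u, p) else 0)"
    unfolding PA_simps(2) by (rule sum.cong) (use supp[of u p] in \<open>auto simp: PA_simps(3) awlast_simps\<close>)
   then show "(\<one>\<^bsub>PA\<^esub> \<otimes>\<^bsub>PA\<^esub> f) (u, p) = f (u, p)" by simp
  qed
  have last: "awlast u p \<in> verts G" if "f (u, p) \<noteq> 0" for u p
  proof -
   have "(u, p) \<in> qpaths G" using f that by (simp add: PA_simps(1))
   then show ?thesis by (rule qpaths_last)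
  qed
  show "f \<otimes>\<^bsub>PA\<^esub> \<one>\<^bsub>PA\<^esub> = f"
  proof (rule ext, clarify)
   fix u p
   have "(f \<otimes>\<^bsub>PA\<^esub> \<one>\<^bsub>PA\<^esub>) (u, p) = (\<Sum>k\<le>length p. if k = length p then f (u, p) else 0)"
    unfolding PA_simps(2) by (rule sum.cong) (use last[of u p] in \<open>auto simp: PA_simps(3)\<close>)
   then show "(f \<otimes>\<^bsub>PA\<^esub> \<one>\<^bsub>PA\<^esub>) (u, p) = f (u, p)" by simp
  qed
 qed (rule PA_mult_closed PA_one_closed PA_assoc; assumption?)+
 fix f g h :: "('a, 'b) path \<Rightarrow> 'k"
 show "(f \<oplus>\<^bsub>PA\<^esub> g) \<otimes>\<^bsub>PA\<^esub> h = f \<otimes>\<^bsub>PA\<^esub> h \<oplus>\<^bsub>PA\<^esub> g \<otimes>\<^bsub>PA\<^esub> h"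
  by (rule ext, clarify) (simp add: PA_simps(2,5) distrib_right sum.distrib)
 show "h \<otimes>\<^bsub>PA\<^esub> (f \<oplus>\<^bsub>PA\<^esub> g) = h \<otimes>\<^bsub>PA\<^esub> f \<oplus>\<^bsub>PA\<^esub> h \<otimes>\<^bsub>PA\<^esub> g"
  by (rule ext, clarify) (simp add: PA_simps(2,5) distrib_left sum.distrib)
qed

text \<open>On paths of length at most one these are the multiplication rules \<open>ec_mult\<close>
  and \<open>xc_mult\<close> demanded by \<open>rsz\<close>.\<close>

lemma PA_mult_low:
 "(f \<otimes>\<^bsub>PA\<^esub> g) (u, []) = f (u, []) * g (u, [])"
 "(f \<otimes>\<^bsub>PA\<^esub> g) (u, [a]) = f (u, []) * g (u, [a]) + f (u, [a]) * g (head G a, [])"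
 by (simp_all add: PA_simps(2))

section \<open>The ideals of long paths and the square of the arrow ideal\<close>

definition Jp :: "nat \<Rightarrow> (('a, 'b) path \<Rightarrow> 'k::field) set"
 where "Jp m = {f\<in>carrier PA. \<forall>u p. length p < m --> f (u, p) = 0}"

lemma JpD: "f \<in> Jp m \<Longrightarrow> f \<in> carrier PA" "f \<in> Jp m \<Longrightarrow> length p < m \<Longrightarrow> f (u, p) = 0"
 by (auto simp: Jp_def)

text \<open>In any cut of a path shorter than \<open>m + m'\<close>, the first piece is shorter than
  \<open>m\<close> or the second is shorter than \<open>m'\<close>.\<close>

lemma Jp_mult: "f \<in> Jp m \<Longrightarrow> g \<in> Jp m' \<Longrightarrow> f \<otimes>\<^bsub>PA\<^esub> g \<in> Jp (m + m')"
proof -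
 assume f: "f \<in> Jp m" and g: "g \<in> Jp m'"
 have "(f \<otimes>\<^bsub>PA\<^esub> g) (u, p) = 0" if p: "length p < m + m'" for u p
  unfolding PA_simps(2)
 proof (rule sum.neutral, rule ballI)
  fix k assume k: "k \<in> {..length p}"
  show "f (u, take k p) * g (awlast u (take k p), drop k p) = 0"
  proof (cases "k < m")
   case True
   then have "f (u, take k p) = 0" using k by (intro JpD(2)[OF f]) simp
   then show ?thesis by simp
  next
   case False
   then have "g (awlast u (take k p), drop k p) = 0" using k p by (intro JpD(2)[OF g]) simp
   then show ?thesis by simp
  qed
 qed
 then show ?thesis using PA_mult_closed[OF JpD(1)[OF f] JpD(1)[OF g]] by (simp add: Jp_def)
qed

lemma Jp_add: "f \<in> Jp m \<Longrightarrow> g \<in> Jp m \<Longrightarrow> f \<oplus>\<^bsub>PA\<^esub> g \<in> Jp m"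
 using ring.ring_simprules(1)[OF ring_PA] by (auto simp: Jp_def PA_simps(5))

lemma Jp_ideal: "ideal (Jp m :: (('a, 'b) path \<Rightarrow> 'k::field) set) PA"
proof (rule idealI)
 interpret P: ring "PA :: (('a, 'b) path \<Rightarrow> 'k) ring" by (rule ring_PA)
 have J0: "f \<in> Jp 0" if "f \<in> carrier PA" for f :: "('a, 'b) path \<Rightarrow> 'k" using that by (simp add: Jp_def)
 show "ring (PA :: (('a, 'b) path \<Rightarrow> 'k) ring)" by (rule ring_PA)
 show "subgroup (Jp m :: (('a, 'b) path \<Rightarrow> 'k) set) (add_monoid PA)"
 proof (rule group.subgroupI[OF P.a_group])
  show "(Jp m :: (('a, 'b) path \<Rightarrow> 'k) set) \<subseteq> carrier (add_monoid PA)" by (auto simp: Jp_def)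
  have "(\<lambda>_. 0) \<in> (Jp m :: (('a, 'b) path \<Rightarrow> 'k) set)" by (simp add: Jp_def PA_simps(1))
  then show "(Jp m :: (('a, 'b) path \<Rightarrow> 'k) set) \<noteq> {}" by blast
  fix f :: "('a, 'b) path \<Rightarrow> 'k" assume f: "f \<in> Jp m"
  have n: "(\<lambda>x. - f x) \<in> carrier PA" by (rule PA_carrier_sub[OF JpD(1)[OF f] JpD(1)[OF f]]) simp
  have "\<ominus>\<^bsub>PA\<^esub> f = (\<lambda>x. - f x)"
   by (rule P.minus_equality[OF _ JpD(1)[OF f] n]) (simp add: PA_simps(4,5))
  then have "inv\<^bsub>add_monoid PA\<^esub> f = (\<lambda>x. - f x)" unfolding a_inv_def .
  moreover have "(\<lambda>x. - f x) \<in> Jp m" using f n by (simp add: Jp_def)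
  ultimately show "inv\<^bsub>add_monoid PA\<^esub> f \<in> Jp m" by (simp only:)
  fix g :: "('a, 'b) path \<Rightarrow> 'k" assume "g \<in> Jp m"
  then show "f \<otimes>\<^bsub>add_monoid PA\<^esub> g \<in> Jp m" using f by (simp add: Jp_add)
 qed
 fix f g :: "('a, 'b) path \<Rightarrow> 'k" assume "f \<in> Jp m" "g \<in> carrier PA"
 then show "g \<otimes>\<^bsub>PA\<^esub> f \<in> Jp m" "f \<otimes>\<^bsub>PA\<^esub> g \<in> Jp m" using Jp_mult[of g 0 f m] Jp_mult[of f m g 0] J0 by simp_all
qed

lemma path_elem_mult:
 "(path_elem (tail G a, [a]) \<otimes>\<^bsub>PA\<^esub> (\<lambda>x. if x = (head G a, q) then c else 0)) = (\<lambda>x. if x = (tail G a, a # q) then c else 0)"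
proof (rule ext, clarify)
 fix u p
 let ?F = "\<lambda>k. path_elem (tail G a, [a]) (u, take k p) * (if (awlast u (take k p), drop k p) = (head G a, q) then c else 0)"
 have "(\<Sum>k\<le>length p. ?F k) = (\<Sum>k\<le>length p. if k = 1 then ?F 1 else 0)"
 proof (rule sum.cong[OF refl])
  fix k assume k: "k \<in> {..length p}"
  have "k = 1" if "take k p = [a]" using arg_cong[OF that, of length] k by simp
  then show "?F k = (if k = 1 then ?F 1 else 0)"
   by (cases "k = 1") (simp_all only: if_True if_False, auto simp: path_elem_def)
 qed
 also have "\<dots> = (if (u, p) = (tail G a, a # q) then c else 0)"
 proof (cases p)
  case (Cons b r)
  define X where "X = ?F 1"
  have "(\<Sum>k\<le>length p. if k = 1 then X else 0) = X"
   by (subst sum.delta) (simp_all only: finite_atMost atMost_iff Cons length_Cons One_nat_def Suc_le_mono le0 if_True)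
  moreover have "X = (if (u, p) = (tail G a, a # q) then c else 0)" by (auto simp: X_def Cons path_elem_def)
  ultimately show ?thesis unfolding X_def by (simp only:)
 qed simp
 finally show "(path_elem (tail G a, [a]) \<otimes>\<^bsub>PA\<^esub> (\<lambda>x. if x = (head G a, q) then c else 0)) (u, p)
   = (if (u, p) = (tail G a, a # q) then c else 0)" unfolding PA_simps(2) .
qed

lemma single_carrier: "x \<in> qpaths G \<Longrightarrow> (\<lambda>y. if y = x then c else 0) \<in> carrier PA"
proof -
 assume x: "x \<in> qpaths G"
 have "finite {y. (if y = x then c else 0) \<noteq> 0}" by (rule finite_subset[of _ "{x}"]) auto
 then show ?thesis using x by (simp add: PA_simps(1))
qed

text \<open>One inclusion is a count of lengths. For the other, a path of length at least two is an
  arrow times an arrow times the rest, where the last two factors multiply into J; general elements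
  follow by induction on the support.\<close>

lemma arrow_ideal_sq: "arrow_ideal_sq TYPE('k::field) G = Jp 2"
proof -
 interpret P: ring "PA :: (('a, 'b) path \<Rightarrow> 'k) ring" by (rule ring_PA)
 let ?J = "arrow_ideal TYPE('k) G"
 let ?S = "{path_elem (tail G a, [a]) | a. a \<in> arcs G} :: (('a, 'b) path \<Rightarrow> 'k) set"
 have q: "(tail G a, [a]) \<in> qpaths G" if "a \<in> arcs G" for a using that by (simp add: qpaths_simps)
 have pe: "path_elem x = (\<lambda>y. if y = x then 1 else 0)" for x :: "('a, 'b) path" unfolding path_elem_def ..
 have S1: "?S \<subseteq> Jp 1" using single_carrier[OF q] by (auto simp: Jp_def pe)
 have Sc: "?S \<subseteq> carrier PA" using S1 JpD(1) by blast
 have id: "ideal ?J PA" unfolding arrow_ideal_def by (rule P.genideal_ideal[OF Sc])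
 have sub: "?J \<subseteq> Jp 1" unfolding arrow_ideal_def by (rule P.genideal_minimal[OF Jp_ideal S1])
 have in_J: "path_elem (tail G a, [a]) \<in> ?J" if "a \<in> arcs G" for a
  unfolding arrow_ideal_def using P.genideal_self[OF Sc] that by blast
 have "ideal_prod PA ?J ?J \<subseteq> Jp 2"
 proof
  fix f assume "f \<in> ideal_prod PA ?J ?J"
  then show "f \<in> Jp 2"
  proof (induct rule: ideal_prod.induct)
   case (prod i j)
   then show ?case using Jp_mult[OF subsetD[OF sub] subsetD[OF sub], of i j] by (simp add: numeral_2_eq_2)
  qed (rule Jp_add)
 qed
 moreover have "Jp 2 \<subseteq> ideal_prod PA ?J ?J"
 proof
  fix f :: "('a, 'b) path \<Rightarrow> 'k"
  interpret JJ: ideal "ideal_prod PA ?J ?J" PA by (rule P.ideal_prod_is_ideal[OF id id])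
  have single: "(\<lambda>y. if y = (u, p) then c else 0) \<in> ideal_prod PA ?J ?J"
   if up: "(u, p) \<in> qpaths G" "length p \<ge> 2" for u p and c :: 'k
  proof -
   obtain a b r where p: "p = a # b # r" using up(2) by (cases p; cases "tl p") auto
   have ab: "a \<in> arcs G" "u = tail G a" "b \<in> arcs G" "head G a = tail G b" "(head G b, r) \<in> qpaths G"
    using up(1) unfolding p by (auto simp: qpaths_simps)
   note 1 = ideal.I_r_closed[OF id in_J[OF ab(3)] single_carrier[OF ab(5), of c], unfolded path_elem_mult, folded ab(4)]
   note 2 = ideal_prod.prod[OF in_J[OF ab(1)] 1, where R = PA, unfolded path_elem_mult]
   show ?thesis unfolding p ab(2) by (rule 2)
  qed
  have "\<forall>f. f \<in> Jp 2 --> {x. f x \<noteq> 0} = S --> f \<in> ideal_prod PA ?J ?J" if "finite S" for S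
   using that
  proof (induct S rule: finite_induct)
   case empty
   have "f = \<zero>\<^bsub>PA\<^esub>" if "{x. f x \<noteq> 0} = {}" for f :: "('a, 'b) path \<Rightarrow> 'k" using that by (auto simp: PA_simps(4))
   then show ?case using JJ.zero_closed by blast
  next
   case (insert x S)
   show ?case
   proof (intro allI impI)
    fix f :: "('a, 'b) path \<Rightarrow> 'k" assume f: "f \<in> Jp 2" and s: "{x. f x \<noteq> 0} = insert x S"
    obtain u p where x: "x = (u, p)" by (cases x)
    have fx: "f (u, p) \<noteq> 0" using s x by blast
    have up: "(u, p) \<in> qpaths G" using JpD(1)[OF f] fx by (simp add: PA_simps(1))
    have len: "length p \<ge> 2" using JpD(2)[OF f, of p u] fx by linarith
    let ?g = "\<lambda>y. if y = x then 0 else f y"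
    have "?g \<in> carrier PA" by (rule PA_carrier_sub[OF JpD(1)[OF f] JpD(1)[OF f]]) (auto split: if_splits)
    then have g: "?g \<in> Jp 2" using f by (auto simp: Jp_def)
    have "{y. ?g y \<noteq> 0} = S" using s insert(2) by auto
    then have "?g \<in> ideal_prod PA ?J ?J" using insert(3) g by blast
    from ideal_prod.sum[OF single[OF up len, of "f (u, p)"] this] show "f \<in> ideal_prod PA ?J ?J"
     unfolding PA_simps(5) by (rule back_subst[of "\<lambda>h. h \<in> ideal_prod PA ?J ?J"]) (auto simp: x fun_eq_iff)
   qed
  qed
  then show "f \<in> Jp 2 \<Longrightarrow> f \<in> ideal_prod PA ?J ?J" using JpD(1)[of f 2] unfolding PA_simps(1) by blast
 qed
 ultimately show ?thesis unfolding arrow_ideal_sq_def by blast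
qed

section \<open>Coordinates on the quotient algebra\<close>

abbreviation RA :: "(('a, 'b) path \<Rightarrow> 'k::field) set ring" where "RA \<equiv> rad_sq_zero_algebra TYPE('k) G"

text \<open>Any representative will do, because elements of \<open>Jp 2\<close> vanish on paths of
  length at most one; see \<open>coset_coords\<close>.\<close>

definition ecf :: "(('a, 'b) path \<Rightarrow> 'k::field) set \<Rightarrow> 'a \<Rightarrow> 'k" where "ecf C i = (SOME f. f \<in> C) (i, [])"
definition xcf :: "(('a, 'b) path \<Rightarrow> 'k::field) set \<Rightarrow> 'b \<Rightarrow> 'k" where "xcf C a = (SOME f. f \<in> C) (tail G a, [a])"

lemma RA_eq: "(RA :: (('a, 'b) path \<Rightarrow> 'k::field) set ring) = PA Quot (Jp 2)"
 by (simp add: rad_sq_zero_algebra_def arrow_ideal_sq)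

lemma coset_coords:
 assumes f: "f \<in> carrier PA"
 shows "ecf (Jp 2 +>\<^bsub>PA\<^esub> f) i = f (i, [])" "xcf (Jp 2 +>\<^bsub>PA\<^esub> f) a = f (tail G a, [a])"
proof -
 interpret P: ring "PA :: (('a, 'b) path \<Rightarrow> 'c) ring" by (rule ring_PA)
 interpret J: ideal "Jp 2 :: (('a, 'b) path \<Rightarrow> 'c) set" PA by (rule Jp_ideal)
 have "(SOME g. g \<in> Jp 2 +>\<^bsub>PA\<^esub> f) \<in> Jp 2 +>\<^bsub>PA\<^esub> f" by (rule someI[of _ f]) (rule J.a_rcos_self[OF f])
 then obtain h where "h \<in> Jp 2" "(SOME g. g \<in> Jp 2 +>\<^bsub>PA\<^esub> f) = (\<lambda>x. h x + f x)"
  unfolding a_r_coset_def' PA_simps(5) by blast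
 then show "ecf (Jp 2 +>\<^bsub>PA\<^esub> f) i = f (i, [])" "xcf (Jp 2 +>\<^bsub>PA\<^esub> f) a = f (tail G a, [a])"
  using JpD(2)[of h 2] by (simp_all add: ecf_def xcf_def)
qed

lemma RA_cases:
 assumes "r \<in> carrier (RA :: (('a, 'b) path \<Rightarrow> 'k::field) set ring)"
 obtains f where "f \<in> carrier PA" "r = Jp 2 +>\<^bsub>PA\<^esub> f"
 using assms by (auto simp: RA_eq FactRing_def A_RCOSETS_def')

lemma rsz_RA:
 assumes ne: "verts G \<noteq> {}"
 shows "rsz (RA :: (('a, 'b) path \<Rightarrow> 'k::field) set ring) (verts G) (arcs G) (tail G) (head G) ecf xcf"
proof -
 interpret P: ring "PA :: (('a, 'b) path \<Rightarrow> 'k) ring" by (rule ring_PA)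
 interpret J: ideal "Jp 2 :: (('a, 'b) path \<Rightarrow> 'k) set" PA by (rule Jp_ideal)
 interpret R: ring "RA :: (('a, 'b) path \<Rightarrow> 'k) set ring" unfolding RA_eq by (rule J.quotient_is_ring)
 note hom = J.rcos_ring_hom[folded RA_eq]
 let ?c = "\<lambda>f. Jp 2 +>\<^bsub>PA\<^esub> f"
 note H = ring_hom_memE[OF hom]
 note cc = coset_coords
 have mult: "?c f \<otimes>\<^bsub>RA\<^esub> ?c g = ?c (f \<otimes>\<^bsub>PA\<^esub> g)" and add: "?c f \<oplus>\<^bsub>RA\<^esub> ?c g = ?c (f \<oplus>\<^bsub>PA\<^esub> g)"
  if "f \<in> carrier PA" "g \<in> carrier PA" for f g :: "('a, 'b) path \<Rightarrow> 'k"
  using H(2,3)[OF that] by simp_all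
 show ?thesis
 proof (unfold_locales)
  fix r r' :: "(('a, 'b) path \<Rightarrow> 'k) set" assume r: "r \<in> carrier RA" and r': "r' \<in> carrier RA"
  obtain f g where f: "f \<in> carrier PA" "r = ?c f" and g: "g \<in> carrier PA" "r' = ?c g"
   by (rule RA_cases[OF r], rule RA_cases[OF r']) (rule that)
  note fg = P.add.m_closed[OF f(1) g(1)] P.m_closed[OF f(1) g(1)]
  show "ecf (r \<oplus>\<^bsub>RA\<^esub> r') i = ecf r i + ecf r' i" for i
   unfolding f g add[OF f(1) g(1)] cc[OF f(1)] cc[OF g(1)] cc[OF fg(1)] by (simp add: PA_simps(5))
  show "xcf (r \<oplus>\<^bsub>RA\<^esub> r') a = xcf r a + xcf r' a" for a
   unfolding f g add[OF f(1) g(1)] cc[OF f(1)] cc[OF g(1)] cc[OF fg(1)] by (simp add: PA_simps(5))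
  show "ecf (r \<otimes>\<^bsub>RA\<^esub> r') i = ecf r i * ecf r' i" for i
   unfolding f g mult[OF f(1) g(1)] cc[OF f(1)] cc[OF g(1)] cc[OF fg(2)] by (rule PA_mult_low)
  show "xcf (r \<otimes>\<^bsub>RA\<^esub> r') a = ecf r (tail G a) * xcf r' a + xcf r a * ecf r' (head G a)" for a
   unfolding f g mult[OF f(1) g(1)] cc[OF f(1)] cc[OF g(1)] cc[OF fg(2)] by (rule PA_mult_low)
  assume e: "\<And>i. i \<in> verts G \<Longrightarrow> ecf r i = ecf r' i" and x: "\<And>a. a \<in> arcs G \<Longrightarrow> xcf r a = xcf r' a"
  have dc: "(\<lambda>y. f y - g y) \<in> carrier PA" by (rule PA_carrier_sub[OF f(1) g(1)]) auto
  have low: "f (u, p) = g (u, p)" if p: "length p < 2" for u p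
  proof (cases "(u, p) \<in> qpaths G")
   case True
   have "p = [] \<or> (\<exists>a. p = [a])" using p by (cases p; cases "tl p") auto
   then show ?thesis
   proof (elim disjE exE)
    assume p0: "p = []"
    then show ?thesis using e[of u] True unfolding f(2) g(2) cc[OF f(1)] cc[OF g(1)] by (simp add: qpaths_simps)
   next
    fix a assume p1: "p = [a]"
    then have "a \<in> arcs G" "u = tail G a" using True by (simp_all add: qpaths_simps)
    then show ?thesis using x[of a] p1 unfolding f(2) g(2) cc[OF f(1)] cc[OF g(1)] by simp
   qed
  next
   case False
   have "f (u, p) = 0" using conjunct2[OF iffD1[OF PA_simps(1) f(1)]] False by blast
   moreover have "g (u, p) = 0" using conjunct2[OF iffD1[OF PA_simps(1) g(1)]] False by blast
   ultimately show ?thesis by (simp only:)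
  qed
  \<comment> \<open>Equal coordinates mean that the difference vanishes on paths of length at most
    one, so the cosets coincide.\<close>
  have d: "(\<lambda>y. f y - g y) \<in> Jp 2"
   unfolding Jp_def by (intro CollectI conjI allI impI dc) (simp only: low diff_self)
  have "(\<lambda>y. f y - g y) \<oplus>\<^bsub>PA\<^esub> g \<in> ?c g" unfolding a_r_coset_def' by (rule UN_I[OF d]) (rule singletonI)
  moreover have "(\<lambda>y. f y - g y) \<oplus>\<^bsub>PA\<^esub> g = f" by (simp add: PA_simps(5))
  ultimately have fg: "f \<in> ?c g" by (simp only:)
  have "?c g = ?c f"
   by (rule P.a_repr_independence[OF fg g(1) additive_subgroup.a_subgroup[OF J.is_additive_subgroup]])
  then show "r = r'" unfolding f(2) g(2) by (rule sym)
 next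
  fix c :: "'a \<Rightarrow> 'k" and d :: "'b \<Rightarrow> 'k"
  \<comment> \<open>Prescribed on trivial paths and on single arrows, zero on all longer
    paths.\<close>
  define f where "f = (\<lambda>(u, p). if u \<in> verts G \<and> p = [] then c u
   else if \<exists>a\<in>arcs G. u = tail G a \<and> p = [a] then d (hd p) else 0)"
  have "{x. f x \<noteq> 0} \<subseteq> verts G \<times> {[]} \<union> (\<lambda>a. (tail G a, [a])) ` arcs G"
   by (auto simp: f_def split: if_splits)
  then have "finite {x. f x \<noteq> 0}" by (rule finite_subset) simp
  moreover have "x \<in> qpaths G" if "f x \<noteq> 0" for x
   using that by (cases x) (auto simp: f_def qpaths_simps split: if_splits)
  ultimately have f: "f \<in> carrier PA" by (simp add: PA_simps(1))
  have "f (i, []) = c i" if "i \<in> verts G" for i using that by (simp add: f_def)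
  moreover have "f (tail G a, [a]) = d a" if "a \<in> arcs G" for a using that by (auto simp: f_def)
  ultimately show "\<exists>r\<in>carrier RA. (\<forall>i\<in>verts G. ecf r i = c i) \<and> (\<forall>a\<in>arcs G. xcf r a = d a)"
   by (intro bexI[OF _ H(1)[OF f]] conjI ballI) (simp_all only: cc[OF f])
 next
  note 1 = H(4)[symmetric]
  show "i \<in> verts G \<Longrightarrow> ecf \<one>\<^bsub>RA\<^esub> i = (1::'k)" for i unfolding 1 cc[OF P.one_closed] by (simp add: PA_simps(3))
  show "xcf \<one>\<^bsub>RA\<^esub> a = (0::'k)" for a unfolding 1 cc[OF P.one_closed] by (simp add: PA_simps(3))
 qed (use ne in auto)
qed

lemma vertex_idem_coords:
 assumes "i \<in> verts G"
 shows "vertex_idem TYPE('k::field) G i \<in> carrier RA"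
  "ecf (vertex_idem TYPE('k) G i) j = (if j = i then 1 else 0)" "xcf (vertex_idem TYPE('k) G i) a = 0"
proof -
 interpret J: ideal "Jp 2 :: (('a, 'b) path \<Rightarrow> 'k) set" PA by (rule Jp_ideal)
 have c: "(path_elem (i, []) :: ('a, 'b) path \<Rightarrow> 'k) \<in> carrier PA"
  using single_carrier[of "(i, [])" "1::'k"] assms by (simp add: path_elem_def[abs_def] qpaths_simps)
 have v: "vertex_idem TYPE('k) G i = Jp 2 +>\<^bsub>PA\<^esub> path_elem (i, [])" by (simp add: vertex_idem_def arrow_ideal_sq)
 show "vertex_idem TYPE('k) G i \<in> carrier RA" unfolding v
  using ring_hom_memE(1)[OF J.rcos_ring_hom[folded RA_eq] c] by simp
 show "ecf (vertex_idem TYPE('k) G i) j = (if j = i then 1 else 0)" "xcf (vertex_idem TYPE('k) G i) a = 0"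
  unfolding v coset_coords[OF c] by (auto simp: path_elem_def)
qed

section \<open>Translation into walks of the quiver\<close>

abbreviation step :: "('a \<times> 'a) set" where "step \<equiv> {(tail G a, head G a) | a. a \<in> arcs G}"

lemma awalk_step: "(\<exists>p. awalk u p v) \<longleftrightarrow> u \<in> verts G \<and> (u, v) \<in> step\<^sup>*"
proof
 assume "\<exists>p. awalk u p v"
 then obtain p where "awalk u p v" by blast
 then show "u \<in> verts G \<and> (u, v) \<in> step\<^sup>*"
 proof (induct p arbitrary: u)
  case (Cons a p)
  then have "(head G a, v) \<in> step\<^sup>*" "a \<in> arcs G" "u = tail G a" by (auto simp: awalk_Cons_iff)
  then show ?case by (auto intro!: converse_rtrancl_into_rtrancl[of "tail G a" "head G a"])
 qed (simp add: awalk_Nil_iff)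
next
 assume uv: "u \<in> verts G \<and> (u, v) \<in> step\<^sup>*"
 then have "(u, v) \<in> step\<^sup>*" by blast
 then have "v \<in> verts G --> (\<exists>p. awalk u p v)"
 proof (induct rule: converse_rtrancl_induct)
  case base then show ?case by (auto intro!: exI[of _ "[]"] simp: awalk_Nil_iff)
 next
  case (step y z)
  then obtain a where "a \<in> arcs G" "y = tail G a" "z = head G a" by blast
  then show ?case using step(3) awalk_Cons_iff by metis
 qed
 moreover have "v \<in> verts G" using \<open>(u, v) \<in> step\<^sup>*\<close> uv by (induct rule: rtrancl_induct) auto
 ultimately show "\<exists>p. awalk u p v" by blast
qed

lemma psi_dim_chain:
 assumes "card (verts G) = n" "n > 3"
 shows "psi_dim (RA :: (('a, 'b) path \<Rightarrow> 'k::field) set ring) = enat (2 * n - 3) \<longleftrightarrow> (\<exists>c w. chain_form step (verts G) n c w)"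
proof -
 interpret rsz "RA :: (('a, 'b) path \<Rightarrow> 'k) set ring" "verts G" "arcs G" "tail G" "head G" ecf xcf
  by (rule rsz_RA) (use assms in auto)
 show ?thesis using psi_dim_iff[OF assms] unfolding adj_def .
qed

text \<open>The vertex idempotents of the quotient have the coordinates of \<open>e i\<close>, so
  the chosen simples and their sum satisfy \<open>supports_iff\<close>, which turns both support
  conditions into walks of length \<open>n\<close>.\<close>

lemma heart_verts:
 assumes n: "card (verts G) = n" and ne: "verts G \<noteq> {}"
 shows "heart TYPE('k::field) G = G \<restriction> {i\<in>verts G. (\<exists>y. (y, i) \<in> step ^^ n) \<and> (\<exists>y. (i, y) \<in> step ^^ n)}"
proof -
 interpret rsz "RA :: (('a, 'b) path \<Rightarrow> 'k) set ring" "verts G" "arcs G" "tail G" "head G" ecf xcf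
  by (rule rsz_RA[OF ne])
 let ?R = "RA :: (('a, 'b) path \<Rightarrow> 'k) set ring"
 let ?S = "vertex_simple TYPE('k) G"
 have e: "vertex_idem TYPE('k) G i = e i" if "i \<in> verts G" for i
  by (rule coord_inj) (simp_all add: vertex_idem_coords[OF that])
 have S: "simple_mod ?R (?S i) \<and> (\<exists>x\<in>carrier (?S i). x \<triangleleft>\<^bsub>?S i\<^esub> e i \<noteq> \<zero>\<^bsub>?S i\<^esub>)" if i: "i \<in> verts G" for i
  unfolding vertex_simple_def e[OF i] by (rule someI_ex) (use simple_ex[OF i] in blast)
 have Sd: "?S i \<in> fgmod ?R" "semis (?S i)" "dd (?S i) j = (if j = i then 1 else 0)" if i: "i \<in> verts G" for i j
  using S[OF i] simple_dims[OF _ _ _ i] by blast+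
 have "sum_of_simples TYPE('k) G \<in> fgmod ?R \<and> miso ?R (sum_of_simples TYPE('k) G) (msum_fam (verts G) ?S)"
  unfolding sum_of_simples_def by (rule someI_ex) (rule sum_of_lines(1)[OF Sd])
 then have A: "sum_of_simples TYPE('k) G \<in> fgmod ?R" "miso ?R (sum_of_simples TYPE('k) G) (msum_fam (verts G) ?S)" by blast+
 show ?thesis
  unfolding heart_def Let_def n using supports_iff[OF S A, of _ n, unfolded adj_def]
  by (intro arg_cong[of _ _ "\<lambda>V. G \<restriction> V"]) blast
qed

end

section \<open>The characterisation through heart and member\<close>

theorem theorem4p66:
  fixes Q :: "('v, 'e) pre_digraph" and n :: nat
  assumes "fin_digraph Q" and "connected Q" and "card (verts Q) = n" and "n > 3"
  shows "psi_dim (rad_sq_zero_algebra TYPE('k::field) Q) = enat (2 * n - 3) \<longleftrightarrow>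
    linear_order_on (verts (member TYPE('k) Q)) (path_order_on Q (verts (member TYPE('k) Q))) \<and>
    (\<exists>v. is_sink Q v) \<and>
    (\<exists>c. verts (heart TYPE('k) Q) = {c} \<and>
      (\<exists>a\<in>arcs (heart TYPE('k) Q). tail Q a = c \<and> head Q a = c)) \<and>
    has_form Q (heart TYPE('k) Q) (member TYPE('k) Q)"
proof -
  interpret fin_digraph Q by (rule assms(1))
  note n = assms(3,4)
  let ?V = "verts Q"
  have ne: "?V \<noteq> {}" using n by auto
  have sub: "step \<subseteq> ?V \<times> ?V" by auto
  define H where "H = {i\<in>?V. (\<exists>y. (y, i) \<in> step ^^ n) \<and> (\<exists>y. (i, y) \<in> step ^^ n)}"
  have heart: "heart TYPE('k) Q = Q \<restriction> H" unfolding H_def by (rule heart_verts[OF n(1) ne])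
  have member: "member TYPE('k) Q = Q \<restriction> (?V - H)" by (simp add: member_def heart)
  have order: "path_order_on Q S = {(x, y). x \<in> S \<and> y \<in> S \<and> (x, y) \<in> step\<^sup>*}" if "S \<subseteq> ?V" for S
    using that by (auto simp: path_order_on_def awalk_step)
  have arcI: "\<exists>a\<in>arcs Q. tail Q a = x \<and> head Q a = y" if "(x, y) \<in> step" for x y using that by blast
  show ?thesis
    unfolding psi_dim_chain[OF n] heart member induce_subgraph_verts
  proof (intro iffI; (elim conjE)?)
    assume "\<exists>c w. chain_form step ?V n c w"
    then obtain c w where cf: "chain_form step ?V n c w" by blast
    have H: "H = {c}" unfolding H_def by (rule chain_form_heart[OF cf sub n(2)])
    have V: "?V = insert c (w ` {..<n - 1})" and wi: "inj_on w {..<n - 1}" and cw: "c \<notin> w ` {..<n - 1}"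
      and cc: "(c, c) \<in> step" and c0: "(c, w 0) \<in> step" and ws: "\<And>k. Suc k < n - 1 \<Longrightarrow> (w k, w (Suc k)) \<in> step"
      and wc: "\<And>k. k < n - 1 \<Longrightarrow> (w k, c) \<notin> step"
      and ww: "\<And>j k. j < n - 1 \<Longrightarrow> k < n - 1 \<Longrightarrow> (w j, w k) \<in> step \<Longrightarrow> j < k"
      using cf unfolding chain_form_def by blast+
    have M: "?V - H = w ` {..<n - 1}" using V cw H by blast
    have walk: "(w j, w (j + m)) \<in> step\<^sup>*" if "j + m < n - 1" for j m
      using that
    proof (induct m)
      case (Suc m)
      then show ?case using ws[of "j + m"] by (auto intro: rtrancl_into_rtrancl)
    qed simp
    \<comment> \<open>Walks never lower the index by \<open>chain_form_walks\<close>, and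
      \<open>w\<close> is injective; this gives antisymmetry of the order.\<close>
    have le: "j \<le> k" if jk: "j < n - 1" "k < n - 1" "(w j, w k) \<in> step\<^sup>*" for j k
    proof -
      obtain m where "(w j, w k) \<in> step ^^ m" using jk(3) rtrancl_imp_relpow by blast
      then have "w k \<in> w ` {j + m..<n - 1}" by (rule chain_form_walks[OF cf sub jk(1)])
      then obtain l where l: "l \<in> {j + m..<n - 1}" "w k = w l" by blast
      then have "k = l" using inj_onD[OF wi, of k l] jk(2) by simp
      then show ?thesis using l(1) by simp
    qed
    let ?r = "{(x, y). x \<in> ?V - H \<and> y \<in> ?V - H \<and> (x, y) \<in> step\<^sup>*}"
    have "linear_order_on (?V - H) ?r"
      unfolding linear_order_on_def partial_order_on_def preorder_on_def
    proof (intro conjI)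
      show "?r \<subseteq> (?V - H) \<times> (?V - H)" "refl_on (?V - H) ?r" by (auto simp: refl_on_def)
      show "trans ?r" by (rule transI) (auto intro: rtrancl_trans)
      show "antisym ?r"
      proof (rule antisymI)
        fix x y assume xy: "(x, y) \<in> ?r" "(y, x) \<in> ?r"
        then obtain j k where "x = w j" "j < n - 1" "y = w k" "k < n - 1" unfolding M by blast
        then show "x = y" using le[of j k] le[of k j] xy by simp
      qed
      show "total_on (?V - H) ?r"
      proof (rule total_onI)
        fix x y assume "x \<in> ?V - H" "y \<in> ?V - H" "x \<noteq> y"
        then obtain j k where jk: "x = w j" "j < n - 1" "y = w k" "k < n - 1" unfolding M by blast
        have "(x, y) \<in> step\<^sup>* \<or> (y, x) \<in> step\<^sup>*"
          using walk[of j "k - j"] walk[of k "j - k"] jk by (cases "j \<le> k") simp_all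
        then show "(x, y) \<in> ?r \<or> (y, x) \<in> ?r" using \<open>x \<in> ?V - H\<close> \<open>y \<in> ?V - H\<close> by blast
      qed
    qed
    then have lin: "linear_order_on (?V - H) (path_order_on Q (?V - H))" unfolding order[OF Diff_subset] .
    \<comment> \<open>The last vertex of the chain: one further step would need an index of at least
      \<open>n - 1\<close>.\<close>
    have sink: "is_sink Q (w (n - 2))"
      unfolding is_sink_def
    proof (intro conjI ballI notI)
      show "w (n - 2) \<in> ?V" using V n(2) by simp
      fix a assume "a \<in> arcs Q" "tail Q a = w (n - 2)"
      then have "(w (n - 2), head Q a) \<in> step" by force
      then have "(w (n - 2), head Q a) \<in> step ^^ 1" by (simp only: relpow_1)
      then have "head Q a \<in> w ` {n - 2 + 1..<n - 1}" by (rule chain_form_walks[OF cf sub, rotated]) (use n(2) in simp)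
      then show False by auto
    qed
    have loop: "\<exists>a\<in>arcs (Q \<restriction> H). tail Q a = c \<and> head Q a = c"
      using arcI[OF cc] unfolding H induce_subgraph_arcs by blast
    have no_back: "head Q a \<noteq> c" if aM: "a \<in> arcs Q" "tail Q a \<in> ?V - H" for a
    proof
      assume hc: "head Q a = c"
      have "(tail Q a, head Q a) \<in> step" using aM(1) by blast
      moreover obtain k where "tail Q a = w k" "k < n - 1" using aM(2) unfolding M by auto
      ultimately show False using wc[of k] hc by simp
    qed
    obtain a0 where a0: "a0 \<in> arcs Q" "tail Q a0 = c" "head Q a0 = w 0" using arcI[OF c0] by blast
    \<comment> \<open>An arrow into \<open>w 0\<close> from inside the member would have to start at
      a smaller index.\<close>
    have "is_source (Q \<restriction> (?V - H)) (w 0)"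
      unfolding is_source_def induce_subgraph_verts induce_subgraph_arcs induce_subgraph_head
    proof (intro conjI ballI notI)
      show "w 0 \<in> ?V - H" unfolding M using n(2) by simp
      fix a assume a: "a \<in> {e \<in> arcs Q. tail Q e \<in> ?V - H \<and> head Q e \<in> ?V - H}" "head Q a = w 0"
      from a(1) have "tail Q a \<in> ?V - H" by blast
      then obtain j where j: "tail Q a = w j" "j < n - 1" unfolding M by auto
      have "(tail Q a, head Q a) \<in> step" using a(1) by blast
      then have "(w j, w 0) \<in> step" unfolding a(2) j(1) .
      then show False using ww[of j 0] j(2) n(2) by simp
    qed
    then have "has_form Q (Q \<restriction> H) (Q \<restriction> (?V - H))"
      unfolding has_form_def induce_subgraph_verts using no_back a0 H
      by (intro conjI ballI impI bexI[of _ a0]) auto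
    then show "linear_order_on (?V - H) (path_order_on Q (?V - H)) \<and> (\<exists>v. is_sink Q v) \<and>
      (\<exists>c. H = {c} \<and> (\<exists>a\<in>arcs (Q \<restriction> H). tail Q a = c \<and> head Q a = c)) \<and> has_form Q (Q \<restriction> H) (Q \<restriction> (?V - H))"
      using lin sink loop
      by (intro conjI exI[where P = "is_sink Q" and x = "w (n - 2)"]
          exI[where P = "\<lambda>c. H = {c} \<and> (\<exists>a\<in>arcs (Q \<restriction> H). tail Q a = c \<and> head Q a = c)" and x = c] H)
  next
    assume lin: "linear_order_on (?V - H) (path_order_on Q (?V - H))"
      and heart1: "\<exists>c. H = {c} \<and> (\<exists>a\<in>arcs (Q \<restriction> H). tail Q a = c \<and> head Q a = c)"
      and form: "has_form Q (Q \<restriction> H) (Q \<restriction> (?V - H))"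
    from heart1 obtain c a where H: "H = {c}" and a: "a \<in> arcs (Q \<restriction> H)" "tail Q a = c" "head Q a = c"
      by (elim exE conjE bexE) (rule that)
    have cV: "c \<in> ?V" using H unfolding H_def by blast
    have "(tail Q a, head Q a) \<in> step" using a(1) unfolding induce_subgraph_arcs by blast
    then have cc: "(c, c) \<in> step" unfolding a(2,3) .
    have f1: "\<And>a. a \<in> arcs Q \<Longrightarrow> tail Q a \<in> ?V - H \<Longrightarrow> head Q a \<in> H \<Longrightarrow> tail Q a \<in> H"
      and f2: "\<exists>a\<in>arcs Q. tail Q a \<in> H \<and> is_source (Q \<restriction> (?V - H)) (head Q a)"
      using form unfolding has_form_def induce_subgraph_verts by blast+
    \<comment> \<open>An arrow into \<open>c\<close> from another vertex would lead from the member
      to the heart, which the form excludes.\<close>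
    have bk: "x = c" if x: "(x, c) \<in> step" for x
    proof -
      obtain b where b: "b \<in> arcs Q" "tail Q b = x" "head Q b = c" using arcI[OF x] by blast
      have "tail Q b \<in> H"
      proof (rule ccontr)
        assume nh: "tail Q b \<notin> H"
        have "tail Q b \<in> H" by (rule f1[OF b(1)]) (use nh tail_in_verts[OF b(1)] in \<open>simp_all add: H b(3)\<close>)
        then show False using nh by contradiction
      qed
      then show ?thesis unfolding b(2) H by (rule singletonD)
    qed
    obtain b where b: "b \<in> arcs Q" "tail Q b \<in> H" "is_source (Q \<restriction> (?V - H)) (head Q b)" using f2 by blast
    have bc: "tail Q b = c" using b(2) unfolding H by (rule singletonD)
    let ?s = "head Q b"
    have s1: "?s \<in> ?V - {c}" using b(3) H unfolding is_source_def induce_subgraph_verts by simp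
    \<comment> \<open>Being a source of the member, the vertex receives arrows only from outside the
      member, that is, from \<open>c\<close>.\<close>
    have s2: "x = c" if x: "(x, ?s) \<in> step" for x
    proof (rule ccontr)
      assume "x \<noteq> c"
      obtain d where d: "d \<in> arcs Q" "tail Q d = x" "head Q d = ?s" using arcI[OF x] by blast
      then have "d \<in> arcs (Q \<restriction> (?V - H))" using s1 \<open>x \<noteq> c\<close> tail_in_verts[OF d(1)] by (simp add: H)
      then show False using b(3) d(3) unfolding is_source_def induce_subgraph_head by blast
    qed
    have "\<exists>w. chain_form step ?V n c w"
    proof (rule chain_formI_order[OF _ sub n _ cc bk _ _ s1 s2])
      show "{i \<in> ?V. (\<exists>y. (y, i) \<in> step ^^ n) \<and> (\<exists>y. (i, y) \<in> step ^^ n)} = {c}" using H unfolding H_def .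
      show "linear_order_on (?V - {c}) {(x, y). x \<in> ?V - {c} \<and> y \<in> ?V - {c} \<and> (x, y) \<in> step\<^sup>*}"
        using lin unfolding H order[OF Diff_subset] .
      have "(tail Q b, ?s) \<in> step" using b(1) by blast
      then show "(c, ?s) \<in> step" unfolding bc .
    qed auto
    then show "\<exists>c w. chain_form step ?V n c w" by blast
  qed
qed

end
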